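(* Let $N\ge1$, let $\phi:\mathbb{P}^N\to\mathbb{P}^N$ be a morphism defined over $\overline{\mathbb{Q}}$ of degree at least $2$, and let $P\in\mathbb{P}^N(\overline{\mathbb{Q}})$. Let $\psi:\mathbb{P}^N\to\mathbb{P}^N$ be another morphism over $\overline{\mathbb{Q}}$ of degree $d\ge2$, and let $D$ be an effective divisor on $\mathbb{P}^N$ defined over $\overline{\mathbb{Q}}$, with $D^{(n)}_{\mathrm{nc},\psi}$ the normal-crossings part of $(\psi^{(n)})^*(D)$. Assume that $\deg D^{(n)}_{\mathrm{nc},\psi}>N+1$ for some $n$, and further assume the following "inverse image property" for this $n$: there exists a number field $k$ (over which $\phi$, $\psi$ and $D$ are defined) such that for each $m\ge 0$ there exists $Q_m\in\mathbb{P}^N(k)$ with $\phi^{(m)}(P)=\psi^{(n)}(Q_m)$. Let $$c_n=\frac{\deg D^{(n)}_{\mathrm{nc},\psi}-(N+1)}{d^n\deg(D)}$$ and assume Vojta's conjecture for the divisor $D^{(n)}_{\mathrm{nc},\psi}$ on $\mathbb{P}^N$. Then for every finite subset $S$ of $M_k$ and every $\epsilon>0$, the set $$\left\{\phi^{(m)}(P):\frac{\sum_{v\notin S}\lambda_v(D,\phi^{(m)}(P))}{\deg(D)\,h(\phi^{(m)}(P))}\le c_n-\epsilon\right\}$$ is not Zariski-dense in $\mathbb{P}^N$.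
   Context: $\phi^{(m)}$ is the $m$-fold composition of $\phi$ with itself ($\phi^{(0)}=\mathrm{id}$), and similarly $\psi^{(n)}$. The degree of a morphism $\mathbb{P}^N\to\mathbb{P}^N$ is the common degree of the homogeneous polynomials (without common factor) defining it. Heights: For a number field $k$, $M_k$ is the set of its places; for $v\in M_k$, $|\cdot|_v$ is the $\frac{[k_v:\mathbb{Q}_v]}{[k:\mathbb{Q}]}$-th power of the extension of the normalized absolute value on $\mathbb{Q}$, and $v(x)=-\log|x|_v$ (with $v(0)=+\infty$). The Weil height is $h([x_0:\cdots:x_N])=\sum_{v\in M_k}\log\max_i|x_i|_v$. If an effective divisor $D$ on $\mathbb{P}^N$ defined over $k$ is given by a homogeneous polynomial $F$ with coefficients in the ring of integers of $k$ (fix one choice of $F$), the local height is $\lambda_v(D,[x_0:\cdots:x_N])=v(F(x_0,\ldots,x_N))-\deg(D)\min_i v(x_i)$ (equal to $+\infty$ on $|D|$). Quotients of heights are considered only at points of positive height outside $|D|$. Normal crossings: a divisor is normal-crossings if near each point it is defined by $x_1\cdots x_k=0$ where $x_1,\ldots,x_k$ is part of a local (analytic) coordinate system; in particular each irreducible component has multiplicity $1$. A normal-crossings part $E_{\mathrm{nc}}$ of an effective divisor $E$ is a normal-crossings subdivisor of $E$ over $\overline{\mathbb{Q}}$ (i.e. $E-E_{\mathrm{nc}}$ effective) of highest possible degree; fix one if there are several. Vojta's conjecture on $\mathbb{P}^N$ for a normal-crossings divisor $E$: for every number field $k$ over which $E$ is defined, every finite set $S\subset M_k$ and every $\epsilon>0$,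 there exist a finite union $Z_\epsilon$ of hypersurfaces and a constant $C$ such that $\sum_{v\in S}\lambda_v(E,P)<(N+1+\epsilon)h(P)+C$ for all $P\in\mathbb{P}^N(k)\setminus Z_\epsilon$. *)

theory Defs
  imports
    "HOL-Analysis.Analysis"
    "HOL-Computational_Algebra.Computational_Algebra"
    "HOL-Library.Poly_Mapping"
    "HOL-Combinatorics.Transposition"
    "HOL-Algebra.Embedded_Algebras"
    "HOL-Algebra.QuotRing"
    "HOL-Algebra.Algebraic_Closure_Type"
begin

unbundle no fps_syntax  (* frees $ for vector components *)

text \<open>
  The dimension of projective space is \<open>N = CARD('n)\<close>, hence \<open>N \<ge> 1\<close>; the \<open>N + 1\<close> homogeneous
  coordinates are indexed by \<^typ>\<open>'n option\<close>.  The algebraic closure of the rationals is the set of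
  algebraic complex numbers, and number fields are subfields of it.
\<close>

section \<open>Projective space\<close>

definition proj_rel :: "complex ^ ('n::finite) option \<Rightarrow> complex ^ 'n option \<Rightarrow> bool" where
  "proj_rel x y \<longleftrightarrow> x \<noteq> 0 \<and> (\<exists>c. c \<noteq> 0 \<and> y = c *s x)"

quotient_type 'n proj = "complex ^ ('n::finite) option" / partial: proj_rel
proof (rule part_equivpI)
  show "\<exists>x::complex ^ 'n option. proj_rel x x"
    by (rule exI[of _ 1]) (auto simp: proj_rel_def intro!: exI[of _ 1])
  show "symp (proj_rel :: complex ^ 'n option \<Rightarrow> _)"
  proof (rule sympI)
    fix x y :: "complex ^ 'n option"
    assume "proj_rel x y"
    then obtain c where "x \<noteq> 0" "c \<noteq> 0" "y = c *s x"
      unfolding proj_rel_def by blast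
    then show "proj_rel y x"
      unfolding proj_rel_def by (auto intro!: exI[of _ "inverse c"])
  qed
  show "transp (proj_rel :: complex ^ 'n option \<Rightarrow> _)"
  proof (rule transpI)
    fix x y z :: "complex ^ 'n option"
    assume "proj_rel x y" "proj_rel y z"
    then obtain c c' where "x \<noteq> 0" "c \<noteq> 0" "c' \<noteq> 0" "y = c *s x" "z = c' *s y"
      unfolding proj_rel_def by blast
    then show "proj_rel x z"
      unfolding proj_rel_def by (auto intro!: exI[of _ "c' * c"])
  qed
qed

definition Qbar :: "complex set" where
  "Qbar = {z. algebraic z}"

definition rational_points :: "complex set \<Rightarrow> ('n::finite) proj set" where
  "rational_points K = {abs_proj x |x. x \<noteq> 0 \<and> (\<forall>i. x $ i \<in> K)}"

definition coords :: "complex set \<Rightarrow> ('n::finite) proj \<Rightarrow> complex ^ 'n option" where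
  "coords K p = (SOME x. x \<noteq> 0 \<and> (\<forall>i. x $ i \<in> K) \<and> abs_proj x = p)"

section \<open>Forms and effective divisors\<close>

type_synonym 'n form = "('n option \<Rightarrow>\<^sub>0 nat) \<Rightarrow>\<^sub>0 complex"

definition mono_degree :: "('i::finite \<Rightarrow>\<^sub>0 nat) \<Rightarrow> nat" where
  "mono_degree m = (\<Sum>i\<in>UNIV. Poly_Mapping.lookup m i)"

definition homogeneous :: "nat \<Rightarrow> ('n::finite) form \<Rightarrow> bool" where
  "homogeneous e F \<longleftrightarrow> (\<forall>m\<in>Poly_Mapping.keys F. mono_degree m = e)"

definition form_degree :: "('n::finite) form \<Rightarrow> nat" where
  "form_degree F = Max (mono_degree ` Poly_Mapping.keys F)"

definition form_smult :: "complex \<Rightarrow> 'n form \<Rightarrow> 'n form" where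
  "form_smult c F = Poly_Mapping.single 0 c * F"

definition eval_form :: "('n::finite) form \<Rightarrow> complex ^ 'n option \<Rightarrow> complex" where
  "eval_form F x = (\<Sum>m\<in>Poly_Mapping.keys F. Poly_Mapping.lookup F m * (\<Prod>i\<in>UNIV. x $ i ^ Poly_Mapping.lookup m i))"

definition subst_form :: "('n option \<Rightarrow> 'n form) \<Rightarrow> ('n::finite) form \<Rightarrow> 'n form" where
  "subst_form \<Phi> F =
     (\<Sum>m\<in>Poly_Mapping.keys F. form_smult (Poly_Mapping.lookup F m) (\<Prod>i\<in>UNIV. \<Phi> i ^ Poly_Mapping.lookup m i))"

definition coeffs_in :: "complex set \<Rightarrow> 'n form \<Rightarrow> bool" where
  "coeffs_in A F \<longleftrightarrow> (\<forall>m. Poly_Mapping.lookup F m \<in> A)"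

text \<open>
  An effective divisor on projective space is represented by a nonzero form defining it, which is
  unique up to a nonzero scalar.  Thus the degree of a divisor is \<^const>\<open>form_degree\<close>, and for forms
  \<open>E\<close>, \<open>G\<close> the difference \<open>E - G\<close> of divisors is effective iff \<open>G dvd E\<close>.
\<close>

definition effective_divisor :: "('n::finite) form \<Rightarrow> bool" where
  "effective_divisor D \<longleftrightarrow> D \<noteq> 0 \<and> (\<exists>e. homogeneous e D) \<and> coeffs_in Qbar D"

definition divisor_defined_over :: "complex set \<Rightarrow> 'n form \<Rightarrow> bool" where
  "divisor_defined_over K D \<longleftrightarrow> (\<exists>c. c \<noteq> 0 \<and> coeffs_in K (form_smult c D))"

definition zero_locus :: "('n::finite) form \<Rightarrow> 'n proj set" where
  "zero_locus F = {p. eval_form F (rep_proj p) = 0}"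

definition hypersurface :: "('n::finite) proj set \<Rightarrow> bool" where
  "hypersurface H \<longleftrightarrow> (\<exists>F. effective_divisor F \<and> form_degree F > 0 \<and> H = zero_locus F)"

definition zariski_closed :: "('n::finite) proj set \<Rightarrow> bool" where
  "zariski_closed A \<longleftrightarrow>
     (\<exists>\<F>. (\<forall>F\<in>\<F>. (\<exists>e. homogeneous e F) \<and> coeffs_in Qbar F) \<and> A = (\<Inter>F\<in>\<F>. zero_locus F))"

definition zariski_dense :: "('n::finite) proj set \<Rightarrow> bool" where
  "zariski_dense T \<longleftrightarrow> (\<forall>A. zariski_closed A \<and> T \<subseteq> A \<longrightarrow> A = UNIV)"

section \<open>Morphisms of projective space\<close>

text \<open>
  A morphism of degree \<open>d\<close> is given by the tuple of forms of degree \<open>d\<close> defining it; these have no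
  common zero, hence for \<open>N \<ge> 1\<close> no common factor.
\<close>

definition proj_morphism :: "nat \<Rightarrow> ('n option \<Rightarrow> ('n::finite) form) \<Rightarrow> bool" where
  "proj_morphism d \<Phi> \<longleftrightarrow>
     (\<forall>i. homogeneous d (\<Phi> i) \<and> coeffs_in Qbar (\<Phi> i)) \<and>
     (\<forall>x. x \<noteq> 0 \<longrightarrow> (\<exists>i. eval_form (\<Phi> i) x \<noteq> 0))"

definition morphism_defined_over :: "complex set \<Rightarrow> ('n option \<Rightarrow> 'n form) \<Rightarrow> bool" where
  "morphism_defined_over K \<Phi> \<longleftrightarrow> (\<exists>c. c \<noteq> 0 \<and> (\<forall>i. coeffs_in K (form_smult c (\<Phi> i))))"

definition proj_map :: "('n option \<Rightarrow> ('n::finite) form) \<Rightarrow> 'n proj \<Rightarrow> 'n proj" where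
  "proj_map \<Phi> p = abs_proj (\<chi> i. eval_form (\<Phi> i) (rep_proj p))"

definition id_morphism :: "'n option \<Rightarrow> 'n form" where
  "id_morphism i = Poly_Mapping.single (Poly_Mapping.single i 1) 1"

definition comp_morphism ::
    "('n option \<Rightarrow> ('n::finite) form) \<Rightarrow> ('n option \<Rightarrow> 'n form) \<Rightarrow> 'n option \<Rightarrow> 'n form" where
  "comp_morphism \<Phi> \<Psi> = (\<lambda>i. subst_form \<Psi> (\<Phi> i))"

definition iter_morphism :: "nat \<Rightarrow> ('n option \<Rightarrow> ('n::finite) form) \<Rightarrow> 'n option \<Rightarrow> 'n form" where
  "iter_morphism n \<Psi> = (comp_morphism \<Psi> ^^ n) id_morphism"

definition pullback :: "('n option \<Rightarrow> ('n::finite) form) \<Rightarrow> 'n form \<Rightarrow> 'n form" where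
  "pullback \<Phi> D = subst_form \<Phi> D"

section \<open>Normal crossings\<close>

text \<open>
  The library's \<^const>\<open>has_derivative\<close> is real-linear; homogeneity over the complex numbers makes the
  Frechet derivative complex-linear.
\<close>

definition holomorphic_several :: "(complex ^ 'n) set \<Rightarrow> (complex ^ ('n::finite) \<Rightarrow> complex) \<Rightarrow> bool" where
  "holomorphic_several U f \<longleftrightarrow> open U \<and>
     (\<forall>y\<in>U. \<exists>f'. (f has_derivative f') (at y) \<and> (\<forall>c v. f' (c *s v) = c * f' v))"

definition local_coordinates ::
    "(complex ^ 'n) set \<Rightarrow> complex ^ 'n \<Rightarrow> (complex ^ ('n::finite) \<Rightarrow> complex ^ 'n) \<Rightarrow> bool" where
  "local_coordinates U a z \<longleftrightarrow>
     a \<in> U \<and> z a = 0 \<and> inj_on z U \<and>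
     (\<forall>i. holomorphic_several U (\<lambda>y. z y $ i)) \<and>
     (\<forall>i. holomorphic_several (z ` U) (\<lambda>w. inv_into U z w $ i))"

text \<open>
  The standard affine chart where the \<open>j\<close>-th homogeneous coordinate is \<open>1\<close>.  The transposition of
  \<open>None\<close> and \<open>j\<close> only serves to number the remaining coordinates by \<^typ>\<open>'n\<close>.
\<close>

definition affine_chart :: "'n option \<Rightarrow> complex ^ ('n::finite) \<Rightarrow> complex ^ 'n option" where
  "affine_chart j y = (\<chi> i. case Transposition.transpose None j i of None \<Rightarrow> 1 | Some k \<Rightarrow> y $ k)"

text \<open>
  The local equation of the divisor in each chart is a unit times a product of distinct members of
  a local coordinate system (the empty product at points outside the support).
\<close>

definition normal_crossings :: "('n::finite) form \<Rightarrow> bool" where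
  "normal_crossings E \<longleftrightarrow>
     (\<forall>j a. \<exists>U z I u.
        local_coordinates U a z \<and> holomorphic_several U u \<and> (\<forall>y\<in>U. u y \<noteq> 0) \<and>
        (\<forall>y\<in>U. eval_form E (affine_chart j y) = u y * (\<Prod>i\<in>I. z y $ i)))"

definition nc_subdivisor :: "('n::finite) form \<Rightarrow> 'n form \<Rightarrow> bool" where
  "nc_subdivisor E G \<longleftrightarrow> effective_divisor G \<and> normal_crossings G \<and> G dvd E"

definition nc_part :: "('n::finite) form \<Rightarrow> 'n form \<Rightarrow> bool" where
  "nc_part E G \<longleftrightarrow>
     nc_subdivisor E G \<and> (\<forall>G'. nc_subdivisor E G' \<longrightarrow> form_degree G' \<le> form_degree G)"

section \<open>Number fields and their places\<close>

definition number_field :: "complex set \<Rightarrow> bool" where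
  "number_field K \<longleftrightarrow>
     subfield K (ring_of_type_algebra :: complex ring) \<and>
     ring.finite_dimension (ring_of_type_algebra :: complex ring) \<rat> K"

definition field_degree :: "complex set \<Rightarrow> nat" where
  "field_degree K = (ring.dim (ring_of_type_algebra :: complex ring) over \<rat>) K"

definition ring_of_integers :: "complex set \<Rightarrow> complex set" where
  "ring_of_integers K = {x \<in> K. algebraic_int x}"

definition padic_abs :: "nat \<Rightarrow> rat \<Rightarrow> real" where
  "padic_abs p q = (if q = 0 then 0 else
     (case quotient_of q of (a, b) \<Rightarrow>
       real p powi (int (multiplicity (int p) b) - int (multiplicity (int p) a))))"

definition absolute_value_on :: "complex set \<Rightarrow> (complex \<Rightarrow> real) \<Rightarrow> bool" where
  "absolute_value_on K v \<longleftrightarrow>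
     (\<forall>x\<in>K. 0 \<le> v x \<and> (v x = 0 \<longleftrightarrow> x = 0)) \<and>
     (\<forall>x\<in>K. \<forall>y\<in>K. v (x * y) = v x * v y \<and> v (x + y) \<le> v x + v y)"

text \<open>
  Each place is represented by its unique absolute value that extends the usual or a \<open>p\<close>-adic
  absolute value of the rationals; extensionality makes the representing function unique.
\<close>

definition places :: "complex set \<Rightarrow> (complex \<Rightarrow> real) set" where
  "places K = {v \<in> extensional K. absolute_value_on K v \<and>
     ((\<forall>q::rat. v (of_rat q) = real_of_rat \<bar>q\<bar>) \<or>
      (\<exists>p. Factorial_Ring.prime p \<and> (\<forall>q. v (of_rat q) = padic_abs p q)))}"

text \<open>
  The completion of \<open>K\<close> at \<open>v\<close>: Cauchy sequences modulo null sequences.  The completion of the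
  rationals is the subfield of classes of rational Cauchy sequences.
\<close>

definition cauchy_ring :: "complex set \<Rightarrow> (complex \<Rightarrow> real) \<Rightarrow> (nat \<Rightarrow> complex) ring" where
  "cauchy_ring K v =
     \<lparr>carrier = {s. range s \<subseteq> K \<and> (\<forall>e>0. \<exists>M. \<forall>m\<ge>M. \<forall>n\<ge>M. v (s m - s n) < e)},
      monoid.mult = (\<lambda>s t n. s n * t n), one = (\<lambda>n. 1),
      ring.zero = (\<lambda>n. 0), add = (\<lambda>s t n. s n + t n)\<rparr>"

definition null_sequences :: "complex set \<Rightarrow> (complex \<Rightarrow> real) \<Rightarrow> (nat \<Rightarrow> complex) set" where
  "null_sequences K v = {s \<in> carrier (cauchy_ring K v). (\<lambda>n. v (s n)) \<longlonglongrightarrow> 0}"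

definition completion_ring :: "complex set \<Rightarrow> (complex \<Rightarrow> real) \<Rightarrow> (nat \<Rightarrow> complex) set ring" where
  "completion_ring K v = cauchy_ring K v Quot null_sequences K v"

definition rat_completion :: "complex set \<Rightarrow> (complex \<Rightarrow> real) \<Rightarrow> (nat \<Rightarrow> complex) set set" where
  "rat_completion K v =
     {null_sequences K v +>\<^bsub>cauchy_ring K v\<^esub> s |s. s \<in> carrier (cauchy_ring K v) \<and> range s \<subseteq> \<rat>}"

definition local_degree :: "complex set \<Rightarrow> (complex \<Rightarrow> real) \<Rightarrow> nat" where
  "local_degree K v =
     (ring.dim (completion_ring K v) over rat_completion K v) (carrier (completion_ring K v))"

definition normalized_abs :: "complex set \<Rightarrow> (complex \<Rightarrow> real) \<Rightarrow> complex \<Rightarrow> real" where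
  "normalized_abs K v x = v x powr (real (local_degree K v) / real (field_degree K))"

definition valuation :: "complex set \<Rightarrow> (complex \<Rightarrow> real) \<Rightarrow> complex \<Rightarrow> ereal" where
  "valuation K v x = (if x = 0 then \<infinity> else ereal (- ln (normalized_abs K v x)))"

section \<open>Heights\<close>

definition height :: "complex set \<Rightarrow> ('n::finite) proj \<Rightarrow> real" where
  "height K p =
     (\<Sum>\<^sub>\<infinity>v\<in>places K. ln (Max (range (\<lambda>i. normalized_abs K v (coords K p $ i)))))"

definition local_height ::
    "complex set \<Rightarrow> (complex \<Rightarrow> real) \<Rightarrow> ('n::finite) form \<Rightarrow> 'n proj \<Rightarrow> ereal" where
  "local_height K v F p =
     valuation K v (eval_form F (coords K p)) -
     ereal (real (form_degree F)) * Min (range (\<lambda>i. valuation K v (coords K p $ i)))"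

text \<open>
  Local heights depend on a choice, for every number field and every divisor defined over it, of a
  defining form with integral coefficients.
\<close>

definition integral_equations :: "(complex set \<Rightarrow> ('n::finite) form \<Rightarrow> 'n form) \<Rightarrow> bool" where
  "integral_equations eqn \<longleftrightarrow>
     (\<forall>K D. number_field K \<and> effective_divisor D \<and> divisor_defined_over K D \<longrightarrow>
        coeffs_in (ring_of_integers K) (eqn K D) \<and>
        (\<exists>c. c \<noteq> 0 \<and> eqn K D = form_smult c D))"

definition vojta_conjecture ::
    "(complex set \<Rightarrow> ('n::finite) form \<Rightarrow> 'n form) \<Rightarrow> 'n form \<Rightarrow> bool" where
  "vojta_conjecture eqn E \<longleftrightarrow>
     (\<forall>K S \<epsilon>. number_field K \<and> divisor_defined_over K E \<and> finite S \<and> S \<subseteq> places K \<and> \<epsilon> > 0 \<longrightarrow>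
        (\<exists>\<H> C. finite \<H> \<and> (\<forall>H\<in>\<H>. hypersurface H) \<and>
          (\<forall>p \<in> rational_points K - \<Union>\<H>.
             (\<Sum>v\<in>S. local_height K v (eqn K E) p)
               < ereal ((real CARD('n) + 1 + \<epsilon>) * height K p + C))))"

end

(* Only the points Q_m matter.  Over a Galois number field M containing K and all coefficients,
   write the equation F of D pulled back along the n-th iterate of psi as G * H with G an equation
   of the normal-crossings part.  Vojta's conjecture and the product formula bound the part of the
   height of G outside S from below by (deg G - (N+1) - eps) h(Q); the cofactor H is bounded below
   trivially, and since the iterate has no common zero, the Nullstellensatz compares the norms of
   y and psi^n(y) at every place.  Hence a point violating the bound has bounded height, so by
   Northcott there are finitely many, or comes from a point Q in the exceptional hypersurfaces,
   whose images lie in hypersurfaces by a dimension count.  Local degrees are counted as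
   embeddings into M, which turns sums over places into sums over the Galois group. *)

theory Submission
  imports Defs "HOL-Real_Asymp.Real_Asymp"
begin

hide_const (open) up_ring.coeff up_ring.monom module.smult Polynomials.degree Polynomials.lead_coeff
  Coset.order Divisibility.prime Divisibility.irreducible Poly_Mapping.degree
unbundle no fps_syntax

section \<open>Subfields of the complex numbers\<close>

text \<open>The weights in a height are quotients of dimensions, and the local degree is even the
  dimension of a ring of Cauchy sequences modulo null sequences, so no weight can be used before it
  is computed. The tool is a dual basis for a finite set of characters
  (\<open>character_basis\<close>). Fed with all embeddings of K and their rational traces it yields
  the field degree; fed with the embeddings that induce one place, whose traces lie in the closure
  of the rationals inside M, it yields the local degree. Weak approximation puts those traces into
  the closure, and it also shows that all places of a subfield above p come from a single place of
  M. A place above p is obtained without any factorisation of ideals: a maximal subring of M without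
  1/p is a valuation ring, and algebraicity bounds the denominators of its values. The O(1) of each
  height comparison has to be uniform in the point. Errors are therefore bounded by a function on
  the places of the rationals that vanishes almost everywhere, and its total is the constant.
  Vojta's conjecture is used with an \<epsilon>' of size \<epsilon> f d^n / 2, because heights grow
  by about d^n from Q to the n-th iterate; half of \<epsilon> then survives.\<close>

locale csubfield =
 fixes F :: "complex set"
 assumes zero_in [simp]: "0 \<in> F" and one_in [simp]: "1 \<in> F"
  and add_in: "x \<in> F ==> y \<in> F ==> x + y \<in> F"
  and mult_in: "x \<in> F ==> y \<in> F ==> x * y \<in> F"
  and minus_in: "x \<in> F ==> - x \<in> F"
  and inverse_in: "x \<in> F ==> inverse x \<in> F"
begin

lemma diff_in: "x \<in> F ==> y \<in> F ==> x - y \<in> F"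
 using add_in[of x "- y"] minus_in[of y] by simp

lemma divide_in: "x \<in> F ==> y \<in> F ==> x / y \<in> F"
 using mult_in[of x "inverse y"] inverse_in[of y] by (simp add: divide_inverse)

lemma power_in: "x \<in> F ==> x ^ n \<in> F"
 by (induction n) (auto intro: mult_in)

lemma sum_in: "(\<And>i. i \<in> I ==> f i \<in> F) ==> sum f I \<in> F"
 by (induction I rule: infinite_finite_induct) (auto intro: add_in)

lemma prod_in: "(\<And>i. i \<in> I ==> f i \<in> F) ==> prod f I \<in> F"
 by (induction I rule: infinite_finite_induct) (auto intro: mult_in)

lemma of_nat_in: "of_nat n \<in> F"
 by (induction n) (auto intro: add_in)

lemma of_int_in: "of_int n \<in> F"
 by (cases n rule: int_cases2) (auto intro: of_nat_in minus_in)

lemma Rats_subset: "\<rat> \<subseteq> F"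
 by (auto elim!: Rats_cases' intro!: divide_in of_int_in)

lemmas closed = add_in mult_in minus_in inverse_in diff_in divide_in power_in sum_in prod_in
 of_nat_in of_int_in

end

lemma csubfield_Rats: "csubfield \<rat>"
 by unfold_locales auto

text \<open>Gaussian elimination, one equation at a time: an equation that is not trivial removes
  one unknown, so the surplus of unknowns survives. All divisions take place in \<open>F\<close>,
  hence so does the solution. This is the dimension count behind algebraicity, the Nullstellensatz
  and the images of hypersurfaces.\<close>

lemma underdetermined_system:
 fixes a :: "'e => 'u => complex"
 assumes "csubfield F" "finite E" "finite U" "card E < card U"
  and "\<And>e u. e \<in> E ==> u \<in> U ==> a e u \<in> F"
 shows "\<exists>x. (\<forall>u\<in>U. x u \<in> F) \<and> (\<exists>u\<in>U. x u \<noteq> 0) \<and> (\<forall>e\<in>E. (\<Sum>u\<in>U. a e u * x u) = 0)"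
proof -
 interpret csubfield F by fact
 show ?thesis
  using assms(2-5)
 proof (induction E arbitrary: U a rule: finite_induct)
  case empty
  hence "U \<noteq> {}" by auto
  thus ?case by (intro exI[of _ "\<lambda>_. 1"]) auto
 next
  case (insert e0 E)
  show ?case
  proof (cases "\<forall>u\<in>U. a e0 u = 0")
   case True
   from insert.IH[of U a] insert.prems insert.hyps
   obtain x where x: "\<forall>u\<in>U. x u \<in> F" "\<exists>u\<in>U. x u \<noteq> 0" "\<forall>e\<in>E. (\<Sum>u\<in>U. a e u * x u) = 0"
    by auto
   have "(\<Sum>u\<in>U. a e0 u * x u) = 0" using True by simp
   with x show ?thesis by auto
  next
   case False
   then obtain u0 where u0: "u0 \<in> U" "a e0 u0 \<noteq> 0" by auto
   define U' where "U' = U - {u0}"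
   \<comment> \<open>Each row minus the multiple of row \<open>e0\<close> that clears the column
     \<open>u0\<close>.\<close>
   define a' where "a' = (\<lambda>e u. a e u - a e u0 * (a e0 u / a e0 u0))"
   have "card E < card U'" using insert.prems insert.hyps u0 by (simp add: U'_def)
   moreover have "a' e u \<in> F" if "e \<in> E" "u \<in> U'" for e u
    using insert.prems(3)[of e u] insert.prems(3)[of e u0] insert.prems(3)[of e0 u]
     insert.prems(3)[of e0 u0] that u0 unfolding a'_def U'_def by (auto intro!: closed)
   moreover have "finite U'" using insert.prems by (simp add: U'_def)
   ultimately obtain x where x: "\<forall>u\<in>U'. x u \<in> F" "\<exists>u\<in>U'. x u \<noteq> 0"
    "\<forall>e\<in>E. (\<Sum>u\<in>U'. a' e u * x u) = 0" using insert.IH[of U' a'] by auto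
   define y where "y = (\<lambda>u. if u = u0 then - (\<Sum>u\<in>U'. a e0 u / a e0 u0 * x u) else x u)"
   have split: "(\<Sum>u\<in>U. a e u * y u) = a e u0 * y u0 + (\<Sum>u\<in>U'. a e u * x u)" for e
   proof -
    have "(\<Sum>u\<in>U. a e u * y u) = a e u0 * y u0 + (\<Sum>u\<in>U'. a e u * y u)"
     using u0 insert.prems(1) unfolding U'_def by (simp add: sum.remove[of U u0])
    also have "(\<Sum>u\<in>U'. a e u * y u) = (\<Sum>u\<in>U'. a e u * x u)"
     by (rule sum.cong) (auto simp: U'_def y_def)
    finally show ?thesis .
   qed
   have e: "(\<Sum>u\<in>U. a e u * y u) = (\<Sum>u\<in>U'. a' e u * x u)" for e
   proof -
    have "(\<Sum>u\<in>U'. a' e u * x u)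
      = (\<Sum>u\<in>U'. a e u * x u) - a e u0 * (\<Sum>u\<in>U'. a e0 u / a e0 u0 * x u)"
     by (simp add: a'_def algebra_simps sum_distrib_left sum_subtractf)
    thus ?thesis unfolding split by (simp add: y_def)
   qed
   have "(\<Sum>u\<in>U'. a' e0 u * x u) = 0"
    using u0 by (simp add: a'_def)
   hence "\<forall>e\<in>insert e0 E. (\<Sum>u\<in>U. a e u * y u) = 0" using x e by auto
   moreover have "y u \<in> F" if "u \<in> U" for u
    using that x u0 insert.prems(3)[of e0] unfolding y_def U'_def by (auto intro!: closed)
   moreover have "\<exists>u\<in>U. y u \<noteq> 0" using x(2) unfolding U'_def y_def by auto
   ultimately show ?thesis by blast
  qed
 qed
qed

section \<open>Polynomials over a subfield and minimal polynomials\<close>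

definition poly_over :: "complex set => complex poly => bool" where
 "poly_over F p \<longleftrightarrow> (\<forall>i. coeff p i \<in> F)"

context csubfield
begin

lemma poly_over_0 [simp]: "poly_over F 0" by (simp add: poly_over_def)
lemma poly_over_1 [simp]: "poly_over F 1" by (simp add: poly_over_def)
lemma poly_over_const: "c \<in> F ==> poly_over F [:c:]"
 by (auto simp: poly_over_def coeff_pCons split: nat.splits)
lemma poly_over_monom: "c \<in> F ==> poly_over F (monom c n)"
 by (auto simp: poly_over_def)
lemma poly_over_pCons: "c \<in> F ==> poly_over F p ==> poly_over F (pCons c p)"
 by (auto simp: poly_over_def coeff_pCons split: nat.splits)
lemma poly_over_add: "poly_over F p ==> poly_over F q ==> poly_over F (p + q)"
 by (auto simp: poly_over_def intro: closed)
lemma poly_over_diff: "poly_over F p ==> poly_over F q ==> poly_over F (p - q)"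
 by (auto simp: poly_over_def intro: closed)
lemma poly_over_uminus: "poly_over F p ==> poly_over F (- p)"
 by (auto simp: poly_over_def intro: closed)
lemma poly_over_mult: "poly_over F p ==> poly_over F q ==> poly_over F (p * q)"
 by (auto simp: poly_over_def coeff_mult intro!: closed)
lemma poly_over_smult: "c \<in> F ==> poly_over F q ==> poly_over F (smult c q)"
 by (auto simp: poly_over_def intro: closed)
lemma poly_over_sum: "(\<And>i. i \<in> I ==> poly_over F (f i)) ==> poly_over F (sum f I)"
 by (induction I rule: infinite_finite_induct) (auto intro: poly_over_add)
lemma poly_over_prod: "(\<And>i. i \<in> I ==> poly_over F (f i)) ==> poly_over F (prod f I)"
 by (induction I rule: infinite_finite_induct) (auto intro: poly_over_mult)
lemma poly_over_power: "poly_over F p ==> poly_over F (p ^ n)"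
 by (induction n) (auto intro: poly_over_mult)
lemma poly_over_pderiv: "poly_over F p ==> poly_over F (pderiv p)"
 unfolding poly_over_def coeff_pderiv by (auto intro!: mult_in of_nat_in simp del: of_nat_Suc)
lemma poly_over_pcompose: "poly_over F p ==> poly_over F q ==> poly_over F (pcompose p q)"
proof (induction p)
 case (pCons a p)
 hence "a \<in> F" "poly_over F p" unfolding poly_over_def
  by (metis coeff_pCons_0, metis coeff_pCons_Suc)
 thus ?case using pCons by (auto simp: pcompose_pCons intro!: poly_over_add poly_over_mult poly_over_const)
qed auto

lemma poly_in: "poly_over F p ==> x \<in> F ==> poly p x \<in> F"
 by (auto simp: poly_altdef poly_over_def intro!: closed)

lemmas poly_over_closed = poly_over_const poly_over_monom poly_over_pCons poly_over_add poly_over_diff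
 poly_over_uminus poly_over_mult poly_over_smult poly_over_sum poly_over_prod poly_over_power

lemma poly_over_division:
 assumes "poly_over F m" "m \<noteq> 0" "poly_over F g"
 shows "\<exists>q r. poly_over F q \<and> poly_over F r \<and> g = q * m + r \<and> (r = 0 \<or> degree r < degree m)"
 using assms(3)
proof (induction "degree g" arbitrary: g rule: less_induct)
 case less
 show ?case
 proof (cases "g = 0 \<or> degree g < degree m")
  case True
  thus ?thesis using less.prems by (intro exI[of _ 0] exI[of _ g]) auto
 next
  case False
  define c where "c = lead_coeff g / lead_coeff m"
  define t where "t = monom c (degree g - degree m)"
  have c: "c \<in> F" "c \<noteq> 0" using False assms less.prems unfolding c_def poly_over_def
   by (auto intro!: closed)
  have t: "poly_over F t" using c by (auto simp: t_def intro: poly_over_monom)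
  define g' where "g' = g - t * m"
  have g': "poly_over F g'" unfolding g'_def using t assms less.prems by (intro poly_over_closed)
  have dt: "degree (t * m) = degree g" using c False assms
   by (simp add: t_def degree_mult_eq degree_monom_eq monom_eq_0_iff)
  have lt: "lead_coeff (t * m) = lead_coeff g" using c False assms
   by (simp add: t_def lead_coeff_mult degree_monom_eq c_def)
  have "g' = 0 \<or> degree g' < degree g"
  proof -
   have "degree g' \<le> degree g" using dt unfolding g'_def
    by (metis degree_diff_le order_refl)
   moreover have "coeff g' (degree g) = 0" using lt dt unfolding g'_def by simp
   ultimately show ?thesis
    by (metis le_neq_implies_less leading_coeff_0_iff)
  qed
  thus ?thesis
  proof
   assume "g' = 0"
   thus ?thesis using t by (intro exI[of _ t] exI[of _ 0]) (auto simp: g'_def)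
  next
   assume "degree g' < degree g"
   from less.hyps[OF this g'] obtain q r where
    "poly_over F q" "poly_over F r" "g' = q * m + r" "r = 0 \<or> degree r < degree m" by blast
   thus ?thesis using t
    by (intro exI[of _ "q + t"] exI[of _ r]) (auto simp: g'_def algebra_simps intro: poly_over_add)
  qed
 qed
qed

text \<open>The generator is an element of least degree, made monic; a remainder on division by it
  lies in the ideal and has smaller degree, so it is 0. It serves for the annihilator of a number
  and for the ideal of two polynomials in a Bezout argument.\<close>

lemma poly_over_ideal_principal:
 assumes sub: "\<And>p. p \<in> I ==> poly_over F p"
  and ne: "p0 \<in> I" "p0 \<noteq> 0"
  and lin: "\<And>p q r. p \<in> I ==> q \<in> I ==> poly_over F r ==> p - r * q \<in> I"
 obtains d where "d \<in> I" "lead_coeff d = 1" "\<And>p. p \<in> I ==> \<exists>q. poly_over F q \<and> p = q * d"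
proof -
 define k where "k = (LEAST k. \<exists>p\<in>I. p \<noteq> 0 \<and> degree p = k)"
 have "\<exists>p\<in>I. p \<noteq> 0 \<and> degree p = k" unfolding k_def
  by (rule LeastI_ex) (use ne in auto)
 then obtain e where e: "e \<in> I" "e \<noteq> 0" "degree e = k" by blast
 have least: "k \<le> degree p" if "p \<in> I" "p \<noteq> 0" for p
  unfolding k_def by (rule Least_le) (use that in auto)
 define c where "c = inverse (lead_coeff e)"
 have c: "c \<in> F" using sub[OF e(1)] by (auto simp: c_def poly_over_def intro: closed)
 define d where "d = smult c e"
 have zero: "0 \<in> I" using lin[OF e(1) e(1), of 1] by simp
 have "d \<in> I" using lin[OF zero e(1), of "[:-c:]"] c
  by (auto simp: d_def intro!: poly_over_const closed)
 have lc: "lead_coeff e \<noteq> 0" using e(2) by simp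
 have dlc: "lead_coeff d = 1" using lc by (simp add: d_def c_def)
 have d0: "d \<noteq> 0" using dlc by auto
 have dd: "degree d = k" using e lc by (simp add: d_def c_def)
 have "\<exists>q. poly_over F q \<and> p = q * d" if p: "p \<in> I" for p
 proof -
  obtain q r where qr: "poly_over F q" "p = q * d + r" "r = 0 \<or> degree r < degree d"
   using poly_over_division[OF sub[OF \<open>d \<in> I\<close>] d0 sub[OF p]] by blast
  have "r \<in> I" using lin[OF p \<open>d \<in> I\<close> qr(1)] qr(2) by simp
  hence "r = 0" using least[of r] qr(3) dd by (metis not_le)
  with qr show ?thesis by auto
 qed
 with \<open>d \<in> I\<close> dlc show thesis using that by blast
qed

definition alg_over :: "complex => bool" where
 "alg_over x \<longleftrightarrow> (\<exists>p. poly_over F p \<and> p \<noteq> 0 \<and> poly p x = 0)"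

text \<open>The last clause records separability. It allows roots to be counted and the polynomial
  to be split into distinct linear factors.\<close>

definition is_min_poly :: "complex poly => complex => bool" where
 "is_min_poly m x \<longleftrightarrow> poly_over F m \<and> lead_coeff m = 1 \<and> poly m x = 0 \<and> degree m > 0 \<and>
  (\<forall>p. poly_over F p \<longrightarrow> poly p x = 0 \<longrightarrow> (\<exists>q. poly_over F q \<and> p = q * m)) \<and>
  (\<forall>y. poly m y = 0 \<longrightarrow> poly (pderiv m) y \<noteq> 0)"

lemma is_min_polyD:
 assumes "is_min_poly m x"
 shows "poly_over F m" "lead_coeff m = 1" "poly m x = 0" "degree m > 0"
  "\<And>p. poly_over F p ==> poly p x = 0 ==> \<exists>q. poly_over F q \<and> p = q * m"
  "\<And>y. poly m y = 0 ==> poly (pderiv m) y \<noteq> 0"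
 using assms unfolding is_min_poly_def by blast+

text \<open>For separability, let \<open>y\<close> be a multiple root of \<open>m\<close> and
  \<open>n\<close> its own monic annihilator. Then \<open>n\<close> divides \<open>m\<close> and
  vanishes at \<open>x\<close>, since otherwise the cofactor would vanish there with too small a
  degree; so \<open>n\<close> has at least the degree of \<open>m\<close>. But \<open>n\<close> also
  divides the derivative of \<open>m\<close>, which has smaller degree.\<close>

lemma minimal_polynomial:
 assumes "alg_over x"
 shows "\<exists>m. is_min_poly m x"
proof -
 have *: "\<exists>m. poly_over F m \<and> lead_coeff m = 1 \<and> poly m x = 0 \<and>
   (\<forall>p. poly_over F p \<longrightarrow> poly p x = 0 \<longrightarrow> (\<exists>q. poly_over F q \<and> p = q * m))"
  if alg: "alg_over x" for x
 proof -
  define I where "I = {p. poly_over F p \<and> poly p x = 0}"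
  obtain p0 where p0: "p0 \<in> I" "p0 \<noteq> 0"
   using alg unfolding alg_over_def I_def by blast
  obtain d where "d \<in> I" "lead_coeff d = 1" "\<And>p. p \<in> I ==> \<exists>q. poly_over F q \<and> p = q * d"
   by (rule poly_over_ideal_principal[of I p0])
    (use p0 in \<open>auto simp: I_def intro: poly_over_closed\<close>)
  thus ?thesis by (auto simp: I_def)
 qed
 obtain m where m: "poly_over F m" "lead_coeff m = 1" "poly m x = 0"
  and mdiv: "\<And>p. poly_over F p ==> poly p x = 0 ==> \<exists>q. poly_over F q \<and> p = q * m"
  using *[OF assms] by blast
 have posdeg: "degree m > 0" if "lead_coeff m = 1" "poly m x = 0" for m and x :: complex
  using that by (metis degree_0_id gr_zeroI poly_1 lead_coeff_1 of_nat_0 one_poly_eq_simps(1) pCons_one zero_neq_one)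
 have "poly (pderiv m) y \<noteq> 0" if y: "poly m y = 0" for y
 proof
  assume y': "poly (pderiv m) y = 0"
  have "m \<noteq> 0" using m by auto
  hence "alg_over y" unfolding alg_over_def using m y by blast
  from *[OF this] obtain n where n: "poly_over F n" "lead_coeff n = 1" "poly n y = 0"
   and ndiv: "\<And>p. poly_over F p ==> poly p y = 0 ==> \<exists>q. poly_over F q \<and> p = q * n" by blast
  obtain q where q: "poly_over F q" "m = q * n" using ndiv[OF m(1) y] by blast
  have q0: "q \<noteq> 0" "n \<noteq> 0" using q \<open>m \<noteq> 0\<close> by auto
  have dn: "degree n > 0" using posdeg n by blast
  have "poly n x = 0"
  proof (rule ccontr)
   assume "poly n x \<noteq> 0"
   hence "poly q x = 0" using m(3) q by simp
   then obtain r where "q = r * m" using mdiv q by blast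
   hence "degree m \<le> degree q" using q0 by (simp add: degree_mult_eq)
   moreover have "degree m = degree q + degree n" using q q0 by (simp add: degree_mult_eq)
   ultimately show False using dn by simp
  qed
  then obtain r where r: "n = r * m" using mdiv n by blast
  hence "degree m \<le> degree n" using q0 by (auto simp: degree_mult_eq)
  obtain s where s: "pderiv m = s * n" using ndiv[OF poly_over_pderiv[OF m(1)] y'] by blast
  have "pderiv m \<noteq> 0" using posdeg m by (simp add: pderiv_eq_0_iff)
  hence "degree n \<le> degree (pderiv m)" using s by (auto simp: degree_mult_eq)
  also have "... < degree m" using posdeg m by (simp add: degree_pderiv)
  finally show False using \<open>degree m \<le> degree n\<close> by simp
 qed
 with m mdiv posdeg[OF m(2,3)] show ?thesis unfolding is_min_poly_def by blast
qed

text \<open>The powers of \<open>x\<close> with exponents from 0 to \<open>card I\<close> are one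
  more than the spanning elements, hence linearly dependent.\<close>

lemma alg_over_of_finite_span:
 assumes "finite I" and "\<And>k. \<exists>q. (\<forall>i\<in>I. q i \<in> F) \<and> x ^ k = (\<Sum>i\<in>I. q i * f i)"
 shows "alg_over x"
proof -
 obtain q where q: "\<And>k i. i \<in> I ==> q k i \<in> F" "\<And>k. x ^ k = (\<Sum>i\<in>I. q k i * f i)"
  using assms(2) by metis
 obtain c where c: "\<forall>k\<in>{..card I}. c k \<in> F" "\<exists>k\<in>{..card I}. c k \<noteq> 0"
  "\<forall>i\<in>I. (\<Sum>k\<in>{..card I}. q k i * c k) = 0"
  using underdetermined_system[OF csubfield_axioms assms(1), of "{..card I}" "\<lambda>i k. q k i"] q
  by auto
 define p where "p = (\<Sum>k\<le>card I. monom (c k) k)"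
 have "poly_over F p" unfolding p_def using c(1) by (auto intro!: poly_over_closed)
 moreover have "p \<noteq> 0"
 proof -
  obtain k where k: "k \<le> card I" "c k \<noteq> 0" using c(2) by auto
  have "coeff p k = c k" using k by (simp add: p_def coeff_sum)
  thus ?thesis using k by auto
 qed
 moreover have "poly p x = 0"
 proof -
  have "poly p x = (\<Sum>k\<le>card I. \<Sum>i\<in>I. (q k i * c k) * f i)"
   unfolding p_def poly_sum poly_monom
   by (intro sum.cong) (auto simp: q(2) sum_distrib_left mult_ac)
  also have "... = (\<Sum>i\<in>I. (\<Sum>k\<le>card I. q k i * c k) * f i)"
   by (subst sum.swap) (simp add: sum_distrib_right)
  also have "... = 0" using c(3) by simp
  finally show ?thesis .
 qed
 ultimately show ?thesis unfolding alg_over_def by blast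
qed

end

section \<open>Spans; sums and products of algebraic numbers\<close>

definition lspan :: "complex set => 'i set => ('i => complex) => complex set" where
 "lspan F I f = {\<Sum>i\<in>I. q i * f i |q. \<forall>i\<in>I. q i \<in> F}"

context csubfield
begin

lemma lspan_add: "x \<in> lspan F I f ==> y \<in> lspan F I f ==> x + y \<in> lspan F I f"
proof -
 assume "x \<in> lspan F I f" "y \<in> lspan F I f"
 then obtain q r where "\<forall>i\<in>I. q i \<in> F" "x = (\<Sum>i\<in>I. q i * f i)" "\<forall>i\<in>I. r i \<in> F" "y = (\<Sum>i\<in>I. r i * f i)"
  unfolding lspan_def by blast
 thus ?thesis unfolding lspan_def
  by (intro CollectI exI[of _ "\<lambda>i. q i + r i"]) (auto simp: algebra_simps sum.distrib intro: closed)
qed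

lemma lspan_smult: "c \<in> F ==> x \<in> lspan F I f ==> c * x \<in> lspan F I f"
proof -
 assume c: "c \<in> F" and "x \<in> lspan F I f"
 then obtain q where "\<forall>i\<in>I. q i \<in> F" "x = (\<Sum>i\<in>I. q i * f i)"
  unfolding lspan_def by blast
 thus ?thesis unfolding lspan_def using c
  by (intro CollectI exI[of _ "\<lambda>i. c * q i"]) (auto simp: algebra_simps sum_distrib_left intro: closed)
qed

lemma lspan_0: "0 \<in> lspan F I f"
 unfolding lspan_def by (intro CollectI exI[of _ "\<lambda>i. 0"]) auto

lemma lspan_sum: "(\<And>j. j \<in> J ==> g j \<in> lspan F I f) ==> sum g J \<in> lspan F I f"
 by (induction J rule: infinite_finite_induct) (auto intro: lspan_0 lspan_add)

lemma lspan_base: "finite I ==> i \<in> I ==> f i \<in> lspan F I f"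
 unfolding lspan_def by (intro CollectI exI[of _ "\<lambda>j. if j = i then 1 else 0"]) (auto simp: if_distrib[of "\<lambda>c. c * _"] cong: if_cong)

lemma lspan_mult_closed:
 assumes "\<And>i. i \<in> I ==> a * f i \<in> lspan F I f" "x \<in> lspan F I f"
 shows "a * x \<in> lspan F I f"
proof -
 obtain q where q: "\<forall>i\<in>I. q i \<in> F" "x = (\<Sum>i\<in>I. q i * f i)" using assms(2) unfolding lspan_def by blast
 have "a * x = (\<Sum>i\<in>I. q i * (a * f i))" unfolding q by (simp add: sum_distrib_left mult_ac)
 also have "... \<in> lspan F I f" using q(1) assms(1) by (auto intro!: lspan_sum intro: lspan_smult)
 finally show ?thesis .
qed

lemma alg_over_power_reduce:
 assumes "alg_over x"
 obtains a q where "a > 0" "\<And>i. q i \<in> F" "x ^ a = (\<Sum>i<a. q i * x ^ i)"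
proof -
 obtain m where "is_min_poly m x"
  using minimal_polynomial[OF assms] by blast
 note m = is_min_polyD[OF this]
 have "0 = (\<Sum>i\<le>degree m. coeff m i * x ^ i)" using m(3) by (simp add: poly_altdef)
 also have "... = (\<Sum>i<degree m. coeff m i * x ^ i) + x ^ degree m"
  using m(2) by (simp flip: lessThan_Suc_atMost)
 finally have "x ^ degree m = (\<Sum>i<degree m. (- coeff m i) * x ^ i)"
  by (simp add: sum_negf eq_neg_iff_add_eq_0 add.commute)
 with m show thesis using that[of "degree m" "\<lambda>i. - coeff m i"]
  unfolding poly_over_def by (auto intro: closed)
qed

text \<open>The products \<open>x ^ i * y ^ j\<close> with i < a, j < b span a space that contains 1
  and is stable under multiplication by \<open>x\<close> and by \<open>y\<close>, hence contains all
  powers of the sum and of the product.\<close>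

lemma alg_over_add_mult:
 assumes "alg_over x" "alg_over y"
 shows "alg_over (x + y)" "alg_over (x * y)"
proof -
 obtain a q where a: "a > 0" "\<And>i. q i \<in> F" "x ^ a = (\<Sum>i<a. q i * x ^ i)"
  using alg_over_power_reduce[OF assms(1)] by blast
 obtain b r where b: "b > 0" "\<And>i. r i \<in> F" "y ^ b = (\<Sum>i<b. r i * y ^ i)"
  using alg_over_power_reduce[OF assms(2)] by blast
 define I where "I = {..<a} \<times> {..<b}"
 define f where "f = (\<lambda>(i,j). x ^ i * y ^ j)"
 have fin: "finite I" by (simp add: I_def)
 let ?V = "lspan F I f"
 have x: "x * f u \<in> ?V" if uI: "u \<in> I" for u
 proof -
  obtain i j where u: "u = (i, j)" "i < a" "j < b" using uI by (auto simp: I_def)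
  show ?thesis
  proof (cases "Suc i < a")
   case True
   thus ?thesis using lspan_base[OF fin, of "(Suc i, j)" f] u by (simp add: I_def f_def mult_ac)
  next
   case False
   hence "Suc i = a" using u by simp
   hence "x * f u = x ^ a * y ^ j" using u by (auto simp: f_def simp flip: power_Suc)
   also have "... = (\<Sum>i'<a. q i' * f (i', j))" unfolding a(3) by (simp add: f_def sum_distrib_right mult.assoc)
   also have "... \<in> ?V" using a u by (intro lspan_sum lspan_smult lspan_base fin) (auto simp: I_def)
   finally show ?thesis .
  qed
 qed
 have y: "y * f u \<in> ?V" if uI: "u \<in> I" for u
 proof -
  obtain i j where u: "u = (i, j)" "i < a" "j < b" using uI by (auto simp: I_def)
  show ?thesis
  proof (cases "Suc j < b")
   case True
   thus ?thesis using lspan_base[OF fin, of "(i, Suc j)" f] u by (simp add: I_def f_def mult_ac)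
  next
   case False
   hence "Suc j = b" using u by simp
   hence "y * f u = x ^ i * y ^ b" using u by (auto simp: f_def)
   also have "... = (\<Sum>i'<b. r i' * f (i, i'))" unfolding b(3) by (simp add: f_def sum_distrib_left mult.left_commute)
   also have "... \<in> ?V" using b u by (intro lspan_sum lspan_smult lspan_base fin) (auto simp: I_def)
   finally show ?thesis .
  qed
 qed
 have one: "1 \<in> ?V" using lspan_base[OF fin, of "(0,0)" f] a b by (simp add: I_def f_def)
 have "(x + y) ^ k \<in> ?V" for k
  by (induction k) (auto simp: one algebra_simps intro!: lspan_add lspan_mult_closed[OF x] lspan_mult_closed[OF y])
 thus "alg_over (x + y)"
  by (intro alg_over_of_finite_span[OF fin, of _ f]) (auto simp: lspan_def)
 have "(x * y) ^ k \<in> ?V" for k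
 proof (induction k)
  case (Suc k)
  have "(x * y) ^ Suc k = x * (y * (x * y) ^ k)" by simp
  also have "... \<in> ?V" by (intro lspan_mult_closed[OF x] lspan_mult_closed[OF y] Suc)
  finally show ?case .
 qed (simp add: one)
 thus "alg_over (x * y)"
  by (intro alg_over_of_finite_span[OF fin, of _ f]) (auto simp: lspan_def)
qed

end

lemma algebraic_iff_alg_over: "algebraic x \<longleftrightarrow> csubfield.alg_over \<rat> x"
 unfolding algebraic_altdef csubfield.alg_over_def[OF csubfield_Rats] poly_over_def by auto

lemma csubfield_Qbar: "csubfield Qbar"
proof -
 interpret csubfield \<rat> by (rule csubfield_Rats)
 show ?thesis
 proof
  fix x assume "x \<in> Qbar"
  thus "- x \<in> Qbar" "inverse x \<in> Qbar" by (auto simp: Qbar_def)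
  fix y assume "y \<in> Qbar"
  with \<open>x \<in> Qbar\<close> show "x + y \<in> Qbar" "x * y \<in> Qbar"
   by (auto simp: Qbar_def algebraic_iff_alg_over intro: alg_over_add_mult)
 qed (auto simp: Qbar_def)
qed

section \<open>Simple extensions of the rationals and primitive elements\<close>

lemmas minimal_polynomial_Rats = csubfield.minimal_polynomial[OF csubfield_Rats, folded algebraic_iff_alg_over]

definition adjoin :: "complex => complex set" where
 "adjoin x = {poly g x |g. poly_over \<rat> g}"

text \<open>Inverses come from Bezout. The generator \<open>d\<close> of the ideal of
  \<open>g\<close> and the minimal polynomial \<open>m\<close> does not vanish at \<open>x\<close>,
  so the cofactor of \<open>d\<close> in \<open>m\<close> does; that cofactor is then a multiple of
  \<open>m\<close>, which leaves degree 0 for \<open>d\<close>.\<close>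

lemma csubfield_adjoin:
 assumes "algebraic x"
 shows "csubfield (adjoin x)" "x \<in> adjoin x"
proof -
 interpret csubfield \<rat> by (rule csubfield_Rats)
 show "x \<in> adjoin x" unfolding adjoin_def
  by (intro CollectI exI[of _ "[:0,1:]"]) (auto intro!: poly_over_closed)
 have alg: "alg_over x" using assms by (simp add: algebraic_iff_alg_over)
 obtain m where "csubfield.is_min_poly \<rat> m x"
  using minimal_polynomial_Rats[OF assms] by blast
 note m = csubfield.is_min_polyD[OF csubfield_Rats this]
 have inv: "inverse (poly g x) \<in> adjoin x" if g: "poly_over \<rat> g" for g
 proof (cases "poly g x = 0")
  case True
  thus ?thesis unfolding adjoin_def by (intro CollectI exI[of _ 0]) auto
 next
  case False
  define I where "I = {u * g + v * m |u v. poly_over \<rat> u \<and> poly_over \<rat> v}"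
  have "m = 0 * g + 1 * m" "g = 1 * g + 0 * m" by auto
  hence mg: "m \<in> I" "g \<in> I" unfolding I_def
   using poly_over_0 poly_over_1 by blast+
  have lin: "p - r * q \<in> I" if pq: "p \<in> I" "q \<in> I" "poly_over \<rat> r" for p q r
  proof -
   obtain u v u' v' where "poly_over \<rat> u" "poly_over \<rat> v" "poly_over \<rat> u'" "poly_over \<rat> v'"
    "p = u * g + v * m" "q = u' * g + v' * m" using pq(1,2) unfolding I_def by blast
   thus ?thesis unfolding I_def using pq(3)
    by (intro CollectI exI[of _ "u - r * u'"] exI[of _ "v - r * v'"])
     (auto simp: algebra_simps intro!: poly_over_closed)
  qed
  have m0: "m \<noteq> 0" using m(2) by auto
  have sub: "poly_over \<rat> p" if "p \<in> I" for p
   using that m(1) g unfolding I_def by (auto intro!: poly_over_add poly_over_mult)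
  obtain d where d: "d \<in> I" "lead_coeff d = 1" "\<And>p. p \<in> I ==> \<exists>q. poly_over \<rat> q \<and> p = q * d"
   by (rule poly_over_ideal_principal[of I m]) (use sub mg(1) m0 lin in blast)+
  obtain q where q: "poly_over \<rat> q" "m = q * d" using d(3)[OF mg(1)] by blast
  obtain q' where q': "g = q' * d" using d(3)[OF mg(2)] by blast
  have "poly d x \<noteq> 0" using q' False by auto
  hence "poly q x = 0" using q m(3) by auto
  then obtain s where s: "q = s * m" using m(5)[OF q(1)] by blast
  have "degree d = 0"
  proof -
   have "q \<noteq> 0" "d \<noteq> 0" "s \<noteq> 0" using q(2) s m0 by auto
   hence "degree (q * d) = degree q + degree d" "degree m \<le> degree (s * m)"
    using m0 by (simp_all add: degree_mult_eq)
   thus ?thesis by (simp flip: q(2) s)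
  qed
  then obtain a where "d = [:a:]" by (rule degree_eq_zeroE)
  hence "d = 1" using d(2) by (simp add: one_pCons)
  then obtain u v where uv: "poly_over \<rat> u" "1 = u * g + v * m" using d(1) unfolding I_def by blast
  have "1 = poly u x * poly g x" using arg_cong[OF uv(2), of "\<lambda>p. poly p x"] m(3) by simp
  hence "inverse (poly g x) = poly u x" using False by (simp add: field_simps)
  thus ?thesis using uv(1) unfolding adjoin_def by auto
 qed
 show "csubfield (adjoin x)"
 proof
  show "0 \<in> adjoin x" unfolding adjoin_def by (intro CollectI exI[of _ 0]) auto
  show "1 \<in> adjoin x" unfolding adjoin_def by (intro CollectI exI[of _ 1]) auto
  fix y assume y: "y \<in> adjoin x"
  then obtain g where g: "y = poly g x" "poly_over \<rat> g" unfolding adjoin_def by auto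
  show "- y \<in> adjoin x" unfolding adjoin_def
   by (intro CollectI exI[of _ "- g"]) (auto simp: g intro: poly_over_closed)
  show "inverse y \<in> adjoin x" using inv g by simp
  fix z assume "z \<in> adjoin x"
  then obtain h where h: "z = poly h x" "poly_over \<rat> h" unfolding adjoin_def by auto
  show "y + z \<in> adjoin x" unfolding adjoin_def
   by (intro CollectI exI[of _ "g + h"]) (auto simp: g h intro: poly_over_closed)
  show "y * z \<in> adjoin x" unfolding adjoin_def
   by (intro CollectI exI[of _ "g * h"]) (auto simp: g h intro: poly_over_closed)
 qed
qed

lemma adjoin_least:
 assumes "csubfield F" "x \<in> F" shows "adjoin x \<subseteq> F"
proof -
 interpret csubfield F by fact
 have "poly_over F g" if "poly_over \<rat> g" for g
  using that Rats_subset unfolding poly_over_def by blast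
 thus ?thesis using assms(2) unfolding adjoin_def by (auto intro: poly_in)
qed

text \<open>With t = x + c y, the number \<open>y\<close> is a root of g(z) and of f(t - c z). If
  \<open>c\<close> avoids finitely many values there is no other common root, so the minimal
  polynomial of \<open>y\<close> over the field generated by t has only the root \<open>y\<close>,
  which is simple; it is linear and its constant term puts \<open>y\<close> into that field.\<close>

lemma primitive_element_two:
 assumes "algebraic x" "algebraic y"
 obtains c :: int where "x \<in> adjoin (x + of_int c * y)" "y \<in> adjoin (x + of_int c * y)"
proof -
 interpret Q: csubfield \<rat> by (rule csubfield_Rats)
 obtain f where "csubfield.is_min_poly \<rat> f x"
  using minimal_polynomial_Rats[OF assms(1)] by blast
 note f = csubfield.is_min_polyD[OF csubfield_Rats this]
 obtain g where "csubfield.is_min_poly \<rat> g y"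
  using minimal_polynomial_Rats[OF assms(2)] by blast
 note g = csubfield.is_min_polyD[OF csubfield_Rats this]
 have f0: "f \<noteq> 0" "g \<noteq> 0" using f g by auto
 \<comment> \<open>The values of \<open>c\<close> for which some z different from \<open>y\<close>
   would be another common root. Pairs with y' = y contribute only 0, by the convention for division
   by zero.\<close>
 define B where "B = (\<lambda>(x', y'). (x' - x) / (y - y')) ` ({z. poly f z = 0} \<times> {z. poly g z = 0})"
 have "finite B" unfolding B_def using f0 by (intro finite_imageI finite_cartesian_product poly_roots_finite)
 moreover have "infinite (range (of_int :: int => complex))"
 proof
  assume "finite (range (of_int :: int => complex))"
  hence "finite (UNIV :: int set)" by (rule finite_imageD) (simp add: inj_on_def)
  thus False using infinite_UNIV_int by simp
 qed
 ultimately have "\<not> range (of_int :: int => complex) \<subseteq> B" using finite_subset by blast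
 then obtain c :: int where c: "of_int c \<notin> B" by auto
 define t where "t = x + of_int c * y"
 have qint: "of_int k \<in> Qbar" for k by (simp add: csubfield.of_int_in[OF csubfield_Qbar])
 have algt: "algebraic t" using assms csubfield.closed(1,2)[OF csubfield_Qbar] qint
  unfolding t_def Qbar_def by simp
 interpret T: csubfield "adjoin t" by (rule csubfield_adjoin[OF algt])
 have up: "poly_over (adjoin t) p" if "poly_over \<rat> p" for p
  using that T.Rats_subset unfolding poly_over_def by blast
 define h where "h = pcompose f [:t, - of_int c:]"
 have tin: "t \<in> adjoin t" by (rule csubfield_adjoin(2)[OF algt])
 have hover: "poly_over (adjoin t) h" unfolding h_def
  by (intro T.poly_over_pcompose up f(1) T.poly_over_pCons T.poly_over_0 T.minus_in T.of_int_in tin)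
 have hy: "poly h y = 0" unfolding h_def t_def using f by (simp add: poly_pcompose)
 have "T.alg_over y" unfolding T.alg_over_def using up[OF g(1)] g f0 by blast
 then obtain m where "T.is_min_poly m y"
  using T.minimal_polynomial by blast
 note m = T.is_min_polyD[OF this]
 obtain q1 where q1: "g = q1 * m" using m(5)[OF up[OF g(1)] g(3)] by blast
 obtain q2 where q2: "h = q2 * m" using m(5)[OF hover hy] by blast
 have only: "z = y" if z: "poly m z = 0" for z
 proof (rule ccontr)
  assume "z \<noteq> y"
  have "poly g z = 0" "poly h z = 0" using z q1 q2 by auto
  hence "poly f (t - of_int c * z) = 0" by (simp add: h_def poly_pcompose algebra_simps)
  moreover have "of_int c = (t - of_int c * z - x) / (y - z)"
   using \<open>z \<noteq> y\<close> by (simp add: t_def field_simps)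
  ultimately have "of_int c \<in> B" unfolding B_def using \<open>poly g z = 0\<close>
   by (intro image_eqI[of _ _ "(t - of_int c * z, z)"]) auto
  thus False using c by simp
 qed
 have m0: "m \<noteq> 0" using m(2) by auto
 have "rsquarefree m" unfolding rsquarefree_roots using m(6) by blast
 from complex_poly_decompose_rsquarefree[OF this]
 have "m = (\<Prod>z | poly m z = 0. [:- z, 1:])" using m(2) by simp
 also have "{z. poly m z = 0} = {y}"
 proof (rule Set.set_eqI)
  fix z show "z \<in> {z. poly m z = 0} \<longleftrightarrow> z \<in> {y}" using only[of z] m(3) by auto
 qed
 finally have "m = [:- y, 1:]" by simp
 moreover have "coeff m 0 \<in> adjoin t" using m(1) by (simp add: poly_over_def)
 ultimately have "- y \<in> adjoin t" by simp
 from T.minus_in[OF this] have yin: "y \<in> adjoin t" by simp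
 have "x = t - of_int c * y" by (simp add: t_def)
 also have "... \<in> adjoin t" by (intro T.diff_in T.mult_in T.of_int_in yin tin)
 finally show thesis using yin unfolding t_def by (rule that)
qed

text \<open>Integer coefficients are fixed by every field homomorphism, so the image of a primitive
  element is the same combination of the images of the generators.\<close>

definition int_comb :: "complex set => (complex => int) => complex" where
 "int_comb A c = (\<Sum>a\<in>A. of_int (c a) * a)"

lemma algebraic_int_comb:
 assumes "\<forall>a\<in>A. algebraic a"
 shows "algebraic (int_comb A c)"
proof -
 interpret csubfield Qbar by (rule csubfield_Qbar)
 have "int_comb A c \<in> Qbar"
  unfolding int_comb_def using assms by (intro sum_in mult_in of_int_in) (simp add: Qbar_def)
 thus ?thesis by (simp add: Qbar_def)
qed

lemma primitive_element:
 assumes "finite A" "\<forall>a\<in>A. algebraic a"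
 shows "\<exists>c. A \<subseteq> adjoin (int_comb A c)"
 using assms
proof (induction A rule: finite_induct)
 case empty
 show ?case by (rule exI[of _ "\<lambda>_. 0"]) simp
next
 case (insert b A)
 have algA: "\<forall>a\<in>A. algebraic a" and algb: "algebraic b" using insert.prems by auto
 obtain c where c: "A \<subseteq> adjoin (int_comb A c)"
  using insert.IH[OF algA] by (elim exE)
 have sa: "algebraic (int_comb A c)" by (rule algebraic_int_comb[OF algA])
 obtain k :: int where k: "int_comb A c \<in> adjoin (int_comb A c + of_int k * b)"
  "b \<in> adjoin (int_comb A c + of_int k * b)"
  by (rule primitive_element_two[OF sa algb])
 define c' where "c' = c(b := k)"
 have "int_comb A c' = int_comb A c"
  unfolding int_comb_def c'_def using insert.hyps by (intro sum.cong) auto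
 hence eq: "int_comb (insert b A) c' = int_comb A c + of_int k * b"
  using insert.hyps by (simp add: int_comb_def c'_def add.commute)
 define t where "t = int_comb (insert b A) c'"
 note k = k[folded eq, folded t_def]
 have algt: "algebraic t" unfolding t_def by (rule algebraic_int_comb[OF insert.prems])
 have "adjoin (int_comb A c) \<subseteq> adjoin t"
  by (rule adjoin_least[OF csubfield_adjoin(1)[OF algt] k(1)])
 with c have "A \<subseteq> adjoin t" by (rule order_trans)
 with k(2) have "insert b A \<subseteq> adjoin t" by (simp only: insert_subset)
 thus ?case unfolding t_def by (rule exI[of _ c'])
qed

section \<open>Galois number fields\<close>

locale csubfield_hom = csubfield F for F +
 fixes s :: "complex => complex"
 assumes hom_add: "x \<in> F ==> y \<in> F ==> s (x + y) = s x + s y"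
  and hom_mult: "x \<in> F ==> y \<in> F ==> s (x * y) = s x * s y"
  and hom_one: "s 1 = 1"
begin

lemma hom_zero: "s 0 = 0"
 using hom_add[of 0 0] by simp

lemma hom_minus: "x \<in> F ==> s (- x) = - s x"
 using hom_add[of x "- x"] by (simp add: hom_zero minus_in eq_neg_iff_add_eq_0 add.commute)

lemma hom_diff: "x \<in> F ==> y \<in> F ==> s (x - y) = s x - s y"
 using hom_add[of x "- y"] by (simp add: hom_minus minus_in)

lemma hom_eq_0_iff: "x \<in> F ==> s x = 0 \<longleftrightarrow> x = 0"
 using hom_mult[of x "inverse x"] by (cases "x = 0") (auto simp: hom_zero hom_one inverse_in)

lemma hom_inverse: "x \<in> F ==> s (inverse x) = inverse (s x)"
proof (cases "x = 0")
 case False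
 assume x: "x \<in> F"
 have "s x * s (inverse x) = s (x * inverse x)" using x by (simp only: hom_mult inverse_in)
 also have "... = 1" using False by (simp add: hom_one)
 finally show ?thesis by (metis inverse_unique)
qed (simp add: hom_zero)

lemma hom_divide: "x \<in> F ==> y \<in> F ==> s (x / y) = s x / s y"
 by (simp add: divide_inverse hom_mult hom_inverse inverse_in)

lemma hom_sum: "(\<And>i. i \<in> I ==> f i \<in> F) ==> s (sum f I) = (\<Sum>i\<in>I. s (f i))"
 by (induction I rule: infinite_finite_induct) (auto simp: hom_zero hom_add sum_in)

lemma hom_power: "x \<in> F ==> s (x ^ n) = s x ^ n"
 by (induction n) (auto simp: hom_one hom_mult power_in)

lemma hom_of_nat: "s (of_nat n) = of_nat n"
 by (induction n) (auto simp: hom_zero hom_one hom_add of_nat_in)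

lemma hom_of_int: "s (of_int n) = of_int n"
 by (cases n rule: int_cases2) (auto simp: hom_of_nat hom_minus of_nat_in)

lemma hom_Rats: "x \<in> \<rat> ==> s x = x"
 by (auto elim!: Rats_cases' simp: hom_divide hom_of_int of_int_in)

lemma hom_poly: "poly_over \<rat> p ==> x \<in> F ==> s (poly p x) = poly p (s x)"
proof -
 assume p: "poly_over \<rat> p" and x: "x \<in> F"
 have c: "coeff p i \<in> \<rat>" "coeff p i \<in> F" for i using p Rats_subset unfolding poly_over_def by blast+
 have "s (\<Sum>i\<le>degree p. coeff p i * x ^ i) = (\<Sum>i\<le>degree p. s (coeff p i * x ^ i))"
  by (rule hom_sum) (intro mult_in power_in c x)
 also have "... = (\<Sum>i\<le>degree p. coeff p i * s x ^ i)"
  by (intro sum.cong refl) (simp add: hom_mult hom_power hom_Rats c x power_in)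
 finally show ?thesis by (simp add: poly_altdef)
qed

lemma hom_inj: "x \<in> F ==> y \<in> F ==> s x = s y \<longleftrightarrow> x = y"
 using hom_eq_0_iff[of "x - y"] by (auto simp: hom_diff diff_in)

end

text \<open>\<open>G\<close> is the Galois group of \<open>M\<close> over the rationals. Its
  elements are extensional functions on \<open>M\<close>, so that equal automorphisms are equal
  functions and \<open>G\<close> is finite; products must therefore be restricted to
  \<open>M\<close>.\<close>

locale galois_field = csubfield M for M +
 fixes G :: "(complex => complex) set"
 assumes finite_G: "finite G"
  and G_hom: "s \<in> G ==> csubfield_hom M s"
  and G_maps: "s \<in> G ==> x \<in> M ==> s x \<in> M"
  and G_ext: "s \<in> G ==> s \<in> extensional M"
  and G_id: "(\<lambda>x\<in>M. x) \<in> G"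
  and G_comp: "s \<in> G ==> t \<in> G ==> (\<lambda>x\<in>M. s (t x)) \<in> G"
  and G_fixed: "x \<in> M ==> (\<And>s. s \<in> G ==> s x = x) ==> x \<in> \<rat>"
begin

lemma G_ne: "G \<noteq> {}" using G_id by auto

lemma card_G_pos: "card G > 0" using finite_G G_ne by (simp add: card_gt_0_iff)

lemma bij_G_comp: "s \<in> G ==> bij_betw (\<lambda>t. \<lambda>x\<in>M. s (t x)) G G"
proof -
 assume s: "s \<in> G"
 interpret s: csubfield_hom M s using G_hom[OF s] .
 have "inj_on (\<lambda>t. \<lambda>x\<in>M. s (t x)) G"
 proof (rule inj_onI)
  fix t u assume tu: "t \<in> G" "u \<in> G" "(\<lambda>x\<in>M. s (t x)) = (\<lambda>x\<in>M. s (u x))"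
  show "t = u"
  proof (rule extensionalityI[OF G_ext G_ext])
   fix x assume x: "x \<in> M"
   have "s (t x) = s (u x)" using fun_cong[OF tu(3), of x] x by simp
   thus "t x = u x" using s.hom_inj G_maps tu x by blast
  qed (use tu in auto)
 qed
 moreover have "(\<lambda>t. \<lambda>x\<in>M. s (t x)) ` G \<subseteq> G" using G_comp s by auto
 ultimately show ?thesis using finite_G by (simp add: bij_betw_def endo_inj_surj)
qed

text \<open>Left translation permutes \<open>G\<close>. The unrestricted composite of
  \<open>s\<close> and \<open>t\<close> is not itself in \<open>G\<close>, hence the assumption that
  \<open>f\<close> sees only values on \<open>M\<close>.\<close>

lemma sum_G_comp:
 assumes s: "s \<in> G" and f: "\<And>t u. [|\<And>x. x \<in> M ==> t x = u x|] ==> f t = f u"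
 shows "(\<Sum>t\<in>G. f (\<lambda>x. s (t x))) = (\<Sum>t\<in>G. f t)"
proof -
 have "(\<Sum>t\<in>G. f t) = (\<Sum>t\<in>G. f (\<lambda>x\<in>M. s (t x)))"
  by (rule sum.reindex_bij_betw[OF bij_G_comp[OF s], symmetric])
 also have "... = (\<Sum>t\<in>G. f (\<lambda>x. s (t x)))" by (intro sum.cong refl f) auto
 finally show ?thesis by simp
qed

text \<open>The characteristic polynomial of \<open>x\<close> over the rationals. Unlike the minimal
  polynomial it has degree \<open>card G\<close> for every \<open>x\<close>, which makes bounds
  uniform.\<close>

definition gpoly :: "complex => complex poly" where
 "gpoly x = (\<Prod>s\<in>G. [:- s x, 1:])"

lemma gpoly_root: "x \<in> M ==> poly (gpoly x) x = 0"
 unfolding gpoly_def poly_prod using finite_G G_id by (auto simp: prod_zero_iff intro!: bexI[of _ "\<lambda>x\<in>M. x"])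

text \<open>An automorphism applied to the coefficients permutes the linear factors; so the
  coefficients are fixed by \<open>G\<close>.\<close>

lemma gpoly_over: assumes x: "x \<in> M" shows "poly_over \<rat> (gpoly x)"
proof -
 have lin: "poly_over M [:- t x, 1:]" if "t \<in> G" for t
  using minus_in[OF G_maps[OF that x]] by (intro poly_over_pCons) auto
 have M: "poly_over M (gpoly x)" unfolding gpoly_def by (intro poly_over_prod lin)
 have mp: "map_poly s (p * q) = map_poly s p * map_poly s q" if "s \<in> G" "poly_over M p" "poly_over M q" for s p q
 proof -
  interpret s: csubfield_hom M s using G_hom \<open>s \<in> G\<close> .
  have c: "coeff p i \<in> M" "coeff q i \<in> M" for i using that(2,3) unfolding poly_over_def by blast+
  have "s (\<Sum>i\<le>n. coeff p i * coeff q (n - i)) = (\<Sum>i\<le>n. s (coeff p i * coeff q (n - i)))" for n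
   by (rule s.hom_sum) (intro mult_in c)
  thus ?thesis
   by (intro poly_eqI) (simp add: coeff_map_poly s.hom_zero coeff_mult s.hom_mult c)
 qed
 have fx: "map_poly s (gpoly x) = gpoly x" if s: "s \<in> G" for s
 proof -
  interpret s: csubfield_hom M s using G_hom[OF s] .
  have "map_poly s (\<Prod>t\<in>H. [:- t x, 1:]) = (\<Prod>t\<in>H. [:- s (t x), 1:])" if "H \<subseteq> G" for H
   using finite_subset[OF that finite_G] that
  proof (induction H rule: finite_induct)
   case (insert t H)
   have t: "t \<in> G" "H \<subseteq> G" using insert.prems by auto
   have 2: "poly_over M (\<Prod>t\<in>H. [:- t x, 1:])" using t(2) by (intro poly_over_prod lin) auto
   have tx: "t x \<in> M" by (rule G_maps[OF t(1) x])
   have "map_poly s [:- t x, 1:] = [:- s (t x), 1:]"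
    using tx by (simp add: map_poly_pCons s.hom_zero s.hom_one s.hom_minus)
   moreover have "map_poly s (\<Prod>t\<in>H. [:- t x, 1:]) = (\<Prod>t\<in>H. [:- s (t x), 1:])"
    by (rule insert.IH[OF t(2)])
   ultimately show ?case
    using mp[OF s lin[OF t(1)] 2] by (simp only: prod.insert[OF insert.hyps])
  qed (simp add: s.hom_one map_poly_1')
  hence "map_poly s (gpoly x) = (\<Prod>t\<in>G. [:- s (t x), 1:])" unfolding gpoly_def by blast
  also have "... = (\<Prod>t\<in>G. [:- (\<lambda>x\<in>M. s (t x)) x, 1:])" using x by simp
  also have "... = (\<Prod>t\<in>G. [:- t x, 1:])"
   by (rule prod.reindex_bij_betw[OF bij_G_comp[OF s], of "\<lambda>t. [:- t x, 1:]"])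
  finally show ?thesis by (simp add: gpoly_def)
 qed
 show ?thesis unfolding poly_over_def
 proof
  fix i
  show "coeff (gpoly x) i \<in> \<rat>"
  proof (rule G_fixed)
   fix s assume s: "s \<in> G"
   interpret s: csubfield_hom M s using G_hom[OF s] .
   show "s (coeff (gpoly x) i) = coeff (gpoly x) i"
    using arg_cong[OF fx[OF s], of "\<lambda>p. coeff p i"] by (simp add: coeff_map_poly s.hom_zero)
  qed (use M in \<open>auto simp: poly_over_def\<close>)
 qed
qed

lemma gpoly_monic: "lead_coeff (gpoly x) = 1" "degree (gpoly x) = card G" "gpoly x \<noteq> 0"
proof -
 show "lead_coeff (gpoly x) = 1" by (simp add: gpoly_def lead_coeff_prod)
 thus "gpoly x \<noteq> 0" by auto
 show "degree (gpoly x) = card G" by (simp add: gpoly_def degree_prod_eq_sum_degree)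
qed

end

text \<open>\<open>M\<close> is generated by all roots of one rational polynomial that vanishes on
  \<open>B\<close>. Homomorphisms permute these roots, so they map \<open>M\<close> to itself, and
  \<open>G\<close> can be taken to be all of them.\<close>

lemma galois_field_exists:
 assumes B: "finite B" "B \<subseteq> Qbar"
 obtains M G where "galois_field M G" "B \<subseteq> M"
proof -
 interpret Q: csubfield \<rat> by (rule csubfield_Rats)
 have "\<forall>x\<in>B. \<exists>p. poly_over \<rat> p \<and> p \<noteq> 0 \<and> poly p x = 0"
  using B(2) by (auto simp: Qbar_def algebraic_iff_alg_over Q.alg_over_def)
 then obtain p where p: "\<And>x. x \<in> B ==> poly_over \<rat> (p x)" "\<And>x. x \<in> B ==> p x \<noteq> 0"
  "\<And>x. x \<in> B ==> poly (p x) x = 0" by metis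
 define P where "P = (\<Prod>x\<in>B. p x)"
 have P: "poly_over \<rat> P" "P \<noteq> 0" using p B by (auto simp: P_def intro: Q.poly_over_prod)
 define A where "A = {z. poly P z = 0}"
 have XA: "B \<subseteq> A" 
 proof
  fix x assume x: "x \<in> B"
  have "(\<Prod>y\<in>B. poly (p y) x) = 0"
   by (rule prod_zero[OF B(1)], rule bexI[OF _ x], rule p(3)[OF x])
  thus "x \<in> A" by (simp add: A_def P_def poly_prod)
 qed
 have finA: "finite A" unfolding A_def by (rule poly_roots_finite[OF P(2)])
 have algA: "algebraic a" if a: "a \<in> A" for a
 proof -
  have "poly P a = 0" using a by (simp add: A_def)
  with P have "Q.alg_over a" unfolding Q.alg_over_def by blast
  thus ?thesis by (simp add: algebraic_iff_alg_over)
 qed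
 have "\<forall>a\<in>A. algebraic a" using algA by simp
 from primitive_element[OF finA this] obtain c where c: "A \<subseteq> adjoin (int_comb A c)" by (elim exE)
 define \<theta> where "\<theta> = int_comb A c"
 define M where "M = adjoin \<theta>"
 have AM: "A \<subseteq> M" using c by (simp add: M_def \<theta>_def)
 have alg: "algebraic \<theta>" unfolding \<theta>_def by (intro algebraic_int_comb ballI algA)
 interpret M: csubfield M unfolding M_def by (rule csubfield_adjoin(1)[OF alg])
 have \<theta>M: "\<theta> \<in> M" unfolding M_def by (rule csubfield_adjoin(2)[OF alg])
 obtain m where "csubfield.is_min_poly \<rat> m \<theta>"
  using minimal_polynomial_Rats[OF alg] by blast
 note m = csubfield.is_min_polyD[OF csubfield_Rats this]
 have m0: "m \<noteq> 0" using m(2) by auto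
 define G where "G = {s \<in> extensional M. csubfield_hom M s \<and> (\<forall>x\<in>M. s x \<in> M)}"
 have hom_\<theta>: "s (poly g \<theta>) = poly g (s \<theta>)" if "csubfield_hom M s" "poly_over \<rat> g" for s g
  using csubfield_hom.hom_poly[OF that(1,2) \<theta>M] .
 have "inj_on (\<lambda>s. s \<theta>) G"
 proof (rule inj_onI)
  fix s t assume st: "s \<in> G" "t \<in> G" "s \<theta> = t \<theta>"
  show "s = t"
  proof (rule extensionalityI[of _ M])
   fix x assume "x \<in> M"
   then obtain g where "x = poly g \<theta>" "poly_over \<rat> g" unfolding M_def adjoin_def by blast
   moreover have "csubfield_hom M s" "csubfield_hom M t" using st by (simp_all add: G_def)
   ultimately show "s x = t x" using hom_\<theta>[of s g] hom_\<theta>[of t g] st(3) by simp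
  qed (use st in \<open>auto simp: G_def\<close>)
 qed
 moreover have "(\<lambda>s. s \<theta>) ` G \<subseteq> {z. poly m z = 0}"
 proof (rule image_subsetI)
  fix s assume "s \<in> G"
  hence s: "csubfield_hom M s" by (simp add: G_def)
  show "s \<theta> \<in> {z. poly m z = 0}" using hom_\<theta>[OF s m(1)] m(3) csubfield_hom.hom_zero[OF s] by simp
 qed
 ultimately have finG: "finite G"
  by (rule finite_imageD[OF finite_subset[OF _ poly_roots_finite[OF m0]], rotated])
 \<comment> \<open>Every conjugate of \<theta> comes from an automorphism: substituting the
   conjugate is well defined because two polynomials with the same value at \<theta> differ by a
   multiple of \<open>m\<close>.\<close>
 have ex: "\<exists>s\<in>G. \<forall>g. poly_over \<rat> g \<longrightarrow> s (poly g \<theta>) = poly g \<rho>" if \<rho>: "poly m \<rho> = 0" for \<rho>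
 proof -
  define s where "s = (\<lambda>x\<in>M. poly (SOME g. poly_over \<rat> g \<and> poly g \<theta> = x) \<rho>)"
  have s: "s (poly g \<theta>) = poly g \<rho>" if g: "poly_over \<rat> g" for g
  proof -
   define h where "h = (SOME h. poly_over \<rat> h \<and> poly h \<theta> = poly g \<theta>)"
   have "\<exists>h. poly_over \<rat> h \<and> poly h \<theta> = poly g \<theta>" using g by blast
   hence h: "poly_over \<rat> h" "poly h \<theta> = poly g \<theta>" 
    unfolding h_def by (rule someI2_ex; blast)+
   then obtain q where "h - g = q * m" using m(5)[of "h - g"] g by (auto intro: Q.poly_over_diff)
   hence "poly (h - g) \<rho> = 0" using \<rho> by simp
   moreover have "poly g \<theta> \<in> M" using g unfolding M_def adjoin_def by blast
   ultimately show ?thesis unfolding s_def h_def by simp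
  qed
  have hom: "csubfield_hom M s"
  proof
   fix x y assume "x \<in> M" "y \<in> M"
   then obtain g h where gh: "poly_over \<rat> g" "poly_over \<rat> h" "x = poly g \<theta>" "y = poly h \<theta>"
    unfolding M_def adjoin_def by blast
   show "s (x + y) = s x + s y"
    using s[OF Q.poly_over_add[OF gh(1,2)]] s[OF gh(1)] s[OF gh(2)] gh by simp
   show "s (x * y) = s x * s y"
    using s[OF Q.poly_over_mult[OF gh(1,2)]] s[OF gh(1)] s[OF gh(2)] gh by simp
  next
   show "s 1 = 1" using s[OF Q.poly_over_1] by simp
  qed
  interpret s: csubfield_hom M s by (rule hom)
  have sA: "s a \<in> A" if "a \<in> A" for a
   using s.hom_poly[OF P(1), of a] that AM unfolding A_def by (auto simp: s.hom_zero)
  \<comment> \<open>Here it matters that \<theta> is an integer combination of the roots in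
    \<open>A\<close>: its image is the same combination of elements of \<open>A\<close>, hence in
    \<open>M\<close>.\<close>
  have "\<rho> = s \<theta>" using s[of "[:0,1:]"] by (simp add: Q.poly_over_pCons)
  also have "s \<theta> = (\<Sum>a\<in>A. s (of_int (c a) * a))" unfolding \<theta>_def int_comb_def
   by (rule s.hom_sum) (intro M.mult_in M.of_int_in subsetD[OF AM])
  also have "... = (\<Sum>a\<in>A. of_int (c a) * s a)"
   by (intro sum.cong refl) (simp add: s.hom_mult s.hom_of_int M.of_int_in subsetD[OF AM])
  also have "... \<in> M" by (intro M.sum_in M.mult_in M.of_int_in subsetD[OF AM sA])
  finally have \<rho>M: "\<rho> \<in> M" .
  have sM: "s x \<in> M" if xM: "x \<in> M" for x
  proof -
   obtain g where g: "x = poly g \<theta>" "poly_over \<rat> g" using xM unfolding M_def adjoin_def by blast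
   have "poly_over M g" using g(2) M.Rats_subset unfolding poly_over_def by blast
   hence "poly g \<rho> \<in> M" using \<rho>M by (rule M.poly_in)
   thus ?thesis using s[OF g(2)] g(1) by simp
  qed
  have "s \<in> G" unfolding G_def using hom sM by (auto simp: s_def)
  with s show ?thesis by blast
 qed
 have "galois_field M G"
 proof (rule galois_field.intro[OF M.csubfield_axioms], rule galois_field_axioms.intro)
  show "finite G" by (rule finG)
 next
  show "(\<lambda>x\<in>M. x) \<in> G" unfolding G_def
   by (auto intro!: csubfield_hom.intro M.csubfield_axioms csubfield_hom_axioms.intro simp: M.closed)
 next
  fix s t assume st: "s \<in> G" "t \<in> G"
  show "(\<lambda>x\<in>M. s (t x)) \<in> G"
  proof -
   interpret s: csubfield_hom M s using st by (simp add: G_def)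
   interpret t: csubfield_hom M t using st by (simp add: G_def)
   show ?thesis using st unfolding G_def
    by (auto intro!: csubfield_hom.intro M.csubfield_axioms csubfield_hom_axioms.intro
     simp: s.hom_add t.hom_add s.hom_mult t.hom_mult s.hom_one t.hom_one M.add_in M.mult_in)
  qed
 next
  fix x assume x: "x \<in> M" and fixed: "\<And>s. s \<in> G ==> s x = x"
  obtain g where g: "x = poly g \<theta>" "poly_over \<rat> g" using x unfolding M_def adjoin_def by blast
  \<comment> \<open>A fixed element is r(\<theta>) with deg r < deg m. Then r minus the constant x
    vanishes at all deg m distinct roots of \<open>m\<close>, hence is zero.\<close>
  obtain q r where qr: "poly_over \<rat> r" "g = q * m + r" "r = 0 \<or> degree r < degree m"
   using Q.poly_over_division[OF m(1) m0 g(2)] by blast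
  have xr: "x = poly r \<theta>" using g qr m by simp
  have root: "poly (r - [:x:]) \<rho> = 0" if rho: "poly m \<rho> = 0" for \<rho>
  proof -
   obtain s where "s \<in> G" "s (poly r \<theta>) = poly r \<rho>" using ex[OF rho] qr(1) by auto
   thus ?thesis using fixed[of s] xr by simp
  qed
  have "rsquarefree m" unfolding rsquarefree_roots using m(6) by blast
  from complex_poly_decompose_rsquarefree[OF this]
  have "m = (\<Prod>z | poly m z = 0. [:- z, 1:])" using m(2) by simp
  hence "degree m = degree (\<Prod>z | poly m z = 0. [:- z, 1:])" by (rule arg_cong)
  also have "... = card {z. poly m z = 0}"
   by (subst degree_prod_eq_sum_degree) auto
  finally have card: "degree m = card {z. poly m z = 0}" .
  have "r - [:x:] = 0"
  proof (rule ccontr)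
   assume ne: "r - [:x:] \<noteq> 0"
   have "card {z. poly m z = 0} \<le> card {z. poly (r - [:x:]) z = 0}"
    using root poly_roots_finite[OF ne] by (intro card_mono) auto
   also have "... \<le> degree (r - [:x:])" by (rule card_poly_roots_bound[OF ne])
   also have "... < degree m" using qr(3) m(4) by (intro degree_diff_less) auto
   finally show False using card by simp
  qed
  hence "x = coeff r 0" using arg_cong[of "r - [:x:]" 0 "\<lambda>p. coeff p 0"] by simp
  thus "x \<in> \<rat>" using qr(1) unfolding poly_over_def by blast
 next
  fix s assume "s \<in> G"
  thus "csubfield_hom M s" "s \<in> extensional M" "\<And>x. x \<in> M ==> s x \<in> M" by (auto simp: G_def)
 qed
 thus thesis using that[of M G] XA AM by blast
qed

section \<open>Independence of characters and dual bases\<close>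

lemma csubfield_UNIV: "csubfield UNIV"
 by unfold_locales auto

text \<open>Artin's trick: from the relation at \<open>x0 * x\<close> subtract \<open>u x0\<close>
  times the relation at \<open>x\<close>. The character \<open>u\<close> disappears, and
  \<open>r\<close> keeps a nonzero factor because \<open>x0\<close> separates it from
  \<open>u\<close>.\<close>

lemma dedekind_independence:
 assumes K: "csubfield K" and "finite E"
  and hom: "\<And>s. s \<in> E ==> csubfield_hom K s"
  and dist: "\<And>s t. s \<in> E ==> t \<in> E ==> s \<noteq> t ==> \<exists>x\<in>K. s x \<noteq> t x"
  and zero: "\<And>x. x \<in> K ==> (\<Sum>s\<in>E. c s * s x) = 0"
 shows "\<forall>s\<in>E. c s = (0::complex)"
 using assms(2-5)
proof (induction E arbitrary: c rule: finite_induct)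
 case (insert u E)
 interpret K: csubfield K by fact
 have homE: "csubfield_hom K s" if "s \<in> insert u E" for s using insert.prems(1) that by blast
 have z: "c u * u x + (\<Sum>s\<in>E. c s * s x) = 0" if "x \<in> K" for x
  using insert.prems(3)[OF that] insert.hyps by simp
 have "\<forall>s\<in>E. c s = 0"
 proof
  fix r assume r: "r \<in> E"
  hence "r \<noteq> u" using insert.hyps by auto
  then obtain x0 where x0: "x0 \<in> K" "r x0 \<noteq> u x0" using insert.prems(2)[of r u] r by auto
  have "\<forall>s\<in>E. c s * (s x0 - u x0) = 0"
  proof (rule insert.IH)
   fix x assume x: "x \<in> K"
   have "c u * u (x0 * x) + (\<Sum>s\<in>E. c s * s (x0 * x)) = 0"
    using x x0 by (intro z K.closed)
   moreover have "u (x0 * x) = u x0 * u x"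
    using csubfield_hom.hom_mult[OF homE] x x0 by simp
   moreover have "(\<Sum>s\<in>E. c s * s (x0 * x)) = (\<Sum>s\<in>E. c s * (s x0 * s x))"
    using csubfield_hom.hom_mult[OF homE] x x0 by (intro sum.cong) auto
   ultimately have 1: "(\<Sum>s\<in>E. c s * (s x0 * s x)) = - c u * (u x0 * u x)"
    by (simp add: eq_neg_iff_add_eq_0 add.commute)
   have 2: "(\<Sum>s\<in>E. c s * s x) = - c u * u x" using z[OF x] by (simp add: eq_neg_iff_add_eq_0 add.commute)
   have "(\<Sum>s\<in>E. c s * (s x0 - u x0) * s x) = (\<Sum>s\<in>E. c s * (s x0 * s x)) - u x0 * (\<Sum>s\<in>E. c s * s x)"
    unfolding sum_distrib_left sum_subtractf[symmetric]
    by (intro sum.cong refl) (simp add: algebra_simps)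
   also have "... = 0" unfolding 1 2 by simp
   finally show "(\<Sum>s\<in>E. c s * (s x0 - u x0) * s x) = 0" .
  qed (use insert.prems in auto)
  thus "c r = 0" using r x0 by auto
 qed
 moreover from this have "c u = 0" using z[of 1] csubfield_hom.hom_one[OF homE, of u] by simp
 ultimately show ?case by simp
qed auto

text \<open>The right-hand side becomes a column for an extra unknown \<open>None\<close>. The
  enlarged system is underdetermined, and a nontrivial solution cannot vanish at \<open>None\<close>
  because the original kernel is trivial; dividing by that value solves the system.\<close>

lemma square_system_solvable:
 fixes a :: "'e => 'u => complex"
 assumes "csubfield F" "finite E" "finite U" "card E = card U"
  and a: "\<And>e u. e \<in> E ==> u \<in> U ==> a e u \<in> F"
  and b: "\<And>e. e \<in> E ==> b e \<in> F"
  and ker: "\<And>x. [|\<And>u. u \<in> U ==> x u \<in> F; \<And>e. e \<in> E ==> (\<Sum>u\<in>U. a e u * x u) = 0|] ==> \<forall>u\<in>U. x u = 0"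
 shows "\<exists>x. (\<forall>u. x u \<in> F) \<and> (\<forall>e\<in>E. (\<Sum>u\<in>U. a e u * x u) = b e)"
proof -
 interpret csubfield F by fact
 define U' where "U' = insert None (Some ` U)"
 define a' where "a' = (\<lambda>e u. case u of None => - b e | Some u => a e u)"
 have fin: "finite U'" and card: "card E < card U'"
  using assms(3,4) by (auto simp: U'_def card_image)
 have a'F: "a' e u \<in> F" if "e \<in> E" "u \<in> U'" for e u
  using that a[of e] minus_in[OF b[of e]] by (auto simp: a'_def U'_def)
 have split: "(\<Sum>u\<in>U'. a' e u * x u) = - b e * x None + (\<Sum>u\<in>U. a e u * x (Some u))" for e x
  using assms(3) by (simp add: U'_def a'_def sum.reindex)
 obtain x where x': "\<forall>u\<in>U'. x u \<in> F" "\<exists>u\<in>U'. x u \<noteq> 0"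
  "\<forall>e\<in>E. (\<Sum>u\<in>U'. a' e u * x u) = 0"
  using underdetermined_system[of F E U' a', OF assms(1,2) fin card a'F] by blast
 note x = x'(1)[rule_format] x'(2) x'(3)[rule_format]
 have "x None \<noteq> 0"
 proof
  assume n: "x None = 0"
  have "\<forall>u\<in>U. x (Some u) = 0"
  proof (rule ker)
   fix e assume "e \<in> E"
   thus "(\<Sum>u\<in>U. a e u * x (Some u)) = 0" using x(3)[of e] split[of e x] n by simp
  qed (use x(1) in \<open>auto simp: U'_def\<close>)
  thus False using x(2) n by (auto simp: U'_def)
 qed
 moreover have "x None \<in> F" using x(1) by (simp add: U'_def)
 moreover have "(\<Sum>u\<in>U. a e u * (x (Some u) / x None)) = b e" if "e \<in> E" for e
  using x(3)[OF that] split[of e x] \<open>x None \<noteq> 0\<close>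
  by (simp add: sum_divide_distrib[symmetric] field_simps)
 moreover have "(\<Sum>u\<in>U. a e u * (if u \<in> U then x (Some u) / x None else 0)) = (\<Sum>u\<in>U. a e u * (x (Some u) / x None))" for e
  by (rule sum.cong) auto
 ultimately show ?thesis using x(1)
  by (intro exI[of _ "\<lambda>u. if u \<in> U then x (Some u) / x None else 0"]) (auto simp: U'_def intro!: divide_in)
qed

text \<open>Points at which the matrix of character values is nonsingular, found one at a time. On
  the old points the new character \<open>u\<close> agrees with a combination of the old characters;
  by Dedekind it differs from that combination at some \<open>z\<close>, and \<open>z\<close> is the
  next point.\<close>

lemma character_dual_points:
 assumes M: "csubfield M" and K: "csubfield K" and "finite E"
  and hom: "\<And>s. s \<in> E ==> csubfield_hom K s"
  and maps: "\<And>s x. s \<in> E ==> x \<in> K ==> s x \<in> M"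
  and dist: "\<And>s t. s \<in> E ==> t \<in> E ==> s \<noteq> t ==> \<exists>x\<in>K. s x \<noteq> t x"
 shows "\<exists>x. (\<forall>t\<in>E. x t \<in> K) \<and> (\<forall>y. (\<forall>t\<in>E. (\<Sum>s\<in>E. s (x t) * y s) = 0) \<longrightarrow> (\<forall>s\<in>E. y s = (0::complex)))"
 using assms(3-6)
proof (induction E rule: finite_induct)
 case (insert u E)
 interpret K: csubfield K by fact
 have "\<exists>x. (\<forall>t\<in>E. x t \<in> K) \<and> (\<forall>y. (\<forall>t\<in>E. (\<Sum>s\<in>E. s (x t) * y s) = 0) \<longrightarrow> (\<forall>s\<in>E. y s = 0))"
 proof (rule insert.IH)
  fix s assume s: "s \<in> E"
  show "csubfield_hom K s" by (rule insert.prems(1)) (simp add: s)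
  show "\<And>x. x \<in> K ==> s x \<in> M" by (rule insert.prems(2)) (simp_all add: s)
  show "\<And>t. t \<in> E ==> s \<noteq> t ==> \<exists>x\<in>K. s x \<noteq> t x" by (rule insert.prems(3)) (simp_all add: s)
 qed
 then obtain x where x: "\<forall>t\<in>E. x t \<in> K"
  and ker': "\<forall>y. (\<forall>t\<in>E. (\<Sum>s\<in>E. s (x t) * y s) = 0) \<longrightarrow> (\<forall>s\<in>E. y s = 0)" by (elim exE conjE)
 have ker: "\<forall>s\<in>E. y s = 0" if "\<And>t. t \<in> E ==> (\<Sum>s\<in>E. s (x t) * y s) = 0" for y
  using ker'[THEN spec, of y] that by simp
 have "\<exists>b. (\<forall>s. b s \<in> UNIV) \<and> (\<forall>t\<in>E. (\<Sum>s\<in>E. s (x t) * b s) = u (x t))"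
 proof (rule square_system_solvable[OF csubfield_UNIV insert.hyps(1) insert.hyps(1) refl UNIV_I UNIV_I])
  fix y assume "\<And>t. t \<in> E ==> (\<Sum>s\<in>E. s (x t) * y s) = 0"
  thus "\<forall>s\<in>E. y s = 0" by (rule ker)
 qed
 then obtain b where b': "\<forall>t\<in>E. (\<Sum>s\<in>E. s (x t) * b s) = u (x t)" by (elim exE conjE)
 note b = b'[rule_format]
 have "\<exists>z\<in>K. u z - (\<Sum>s\<in>E. b s * s z) \<noteq> 0"
 proof (rule ccontr)
  assume "\<not> ?thesis"
  hence 0: "u z - (\<Sum>s\<in>E. b s * s z) = 0" if "z \<in> K" for z using that by blast
  have "\<forall>s\<in>insert u E. (if s = u then 1 else - b s) = 0"
  proof (rule dedekind_independence[OF K])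
   fix z assume z: "z \<in> K"
   have "(\<Sum>s\<in>E. (if s = u then 1 else - b s) * s z) = - (\<Sum>s\<in>E. b s * s z)"
    using insert.hyps by (auto simp: sum_negf[symmetric] intro!: sum.cong)
   thus "(\<Sum>s\<in>insert u E. (if s = u then 1 else - b s) * s z) = 0"
    using 0[OF z] insert.hyps by simp
  qed (use insert in auto)
  thus False by auto
 qed
 then obtain z where z: "z \<in> K" "u z - (\<Sum>s\<in>E. b s * s z) \<noteq> 0" by blast
 define x' where "x' = x(u := z)"
 have "\<forall>s\<in>insert u E. y s = 0" if y: "\<forall>t\<in>insert u E. (\<Sum>s\<in>insert u E. s (x' t) * y s) = 0" for y
 proof -
  have 1: "u (x' t) * y u + (\<Sum>s\<in>E. s (x' t) * y s) = 0" if "t \<in> insert u E" for t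
   using y that insert.hyps by auto
  have "\<forall>s\<in>E. y s + y u * b s = 0"
  proof (rule ker)
   fix t assume t: "t \<in> E"
   hence "x' t = x t" using insert.hyps by (auto simp: x'_def)
   hence "u (x t) * y u + (\<Sum>s\<in>E. s (x t) * y s) = 0" using 1[of t] t by simp
   moreover have "(\<Sum>s\<in>E. s (x t) * (y s + y u * b s)) = (\<Sum>s\<in>E. s (x t) * y s) + y u * (\<Sum>s\<in>E. s (x t) * b s)"
    unfolding sum_distrib_left sum.distrib[symmetric]
    by (intro sum.cong refl) (simp add: algebra_simps)
   ultimately show "(\<Sum>s\<in>E. s (x t) * (y s + y u * b s)) = 0"
    unfolding b[OF t] by (simp add: algebra_simps)
  qed
  hence ys: "y s = - y u * b s" if "s \<in> E" for s using that by (simp add: eq_neg_iff_add_eq_0)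
  have "u z * y u + (\<Sum>s\<in>E. s z * y s) = 0" using 1[of u] by (simp add: x'_def)
  moreover have "(\<Sum>s\<in>E. s z * y s) = - y u * (\<Sum>s\<in>E. b s * s z)"
   unfolding sum_distrib_left by (intro sum.cong) (auto simp: ys)
  ultimately have "y u * (u z - (\<Sum>s\<in>E. b s * s z)) = 0" by (simp add: algebra_simps)
  hence "y u = 0" using z by simp
  with ys show ?thesis by simp
 qed
 moreover have "\<forall>t\<in>insert u E. x' t \<in> K" using x z by (auto simp: x'_def)
 ultimately show ?case by blast
qed auto

lemma sum_mult_delta:
 fixes q :: "'a => complex"
 shows "finite E ==> t \<in> E ==> (\<Sum>u\<in>E. q u * (if t = u then 1 else 0)) = q t"
 by (simp add: if_distrib[of "\<lambda>c. _ * c"] cong: if_cong)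

text \<open>If all traces lie in \<open>F\<close>, the dual points \<open>x\<close> behave as a
  basis of \<open>K\<close> over \<open>F\<close>, and \<open>a\<close> is the inverse of the matrix
  of values, reading coordinates off the conjugates. The coordinates of \<open>y\<close> solve the
  system given by the trace form; its entries are traces, so the solution stays in
  \<open>F\<close>.\<close>

lemma character_basis:
 assumes M: "csubfield M" and K: "csubfield K" and F: "csubfield F" and E: "finite E"
  and hom: "\<And>s. s \<in> E ==> csubfield_hom K s"
  and maps: "\<And>s x. s \<in> E ==> x \<in> K ==> s x \<in> M"
  and dist: "\<And>s t. s \<in> E ==> t \<in> E ==> s \<noteq> t ==> \<exists>x\<in>K. s x \<noteq> t x"
  and trace: "\<And>x. x \<in> K ==> (\<Sum>s\<in>E. s x) \<in> F"
 shows "\<exists>x a. (\<forall>t\<in>E. x t \<in> K) \<and> (\<forall>t s. a t s \<in> M) \<and>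
  (\<forall>t\<in>E. \<forall>t'\<in>E. (\<Sum>s\<in>E. a t s * s (x t')) = (if t = t' then 1 else 0)) \<and>
  (\<forall>y\<in>K. \<exists>q. (\<forall>t. q t \<in> F) \<and> (\<forall>s\<in>E. s y = (\<Sum>t\<in>E. q t * s (x t))))"
proof -
 interpret M: csubfield M by fact
 interpret K: csubfield K by fact
 have "\<exists>x. (\<forall>t\<in>E. x t \<in> K) \<and> (\<forall>y. (\<forall>t\<in>E. (\<Sum>s\<in>E. s (x t) * y s) = 0) \<longrightarrow> (\<forall>s\<in>E. y s = (0::complex)))"
  by (rule character_dual_points[OF M K E]) (fact hom maps dist)+
 then obtain x where x': "\<forall>t\<in>E. x t \<in> K"
  and ker': "\<forall>y. (\<forall>t\<in>E. (\<Sum>s\<in>E. s (x t) * y s) = 0) \<longrightarrow> (\<forall>s\<in>E. y s = 0)" by (elim exE conjE)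
 note x = x'[rule_format]
 have ker: "\<forall>s\<in>E. y s = 0" if "\<And>t. t \<in> E ==> (\<Sum>s\<in>E. s (x t) * y s) = 0" for y
  using ker'[THEN spec, of y] that by simp
 have "\<exists>b. (\<forall>s. b s \<in> M) \<and> (\<forall>t'\<in>E. (\<Sum>s\<in>E. s (x t') * b s) = (if t = t' then 1 else 0))" for t
 proof (rule square_system_solvable[OF M E E refl])
  fix y assume "\<And>t. t \<in> E ==> (\<Sum>s\<in>E. s (x t) * y s) = 0"
  thus "\<forall>s\<in>E. y s = 0" by (rule ker)
 next
  fix t s assume "t \<in> E" "s \<in> E"
  thus "s (x t) \<in> M" using maps x by blast
 qed simp
 hence "\<forall>t. \<exists>b. (\<forall>s. b s \<in> M) \<and> (\<forall>t'\<in>E. (\<Sum>s\<in>E. s (x t') * b s) = (if t = t' then 1 else 0))" ..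
 from choice[OF this] obtain a where a': "\<forall>t. (\<forall>s. a t s \<in> M) \<and>
  (\<forall>t'\<in>E. (\<Sum>s\<in>E. s (x t') * a t s) = (if t = t' then 1 else 0))" by (elim exE)
 have a: "a t s \<in> M" "t' \<in> E ==> (\<Sum>s\<in>E. s (x t') * a t s) = (if t = t' then 1 else 0)" for t s t'
  using a'[THEN spec, of t] by auto
 have rker: "\<forall>t\<in>E. q t = 0" if q: "\<And>s. s \<in> E ==> (\<Sum>t\<in>E. q t * s (x t)) = 0" for q
 proof
  fix t assume t: "t \<in> E"
  have "q t = (\<Sum>t'\<in>E. q t' * (if t = t' then 1 else 0))" using sum_mult_delta[OF E t] by simp
  also have "... = (\<Sum>t'\<in>E. q t' * (\<Sum>s\<in>E. s (x t') * a t s))" by (rule sum.cong) (auto simp: a(2))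
  also have "... = (\<Sum>s\<in>E. a t s * (\<Sum>t'\<in>E. q t' * s (x t')))"
   unfolding sum_distrib_left by (subst sum.swap) (simp add: mult_ac)
  also have "... = 0" using q by simp
  finally show "q t = 0" .
 qed
 define T where "T = (\<lambda>z. \<Sum>s\<in>E. s z)"
 \<comment> \<open>The Gram matrix of the trace form is the matrix of values times its transpose;
   both factors have trivial kernel by \<open>ker\<close> and \<open>rker\<close>.\<close>
 have form: "(\<Sum>t\<in>E. T (x r * x t) * q t) = (\<Sum>s\<in>E. s (x r) * (\<Sum>t\<in>E. q t * s (x t)))" if "r \<in> E" for r q
 proof -
  have "(\<Sum>t\<in>E. T (x r * x t) * q t) = (\<Sum>t\<in>E. \<Sum>s\<in>E. s (x r) * (q t * s (x t)))"
   unfolding T_def sum_distrib_right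
   by (intro sum.cong) (auto simp: csubfield_hom.hom_mult[OF hom] x that)
  thus ?thesis by (subst (asm) sum.swap) (simp add: sum_distrib_left)
 qed
 have "\<exists>q. (\<forall>t. q t \<in> F) \<and> (\<forall>s\<in>E. s y = (\<Sum>t\<in>E. q t * s (x t)))" if y: "y \<in> K" for y
 proof -
  have "\<exists>q. (\<forall>t. q t \<in> F) \<and> (\<forall>r\<in>E. (\<Sum>t\<in>E. T (x r * x t) * q t) = T (x r * y))"
  proof (rule square_system_solvable[OF F E E refl])
   fix q assume q: "\<And>r. r \<in> E ==> (\<Sum>t\<in>E. T (x r * x t) * q t) = 0"
   have "\<forall>s\<in>E. (\<Sum>t\<in>E. q t * s (x t)) = 0"
   proof (rule ker)
    fix r assume r: "r \<in> E"
    show "(\<Sum>s\<in>E. s (x r) * (\<Sum>t\<in>E. q t * s (x t))) = 0" using form[OF r, of q] q[OF r] by simp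
   qed
   thus "\<forall>u\<in>E. q u = 0" using rker[of q] by simp
  next
   show "T (x r * x t) \<in> F" if "r \<in> E" "t \<in> E" for r t
    unfolding T_def by (intro trace K.mult_in x that)
   show "T (x r * y) \<in> F" if "r \<in> E" for r
    unfolding T_def by (intro trace K.mult_in x that y)
  qed
  then obtain q where q': "\<forall>t. q t \<in> F" "\<forall>r\<in>E. (\<Sum>t\<in>E. T (x r * x t) * q t) = T (x r * y)" by (elim exE conjE)
  note q = q'[rule_format]
  have "\<forall>s\<in>E. (\<Sum>t\<in>E. q t * s (x t)) - s y = 0"
  proof (rule ker)
   fix r assume r: "r \<in> E"
   have "(\<Sum>s\<in>E. s (x r) * s y) = T (x r * y)" unfolding T_def
    by (intro sum.cong) (auto simp: csubfield_hom.hom_mult[OF hom] x y r)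
   thus "(\<Sum>s\<in>E. s (x r) * ((\<Sum>t\<in>E. q t * s (x t)) - s y)) = 0"
    using q(2)[OF r] form[OF r, of q] by (simp add: right_diff_distrib sum_subtractf)
  qed
  thus ?thesis using q(1) by (intro exI[of _ q]) auto
 qed
 thus ?thesis using x a by (intro exI[of _ x] exI[of _ a]) (auto simp: mult.commute)
qed

section \<open>Embeddings of number fields\<close>

abbreviation CR :: "complex ring" where "CR \<equiv> ring_of_type_algebra"

lemma CR_simps [simp]:
 "carrier CR = UNIV" "monoid.mult CR = (*)" "one CR = 1" "ring.zero CR = 0" "ring.add CR = (+)"
 by (simp_all add: ring_of_type_algebra_def fun_eq_iff)

lemma field_CR: "field CR" by (rule field_from_type_algebra)
lemma ring_CR: "ring CR" by (rule ring_from_type_algebra)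

lemma a_inv_CR: "a_inv CR x = - x"
proof -
 interpret ring CR by (rule ring_CR)
 show ?thesis by (rule minus_equality) auto
qed

lemma m_inv_CR: "x \<noteq> 0 ==> m_inv CR x = inverse x"
proof -
 interpret field CR by (rule field_CR)
 assume "x \<noteq> 0"
 thus ?thesis by (intro comm_inv_char) auto
qed

lemma subfield_CR_iff: "subfield K CR \<longleftrightarrow> csubfield K"
proof
 interpret R: field CR by (rule field_CR)
 assume K: "subfield K CR"
 note sr = subringE[OF subfieldE(1)[OF K]]
 show "csubfield K"
 proof
  show "0 \<in> K" "1 \<in> K" using sr(2,3) by simp_all
  fix x assume x: "x \<in> K"
  show "- x \<in> K" using sr(5)[OF x] by (simp add: a_inv_CR)
  show "inverse x \<in> K"
  proof (cases "x = 0")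
   case False
   hence "m_inv CR x \<in> K" using R.subfield_m_inv(1)[OF K, of x] x by simp
   thus ?thesis using m_inv_CR False by simp
  qed (use sr(2) in simp)
  fix y assume y: "y \<in> K"
  show "x + y \<in> K" using sr(7)[OF x y] by simp
  show "x * y \<in> K" using sr(6)[OF x y] by simp
 qed
next
 interpret R: field CR by (rule field_CR)
 assume "csubfield K"
 then interpret K: csubfield K .
 show "subfield K CR"
 proof (rule R.subfieldI')
  show "subring K CR"
   by (rule R.subringI) (auto simp: a_inv_CR K.closed)
  fix k assume "k \<in> K - {\<zero>\<^bsub>CR\<^esub>}"
  thus "inv\<^bsub>CR\<^esub> k \<in> K" by (auto simp: m_inv_CR K.inverse_in)
 qed
qed

lemma combine_CR:
 "length ks = length us ==> ring.combine CR ks us = (\<Sum>i<length us. ks ! i * us ! i)"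
proof (induction ks us rule: list_induct2)
 case Nil
 interpret ring CR by (rule ring_CR)
 show ?case by simp
next
 case (Cons k ks u us)
 interpret ring CR by (rule ring_CR)
 show ?case using Cons.IH by (simp add: sum.lessThan_Suc_shift del: sum.lessThan_Suc)
qed

lemma dim_CR:
 assumes F: "csubfield F" and us: "set us \<subseteq> K"
  and K: "csubfield K" "F \<subseteq> K"
  and spn: "\<And>y. y \<in> K ==> \<exists>q. (\<forall>i<length us. q i \<in> F) \<and> y = (\<Sum>i<length us. q i * us ! i)"
  and ind: "\<And>q. (\<forall>i<length us. q i \<in> F) ==> (\<Sum>i<length us. q i * us ! i) = 0 ==> \<forall>i<length us. q i = 0"
 shows "(ring.dim CR over F) K = length us \<and> ring.finite_dimension CR F K"
proof -
 interpret R: ring CR by (rule ring_CR)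
 interpret K: csubfield K by (rule K(1))
 have sf: "subfield F CR" using F by (simp add: subfield_CR_iff)
 have usc: "set us \<subseteq> carrier CR" by simp
 have "R.independent F us"
 proof (rule R.trivial_combine_imp_independent[OF sf usc])
  fix ks assume ks: "set ks \<subseteq> F" "R.combine ks us = \<zero>\<^bsub>CR\<^esub>"
  \<comment> \<open>\<open>combine\<close> stops at the shorter list, so the scalars are first cut
    or padded with zeros to the length of \<open>us\<close>.\<close>
  obtain ks' where ks': "set ks' \<subseteq> F" "length ks' = length us" "R.combine ks' us = 0"
   "set (take (length us) ks) \<subseteq> set ks'"
  proof (cases "length us \<le> length ks")
   case True
   show thesis
   proof (rule that[of "take (length us) ks"])
    show "R.combine (take (length us) ks) us = 0"
     using R.combine_take[of us ks] ks by simp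
    show "set (take (length us) ks) \<subseteq> F" using ks(1) set_take_subset by fast
   qed (use True in auto)
  next
   case False
   interpret F: csubfield F by (rule F)
   show thesis
   proof (rule that[of "ks @ replicate (length us - length ks) 0"])
    show "set (ks @ replicate (length us - length ks) 0) \<subseteq> F" using ks by auto
    show "R.combine (ks @ replicate (length us - length ks) 0) us = 0"
    proof -
     have "R.combine (ks @ replicate (length us - length ks) \<zero>\<^bsub>CR\<^esub>) us = R.combine ks us"
      by (rule R.combine_append_replicate[OF usc])
     thus ?thesis using ks by simp
    qed
   qed (use False in auto)
  qed
  have "(\<Sum>i<length us. ks' ! i * us ! i) = 0" using combine_CR[OF ks'(2)] ks'(3) by simp
  moreover have "\<forall>i<length us. ks' ! i \<in> F" using ks'(1,2) nth_mem[of _ ks'] by auto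
  ultimately have "\<forall>i<length us. ks' ! i = 0" by (intro ind) auto
  hence "set ks' \<subseteq> {0}" using ks'(2) by (auto simp: in_set_conv_nth)
  thus "set (take (length us) ks) \<subseteq> {\<zero>\<^bsub>CR\<^esub>}" using ks'(4) by simp
 qed
 moreover have "R.Span F us = K"
 proof (rule Set.set_eqI)
  fix y
  have "y \<in> R.Span F us \<longleftrightarrow> (\<exists>ks. set ks \<subseteq> F \<and> length ks = length us \<and> y = R.combine ks us)"
   by (rule R.Span_mem_iff_length_version[OF sf usc])
  also have "... \<longleftrightarrow> y \<in> K"
  proof
   assume "\<exists>ks. set ks \<subseteq> F \<and> length ks = length us \<and> y = R.combine ks us"
   then obtain ks where ks: "set ks \<subseteq> F" "length ks = length us" "y = R.combine ks us" by blast
   have "ks ! i * us ! i \<in> K" if "i < length us" for i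
   proof (rule K.mult_in)
    show "ks ! i \<in> K" 
    proof -
     have "ks ! i \<in> set ks" using that ks(2) by simp
     thus ?thesis using ks(1) K(2) by blast
    qed
    show "us ! i \<in> K" using that us nth_mem[of i us] by auto
   qed
   thus "y \<in> K" unfolding ks(3) combine_CR[OF ks(2)] by (intro K.sum_in) auto
  next
   assume yK: "y \<in> K"
   obtain q where q: "\<forall>i<length us. q i \<in> F" "y = (\<Sum>i<length us. q i * us ! i)"
    using spn[OF yK] by (elim exE conjE)
   have "set (map q [0..<length us]) \<subseteq> F" using q(1) by auto
   moreover have "y = R.combine (map q [0..<length us]) us"
    by (subst combine_CR) (auto simp: q(2))
   ultimately show "\<exists>ks. set ks \<subseteq> F \<and> length ks = length us \<and> y = R.combine ks us"
    by (intro exI[of _ "map q [0..<length us]"]) auto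
  qed
  finally show "y \<in> R.Span F us \<longleftrightarrow> y \<in> K" .
 qed
 ultimately have "R.dimension (length us) F K" by (rule R.dimensionI[OF sf])
 thus ?thesis
  using R.dimI[OF sf] R.finite_dimensionI by blast
qed

text \<open>Finite generation is stated in the form in which it is used: any subfield that contains
  the finite set \<open>B\<close> contains \<open>K\<close>. A basis over the rationals serves as
  \<open>B\<close>.\<close>

lemma number_fieldD:
 assumes "number_field K"
 shows "csubfield K" "\<exists>B. finite B \<and> B \<subseteq> K \<and> (\<forall>F. csubfield F \<and> B \<subseteq> F \<longrightarrow> K \<subseteq> F)" "K \<subseteq> Qbar"
proof -
 interpret R: ring CR by (rule ring_CR)
 show K: "csubfield K" using assms unfolding number_field_def by (simp add: subfield_CR_iff)
 interpret K: csubfield K by (rule K)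
 have sf: "subfield \<rat> CR" using csubfield_Rats by (simp add: subfield_CR_iff)
 obtain n where "R.dimension n \<rat> K"
  using assms unfolding number_field_def R.finite_dimension_def by blast
 from R.exists_base[OF sf this] obtain us where us: "R.independent \<rat> us" "length us = n" "R.Span \<rat> us = K"
  by blast
 have usc: "set us \<subseteq> carrier CR" by simp
 have usK: "set us \<subseteq> K" using R.Span_base_incl[OF sf usc] us(3) by simp
 have comb: "\<exists>q. (\<forall>i<length us. q i \<in> \<rat>) \<and> y = (\<Sum>i<length us. q i * us ! i)" if y: "y \<in> K" for y
 proof -
  have "y \<in> R.Span \<rat> us" using y us(3) by simp
  then obtain ks where ks: "set ks \<subseteq> \<rat>" "length ks = length us" "y = R.combine ks us"
   using R.Span_mem_iff_length_version[OF sf usc, of y] by blast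
  hence "y = (\<Sum>i<length us. ks ! i * us ! i)" using combine_CR by simp
  moreover have "\<forall>i<length us. ks ! i \<in> \<rat>" using ks(1,2) nth_mem[of _ ks] by auto
  ultimately show ?thesis by blast
 qed
 have "K \<subseteq> F" if F: "csubfield F" "set us \<subseteq> F" for F
 proof
  interpret F: csubfield F by (rule F)
  fix y assume "y \<in> K"
  from comb[OF this] obtain q where q: "\<forall>i<length us. q i \<in> \<rat>" "y = (\<Sum>i<length us. q i * us ! i)"
   by (elim exE conjE)
  have "q i * us ! i \<in> F" if "i < length us" for i
   using that q(1) F(2) F.Rats_subset by (intro F.mult_in) auto
  thus "y \<in> F" unfolding q(2) by (intro F.sum_in) auto
 qed
 thus "\<exists>B. finite B \<and> B \<subseteq> K \<and> (\<forall>F. csubfield F \<and> B \<subseteq> F \<longrightarrow> K \<subseteq> F)"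
  using usK by (intro exI[of _ "set us"]) auto
 show "K \<subseteq> Qbar"
 proof
  fix x assume x: "x \<in> K"
  have "csubfield.alg_over \<rat> x"
  proof (rule csubfield.alg_over_of_finite_span[OF csubfield_Rats, of "{..<length us}"])
   fix k
   show "\<exists>q. (\<forall>i\<in>{..<length us}. q i \<in> \<rat>) \<and> x ^ k = (\<Sum>i\<in>{..<length us}. q i * us ! i)"
    using comb[OF K.power_in[OF x, of k]] by (simp only: Ball_def lessThan_iff)
  qed simp
  thus "x \<in> Qbar" by (simp add: Qbar_def algebraic_iff_alg_over)
 qed
qed

section \<open>Embeddings of a subfield of a Galois field\<close>

locale galois_subfield = galois_field M G + K: csubfield K for M G K +
 assumes K_le: "K \<subseteq> M"
begin

definition embs :: "(complex => complex) set" where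
 "embs = (\<lambda>s. restrict s K) ` G"

text \<open>The order of the subgroup fixing \<open>K\<close>, that is the degree of
  \<open>M\<close> over \<open>K\<close>; it is the common size of the fibres of restriction to
  \<open>K\<close>.\<close>

definition stab_card :: nat where
 "stab_card = card {s \<in> G. \<forall>x\<in>K. s x = x}"

lemma finite_embs: "finite embs" unfolding embs_def using finite_G by simp

lemma embs_hom: "e \<in> embs ==> csubfield_hom K e"
proof -
 assume "e \<in> embs"
 then obtain s where s: "s \<in> G" "e = restrict s K" unfolding embs_def by blast
 interpret s: csubfield_hom M s by (rule G_hom[OF s(1)])
 have "x \<in> K ==> x \<in> M" for x using K_le by blast
 thus ?thesis unfolding s(2)
  by unfold_locales (auto simp: K.add_in K.mult_in s.hom_add s.hom_mult s.hom_one)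
qed

lemma embs_maps: "e \<in> embs ==> x \<in> K ==> e x \<in> M"
 unfolding embs_def using G_maps K_le by auto

lemma embs_dist: "e \<in> embs ==> f \<in> embs ==> e \<noteq> f ==> \<exists>x\<in>K. e x \<noteq> f x"
 unfolding embs_def by (metis (no_types, lifting) imageE restrict_ext restrict_apply')

lemma embs_ne: "embs \<noteq> {}" using G_ne by (simp add: embs_def)

text \<open>The fibre through \<open>s\<close> is the coset of the stabiliser of \<open>K\<close>
  under left translation by \<open>s\<close>.\<close>

lemma card_fibre:
 assumes "e \<in> embs"
 shows "card {s \<in> G. restrict s K = e} = stab_card"
proof -
 obtain s where s: "s \<in> G" "e = restrict s K" using assms unfolding embs_def by blast
 interpret s: csubfield_hom M s by (rule G_hom[OF s(1)])
 let ?c = "\<lambda>t. \<lambda>x\<in>M. s (t x)"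
 have inj: "inj_on ?c G" and onto: "?c ` G = G" using bij_G_comp[OF s(1)] by (auto simp: bij_betw_def)
 have iff: "restrict (?c t) K = e \<longleftrightarrow> (\<forall>x\<in>K. t x = x)" if t: "t \<in> G" for t
 proof -
  have "restrict (?c t) K = e \<longleftrightarrow> (\<forall>x\<in>K. s (t x) = s x)"
   unfolding s(2) using K_le by (auto simp: fun_eq_iff restrict_def split: if_splits)
  also have "... \<longleftrightarrow> (\<forall>x\<in>K. t x = x)"
  proof (intro ball_cong refl)
   fix x assume "x \<in> K"
   hence "x \<in> M" using K_le by blast
   thus "s (t x) = s x \<longleftrightarrow> t x = x" using s.hom_inj G_maps[OF t] by simp
  qed
  finally show ?thesis .
 qed
 have "{s \<in> G. restrict s K = e} = ?c ` {t \<in> G. restrict (?c t) K = e}"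
  by (subst onto[symmetric]) auto
 also have "... = ?c ` {t \<in> G. \<forall>x\<in>K. t x = x}" using iff by (intro image_cong) auto
 finally have "card {s \<in> G. restrict s K = e} = card (?c ` {t \<in> G. \<forall>x\<in>K. t x = x})" by simp
 also have "... = stab_card" unfolding stab_card_def
  by (rule card_image[OF inj_on_subset[OF inj]]) auto
 finally show ?thesis .
qed

lemma sum_G_embs:
 fixes f :: "(complex => complex) => 'a::real_vector"
 shows "(\<Sum>s\<in>G. f (restrict s K)) = real stab_card *\<^sub>R (\<Sum>e\<in>embs. f e)"
proof -
 have "(\<Sum>s\<in>G. f (restrict s K)) = (\<Sum>e\<in>embs. \<Sum>s\<in>{s \<in> G. restrict s K = e}. f (restrict s K))"
  unfolding embs_def by (rule sum.image_gen[OF finite_G])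
 also have "... = (\<Sum>e\<in>embs. real stab_card *\<^sub>R f e)"
  by (intro sum.cong refl) (auto simp: sum_constant_scaleR card_fibre)
 finally show ?thesis by (simp add: scaleR_sum_right)
qed

lemma card_G_embs: "card G = stab_card * card embs"
proof -
 have "real (card G) = real (stab_card * card embs)"
  using sum_G_embs[of "\<lambda>_. 1::real"] by simp
 thus ?thesis by (simp only: of_nat_eq_iff)
qed

lemma stab_card_pos: "stab_card > 0"
 using card_G_embs card_G_pos by (cases stab_card) auto

lemma trace_G_rat: "x \<in> M ==> (\<Sum>s\<in>G. s x) \<in> \<rat>"
proof -
 assume x: "x \<in> M"
 show ?thesis
 proof (rule G_fixed)
  show "(\<Sum>s\<in>G. s x) \<in> M" by (intro sum_in) (rule G_maps[OF _ x])
  fix t assume t: "t \<in> G"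
  interpret t: csubfield_hom M t by (rule G_hom[OF t])
  have "t (\<Sum>s\<in>G. s x) = (\<Sum>s\<in>G. t (s x))" by (rule t.hom_sum) (rule G_maps[OF _ x])
  also have "... = (\<Sum>s\<in>G. s x)" by (rule sum_G_comp[OF t, of "\<lambda>s. s x"]) (simp add: x)
  finally show "t (\<Sum>s\<in>G. s x) = (\<Sum>s\<in>G. s x)" .
 qed
qed

lemma trace_embs_rat: assumes x: "x \<in> K" shows "(\<Sum>e\<in>embs. e x) \<in> \<rat>"
proof -
 have "(\<Sum>s\<in>G. s x) = of_nat stab_card * (\<Sum>e\<in>embs. e x)"
  using sum_G_embs[of "\<lambda>e. e x"] x by (simp add: scaleR_conv_of_real)
 moreover have "(\<Sum>s\<in>G. s x) \<in> \<rat>" using trace_G_rat x K_le by blast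
 moreover have "of_nat stab_card \<noteq> (0::complex)" using stab_card_pos by simp
 ultimately have "(\<Sum>e\<in>embs. e x) = (\<Sum>s\<in>G. s x) / of_nat stab_card" by simp
 thus ?thesis using \<open>(\<Sum>s\<in>G. s x) \<in> \<rat>\<close> by simp
qed

text \<open>The dual points for the rationals and all embeddings are a basis of \<open>K\<close>: a
  single injective embedding transfers the expansion back to \<open>K\<close>, and the inverse
  matrix \<open>a\<close> shows that a vanishing combination has zero coefficients.\<close>

lemma field_degree_embs: "field_degree K = card embs" "number_field K"
proof -
 have "\<exists>x a. (\<forall>t\<in>embs. x t \<in> K) \<and> (\<forall>t s. a t s \<in> M) \<and>
  (\<forall>t\<in>embs. \<forall>t'\<in>embs. (\<Sum>s\<in>embs. a t s * s (x t')) = (if t = t' then 1 else 0)) \<and>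
  (\<forall>y\<in>K. \<exists>q. (\<forall>t. q t \<in> \<rat>) \<and> (\<forall>s\<in>embs. s y = (\<Sum>t\<in>embs. q t * s (x t))))"
  by (rule character_basis[OF csubfield_axioms K.csubfield_axioms csubfield_Rats finite_embs])
   (fact embs_hom embs_maps embs_dist trace_embs_rat)+
 then obtain x a where x': "\<forall>t\<in>embs. x t \<in> K"
  and a': "\<forall>t\<in>embs. \<forall>t'\<in>embs. (\<Sum>s\<in>embs. a t s * s (x t')) = (if t = t' then 1 else 0)"
  and rep': "\<forall>y\<in>K. \<exists>q. (\<forall>t. q t \<in> \<rat>) \<and> (\<forall>s\<in>embs. s y = (\<Sum>t\<in>embs. q t * s (x t)))"
  by (elim exE conjE)
 note x = x'[rule_format] and a = a'[rule_format] and rep = rep'[THEN bspec]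
 obtain es where es: "set es = embs" "distinct es" using finite_distinct_list[OF finite_embs] by blast
 have len: "length es = card embs" using es distinct_card by fastforce
 define us where "us = map x es"
 have bij: "bij_betw ((!) es) {..<length es} embs" using bij_betw_nth[OF es(2), of "{..<length es}" embs] es(1) by simp
 have idx: "(\<Sum>i<length us. f (es ! i)) = (\<Sum>t\<in>embs. f t)" for f :: "_ => complex"
  using sum.reindex_bij_betw[OF bij, of f] by (simp add: us_def)
 have us_nth: "us ! i = x (es ! i)" if "i < length us" for i using that by (simp add: us_def)
 have homsum: "s (\<Sum>t\<in>embs. q t * x t) = (\<Sum>t\<in>embs. q t * s (x t))"
  if s: "s \<in> embs" and q: "\<And>t. t \<in> embs ==> q t \<in> \<rat>" for s q
 proof -
  interpret s: csubfield_hom K s by (rule embs_hom[OF s])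
  have qK: "q t \<in> K" if "t \<in> embs" for t using q[OF that] K.Rats_subset by blast
  have "s (\<Sum>t\<in>embs. q t * x t) = (\<Sum>t\<in>embs. s (q t * x t))"
   by (rule s.hom_sum) (intro K.mult_in x qK)
  also have "... = (\<Sum>t\<in>embs. q t * s (x t))"
   by (intro sum.cong refl) (simp add: s.hom_mult x qK s.hom_Rats q)
  finally show ?thesis .
 qed
 have spn: "\<exists>q. (\<forall>i<length us. q i \<in> \<rat>) \<and> y = (\<Sum>i<length us. q i * us ! i)" if y: "y \<in> K" for y
 proof -
  obtain q where q': "\<forall>t. q t \<in> \<rat>" "\<forall>s\<in>embs. s y = (\<Sum>t\<in>embs. q t * s (x t))"
   using rep[OF y] by (elim exE conjE)
  note q = q'[rule_format]
  obtain s where s: "s \<in> embs" using embs_ne by blast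
  interpret s: csubfield_hom K s by (rule embs_hom[OF s])
  have "s y = s (\<Sum>t\<in>embs. q t * x t)" using q(2)[OF s] homsum[OF s, of q] q(1) by simp
  moreover have "(\<Sum>t\<in>embs. q t * x t) \<in> K"
   by (intro K.sum_in K.mult_in x) (use q(1) K.Rats_subset in auto)
  ultimately have "y = (\<Sum>t\<in>embs. q t * x t)" using s.hom_inj y by blast
  also have "... = (\<Sum>i<length us. q (es ! i) * us ! i)"
   unfolding idx[symmetric] by (intro sum.cong refl) (simp add: us_nth)
  finally show ?thesis using q(1) by (intro exI[of _ "\<lambda>i. q (es ! i)"]) auto
 qed
 have ind: "\<forall>i<length us. q i = 0"
  if q: "\<forall>i<length us. q i \<in> \<rat>" and z: "(\<Sum>i<length us. q i * us ! i) = 0" for q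
 proof -
  define r where "r = (\<lambda>t. q (inv_into {..<length es} ((!) es) t))"
  have r_nth: "r (es ! i) = q i" if "i < length es" for i
   unfolding r_def using that bij by (simp add: bij_betw_def)
  have rQ: "r t \<in> \<rat>" if te: "t \<in> embs" for t
  proof -
   obtain i where "i < length es" "t = es ! i" using te es(1) in_set_conv_nth[of t es] by auto
   thus ?thesis using r_nth q by (simp add: us_def)
  qed
  have "(\<Sum>t\<in>embs. r t * x t) = 0"
   unfolding idx[symmetric] using z by (simp add: us_nth r_nth us_def)
  hence 0: "(\<Sum>t\<in>embs. r t * s (x t)) = 0" if "s \<in> embs" for s
   using homsum[OF that, of r] rQ csubfield_hom.hom_zero[OF embs_hom[OF that]] by simp
  have "r t = 0" if t: "t \<in> embs" for t
  proof -
   have "r t = (\<Sum>t'\<in>embs. r t' * (if t = t' then 1 else 0))" using sum_mult_delta[OF finite_embs t] by simp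
   also have "... = (\<Sum>t'\<in>embs. r t' * (\<Sum>s\<in>embs. a t s * s (x t')))"
    by (intro sum.cong refl) (simp add: a t)
   also have "... = (\<Sum>s\<in>embs. a t s * (\<Sum>t'\<in>embs. r t' * s (x t')))"
    unfolding sum_distrib_left by (subst sum.swap) (simp add: mult_ac)
   also have "... = 0" using 0 by simp
   finally show ?thesis .
  qed
  hence "r (es ! i) = 0" if "i < length es" for i using that es(1) nth_mem by blast
  thus ?thesis using r_nth by (simp add: us_def)
 qed
 have usK: "set us \<subseteq> K" using x es by (auto simp: us_def)
 have dim: "(ring.dim CR over \<rat>) K = length us \<and> ring.finite_dimension CR \<rat> K"
 proof (rule dim_CR[OF csubfield_Rats usK K.csubfield_axioms K.Rats_subset])
  fix y assume "y \<in> K"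
  thus "\<exists>q. (\<forall>i<length us. q i \<in> \<rat>) \<and> y = (\<Sum>i<length us. q i * us ! i)" by (rule spn)
 next
  fix q assume "\<forall>i<length us. q i \<in> \<rat>" "(\<Sum>i<length us. q i * us ! i) = 0"
  thus "\<forall>i<length us. q i = 0" by (rule ind)
 qed
 show "field_degree K = card embs" unfolding field_degree_def using dim len by (simp add: us_def)
 show "number_field K" unfolding number_field_def
  using dim K.csubfield_axioms by (simp add: subfield_CR_iff)
qed

end

section \<open>Absolute values and weak approximation\<close>

locale absval = csubfield K for K +
 fixes v :: "complex => real"
 assumes av: "absolute_value_on K v"
begin

lemma v_nonneg: "x \<in> K ==> 0 \<le> v x"
 and v_eq_0: "x \<in> K ==> v x = 0 \<longleftrightarrow> x = 0"
 and v_mult: "x \<in> K ==> y \<in> K ==> v (x * y) = v x * v y"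
 and v_add: "x \<in> K ==> y \<in> K ==> v (x + y) \<le> v x + v y"
 using av unfolding absolute_value_on_def by blast+

lemma v_0 [simp]: "v 0 = 0" using v_eq_0[of 0] by simp

lemma v_1 [simp]: "v 1 = 1"
 using v_mult[of 1 1] v_eq_0[of 1] by simp

lemma v_pos: "x \<in> K ==> x \<noteq> 0 ==> 0 < v x"
 using v_nonneg[of x] v_eq_0[of x] by simp

lemma v_minus: assumes x: "x \<in> K" shows "v (- x) = v x"
proof -
 have m: "- 1 \<in> K" using minus_in[of 1] by simp
 have "v (- 1) * v (- 1) = 1" using v_mult[OF m m] by simp
 hence "v (- 1) = 1" using v_nonneg[OF m] by (metis abs_of_nonneg abs_1 power2_eq_square power2_eq_1_iff abs_minus)
 thus ?thesis using v_mult[OF m x] by simp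
qed

lemma v_inverse: assumes x: "x \<in> K" shows "v (inverse x) = inverse (v x)"
proof (cases "x = 0")
 case False
 have "v x * v (inverse x) = 1" using v_mult[OF x inverse_in[OF x]] False by simp
 thus ?thesis by (simp add: inverse_unique)
qed simp

lemma v_divide: "x \<in> K ==> y \<in> K ==> v (x / y) = v x / v y"
 by (simp add: divide_inverse v_mult v_inverse inverse_in)

lemma v_power: "x \<in> K ==> v (x ^ n) = v x ^ n"
 by (induction n) (simp_all add: v_mult power_in)

lemma v_powi: "x \<in> K ==> v (x powi k) = v x powi k"
 by (cases k rule: int_cases2) (simp_all add: v_power v_inverse power_in power_int_minus)

lemma powi_in: "x \<in> K ==> x powi k \<in> K"
 by (cases k rule: int_cases2) (simp_all add: power_in inverse_in power_int_minus)

lemma v_prod: "(\<And>i. i \<in> I ==> f i \<in> K) ==> v (prod f I) = (\<Prod>i\<in>I. v (f i))"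
 by (induction I rule: infinite_finite_induct) (simp_all add: v_mult prod_in)

lemma v_sum: "(\<And>i. i \<in> I ==> f i \<in> K) ==> v (sum f I) \<le> (\<Sum>i\<in>I. v (f i))"
proof (induction I rule: infinite_finite_induct)
 case (insert i I)
 have "v (f i + sum f I) \<le> v (f i) + v (sum f I)" by (intro v_add sum_in insert.prems) simp_all
 also have "v (sum f I) \<le> (\<Sum>i\<in>I. v (f i))" by (intro insert.IH insert.prems) simp
 finally show ?case using insert.hyps by simp
qed simp_all

lemma v_diff: assumes "x \<in> K" "y \<in> K" shows "v (x - y) \<le> v x + v y"
 using v_add[OF assms(1) minus_in[OF assms(2)]] v_minus[OF assms(2)] by simp

lemma v_diff_commute: "x \<in> K ==> y \<in> K ==> v (x - y) = v (y - x)"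
 using v_minus[OF diff_in, of x y] by simp

lemma v_diff_ge: assumes "x \<in> K" "y \<in> K" shows "v x - v y \<le> v (x - y)"
 using v_add[OF diff_in[OF assms] assms(2)] by simp

text \<open>By the binomial theorem the n-th power of the sum has size at most n + 1 times the n-th
  power of the maximum. If the sum exceeded the maximum, a geometric sequence would stay below n +
  1.\<close>

lemma v_of_nat_ultrametric:
 assumes nat: "\<And>n::nat. v (of_nat n) \<le> 1" and x: "x \<in> K" and y: "y \<in> K"
 shows "v (x + y) \<le> max (v x) (v y)"
proof (rule ccontr)
 define m where "m = max (v x) (v y)"
 have m0: "0 \<le> m" using v_nonneg[OF x] by (simp add: m_def)
 assume "\<not> v (x + y) \<le> max (v x) (v y)"
 hence gt: "m < v (x + y)" unfolding m_def by (simp only: not_le)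
 have "m \<noteq> 0"
 proof
  assume "m = 0"
  hence "v x = 0" "v y = 0" using v_nonneg[OF x] v_nonneg[OF y] unfolding m_def by linarith+
  thus False using gt v_add[OF x y] m0 by simp
 qed
 with m0 have m: "0 < m" by simp
 define r where "r = v (x + y) / m"
 have r: "1 < r" using gt m by (simp add: r_def)
 have bound: "r ^ n \<le> real (Suc n)" for n
 proof -
  have "v ((x + y) ^ n) = v (\<Sum>k\<le>n. of_nat (n choose k) * x ^ k * y ^ (n - k))"
   by (simp add: binomial_ring)
  also have "... \<le> (\<Sum>k\<le>n. v (of_nat (n choose k) * x ^ k * y ^ (n - k)))"
   by (rule v_sum) (intro mult_in of_nat_in power_in x y)
  also have "... \<le> (\<Sum>k\<le>n. m ^ n)"
  proof (rule sum_mono)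
   fix k assume k: "k \<in> {..n}"
   have "v (of_nat (n choose k) * x ^ k * y ^ (n - k)) = v (of_nat (n choose k)) * (v x ^ k * v y ^ (n - k))"
    by (simp add: v_mult v_power of_nat_in power_in mult_in x y)
   also have "... \<le> 1 * (m ^ k * m ^ (n - k))"
    using nat v_nonneg[OF x] v_nonneg[OF y] m0
    by (intro mult_mono power_mono mult_nonneg_nonneg zero_le_power) (auto simp: m_def)
   also have "... = m ^ n" using k by (simp flip: power_add)
   finally show "v (of_nat (n choose k) * x ^ k * y ^ (n - k)) \<le> m ^ n" .
  qed
  also have "... = real (Suc n) * m ^ n" by simp
  finally have "v (x + y) ^ n \<le> real (Suc n) * m ^ n" using v_power[OF add_in[OF x y]] by simp
  thus ?thesis using m by (simp add: r_def power_divide field_simps)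
 qed
 have "(\<lambda>n. real (Suc n) / r ^ n) \<longlonglongrightarrow> 0"
  using r by real_asymp
 hence "eventually (\<lambda>n. real (Suc n) / r ^ n < 1) sequentially" by (rule order_tendstoD) simp
 then obtain n where "real (Suc n) / r ^ n < 1" using eventually_happens'[OF sequentially_bot] by blast
 hence "real (Suc n) < r ^ n" using r by (simp add: field_simps)
 with bound[of n] show False by simp
qed

lemma v_sum_ultrametric:
 assumes nat: "\<And>n::nat. v (of_nat n) \<le> 1" and "0 \<le> B"
  and f: "\<And>i. i \<in> I ==> f i \<in> K" "\<And>i. i \<in> I ==> v (f i) \<le> B"
 shows "v (sum f I) \<le> B"
 using f
proof (induction I rule: infinite_finite_induct)
 case (insert i I)
 have "v (f i + sum f I) \<le> max (v (f i)) (v (sum f I))"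
  by (intro v_of_nat_ultrametric nat sum_in insert.prems) simp_all
 also have "... \<le> B" using insert.IH insert.prems by simp
 finally show ?case using insert.hyps by simp
qed (use assms(2) in simp_all)

text \<open>The quotients z^n / (1 + z^n) tend to 0 where z is small and, by the companion lemma, to
  1 where z is large; this is the switch that drives weak approximation.\<close>

lemma tendsto_quotient_small:
 assumes z: "z \<in> K" "v z < 1"
 shows "(\<lambda>n. v (z ^ n / (1 + z ^ n))) \<longlonglongrightarrow> 0"
proof (rule tendsto_sandwich[of "\<lambda>_. 0" _ _ "\<lambda>n. v z ^ n / (1 - v z ^ n)"])
 have p0: "(\<lambda>n. v z ^ n) \<longlonglongrightarrow> 0" using z v_nonneg[OF z(1)] by (intro LIMSEQ_power_zero) simp
 have "(\<lambda>n. v z ^ n / (1 - v z ^ n)) \<longlonglongrightarrow> 0 / (1 - 0)" by (intro tendsto_intros p0) simp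
 thus "(\<lambda>n. v z ^ n / (1 - v z ^ n)) \<longlonglongrightarrow> 0" by simp
 show "\<forall>\<^sub>F n in sequentially. 0 \<le> v (z ^ n / (1 + z ^ n))"
  by (intro always_eventually allI v_nonneg divide_in add_in power_in z) simp
 show "\<forall>\<^sub>F n in sequentially. v (z ^ n / (1 + z ^ n)) \<le> v z ^ n / (1 - v z ^ n)"
 proof (rule eventually_mono[OF eventually_gt_at_top[of 0]])
  fix n :: nat assume n: "n > 0"
  have zn: "z ^ n \<in> K" using z by (intro power_in)
  have lt: "v z ^ n < 1" using z v_nonneg[OF z(1)] n by (simp add: power_less_one_iff)
  have "1 - v z ^ n \<le> v (1 + z ^ n)"
   using v_diff_ge[of 1 "- (z ^ n)"] v_minus[OF zn] v_power[OF z(1)] minus_in[OF zn] by simp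
  hence "v z ^ n / v (1 + z ^ n) \<le> v z ^ n / (1 - v z ^ n)"
   using lt v_nonneg[OF z(1)] by (intro divide_left_mono) (auto intro!: mult_pos_pos)
  thus "v (z ^ n / (1 + z ^ n)) \<le> v z ^ n / (1 - v z ^ n)"
   using v_divide[OF zn add_in[OF one_in zn]] v_power[OF z(1)] by simp
 qed
qed simp

lemma tendsto_quotient_large:
 assumes z: "z \<in> K" "v z > 1"
 shows "(\<lambda>n. v (z ^ n / (1 + z ^ n) - 1)) \<longlonglongrightarrow> 0"
proof (rule tendsto_sandwich[of "\<lambda>_. 0" _ _ "\<lambda>n. 1 / (v z ^ n - 1)"])
 show "(\<lambda>n. 1 / (v z ^ n - 1)) \<longlonglongrightarrow> 0" using z by real_asymp
 show "\<forall>\<^sub>F n in sequentially. 0 \<le> v (z ^ n / (1 + z ^ n) - 1)"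
  by (intro always_eventually allI v_nonneg divide_in add_in diff_in power_in z) simp_all
 show "\<forall>\<^sub>F n in sequentially. v (z ^ n / (1 + z ^ n) - 1) \<le> 1 / (v z ^ n - 1)"
 proof (rule eventually_mono[OF eventually_gt_at_top[of 0]])
  fix n :: nat assume n: "n > 0"
  have zn: "z ^ n \<in> K" using z by (intro power_in)
  have gt: "1 < v z ^ n" using z n by simp
  have ge: "v z ^ n - 1 \<le> v (1 + z ^ n)"
   using v_diff_ge[of "z ^ n" "- 1"] v_minus[of 1] zn minus_in[of 1] v_power[OF z(1)] by (simp add: add.commute)
  hence "1 + z ^ n \<noteq> 0" using gt by auto
  hence "z ^ n / (1 + z ^ n) - 1 = - inverse (1 + z ^ n)" by (simp add: field_simps)
  hence "v (z ^ n / (1 + z ^ n) - 1) = inverse (v (1 + z ^ n))"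
   using v_minus[OF inverse_in[OF add_in[OF one_in zn]]] v_inverse[OF add_in[OF one_in zn]] by simp
  also have "... \<le> inverse (v z ^ n - 1)" using ge gt by (intro le_imp_inverse_le) auto
  finally show "v (z ^ n / (1 + z ^ n) - 1) \<le> 1 / (v z ^ n - 1)" by (simp add: divide_inverse)
 qed
qed simp

end

lemma ln_powi: "0 < x ==> ln (x powi k) = of_int k * ln (x::real)"
 by (cases k rule: int_cases2) (simp_all add: ln_realpow power_int_minus ln_inverse)

text \<open>\<pi> normalises the two absolute values to the same exponent. Given an element that is
  larger for \<open>v\<close> than for \<open>w\<close>, a high power makes the logarithmic gap
  wider than L = - ln (v \<pi>); then some integer multiple of L lies strictly in the gap, and a
  power of \<pi> moves it to 0.\<close>

lemma absolute_values_separate: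
 assumes K: "csubfield K" and v: "absolute_value_on K v" and w: "absolute_value_on K w"
  and \<pi>: "\<pi> \<in> K" "0 < v \<pi>" "v \<pi> < 1" "w \<pi> = v \<pi>"
  and x: "x \<in> K" "v x \<noteq> w x"
 obtains z where "z \<in> K" "1 < v z" "w z < 1"
proof -
 interpret v: absval K v by (intro absval.intro absval_axioms.intro K v)
 interpret w: absval K w by (intro absval.intro absval_axioms.intro K w)
 have "\<exists>x\<in>K. x \<noteq> 0 \<and> w x < v x"
 proof (cases "w x < v x")
  case True
  hence "x \<noteq> 0" by auto
  with True x show ?thesis by blast
 next
  case False
  hence lt: "v x < w x" using x by simp
  hence x0: "x \<noteq> 0" by auto
  have "w (inverse x) < v (inverse x)"
   using lt v.v_pos[OF x(1) x0] by (simp add: v.v_inverse w.v_inverse x less_imp_inverse_less)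
  thus ?thesis using x0 x v.inverse_in by (intro bexI[of _ "inverse x"]) auto
 qed
 then obtain a where a: "a \<in> K" "a \<noteq> 0" "w a < v a" by blast
 have pos: "0 < w a" "0 < v a" using v.v_pos w.v_pos a by auto
 define L where "L = - ln (v \<pi>)"
 have L: "0 < L" using \<pi> by (simp add: L_def)
 define d where "d = ln (v a) - ln (w a)"
 have d: "0 < d" using a pos by (simp add: d_def)
 obtain n :: nat where n: "L / d < real n" using reals_Archimedean2 by blast
 hence n': "L < real n * d" using d by (simp add: field_simps)
 \<comment> \<open>The least integer with n ln (w a) < k L; the gap n d > L keeps k L below n ln (v
   a).\<close>
 define k where "k = \<lfloor>real n * ln (w a) / L\<rfloor> + 1"
 have k1: "real n * ln (w a) / L < of_int k" unfolding k_def by linarith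
 have k2: "of_int k \<le> real n * ln (w a) / L + 1" unfolding k_def by linarith
 have 1: "real n * ln (w a) < of_int k * L" using k1 L by (simp add: field_simps)
 have "of_int k * L \<le> real n * ln (w a) + L" using k2 L by (simp add: field_simps)
 also have "... < real n * ln (w a) + real n * d" using n' by simp
 also have "... = real n * ln (v a)" by (simp add: d_def algebra_simps)
 finally have 2: "of_int k * L < real n * ln (v a)" .
 define z where "z = a ^ n * \<pi> powi k"
 have zK: "z \<in> K" unfolding z_def by (intro v.mult_in v.power_in v.powi_in a \<pi>)
 have vz: "v z = v a ^ n * v \<pi> powi k" "w z = w a ^ n * v \<pi> powi k"
  unfolding z_def by (simp_all add: v.v_mult w.v_mult v.v_power w.v_power v.v_powi w.v_powi v.power_in v.powi_in a \<pi>)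
 have vzp: "0 < v z" "0 < w z" using pos \<pi> unfolding vz by (auto intro!: mult_pos_pos zero_less_power_int)
 have "ln (v z) = real n * ln (v a) - of_int k * L"
  unfolding vz L_def using pos \<pi> by (simp add: ln_mult ln_realpow ln_powi zero_less_power_int)
 hence "0 < ln (v z)" using 2 by simp
 hence "1 < v z" using vzp by simp
 moreover have "ln (w z) = real n * ln (w a) - of_int k * L"
  unfolding vz L_def using pos \<pi> by (simp add: ln_mult ln_realpow ln_powi zero_less_power_int)
 hence "ln (w z) < 0" using 1 by simp
 hence "w z < 1" using vzp by simp
 ultimately show thesis using zK that by blast
qed

text \<open>Let \<open>z\<close> work for \<open>V\<close> and let \<open>y\<close> separate
  \<open>v0\<close> from the new \<open>w\<close>. If w z \<le> 1, a high power of \<open>z\<close>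
  times \<open>y\<close> works. If w z > 1, the quotients z^n / (1 + z^n) replace the powers: they
  are near 1 at \<open>v0\<close> and \<open>w\<close> and near 0 on \<open>V\<close>, so multiplied
  by \<open>y\<close> they have the required sizes.\<close>

lemma weak_approximation_separate:
 assumes K: "csubfield K" and "finite V" and v0: "absolute_value_on K v0"
  and V: "\<And>v. v \<in> V ==> absolute_value_on K v"
  and \<pi>: "\<pi> \<in> K" "0 < v0 \<pi>" "v0 \<pi> < 1" "\<And>v. v \<in> V ==> v \<pi> = v0 \<pi>"
  and dist: "\<And>v. v \<in> V ==> \<exists>x\<in>K. v0 x \<noteq> v x"
 shows "\<exists>z\<in>K. 1 < v0 z \<and> (\<forall>v\<in>V. v z < 1)"
 using assms(2) V \<pi>(4) dist
proof (induction V rule: finite_induct)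
 case empty
 interpret v0: absval K v0 by (intro absval.intro absval_axioms.intro K v0)
 show ?case using \<pi> by (intro bexI[of _ "inverse \<pi>"]) (auto simp: v0.v_inverse v0.inverse_in one_less_inverse)
next
 case (insert w V)
 interpret v0: absval K v0 by (intro absval.intro absval_axioms.intro K v0)
 have wav: "absolute_value_on K w" by (rule insert.prems(1)) simp
 interpret w: absval K w by (intro absval.intro absval_axioms.intro K wav)
 have Vav: "absval K v" if "v \<in> V" for v
  using insert.prems(1)[of v] that by (intro absval.intro absval_axioms.intro K) simp
 have "\<exists>z\<in>K. 1 < v0 z \<and> (\<forall>v\<in>V. v z < 1)"
  using insert.prems(1) insert.prems(2) insert.prems(3) by (intro insert.IH) simp_all
 then obtain z where z: "z \<in> K" "1 < v0 z" "\<And>v. v \<in> V ==> v z < 1" by blast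
 have wpi: "w \<pi> = v0 \<pi>" by (rule insert.prems(2)) simp
 obtain x where x: "x \<in> K" "v0 x \<noteq> w x" using insert.prems(3)[of w] by auto
 obtain y where y: "y \<in> K" "1 < v0 y" "w y < 1"
  by (rule absolute_values_separate[OF K v0 wav \<pi>(1,2,3) wpi x])
 show ?case
 proof (cases "w z \<le> 1")
  case True
  have "\<forall>\<^sub>F n in sequentially. \<forall>v\<in>V. v z ^ n * v y < 1"
  proof (rule eventually_ball_finite[OF insert.hyps(1)], rule ballI)
   fix v assume v: "v \<in> V"
   interpret v: absval K v by (rule Vav[OF v])
   have "(\<lambda>n. v z ^ n) \<longlonglongrightarrow> 0" using z(3)[OF v] v.v_nonneg[OF z(1)] by (intro LIMSEQ_power_zero) simp
   hence "(\<lambda>n. v z ^ n * v y) \<longlonglongrightarrow> 0" by (rule tendsto_mult_left_zero)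
   thus "\<forall>\<^sub>F n in sequentially. v z ^ n * v y < 1" by (rule order_tendstoD) simp
  qed
  then obtain n where n: "\<forall>v\<in>V. v z ^ n * v y < 1" using eventually_happens'[OF sequentially_bot] by blast
  have "1 < v0 (z ^ n * y)"
  proof -
   have "1 * v0 y \<le> v0 z ^ n * v0 y" using z(2) y(2) by (intro mult_right_mono one_le_power) auto
   hence "1 < v0 z ^ n * v0 y" using y(2) by linarith
   thus ?thesis by (simp add: v0.v_mult v0.v_power v0.power_in z(1) y(1))
  qed
  moreover have "w (z ^ n * y) < 1"
  proof -
   have "w z ^ n \<le> 1" using True w.v_nonneg[OF z(1)] by (simp add: power_le_one)
   hence "w z ^ n * w y \<le> 1 * w y" using w.v_nonneg[OF y(1)] by (intro mult_right_mono)
   hence "w z ^ n * w y < 1" using y(3) by linarith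
   thus ?thesis by (simp add: w.v_mult w.v_power v0.power_in z(1) y(1))
  qed
  moreover have "v (z ^ n * y) < 1" if v: "v \<in> V" for v
  proof -
   interpret v: absval K v by (rule Vav[OF v])
   show ?thesis using n v by (simp add: v.v_mult v.v_power v0.power_in z y)
  qed
  moreover have "z ^ n * y \<in> K" by (intro v0.mult_in v0.power_in z y)
  ultimately show ?thesis by (intro bexI[of _ "z ^ n * y"]) auto
 next
  case False
  define t where "t = (\<lambda>n. z ^ n / (1 + z ^ n))"
  have tK: "t n \<in> K" for n unfolding t_def by (intro v0.divide_in v0.add_in v0.power_in z) simp
  have "\<forall>\<^sub>F n in sequentially. \<forall>v\<in>V. v (t n) * v y < 1"
  proof (rule eventually_ball_finite[OF insert.hyps(1)], rule ballI)
   fix v assume v: "v \<in> V"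
   interpret v: absval K v by (rule Vav[OF v])
   have "(\<lambda>n. v (t n)) \<longlonglongrightarrow> 0" unfolding t_def using z(1) z(3)[OF v] by (rule v.tendsto_quotient_small)
   hence "(\<lambda>n. v (t n) * v y) \<longlonglongrightarrow> 0" by (rule tendsto_mult_left_zero)
   thus "\<forall>\<^sub>F n in sequentially. v (t n) * v y < 1" by (rule order_tendstoD) simp
  qed
  moreover have "\<forall>\<^sub>F n in sequentially. 1 < (1 - v0 (t n - 1)) * v0 y"
  proof -
   have "(\<lambda>n. v0 (t n - 1)) \<longlonglongrightarrow> 0" unfolding t_def using z(1,2) by (rule v0.tendsto_quotient_large)
   hence "(\<lambda>n. (1 - v0 (t n - 1)) * v0 y) \<longlonglongrightarrow> (1 - 0) * v0 y" by (intro tendsto_intros)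
   thus ?thesis by (rule order_tendstoD) (use y in simp)
  qed
  moreover have "\<forall>\<^sub>F n in sequentially. (w (t n - 1) + 1) * w y < 1"
  proof -
   have "(\<lambda>n. w (t n - 1)) \<longlonglongrightarrow> 0" unfolding t_def using z(1) False by (intro w.tendsto_quotient_large) auto
   hence "(\<lambda>n. (w (t n - 1) + 1) * w y) \<longlonglongrightarrow> (0 + 1) * w y" by (intro tendsto_intros)
   thus ?thesis by (rule order_tendstoD) (use y in simp)
  qed
  ultimately have "\<forall>\<^sub>F n in sequentially. (\<forall>v\<in>V. v (t n) * v y < 1) \<and> 1 < (1 - v0 (t n - 1)) * v0 y \<and> (w (t n - 1) + 1) * w y < 1"
   by eventually_elim auto
  then obtain n where n: "\<forall>v\<in>V. v (t n) * v y < 1" "1 < (1 - v0 (t n - 1)) * v0 y" "(w (t n - 1) + 1) * w y < 1"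
   using eventually_happens'[OF sequentially_bot] by blast
  have "1 < v0 (t n * y)"
  proof -
   have "1 - v0 (t n - 1) \<le> v0 (t n)" using v0.v_diff_ge[of 1 "1 - t n"] v0.v_diff_commute[of 1 "t n"] tK[of n]
    by (simp add: v0.diff_in)
   hence "(1 - v0 (t n - 1)) * v0 y \<le> v0 (t n) * v0 y" using y(2) by (intro mult_right_mono) auto
   thus ?thesis using n(2) by (simp add: v0.v_mult tK y)
  qed
  moreover have "w (t n * y) < 1"
  proof -
   have "w (t n) \<le> w (t n - 1) + 1" using w.v_add[of "t n - 1" 1] tK[of n] by (simp add: v0.diff_in)
   hence "w (t n) * w y \<le> (w (t n - 1) + 1) * w y" using w.v_nonneg[OF y(1)] by (intro mult_right_mono)
   thus ?thesis using n(3) by (simp add: w.v_mult tK y)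
  qed
  moreover have "v (t n * y) < 1" if v: "v \<in> V" for v
  proof -
   interpret v: absval K v by (rule Vav[OF v])
   show ?thesis using n(1) v by (simp add: v.v_mult tK y)
  qed
  moreover have "t n * y \<in> K" by (intro v0.mult_in tK y)
  ultimately show ?thesis by (intro bexI[of _ "t n * y"]) auto
 qed
qed

text \<open>Only the approximate idempotent of \<open>v0\<close> is produced; it suffices for the
  conjugacy of places and for the local traces.\<close>

lemma weak_approximation:
 assumes K: "csubfield K" and "finite V" and v0: "absolute_value_on K v0"
  and V: "\<And>v. v \<in> V ==> absolute_value_on K v"
  and \<pi>: "\<pi> \<in> K" "0 < v0 \<pi>" "v0 \<pi> < 1" "\<And>v. v \<in> V ==> v \<pi> = v0 \<pi>"
  and dist: "\<And>v. v \<in> V ==> \<exists>x\<in>K. v0 x \<noteq> v x"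
  and "0 < \<epsilon>"
 shows "\<exists>y\<in>K. v0 (y - 1) < \<epsilon> \<and> (\<forall>v\<in>V. v y < \<epsilon>)"
proof -
 interpret v0: absval K v0 by (intro absval.intro absval_axioms.intro K v0)
 have "\<exists>z\<in>K. 1 < v0 z \<and> (\<forall>v\<in>V. v z < 1)"
  by (rule weak_approximation_separate[OF K assms(2) v0]) (fact V \<pi> dist)+
 then obtain z where z: "z \<in> K" "1 < v0 z" "\<forall>v\<in>V. v z < 1" by blast
 define t where "t = (\<lambda>n. z ^ n / (1 + z ^ n))"
 have tK: "t n \<in> K" for n unfolding t_def by (intro v0.divide_in v0.add_in v0.power_in z) simp
 have "\<forall>\<^sub>F n in sequentially. \<forall>v\<in>V. v (t n) < \<epsilon>"
 proof (rule eventually_ball_finite[OF assms(2)], rule ballI)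
  fix v assume v: "v \<in> V"
  interpret v: absval K v by (intro absval.intro absval_axioms.intro K V v)
  have "(\<lambda>n. v (t n)) \<longlonglongrightarrow> 0" unfolding t_def using z v by (intro v.tendsto_quotient_small) auto
  thus "\<forall>\<^sub>F n in sequentially. v (t n) < \<epsilon>" by (rule order_tendstoD) fact
 qed
 moreover have "\<forall>\<^sub>F n in sequentially. v0 (t n - 1) < \<epsilon>"
 proof -
  have "(\<lambda>n. v0 (t n - 1)) \<longlonglongrightarrow> 0" unfolding t_def using z(1,2) by (rule v0.tendsto_quotient_large)
  thus ?thesis by (rule order_tendstoD) fact
 qed
 ultimately have "\<forall>\<^sub>F n in sequentially. (\<forall>v\<in>V. v (t n) < \<epsilon>) \<and> v0 (t n - 1) < \<epsilon>"
  by eventually_elim auto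
 then obtain n where "\<forall>v\<in>V. v (t n) < \<epsilon>" "v0 (t n - 1) < \<epsilon>"
  using eventually_happens'[OF sequentially_bot] by blast
 thus ?thesis using tK[of n] by (intro bexI[of _ "t n"]) auto
qed

section \<open>Extension of the p-adic absolute value\<close>

definition is_subring :: "complex set => bool" where
 "is_subring R \<longleftrightarrow> 1 \<in> R \<and> (\<forall>x\<in>R. - x \<in> R) \<and> (\<forall>x\<in>R. \<forall>y\<in>R. x + y \<in> R \<and> x * y \<in> R)"

lemma is_subringD:
 assumes "is_subring R"
 shows "1 \<in> R" "x \<in> R ==> - x \<in> R" "x \<in> R ==> y \<in> R ==> x + y \<in> R" "x \<in> R ==> y \<in> R ==> x * y \<in> R"
  "0 \<in> R" "x \<in> R ==> y \<in> R ==> x - y \<in> R" "x \<in> R ==> x ^ n \<in> R"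
  "(\<And>i. i \<in> I ==> f i \<in> R) ==> sum f I \<in> R"
proof -
 show 1: "1 \<in> R" and m: "x \<in> R ==> - x \<in> R" and a: "\<And>x y. x \<in> R ==> y \<in> R ==> x + y \<in> R"
  and t: "\<And>x y. x \<in> R ==> y \<in> R ==> x * y \<in> R" for x
  using assms unfolding is_subring_def by blast+
 show 0: "0 \<in> R" using a[OF 1 m[OF 1]] by simp
 show "x \<in> R ==> y \<in> R ==> x - y \<in> R" using a[OF _ m, of x y] by simp
 show "x \<in> R ==> x ^ n \<in> R" by (induction n) (auto intro: 1 t)
 show "(\<And>i. i \<in> I ==> f i \<in> R) ==> sum f I \<in> R"
  by (induction I rule: infinite_finite_induct) (auto intro: 0 a)
qed

definition ring_adjoin :: "complex set => complex => complex set" where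
 "ring_adjoin R u = {\<Sum>i\<le>n. a i * u ^ i |n a. \<forall>i. a i \<in> R}"

lemma ring_adjoin_poly: assumes R: "is_subring R"
 shows "ring_adjoin R u = {poly g u |g. poly_over R g}"
proof (intro equalityI subsetI)
 fix x assume "x \<in> ring_adjoin R u"
 then obtain n a where x: "x = (\<Sum>i\<le>n. a i * u ^ i)" "\<forall>i. a i \<in> R" unfolding ring_adjoin_def by blast
 have "poly_over R (\<Sum>i\<le>n. monom (a i) i)"
  unfolding poly_over_def coeff_sum by (intro allI is_subringD(8)[OF R]) (use x is_subringD(5)[OF R] in auto)
 moreover have "poly (\<Sum>i\<le>n. monom (a i) i) u = x" unfolding x poly_sum poly_monom by simp
 ultimately show "x \<in> {poly g u |g. poly_over R g}" by blast
next
 fix x assume "x \<in> {poly g u |g. poly_over R g}"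
 then obtain g where g: "x = poly g u" "poly_over R g" by blast
 have "x = (\<Sum>i\<le>degree g. coeff g i * u ^ i)" unfolding g(1) by (rule poly_altdef)
 thus "x \<in> ring_adjoin R u" using g(2) unfolding poly_over_def ring_adjoin_def by blast
qed

lemma is_subring_adjoin:
 assumes R: "is_subring R"
 shows "is_subring (ring_adjoin R u)" "R \<subseteq> ring_adjoin R u" "u \<in> ring_adjoin R u"
proof -
 note r = is_subringD[OF R]
 have one: "poly_over R [:c:]" if "c \<in> R" for c using that r(5) by (auto simp: poly_over_def coeff_pCons split: nat.splits)
 show "R \<subseteq> ring_adjoin R u"
 proof
  fix c assume "c \<in> R"
  thus "c \<in> ring_adjoin R u" unfolding ring_adjoin_poly[OF R] using one[of c] by (intro CollectI exI[of _ "[:c:]"]) simp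
 qed
 have "poly_over R [:0, 1:]" using r(1,5) by (auto simp: poly_over_def coeff_pCons split: nat.splits)
 thus "u \<in> ring_adjoin R u" unfolding ring_adjoin_poly[OF R] by (intro CollectI exI[of _ "[:0, 1:]"]) simp
 show "is_subring (ring_adjoin R u)" unfolding is_subring_def
 proof (intro conjI ballI)
  show "1 \<in> ring_adjoin R u" using \<open>R \<subseteq> ring_adjoin R u\<close> r(1) by blast
  fix x assume "x \<in> ring_adjoin R u"
  then obtain g where g: "x = poly g u" "poly_over R g" unfolding ring_adjoin_poly[OF R] by blast
  have "poly_over R (- g)" using g(2) r(2) unfolding poly_over_def by simp
  thus "- x \<in> ring_adjoin R u" unfolding ring_adjoin_poly[OF R] g(1) by (intro CollectI exI[of _ "- g"]) simp
  fix y assume "y \<in> ring_adjoin R u"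
  then obtain h where h: "y = poly h u" "poly_over R h" unfolding ring_adjoin_poly[OF R] by blast
  have "poly_over R (g + h)" using g(2) h(2) r(3) unfolding poly_over_def by simp
  thus "x + y \<in> ring_adjoin R u" unfolding ring_adjoin_poly[OF R] g(1) h(1) by (intro CollectI exI[of _ "g + h"]) simp
  have "poly_over R (g * h)" using g(2) h(2) unfolding poly_over_def coeff_mult by (auto intro!: r(8) r(4))
  thus "x * y \<in> ring_adjoin R u" unfolding ring_adjoin_poly[OF R] g(1) h(1) by (intro CollectI exI[of _ "g * h"]) simp
 qed
qed

text \<open>Chevalley's construction of a place above p: a subring of \<open>M\<close> that is
  maximal among those without 1/p. It will turn out to be a valuation ring.\<close>

locale padic_ring = csubfield M for M +
 fixes O\<^sub>p :: "complex set" and p :: nat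
 assumes p: "Factorial_Ring.prime p"
  and subring: "is_subring O\<^sub>p" and O_M: "O\<^sub>p \<subseteq> M" and inv_p: "1 / of_nat p \<notin> O\<^sub>p"
  and maximal: "\<And>R. is_subring R ==> R \<subseteq> M ==> 1 / of_nat p \<notin> R ==> O\<^sub>p \<subseteq> R ==> R = O\<^sub>p"
begin

abbreviation cp :: complex where "cp \<equiv> of_nat p"

lemma cp0: "cp \<noteq> 0" using p by (simp add: prime_gt_0_nat)

lemmas O_closed = is_subringD[OF subring]

lemma O_of_nat: "of_nat n \<in> O\<^sub>p" by (induction n) (auto intro: O_closed)
lemma O_of_int: "of_int n \<in> O\<^sub>p" by (cases n rule: int_cases2) (auto intro: O_of_nat O_closed)

lemma adjoin_subset: "u \<in> M ==> ring_adjoin O\<^sub>p u \<subseteq> M"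
 unfolding ring_adjoin_def using O_M by (auto intro!: sum_in mult_in power_in)

text \<open>By maximality, adjoining \<open>u\<close> must produce 1/p; multiplying by p gives a
  relation that can be manipulated inside the ring.\<close>

lemma not_in_O_imp:
 assumes "u \<in> M" "u \<notin> O\<^sub>p"
 shows "\<exists>n a. (\<forall>i. a i \<in> O\<^sub>p) \<and> 1 = cp * (\<Sum>i\<le>n. a i * u ^ i)"
proof -
 note ad = is_subring_adjoin[OF subring, of u]
 have "1 / cp \<in> ring_adjoin O\<^sub>p u"
 proof (rule ccontr)
  assume "1 / cp \<notin> ring_adjoin O\<^sub>p u"
  hence "ring_adjoin O\<^sub>p u = O\<^sub>p" by (intro maximal ad adjoin_subset assms)
  thus False using ad(3) assms by simp
 qed
 then obtain n a where a: "1 / cp = (\<Sum>i\<le>n. a i * u ^ i)" "\<forall>i. a i \<in> O\<^sub>p" unfolding ring_adjoin_def by blast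
 have "1 = cp * (1 / cp)" using cp0 by simp
 also have "... = cp * (\<Sum>i\<le>n. a i * u ^ i)" unfolding a(1) ..
 finally show ?thesis using a(2) by blast
qed

lemma one_minus_in: "b \<in> O\<^sub>p ==> \<exists>b'\<in>O\<^sub>p. (1 - cp * b) ^ n = 1 - cp * b'"
proof (induction n)
 case 0
 show ?case by (intro bexI[of _ 0]) (auto intro: O_closed)
next
 case (Suc n)
 then obtain b' where b': "b' \<in> O\<^sub>p" "(1 - cp * b) ^ n = 1 - cp * b'" by blast
 have "(1 - cp * b) ^ Suc n = (1 - cp * b) * (1 - cp * b')" by (simp add: b'(2))
 also have "... = 1 - cp * (b + b' - cp * b * b')" by (simp add: algebra_simps)
 finally have "(1 - cp * b) ^ Suc n = 1 - cp * (b + b' - cp * b * b')" .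
 moreover have "b + b' - cp * b * b' \<in> O\<^sub>p"
  by (intro O_closed(6) O_closed(3) O_closed(4) O_of_nat b'(1) Suc.prems)
 ultimately show ?case by blast
qed

lemma no_p_inverse: assumes "b \<in> O\<^sub>p" shows "cp * b \<noteq> 1"
proof
 assume "cp * b = 1"
 hence "b = 1 / cp" using cp0 by (simp add: eq_divide_eq mult.commute)
 thus False using assms inv_p by simp
qed

text \<open>Put u = 1 - p b. If 1/u were missing, the relation for 1/u, multiplied by a power of u,
  would make that power a multiple of p; yet it is congruent to 1 modulo p, so p would be
  invertible.\<close>

lemma one_minus_unit:
 assumes b: "b \<in> O\<^sub>p" shows "inverse (1 - cp * b) \<in> O\<^sub>p"
proof (rule ccontr)
 define u where "u = 1 - cp * b"
 have u0: "u \<noteq> 0" unfolding u_def right_minus_eq using no_p_inverse[OF b] by metis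
 have uO: "u \<in> O\<^sub>p" unfolding u_def by (intro O_closed O_of_nat b)
 assume "inverse (1 - cp * b) \<notin> O\<^sub>p"
 hence "inverse u \<notin> O\<^sub>p" by (simp add: u_def)
 moreover have "inverse u \<in> M" using uO O_M by (intro inverse_in) auto
 ultimately obtain n a where a: "\<forall>i. a i \<in> O\<^sub>p" "1 = cp * (\<Sum>i\<le>n. a i * inverse u ^ i)" using not_in_O_imp by blast
 define c where "c = (\<Sum>i\<le>n. a i * u ^ (n - i))"
 have c: "c \<in> O\<^sub>p" unfolding c_def using a by (intro O_closed(8) O_closed(4) O_closed(7) uO) auto
 have "u ^ n = u ^ n * (cp * (\<Sum>i\<le>n. a i * inverse u ^ i))" using a(2) by simp
 also have "... = cp * (\<Sum>i\<le>n. a i * (u ^ n * inverse u ^ i))" by (simp add: sum_distrib_left mult_ac)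
 also have "(\<Sum>i\<le>n. a i * (u ^ n * inverse u ^ i)) = c"
  unfolding c_def by (intro sum.cong refl) (use u0 in \<open>simp add: power_diff field_simps\<close>)
 finally have un: "u ^ n = cp * c" .
 obtain b' where b': "b' \<in> O\<^sub>p" "u ^ n = 1 - cp * b'" using one_minus_in[OF b, of n] by (auto simp: u_def)
 have "cp * (c + b') = 1" using un b'(2) by (simp add: algebra_simps)
 thus False using no_p_inverse[OF O_closed(3)[OF c b'(1)]] by simp
qed

text \<open>In the relation for 1/x the constant term moves to the left as the unit 1 - p b(0).
  Multiplied by x^n this expresses x^n through lower powers, which shortens the relation for
  x.\<close>

lemma reduce_degree:
 assumes x: "x \<in> M" "x \<noteq> 0" and mn: "m \<le> n" "n > 0"
  and a: "\<forall>i. a i \<in> O\<^sub>p" "1 = cp * (\<Sum>i\<le>n. a i * x ^ i)"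
  and b: "\<forall>i. b i \<in> O\<^sub>p" "1 = cp * (\<Sum>i\<le>m. b i * inverse x ^ i)"
 shows "\<exists>c. (\<forall>i. c i \<in> O\<^sub>p) \<and> 1 = cp * (\<Sum>i\<le>n - 1. c i * x ^ i)"
proof -
 define u where "u = 1 - cp * b 0"
 have u0: "u \<noteq> 0" unfolding u_def right_minus_eq using no_p_inverse[OF b(1)[rule_format]] by metis
 have iu: "inverse u \<in> O\<^sub>p" unfolding u_def by (rule one_minus_unit) (use b in simp)
 have "(\<Sum>i\<le>m. b i * inverse x ^ i) = b 0 + (\<Sum>i\<in>{1..m}. b i * inverse x ^ i)"
  by (simp add: atMost_atLeast0 sum.atLeast_Suc_atMost)
 hence "u = cp * (\<Sum>i\<in>{1..m}. b i * inverse x ^ i)" using b(2) by (simp add: u_def algebra_simps)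
 hence "u * x ^ n = cp * (\<Sum>i\<in>{1..m}. b i * (inverse x ^ i * x ^ n))" by (simp add: sum_distrib_left sum_distrib_right mult_ac)
 also have "(\<Sum>i\<in>{1..m}. b i * (inverse x ^ i * x ^ n)) = (\<Sum>i\<in>{1..m}. b i * x ^ (n - i))"
  by (intro sum.cong refl) (use mn x in \<open>simp add: power_diff field_simps\<close>)
 also have "... = (\<Sum>j\<in>{n - m..n - 1}. b (n - j) * x ^ j)"
  by (rule sum.reindex_bij_witness[of _ "\<lambda>j. n - j" "\<lambda>j. n - j"]) (use mn in auto)
 also have "... = (\<Sum>j\<le>n - 1. (if n - m \<le> j then b (n - j) else 0) * x ^ j)"
  by (rule sum.mono_neutral_cong_left) (use mn in auto)
 finally have "x ^ n = inverse u * (cp * (\<Sum>j\<le>n - 1. (if n - m \<le> j then b (n - j) else 0) * x ^ j))"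
  using u0 by (simp add: field_simps)
 hence xn: "x ^ n = (\<Sum>j\<le>n - 1. cp * inverse u * (if n - m \<le> j then b (n - j) else 0) * x ^ j)"
  by (simp add: sum_distrib_left mult_ac)
 define c where "c = (\<lambda>j. a j + a n * (cp * inverse u * (if n - m \<le> j then b (n - j) else 0)))"
 have cO: "c j \<in> O\<^sub>p" for j unfolding c_def
  using a(1) b(1) iu by (intro O_closed(3) O_closed(4) O_of_nat) (auto intro: O_closed)
 obtain n' where n': "n = Suc n'" using mn by (cases n) auto
 have "(\<Sum>i\<le>n. a i * x ^ i) = (\<Sum>i\<le>n - 1. a i * x ^ i) + a n * x ^ n" using n' by simp
 also have "... = (\<Sum>i\<le>n - 1. c i * x ^ i)"
  unfolding c_def xn by (simp add: sum_distrib_left sum.distrib algebra_simps)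
 finally show ?thesis using a(2) cO by auto
qed

text \<open>If neither x nor 1/x lay in the ring, both would satisfy relations as in
  \<open>not_in_O_imp\<close>; among the shortest ones, the longer could be shortened by the
  other.\<close>

lemma valuation_ring:
 assumes x: "x \<in> M" "x \<noteq> 0"
 shows "x \<in> O\<^sub>p \<or> inverse x \<in> O\<^sub>p"
proof (rule ccontr)
 assume not: "\<not> ?thesis"
 define A where "A = (\<lambda>y n. \<exists>a. (\<forall>i. a i \<in> O\<^sub>p) \<and> 1 = cp * (\<Sum>i\<le>n. a i * y ^ i))"
 have ex: "\<exists>n. A x n" "\<exists>n. A (inverse x) n"
  using not_in_O_imp[of x] not_in_O_imp[of "inverse x"] x inverse_in not unfolding A_def by blast+
 define n m where "n = (LEAST n. A x n)" and "m = (LEAST n. A (inverse x) n)"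
 have An: "A x n" and Am: "A (inverse x) m" unfolding n_def m_def using ex by (auto intro: LeastI_ex)
 have pos: "k > 0" if Ayk: "A y k" for y k
 proof (rule ccontr)
  assume k0: "\<not> k > 0"
  obtain a where a: "\<forall>i. a i \<in> O\<^sub>p" "1 = cp * (\<Sum>i\<le>k. a i * y ^ i)" using Ayk unfolding A_def by blast
  have "cp * a 0 = 1" using a(2) k0 by simp
  thus False using no_p_inverse[of "a 0"] a(1) by blast
 qed
 have red: False if y: "y \<in> M" "y \<noteq> 0" and k: "A y k" and l: "A (inverse y) l" "l \<le> k"
  and least: "\<And>i. A y i ==> k \<le> i" for y k l
 proof -
  have "A y (k - 1)" using k l reduce_degree[OF y l(2) pos[OF k]] unfolding A_def by blast
  hence "k \<le> k - 1" by (rule least)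
  thus False using pos[OF k] by simp
 qed
 show False
 proof (cases "m \<le> n")
  case True
  show False by (rule red[OF x An Am True]) (simp add: n_def Least_le)
 next
  case False
  have i: "inverse x \<in> M" "inverse x \<noteq> 0" using x inverse_in by auto
  have An': "A (inverse (inverse x)) n" using An by simp
  show False by (rule red[OF i Am An']) (use False in \<open>simp_all add: m_def Least_le\<close>)
 qed
qed

definition U :: "complex set" where "U = {u \<in> O\<^sub>p. u \<noteq> 0 \<and> inverse u \<in> O\<^sub>p}"

lemma U_mult: "u \<in> U ==> v \<in> U ==> u * v \<in> U" by (auto simp: U_def intro: O_closed)
lemma U_inverse: "u \<in> U ==> inverse u \<in> U" by (auto simp: U_def)
lemma U_one: "1 \<in> U" by (auto simp: U_def intro: O_closed)
lemma U_power: "u \<in> U ==> u ^ n \<in> U" by (induction n) (auto intro: U_mult U_one)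
lemma U_minus: "u \<in> U ==> - u \<in> U" by (auto simp: U_def intro: O_closed)
lemma U_O: "u \<in> U ==> u \<in> O\<^sub>p" by (simp add: U_def)
lemma U_ne: "u \<in> U ==> u \<noteq> 0" by (simp add: U_def)

lemma p_powi_pos_not_inverse: "0 < j ==> inverse (cp powi j) \<notin> O\<^sub>p"
proof
 assume j: "0 < j" "inverse (cp powi j) \<in> O\<^sub>p"
 define k where "k = nat j - 1"
 have "j = int (Suc k)" using j by (simp add: k_def)
 hence "cp powi j = cp * cp ^ k" by (simp only: power_int_of_nat) simp
 hence "cp * (cp ^ k * inverse (cp powi j)) = 1" using cp0 by (simp add: field_simps)
 moreover have "cp ^ k * inverse (cp powi j) \<in> O\<^sub>p" by (intro O_closed(4) O_closed(7) O_of_nat j)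
 ultimately show False using no_p_inverse by blast
qed

lemma p_powi_U: "cp powi j \<in> U ==> j = 0"
 using p_powi_pos_not_inverse[of j] p_powi_pos_not_inverse[of "- j"]
 by (cases j "0 :: int" rule: linorder_cases) (auto simp: U_def power_int_minus)

lemma p_powi_mult: "cp powi (i + j) = cp powi i * cp powi j"
 using cp0 by (simp add: power_int_add)

lemma coprime_U: assumes "coprime a (int p)" shows "of_int a \<in> U"
proof -
 obtain x y where "x * a + y * int p = 1" using assms bezout_int[of a "int p"] by (auto simp: coprime_iff_gcd_eq_1)
 hence "of_int (x * a + y * int p) = (1::complex)" by simp
 hence xa: "of_int x * of_int a = 1 - cp * of_int y" by (simp add: algebra_simps)
 have ne: "(of_int a::complex) \<noteq> 0"
 proof
  assume "(of_int a::complex) = 0"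
  hence "cp * of_int y = 1" using xa by simp
  thus False using no_p_inverse[OF O_of_int] by blast
 qed
 have "inverse (of_int a) = of_int x * inverse (1 - cp * of_int y)"
  using xa ne no_p_inverse[OF O_of_int, of y] by (simp add: field_simps)
 also have "... \<in> O\<^sub>p" by (intro O_closed(4) O_of_int one_minus_unit)
 finally show ?thesis using ne O_of_int by (simp add: U_def)
qed

lemma int_decomp: assumes "a \<noteq> 0" shows "\<exists>u\<in>U. of_int a = cp ^ multiplicity (int p) a * u"
proof -
 have pi: "Factorial_Ring.prime (int p)" using p by simp
 obtain b where b: "a = int p ^ multiplicity (int p) a * b" "\<not> int p dvd b"
  using multiplicity_decompose'[of a "int p"] assms pi by (metis not_prime_unit)
 have "coprime b (int p)" using b(2) pi by (metis prime_imp_coprime coprime_commute)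
 hence "of_int b \<in> U" by (rule coprime_U)
 moreover have "(of_int a::complex) = cp ^ multiplicity (int p) a * of_int b"
  using arg_cong[OF b(1), of "of_int :: int => complex"] by simp
 ultimately show ?thesis by blast
qed

lemma rat_decomp:
 assumes "q \<noteq> 0" "quotient_of q = (a, b)"
 shows "\<exists>u\<in>U. of_rat q = cp powi (int (multiplicity (int p) a) - int (multiplicity (int p) b)) * u"
proof -
 have q: "q = of_int a / of_int b" using quotient_of_div[OF assms(2)] .
 have b0: "b \<noteq> 0" using quotient_of_denom_pos[OF assms(2)] by simp
 have a0: "a \<noteq> 0" using assms(1) q by auto
 obtain u v where uv: "u \<in> U" "v \<in> U" "of_int a = cp ^ multiplicity (int p) a * u" "of_int b = cp ^ multiplicity (int p) b * v"
  using int_decomp[OF a0] int_decomp[OF b0] by blast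
 have "of_rat q = (of_int a :: complex) / of_int b" by (simp add: q of_rat_divide)
 also have "... = cp powi (int (multiplicity (int p) a) - int (multiplicity (int p) b)) * (u * inverse v)"
  unfolding uv(3,4) using cp0 U_ne[OF uv(2)] by (simp add: power_int_diff field_simps)
 finally show ?thesis using U_mult[OF uv(1) U_inverse[OF uv(2)]] by blast
qed

lemma Rat_decomp: assumes "c \<in> \<rat>" "c \<noteq> 0" shows "\<exists>j. \<exists>u\<in>U. c = cp powi j * u"
proof -
 obtain q where q: "c = of_rat q" using assms(1) by (auto elim: Rats_cases)
 have "q \<noteq> 0" using assms(2) q by auto
 obtain a b where "quotient_of q = (a, b)" by (cases "quotient_of q")
 from rat_decomp[OF \<open>q \<noteq> 0\<close> this] show ?thesis unfolding q by blast
qed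

definition nonunits :: "complex set" where "nonunits = {x \<in> O\<^sub>p. x \<notin> U}"

text \<open>One of the two quotients of \<open>x\<close> and \<open>y\<close> lies in the ring. If
  a/b does and a + b were a unit, then 1/b = (1 + a/b) / (a + b) would lie in the ring too.\<close>

lemma nonunits_add: assumes x: "x \<in> nonunits" and y: "y \<in> nonunits" shows "x + y \<in> nonunits"
proof -
 have *: "a + b \<notin> U" if a: "a \<in> O\<^sub>p" and b: "b \<in> nonunits" and ab: "a * inverse b \<in> O\<^sub>p" and b0: "b \<noteq> 0" for a b
 proof
  assume "a + b \<in> U"
  hence s: "a + b \<noteq> 0" "inverse (a + b) \<in> O\<^sub>p" by (auto simp: U_def)
  have "inverse b = (1 + a * inverse b) * inverse (a + b)" using b0 s by (simp add: field_simps)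
  also have "... \<in> O\<^sub>p" by (intro O_closed(4) O_closed(3) O_closed(1) ab s)
  finally show False using b b0 by (simp add: nonunits_def U_def)
 qed
 have xO: "x \<in> O\<^sub>p" "y \<in> O\<^sub>p" using x y by (auto simp: nonunits_def)
 have "x + y \<notin> U"
 proof (cases "x = 0 \<or> y = 0")
  case True
  thus ?thesis using x y by (auto simp: nonunits_def)
 next
  case False
  have "x * inverse y \<in> M" "x * inverse y \<noteq> 0" using False xO O_M by (auto intro!: mult_in inverse_in)
  moreover have "inverse (x * inverse y) = y * inverse x" by simp
  ultimately have "x * inverse y \<in> O\<^sub>p \<or> y * inverse x \<in> O\<^sub>p"
   using valuation_ring[of "x * inverse y"] by metis
  thus ?thesis using *[OF xO(1) y] *[OF xO(2) x] False by (auto simp: add.commute)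
 qed
 thus ?thesis using O_closed(3)[OF xO] by (simp add: nonunits_def)
qed

lemma nonunits_sum: "(\<And>i. i \<in> I ==> f i \<in> nonunits) ==> sum f I \<in> nonunits"
proof (induction I rule: infinite_finite_induct)
 case (insert i I)
 thus ?case using nonunits_add[of "f i" "sum f I"] by simp
qed (simp_all add: nonunits_def U_def O_closed(5))

text \<open>Divisibility is total in a valuation ring, so among finitely many nonzero terms one
  divides all the others; it plays the term of largest absolute value.\<close>

lemma max_term:
 assumes "finite I" "I \<noteq> {}" "\<And>i. i \<in> I ==> t i \<in> M" "\<And>i. i \<in> I ==> t i \<noteq> 0"
 shows "\<exists>k\<in>I. \<forall>i\<in>I. t i * inverse (t k) \<in> O\<^sub>p"
 using assms
proof (induction I rule: finite_ne_induct)
 case (singleton i)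
 thus ?case by (auto intro: O_closed)
next
 case (insert j I)
 have "\<exists>k\<in>I. \<forall>i\<in>I. t i * inverse (t k) \<in> O\<^sub>p" using insert.prems by (intro insert.IH) auto
 then obtain k where k: "k \<in> I" "\<And>i. i \<in> I ==> t i * inverse (t k) \<in> O\<^sub>p" by blast
 have tj: "t j \<in> M" "t j \<noteq> 0" and tk: "t k \<in> M" "t k \<noteq> 0" using insert.prems k(1) by auto
 have "t j * inverse (t k) \<in> M" "t j * inverse (t k) \<noteq> 0" using tj tk by (auto intro!: mult_in inverse_in)
 moreover have "inverse (t j * inverse (t k)) = t k * inverse (t j)" by simp
 ultimately have "t j * inverse (t k) \<in> O\<^sub>p \<or> t k * inverse (t j) \<in> O\<^sub>p"
  using valuation_ring[of "t j * inverse (t k)"] by metis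
 thus ?case
 proof
  assume "t j * inverse (t k) \<in> O\<^sub>p"
  thus ?thesis using k by (intro bexI[of _ k]) auto
 next
  assume h: "t k * inverse (t j) \<in> O\<^sub>p"
  have "t i * inverse (t j) \<in> O\<^sub>p" if "i \<in> I" for i
  proof -
   have "t i * inverse (t j) = (t i * inverse (t k)) * (t k * inverse (t j))" using tk(2) by (simp add: field_simps)
   thus ?thesis using O_closed(4)[OF k(2)[OF that] h] by (simp only:)
  qed
  moreover have "t j * inverse (t j) \<in> O\<^sub>p" using tj O_closed(1) by simp
  ultimately show ?thesis by (intro bexI[of _ j]) auto
 qed
qed

text \<open>In the vanishing sum of the terms of f at x two terms must have equal value: otherwise,
  divided by the largest one, the others would be nonunits with sum -1. Rational coefficients are
  powers of p up to units, so equal values of two terms make some power of x a power of p up to a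
  unit.\<close>

lemma power_decomp:
 assumes x: "x \<in> M" "x \<noteq> 0" and f: "poly_over \<rat> f" "lead_coeff f = 1" "poly f x = 0" "degree f \<le> r"
 shows "\<exists>k j. 1 \<le> k \<and> k \<le> r \<and> x ^ k * cp powi j \<in> U"
proof -
 define I where "I = {i. i \<le> degree f \<and> coeff f i \<noteq> 0}"
 define t where "t = (\<lambda>i. coeff f i * x ^ i)"
 have fin: "finite I" unfolding I_def by simp
 have ne: "degree f \<in> I" using f(2) by (simp add: I_def)
 have tM: "t i \<in> M" for i using f(1) Rats_subset x unfolding t_def poly_over_def by (intro mult_in power_in) auto
 have t0: "t i \<noteq> 0" if "i \<in> I" for i using that x by (simp add: t_def I_def)
 have tsum: "(\<Sum>i\<in>I. t i) = 0"
 proof -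
  have "(\<Sum>i\<in>I. t i) = (\<Sum>i\<le>degree f. t i)" unfolding I_def t_def by (rule sum.mono_neutral_left) auto
  thus ?thesis using f(3) by (simp add: t_def poly_altdef)
 qed
 have "\<exists>k\<in>I. \<forall>i\<in>I. t i * inverse (t k) \<in> O\<^sub>p"
  by (rule max_term[OF fin _ tM]) (use ne t0 in auto)
 then obtain k where k: "k \<in> I" "\<And>i. i \<in> I ==> t i * inverse (t k) \<in> O\<^sub>p" by blast
 have "\<exists>i\<in>I - {k}. t i * inverse (t k) \<in> U"
 proof (rule ccontr)
  assume "\<not> ?thesis"
  hence "(\<Sum>i\<in>I - {k}. t i * inverse (t k)) \<in> nonunits"
   using k(2) by (intro nonunits_sum) (auto simp: nonunits_def)
  moreover have "(\<Sum>i\<in>I - {k}. t i * inverse (t k)) = - 1"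
  proof -
   have "(\<Sum>i\<in>I. t i * inverse (t k)) = 0" using tsum by (simp flip: sum_distrib_right)
   hence "t k * inverse (t k) + (\<Sum>i\<in>I - {k}. t i * inverse (t k)) = 0" using k(1) fin by (simp add: sum.remove)
   thus ?thesis using t0[OF k(1)] by (simp add: eq_neg_iff_add_eq_0 add.commute)
  qed
  ultimately show False using U_minus[OF U_one] by (simp add: nonunits_def)
 qed
 then obtain i where i: "i \<in> I" "i \<noteq> k" "t i * inverse (t k) \<in> U" by blast
 have ci: "coeff f i \<noteq> 0" "coeff f k \<noteq> 0" "i \<le> r" "k \<le> r" using i k f(4) by (auto simp: I_def)
 have "coeff f i * inverse (coeff f k) \<in> \<rat>" using f(1) unfolding poly_over_def by auto
 then obtain j u where j: "u \<in> U" "coeff f i * inverse (coeff f k) = cp powi j * u" using Rat_decomp ci by force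
 have eq: "t i * inverse (t k) = (x ^ i * inverse (x ^ k)) * (cp powi j * u)"
  unfolding t_def j(2)[symmetric] using ci by (simp add: field_simps)
 have V: "(x ^ i * inverse (x ^ k)) * cp powi j \<in> U"
  using U_mult[OF i(3)[unfolded eq] U_inverse[OF j(1)]] U_ne[OF j(1)] by (simp add: mult.assoc)
 show ?thesis
 proof (cases "k < i")
  case True
  have "x ^ (i - k) * cp powi j \<in> U" using V True x by (simp add: power_diff divide_inverse)
  thus ?thesis using True ci by (intro exI[of _ "i - k"] exI[of _ j]) auto
 next
  case False
  have "inverse ((x ^ i * inverse (x ^ k)) * cp powi j) \<in> U" by (rule U_inverse[OF V])
  also have "inverse ((x ^ i * inverse (x ^ k)) * cp powi j) = x ^ (k - i) * cp powi (- j)"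
   using False x i(2) by (simp add: power_diff field_simps power_int_minus)
  finally show ?thesis using False i(2) ci by (intro exI[of _ "k - i"] exI[of _ "- j"]) auto
 qed
qed

context
 fixes r :: nat
 assumes alg: "\<And>x. x \<in> M ==> \<exists>f. poly_over \<rat> f \<and> lead_coeff f = 1 \<and> poly f x = 0 \<and> degree f \<le> r"
begin

text \<open>The exponent depends on x but is at most r, so the factorial of r serves all x at
  once.\<close>

lemma fact_power_decomp:
 assumes x: "x \<in> M" "x \<noteq> 0" shows "\<exists>j. x ^ fact r * cp powi j \<in> U"
proof -
 obtain f where f: "poly_over \<rat> f" "lead_coeff f = 1" "poly f x = 0" "degree f \<le> r"
  using alg[OF x(1)] by blast
 obtain k j where k: "1 \<le> k" "k \<le> r" "x ^ k * cp powi j \<in> U"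
  using power_decomp[OF x f] by blast
 have "k dvd fact r" using k by (intro dvd_fact) auto
 then obtain l where l: "fact r = k * l" by blast
 have "(x ^ k * cp powi j) ^ l \<in> U" by (rule U_power[OF k(3)])
 also have "(x ^ k * cp powi j) ^ l = x ^ fact r * cp powi (j * int l)"
  by (simp add: l power_mult power_mult_distrib power_int_mult)
 finally show ?thesis by blast
qed

text \<open>Minus r! times the additive valuation of x, an integer; the sign is such that the
  absolute value becomes a positive power of p to this exponent over r!.\<close>

definition vj :: "complex => int" where "vj x = (SOME j. x ^ fact r * cp powi j \<in> U)"

lemma vj: "x \<in> M ==> x \<noteq> 0 ==> x ^ fact r * cp powi (vj x) \<in> U"
 unfolding vj_def using someI_ex[OF fact_power_decomp] .

lemma vj_unique:
 assumes "x ^ fact r * cp powi j \<in> U" "x \<in> M" "x \<noteq> 0" shows "vj x = j"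
proof -
 have "(x ^ fact r * cp powi (vj x)) * inverse (x ^ fact r * cp powi j) \<in> U"
  by (intro U_mult U_inverse vj assms)
 also have "(x ^ fact r * cp powi (vj x)) * inverse (x ^ fact r * cp powi j) = cp powi (vj x - j)"
  using assms(3) cp0 by (simp add: power_int_diff field_simps)
 finally have "vj x - j = 0" by (rule p_powi_U)
 thus ?thesis by simp
qed

lemma vj_mult: assumes "x \<in> M" "x \<noteq> 0" "y \<in> M" "y \<noteq> 0" shows "vj (x * y) = vj x + vj y"
proof (rule vj_unique)
 have "(x ^ fact r * cp powi (vj x)) * (y ^ fact r * cp powi (vj y)) \<in> U" by (intro U_mult vj assms)
 thus "(x * y) ^ fact r * cp powi (vj x + vj y) \<in> U" by (simp add: power_mult_distrib p_powi_mult mult_ac)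
qed (use assms mult_in in auto)

text \<open>The exponent describes x^(r!), not x. The ring contains x once it contains that power,
  because otherwise it contains 1/x, and x is the power times a power of 1/x.\<close>

lemma vj_le_0_iff: assumes x: "x \<in> M" "x \<noteq> 0" shows "vj x \<le> 0 \<longleftrightarrow> x \<in> O\<^sub>p"
proof
 define u where "u = x ^ fact r * cp powi (vj x)"
 have u: "u \<in> U" unfolding u_def by (rule vj[OF x])
 have e: "x ^ fact r = u * inverse (cp powi (vj x))" using cp0 by (simp add: u_def)
 {
  assume le: "vj x \<le> 0"
  have "inverse (cp powi (vj x)) = cp ^ nat (- vj x)" using le by (simp add: power_int_def power_inverse)
  hence xe: "x ^ fact r \<in> O\<^sub>p" unfolding e using U_O[OF u] by (auto intro!: O_closed O_of_nat)
  show "x \<in> O\<^sub>p"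
  proof (rule ccontr)
   assume n: "x \<notin> O\<^sub>p"
   hence i: "inverse x \<in> O\<^sub>p" using valuation_ring[OF x] by blast
   obtain k where k: "fact r = Suc k" by (cases "fact r :: nat") auto
   have "x = x ^ fact r * inverse x ^ k" unfolding k using x by (simp add: power_inverse)
   also have "... \<in> O\<^sub>p" by (intro O_closed(4) O_closed(7) xe i)
   finally show False using n by blast
  qed
 }
 assume xO: "x \<in> O\<^sub>p"
 show "vj x \<le> 0"
 proof (rule ccontr)
  assume "\<not> vj x \<le> 0"
  hence "inverse (cp powi (vj x)) \<notin> O\<^sub>p" by (intro p_powi_pos_not_inverse) simp
  moreover have "inverse (cp powi (vj x)) = x ^ fact r * inverse u" unfolding e using U_ne[OF u] by simp
  moreover have "x ^ fact r * inverse u \<in> O\<^sub>p" by (intro O_closed(4) O_closed(7) xO U_O U_inverse u)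
  ultimately show False by simp
 qed
qed

definition w :: "complex => real" where
 "w = (\<lambda>x\<in>M. if x = 0 then 0 else real p powr (of_int (vj x) / fact r))"

text \<open>Dividing by the larger summand reduces the triangle inequality to 1 + z with z of size
  at most 1, which only says that the ring is closed under adding 1.\<close>

lemma absolute_value_w: "absolute_value_on M w"
proof -
 have p1: "1 < real p" using p prime_gt_1_nat by simp
 have powr_le_one_iff: "real p powr a \<le> 1 \<longleftrightarrow> a \<le> 0" for a
  using powr_le_cancel_iff[OF p1, of a 0] p1 by simp
 have mult: "w (x * y) = w x * w y" if "x \<in> M" "y \<in> M" for x y
  using that mult_in[OF that] p1 by (auto simp: w_def vj_mult add_divide_distrib powr_add)
 have ultra: "w (1 + x) \<le> 1" if x: "x \<in> M" "w x \<le> 1" for x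
 proof (cases "x = 0 \<or> 1 + x = 0")
  case True
  have "vj 1 = 0" by (rule vj_unique) (simp_all add: U_one)
  thus ?thesis using True x one_in by (auto simp: w_def)
 next
  case False
  have "of_int (vj x) / fact r \<le> (0::real)" using x False p1 by (simp add: w_def powr_le_one_iff)
  hence "vj x \<le> 0" using fact_gt_zero[of r, where 'a=real] by (auto simp: divide_le_0_iff)
  hence "x \<in> O\<^sub>p" using vj_le_0_iff x False by blast
  hence "1 + x \<in> O\<^sub>p" by (intro O_closed)
  hence "vj (1 + x) \<le> 0" using vj_le_0_iff[of "1 + x"] False x add_in by simp
  thus ?thesis using False x p1 add_in by (simp add: w_def powr_le_one_iff divide_le_0_iff)
 qed
 have nonneg: "0 \<le> w x" if "x \<in> M" for x using that by (simp add: w_def)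
 have zero: "w x = 0 \<longleftrightarrow> x = 0" if "x \<in> M" for x using that p1 by (simp add: w_def)
 have tri: "w (x + y) \<le> w x + w y" if xy: "x \<in> M" "y \<in> M" "w x \<le> w y" for x y
 proof (cases "y = 0")
  case True
  thus ?thesis using xy by (simp add: w_def)
 next
  case False
  have wy: "0 < w y" using nonneg[OF xy(2)] zero[OF xy(2)] False by simp
  define z where "z = x * inverse y"
  have z: "z \<in> M" unfolding z_def by (intro mult_in inverse_in xy)
  have xe: "x = z * y" using False by (simp add: z_def)
  have "w z * w y \<le> 1 * w y" using xy(3) mult[OF z xy(2)] xe by simp
  hence "w z \<le> 1" using wy by simp
  hence "w (1 + z) \<le> 1" by (rule ultra[OF z])
  hence "w ((1 + z) * y) \<le> w y" using mult[OF add_in[OF one_in z] xy(2)] wy by simp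
  moreover have "(1 + z) * y = x + y" using xe by (simp add: algebra_simps)
  ultimately show ?thesis using nonneg[OF xy(1)] by simp
 qed
 have "w (x + y) \<le> w x + w y" if "x \<in> M" "y \<in> M" for x y
  using tri[OF that] tri[OF that(2,1)] by (cases "w x \<le> w y") (simp_all add: add.commute)
 with mult nonneg zero show ?thesis unfolding absolute_value_on_def by blast
qed

lemma w_rat: "w (of_rat q) = padic_abs p q"
proof (cases "q = 0")
 case True
 thus ?thesis by (simp add: w_def padic_abs_def)
next
 case False
 have p1: "1 < real p" using p prime_gt_1_nat by simp
 obtain a b where ab: "quotient_of q = (a, b)" by (cases "quotient_of q")
 define j where "j = int (multiplicity (int p) a) - int (multiplicity (int p) b)"
 obtain u where u: "u \<in> U" "of_rat q = cp powi j * u" using rat_decomp[OF False ab] by (auto simp: j_def)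
 have qM: "(of_rat q :: complex) \<in> M" "(of_rat q :: complex) \<noteq> 0" using Rats_subset False by auto
 have "vj (of_rat q) = - j * int (fact r)"
 proof (rule vj_unique[OF _ qM])
  have "cp powi (- j * int (fact r)) = inverse (cp powi j) ^ fact r"
   by (simp only: power_int_mult power_int_of_nat power_int_minus)
  hence "(of_rat q) ^ fact r * cp powi (- j * int (fact r)) = u ^ fact r"
   unfolding u(2) using cp0 by (simp add: power_mult_distrib power_inverse)
  thus "(of_rat q) ^ fact r * cp powi (- j * int (fact r)) \<in> U" using U_power[OF u(1)] by simp
 qed
 hence "w (of_rat q) = real p powr (of_int (- j))" using qM by (simp add: w_def)
 also have "... = real p powi (- j)" using p1 by (intro powr_real_of_int') auto
 also have "... = padic_abs p q" using False ab by (simp add: padic_abs_def j_def)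
 finally show ?thesis .
qed

end

end

lemma padic_ring_exists:
 assumes M: "csubfield M" and p: "Factorial_Ring.prime p"
 obtains R where "padic_ring M R p"
proof -
 interpret csubfield M by fact
 define A where "A = {R. is_subring R \<and> R \<subseteq> M \<and> 1 / of_nat p \<notin> R}"
 have Z: "\<int> \<in> A"
 proof -
  have "(1 / of_nat p :: complex) \<notin> \<int>"
  proof
   assume "(1 / of_nat p :: complex) \<in> \<int>"
   then obtain k where k: "1 / of_nat p = (of_int k :: complex)" by (auto elim: Ints_cases)
   have "p > 1" using p prime_gt_1_nat by blast
   hence "of_int (k * int p) = (1 :: complex)" using k by (simp add: field_simps)
   hence "k * int p = 1" by (simp only: of_int_eq_1_iff)
   hence "int p dvd 1" by (metis dvd_triv_right)
   thus False using \<open>p > 1\<close> by simp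
  qed
  moreover have "\<int> \<subseteq> M" using of_int_in by (auto elim: Ints_cases)
  ultimately show ?thesis unfolding A_def is_subring_def by auto
 qed
 \<comment> \<open>Zorn's lemma, starting from the integers; the union of a chain of subrings
   without 1/p is another one.\<close>
 have "\<exists>R\<in>A. \<forall>S\<in>A. R \<subseteq> S \<longrightarrow> S = R"
 proof (rule subset_Zorn_nonempty)
  show "A \<noteq> {}" using Z by auto
  fix C assume C: "C \<noteq> {}" "subset.chain A C"
  have CA: "C \<subseteq> A" using C(2) by (simp add: subset.chain_def)
  have dir: "\<exists>R\<in>C. x \<in> R \<and> y \<in> R" if xy: "x \<in> \<Union>C" "y \<in> \<Union>C" for x y
  proof -
   obtain R S where RS: "R \<in> C" "S \<in> C" "x \<in> R" "y \<in> S" using xy by blast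
   have "R \<subseteq> S \<or> S \<subseteq> R" using C(2) RS(1,2) unfolding subset_chain_def by blast
   thus ?thesis using RS by blast
  qed
  have "is_subring (\<Union>C)" unfolding is_subring_def
  proof (intro conjI ballI)
   show "1 \<in> \<Union>C" using C(1) CA is_subringD(1) unfolding A_def by blast
   show "- x \<in> \<Union>C" if "x \<in> \<Union>C" for x using that CA is_subringD(2) unfolding A_def by blast
   fix x y assume xy: "x \<in> \<Union>C" "y \<in> \<Union>C"
   obtain R where R: "R \<in> C" "x \<in> R" "y \<in> R" using dir[OF xy] by blast
   have "is_subring R" using R CA by (auto simp: A_def)
   thus "x + y \<in> \<Union>C" "x * y \<in> \<Union>C" using R is_subringD(3,4) by blast+
  qed
  thus "\<Union>C \<in> A" using CA unfolding A_def by blast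
 qed
 then obtain R where R: "R \<in> A" "\<And>S. S \<in> A ==> R \<subseteq> S ==> S = R" by blast
 have "padic_ring M R p"
  by unfold_locales (use R p in \<open>auto simp: A_def\<close>)
 thus thesis by (rule that)
qed

section \<open>Places of number fields\<close>

lemma absvalI: "csubfield K ==> absolute_value_on K v ==> absval K v"
 by (intro absval.intro absval_axioms.intro)

text \<open>Places of the rationals are indexed by natural numbers: 0, which is not a prime, stands
  for the archimedean one.\<close>

definition rat_abs :: "nat => rat => real" where
 "rat_abs p q = (if p = 0 then of_rat \<bar>q\<bar> else padic_abs p q)"

definition place_ids :: "nat set" where
 "place_ids = insert 0 {p. Factorial_Ring.prime p}"

definition places_over :: "complex set => nat => (complex => real) set" where
 "places_over K p = {v \<in> extensional K. absolute_value_on K v \<and> (\<forall>q. v (of_rat q) = rat_abs p q)}"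

lemma places_eq: "places K = (\<Union>p\<in>place_ids. places_over K p)"
 unfolding places_def places_over_def place_ids_def rat_abs_def
 by (auto simp: prime_gt_0_nat split: if_splits)

lemma rat_abs_prime_self: assumes "Factorial_Ring.prime p" shows "rat_abs p (of_nat p) = 1 / real p"
proof -
 have p: "p \<noteq> 0" using assms by auto
 have "quotient_of (of_nat p) = (int p, 1)" using quotient_of_int[of "int p"] by simp
 thus ?thesis using p assms by (simp add: rat_abs_def padic_abs_def power_int_minus field_simps)
qed

lemma rat_abs_of_nat_le: assumes "Factorial_Ring.prime p" shows "rat_abs p (of_nat n) \<le> 1"
proof -
 have p: "p \<noteq> 0" "1 < real p" using assms prime_gt_1_nat[of p] by auto
 have "quotient_of (of_nat n) = (int n, 1)" using quotient_of_int[of "int n"] by simp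
 thus ?thesis using p by (simp add: rat_abs_def padic_abs_def power_int_minus inverse_le_1_iff one_le_power)
qed

text \<open>A rational number of size strictly between 0 and 1 has the same size at all places above
  p; it is the common \<pi> that weak approximation asks for.\<close>

lemma rat_abs_uniformizer:
 assumes "p \<in> place_ids"
 obtains q where "0 < rat_abs p q" "rat_abs p q < 1"
proof (cases "p = 0")
 case True
 show thesis by (rule that[of "1/2"]) (simp_all add: True rat_abs_def of_rat_divide)
next
 case False
 hence pr: "Factorial_Ring.prime p" using assms by (simp add: place_ids_def)
 show thesis by (rule that[of "of_nat p"]) (use rat_abs_prime_self[OF pr] prime_gt_1_nat[OF pr] in simp_all)
qed

text \<open>A prime has absolute value less than 1 at its own place and at least 1 at every
  other.\<close>

lemma places_over_disjoint:
 assumes "p \<in> place_ids" "p' \<in> place_ids" "p \<noteq> p'" shows "places_over K p \<inter> places_over K p' = {}"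
proof -
 have *: False if v: "v \<in> places_over K a" "v \<in> places_over K b" and a: "Factorial_Ring.prime a" and b: "b \<in> place_ids" "a \<noteq> b" for v a b
 proof -
  have "rat_abs a (of_nat a) = rat_abs b (of_nat a)" 
  proof -
   have "v (of_rat (of_nat a)) = rat_abs a (of_nat a)" using v(1) unfolding places_over_def by blast
   moreover have "v (of_rat (of_nat a)) = rat_abs b (of_nat a)" using v(2) unfolding places_over_def by blast
   ultimately show ?thesis by simp
  qed
  moreover have "rat_abs b (of_nat a) \<ge> 1"
  proof (cases "b = 0")
   case True
   thus ?thesis using prime_gt_0_nat[OF a] by (simp add: rat_abs_def)
  next
   case False
   hence pb: "Factorial_Ring.prime b" using b by (simp add: place_ids_def)
   have "multiplicity (int b) (int a) = 0"
    using primes_dvd_imp_eq[of b a] a pb b(2) by (intro not_dvd_imp_multiplicity_0) auto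
   moreover have "quotient_of (of_nat a) = (int a, 1)" using quotient_of_int[of "int a"] by simp
   ultimately show ?thesis using False prime_gt_0_nat[OF a] by (simp add: rat_abs_def padic_abs_def)
  qed
  moreover have "1 / real a < 1" using prime_gt_1_nat[OF a] by simp
  ultimately show False using rat_abs_prime_self[OF a] by linarith
 qed
 from assms(1-3) consider "Factorial_Ring.prime p" | "Factorial_Ring.prime p'" by (auto simp: place_ids_def)
 thus ?thesis using *[of _ p p'] *[of _ p' p] assms by cases blast+
qed

lemma places_overD:
 assumes "v \<in> places_over K p" "csubfield K"
 shows "absval K v" "\<And>q. v (of_rat q) = rat_abs p q" "v \<in> extensional K"
 using assms by (auto simp: places_over_def intro: absvalI)

lemma place_ultrametric_nat:
 assumes "v \<in> places_over K p" "Factorial_Ring.prime p"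
 shows "v (of_nat n) \<le> 1"
proof -
 have "v (of_rat (of_nat n)) = rat_abs p (of_nat n)" using assms(1) unfolding places_over_def by blast
 thus ?thesis using rat_abs_of_nat_le[OF assms(2)] by simp
qed

context galois_field
begin

lemma place_over_exists: assumes "p \<in> place_ids" shows "places_over M p \<noteq> {}"
proof (cases "p = 0")
 case True
 have "(\<lambda>x\<in>M. cmod x) \<in> places_over M p"
 proof -
  have "of_rat q \<in> M" for q using Rats_subset by auto
  moreover have "cmod (of_rat q) = real_of_rat \<bar>q\<bar>" for q

  proof -
   obtain a b where q: "q = of_int a / of_int b" using quotient_of_div[of q] by (cases "quotient_of q") auto
   show ?thesis unfolding q by (simp add: of_rat_divide norm_divide abs_divide of_int_abs[symmetric] del: of_int_abs)
  qed
  ultimately show ?thesis unfolding places_over_def absolute_value_on_def rat_abs_def True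
   by (auto simp: norm_mult norm_triangle_ineq closed)
 qed
 thus ?thesis by blast
next
 case False
 hence pr: "Factorial_Ring.prime p" using assms by (simp add: place_ids_def)
 obtain R where R: "padic_ring M R p" by (rule padic_ring_exists[OF csubfield_axioms pr])
 \<comment> \<open>The degree bound r of the valuation is \<open>card G\<close>, the degree of every
   \<open>gpoly\<close>.\<close>
 have alg: "\<exists>f. poly_over \<rat> f \<and> lead_coeff f = 1 \<and> poly f x = 0 \<and> degree f \<le> card G" if "x \<in> M" for x
  using gpoly_over[OF that] gpoly_monic[of x] gpoly_root[OF that] by (intro exI[of _ "gpoly x"]) simp
 have "padic_ring.w M R p (card G) \<in> places_over M p"
  unfolding places_over_def
  using padic_ring.absolute_value_w[OF R alg] padic_ring.w_rat[OF R alg] False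
  by (auto simp: rat_abs_def padic_ring.w_def[OF R alg])
 thus ?thesis by blast
qed

end

section \<open>Conjugacy of the places above a prime\<close>

definition coeff_norm :: "(complex => real) => nat => complex poly => real" where
 "coeff_norm v n p = (\<Sum>i\<le>n. v (coeff p i))"

context absval
begin

lemma coeff_norm_shift: assumes "poly_over K q" shows "coeff_norm v n (pCons 0 q) \<le> coeff_norm v n q"
proof -
 have "coeff_norm v n (pCons 0 q) = (\<Sum>i<n. v (coeff q i))"
  unfolding coeff_norm_def by (subst sum.atMost_shift) simp
 also have "... \<le> coeff_norm v n q" unfolding coeff_norm_def
  using assms v_nonneg unfolding poly_over_def by (intro sum_mono2) auto
 finally show ?thesis .
qed

lemma coeff_norm_diff_smult:
 assumes "poly_over K p" "poly_over K q" "a \<in> K"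
 shows "coeff_norm v n (p - smult a q) \<le> coeff_norm v n p + v a * coeff_norm v n q"
proof -
 have "v (coeff p i - a * coeff q i) \<le> v (coeff p i) + v a * v (coeff q i)" for i
  using assms v_diff[of "coeff p i" "a * coeff q i"] unfolding poly_over_def by (simp add: v_mult mult_in)
 thus ?thesis unfolding coeff_norm_def by (simp add: sum_distrib_left sum.distrib[symmetric] sum_mono)
qed

text \<open>The third estimate says that a monic polynomial with small roots is close to a pure
  power: expanding the bound for the whole product, the summand 1 belongs to the leading
  term.\<close>

lemma coeff_norm_prod:
 assumes "finite H" "\<And>s. s \<in> H ==> f s \<in> K"
 shows "poly_over K (\<Prod>s\<in>H. [:- f s, 1:])"
  "coeff_norm v n (\<Prod>s\<in>H. [:- f s, 1:]) \<le> (\<Prod>s\<in>H. 1 + v (f s))"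
  "coeff_norm v n ((\<Prod>s\<in>H. [:- f s, 1:]) - monom 1 (card H)) \<le> (\<Prod>s\<in>H. 1 + v (f s)) - 1"
proof -
 have "poly_over K (\<Prod>s\<in>H. [:- f s, 1:]) \<and> coeff_norm v n (\<Prod>s\<in>H. [:- f s, 1:]) \<le> (\<Prod>s\<in>H. 1 + v (f s)) \<and>
  coeff_norm v n ((\<Prod>s\<in>H. [:- f s, 1:]) - monom 1 (card H)) \<le> (\<Prod>s\<in>H. 1 + v (f s)) - 1"
  using assms
 proof (induction H rule: finite_induct)
  case empty
  have "coeff_norm v n 1 \<le> 1"
  proof -
   have "coeff_norm v n 1 = (\<Sum>i\<le>n. if i = 0 then 1 else 0)" unfolding coeff_norm_def by (intro sum.cong) (auto simp: coeff_1)
   thus ?thesis by simp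
  qed
  thus ?case by (simp add: coeff_norm_def monom_0 one_pCons[symmetric])
 next
  case (insert s H)
  define P where "P = (\<Prod>s\<in>H. [:- f s, 1:])"
  define B where "B = (\<Prod>s\<in>H. 1 + v (f s))"
  have IH: "poly_over K P" "coeff_norm v n P \<le> B" "coeff_norm v n (P - monom 1 (card H)) \<le> B - 1"
   unfolding P_def B_def using insert.IH insert.prems by auto
  have fs: "f s \<in> K" using insert.prems by simp
  have eq: "(\<Prod>s\<in>insert s H. [:- f s, 1:]) = pCons 0 P - smult (f s) P"
   using insert.hyps by (simp add: P_def)
  have eq2: "(\<Prod>s\<in>insert s H. [:- f s, 1:]) - monom 1 (card (insert s H)) = pCons 0 (P - monom 1 (card H)) - smult (f s) P"
   unfolding eq using insert.hyps by (simp add: monom_Suc)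
  have eqB: "(\<Prod>s\<in>insert s H. 1 + v (f s)) = B + v (f s) * B" using insert.hyps by (simp add: B_def algebra_simps)
  have o1: "poly_over K (pCons 0 P)" by (intro poly_over_pCons IH) simp
  have o2: "poly_over K (P - monom 1 (card H))" by (intro poly_over_diff IH poly_over_monom) simp
  have o3: "poly_over K (pCons 0 (P - monom 1 (card H)))" by (intro poly_over_pCons o2) simp
  have m: "v (f s) * coeff_norm v n P \<le> v (f s) * B" using IH(2) v_nonneg[OF fs] by (intro mult_left_mono)
  have "poly_over K (pCons 0 P - smult (f s) P)" by (intro poly_over_diff o1 poly_over_smult fs IH)
  moreover have "coeff_norm v n (pCons 0 P - smult (f s) P) \<le> B + v (f s) * B"
   using coeff_norm_diff_smult[OF o1 IH(1) fs, of n] coeff_norm_shift[OF IH(1), of n] IH(2) m by linarith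
  moreover have "coeff_norm v n (pCons 0 (P - monom 1 (card H)) - smult (f s) P) \<le> B + v (f s) * B - 1"
   using coeff_norm_diff_smult[OF o3 IH(1) fs, of n] coeff_norm_shift[OF o2, of n] IH(3) m by linarith
  ultimately show ?case unfolding eq2 eqB by (simp only: eq)
 qed
 thus "poly_over K (\<Prod>s\<in>H. [:- f s, 1:])"
  "coeff_norm v n (\<Prod>s\<in>H. [:- f s, 1:]) \<le> (\<Prod>s\<in>H. 1 + v (f s))"
  "coeff_norm v n ((\<Prod>s\<in>H. [:- f s, 1:]) - monom 1 (card H)) \<le> (\<Prod>s\<in>H. 1 + v (f s)) - 1" by blast+
qed

end

context galois_subfield
begin

lemma absval_compose:
 assumes w: "w \<in> places_over M p" and s: "s \<in> G"
 shows "(\<lambda>x\<in>K. w (s x)) \<in> places_over K p"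
proof -
 interpret w: absval M w by (rule places_overD[OF w csubfield_axioms])
 interpret s: csubfield_hom M s by (rule G_hom[OF s])
 have KM: "x \<in> M" if "x \<in> K" for x using that K_le by blast
 have sM: "s x \<in> M" if "x \<in> K" for x using G_maps[OF s KM[OF that]] .
 have "absolute_value_on K (\<lambda>x\<in>K. w (s x))" unfolding absolute_value_on_def
  by (auto simp: K.add_in K.mult_in w.v_nonneg sM w.v_eq_0 s.hom_eq_0_iff KM s.hom_mult s.hom_add w.v_mult w.v_add)
 moreover have "w (s (of_rat q)) = rat_abs p q" for q
  using s.hom_Rats[of "of_rat q"] places_overD(2)[OF w csubfield_axioms] by simp
 moreover have "of_rat q \<in> K" for q using K.Rats_subset by auto
 ultimately show ?thesis unfolding places_over_def by auto
qed

text \<open>Otherwise some \<open>y\<close> in \<open>K\<close> would be near 1 at \<open>v\<close>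
  and near 0 at all places induced from \<open>w\<close>. Then every conjugate of \<open>y\<close>
  is small at \<open>w\<close>, so \<open>gpoly y\<close> is close to a pure power there, and also
  at \<open>v\<close> because its coefficients are rational. A root of size near 1 at
  \<open>v\<close> contradicts this.\<close>

theorem places_over_transitive:
 assumes p: "p \<in> place_ids" and w: "w \<in> places_over M p" and v: "v \<in> places_over K p"
 shows "\<exists>s\<in>G. v = (\<lambda>x\<in>K. w (s x))"
proof (rule ccontr)
 assume not: "\<not> ?thesis"
 interpret v: absval K v by (rule places_overD[OF v K.csubfield_axioms])
 interpret w: absval M w by (rule places_overD[OF w csubfield_axioms])
 define V where "V = (\<lambda>s. \<lambda>x\<in>K. w (s x)) ` G"
 have Vp: "u \<in> places_over K p" if "u \<in> V" for u using that absval_compose[OF w] by (auto simp: V_def)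
 have finV: "finite V" unfolding V_def using finite_G by simp
 obtain q where q: "0 < rat_abs p q" "rat_abs p q < 1" by (rule rat_abs_uniformizer[OF p])
 have vq: "v (of_rat q) = rat_abs p q" by (rule places_overD(2)[OF v K.csubfield_axioms])
 have qK: "of_rat q \<in> K" using K.Rats_subset by auto
 define g where "g = card G"
 \<comment> \<open>The lower coefficients will have total size below (1/3)^g, and y has size between
   1/2 and 3/2 at v; since (1/3)(3/2) = 1/2, the leading term y^g is then too large to
   cancel.\<close>
 have "((\<lambda>x. (1 + x) ^ g - 1) \<longlongrightarrow> (1 + 0) ^ g - 1) (at_right (0::real))" by (intro tendsto_intros)
 hence "\<forall>\<^sub>F x in at_right (0::real). (1 + x) ^ g - 1 < (1/3) ^ g"
  by (intro order_tendstoD(2)[where y = "0"]) simp_all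
 hence "\<forall>\<^sub>F x in at_right (0::real). (1 + x) ^ g - 1 < (1/3) ^ g \<and> 0 < x \<and> x < 1/2"
  by (intro eventually_conj eventually_at_right_less eventually_at_right_real[of 0 "1/2", simplified]) 
   (auto elim: eventually_mono simp: eventually_at_right_field intro!: exI[of _ "1/2"])
 then obtain \<epsilon> :: real where \<epsilon>: "(1 + \<epsilon>) ^ g - 1 < (1/3) ^ g" "0 < \<epsilon>" "\<epsilon> < 1/2"
  using eventually_happens'[OF trivial_limit_at_right_real] by blast
 have "\<exists>y\<in>K. v (y - 1) < \<epsilon> \<and> (\<forall>u\<in>V. u y < \<epsilon>)"
 proof (rule weak_approximation[OF K.csubfield_axioms finV v.av])
  show "absolute_value_on K u" if "u \<in> V" for u using Vp[OF that] by (simp add: places_over_def)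
  show "of_rat q \<in> K" by (rule qK)
  show "0 < v (of_rat q)" "v (of_rat q) < 1" using q vq by simp_all
  show "u (of_rat q) = v (of_rat q)" if "u \<in> V" for u
   using places_overD(2)[OF Vp[OF that] K.csubfield_axioms] vq by simp
  show "\<exists>x\<in>K. v x \<noteq> u x" if u: "u \<in> V" for u
  proof (rule ccontr)
   assume "\<not> ?thesis"
   hence "v = u" using places_overD(3)[OF v K.csubfield_axioms] places_overD(3)[OF Vp[OF u] K.csubfield_axioms]
    by (intro extensionalityI[of _ K]) auto
   thus False using not u by (auto simp: V_def)
  qed
 qed fact
 then obtain y where y: "y \<in> K" "v (y - 1) < \<epsilon>" "\<And>u. u \<in> V ==> u y < \<epsilon>" by blast
 have yM: "y \<in> M" using y K_le by blast
 have wsy: "w (s y) < \<epsilon>" if "s \<in> G" for s using y(3)[of "\<lambda>x\<in>K. w (s x)"] that y(1) by (simp add: V_def)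
 define R where "R = gpoly y - monom 1 g"
 have R_rat: "coeff R i \<in> \<rat>" for i
  using gpoly_over[OF yM] unfolding R_def poly_over_def by simp
 have "coeff_norm w g R \<le> (\<Prod>s\<in>G. 1 + w (s y)) - 1"
  unfolding R_def gpoly_def g_def by (rule w.coeff_norm_prod(3)[OF finite_G G_maps[OF _ yM]])
 also have "(\<Prod>s\<in>G. 1 + w (s y)) \<le> (\<Prod>s\<in>G. 1 + \<epsilon>)"
  using wsy w.v_nonneg[OF G_maps[OF _ yM]] by (intro prod_mono) (auto intro: less_imp_le add_nonneg_nonneg)
 also have "(\<Prod>s\<in>G. 1 + \<epsilon>) - 1 < (1/3) ^ g" using \<epsilon>(1) by (simp add: g_def)
 finally have small: "coeff_norm w g R < (1/3) ^ g" by simp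
 have same: "v (coeff R i) = w (coeff R i)" for i
 proof -
  obtain r where "coeff R i = of_rat r" using R_rat[of i] by (auto elim: Rats_cases)
  thus ?thesis using places_overD(2)[OF v K.csubfield_axioms] places_overD(2)[OF w csubfield_axioms] by simp
 qed
 have RK: "coeff R i \<in> K" for i using R_rat K.Rats_subset by blast
 have degR: "degree R \<le> g" unfolding R_def g_def
  by (intro degree_diff_le) (simp_all add: gpoly_monic degree_monom_le)
 have vy: "1/2 \<le> v y" "v y \<le> 3/2"
 proof -
  have "v y \<le> v (y - 1) + 1" using v.v_add[of "y - 1" 1] y(1) K.diff_in[of y 1] by simp
  thus "v y \<le> 3/2" using y(2) \<epsilon> by simp
  have "1 \<le> v (y - 1) + v y" using v.v_diff[of "y" "y - 1"] y(1) K.diff_in[of y 1] by simp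
  thus "1/2 \<le> v y" using y(2) \<epsilon> by simp
 qed
 have "y ^ g = - poly R y" using gpoly_root[OF yM] by (simp add: R_def poly_monom)
 hence "v (y ^ g) = v (- poly R y)" by (rule arg_cong)
 hence "v y ^ g = v (poly R y)"
  using v.v_power[OF y(1), of g] v.v_minus[OF K.poly_in[of R y]] RK y(1) by (simp add: poly_over_def)
 also have "poly R y = (\<Sum>i\<le>g. coeff R i * y ^ i)"
 proof -
  have "poly R y = (\<Sum>i\<le>degree R. coeff R i * y ^ i)" by (rule poly_altdef)
  also have "... = (\<Sum>i\<le>g. coeff R i * y ^ i)"
   by (rule sum.mono_neutral_left) (use degR in \<open>auto simp: coeff_eq_0\<close>)
  finally show ?thesis .
 qed
 also have "v (\<Sum>i\<le>g. coeff R i * y ^ i) \<le> (\<Sum>i\<le>g. v (coeff R i * y ^ i))"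
  by (rule v.v_sum) (intro K.mult_in K.power_in RK y(1))
 also have "... \<le> (\<Sum>i\<le>g. w (coeff R i) * (3/2) ^ g)"
 proof (rule sum_mono)
  fix i assume i: "i \<in> {..g}"
  have "v y ^ i \<le> (3/2) ^ i" using vy by (intro power_mono) auto
  also have "... \<le> (3/2) ^ g" using i by (intro power_increasing) auto
  finally have "v y ^ i \<le> (3/2) ^ g" .
  thus "v (coeff R i * y ^ i) \<le> w (coeff R i) * (3/2) ^ g"
   using v.v_nonneg[OF RK] by (simp add: v.v_mult v.v_power RK y(1) K.power_in same[symmetric] mult_left_mono)
 qed
 also have "... = coeff_norm w g R * (3/2) ^ g" by (simp add: coeff_norm_def sum_distrib_right)
 also have "... < (1/3) ^ g * (3/2) ^ g" using small by (intro mult_strict_right_mono) auto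
 also have "... = (1/2) ^ g" by (simp flip: power_mult_distrib)
 finally have "v y ^ g < (1/2) ^ g" .
 moreover have "(1/2) ^ g \<le> v y ^ g" using vy by (intro power_mono) auto
 ultimately show False by simp
qed

lemma finite_places_over: assumes p: "p \<in> place_ids" shows "finite (places_over K p)"
proof -
 obtain w where w: "w \<in> places_over M p" using place_over_exists[OF p] by blast
 have "places_over K p \<subseteq> (\<lambda>s. \<lambda>x\<in>K. w (s x)) ` G" using places_over_transitive[OF p w] by blast
 thus ?thesis by (rule finite_subset) (simp add: finite_G)
qed

end

section \<open>Local degrees\<close>

lemma (in ring) dimension_eqI:
 assumes sf: "subfield F R" and us: "set us \<subseteq> carrier R"
  and spn: "\<And>y. y \<in> V \<longleftrightarrow> (\<exists>ks. set ks \<subseteq> F \<and> length ks = length us \<and> y = combine ks us)"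
  and ind: "\<And>ks. set ks \<subseteq> F ==> length ks = length us ==> combine ks us = \<zero> ==> set ks \<subseteq> {\<zero>}"
 shows "(dim over F) V = length us"
proof -
 note F = subringE[OF subfieldE(1)[OF sf]]
 have "independent F us"
 proof (rule trivial_combine_imp_independent[OF sf us])
  fix ks assume ks: "set ks \<subseteq> F" "combine ks us = \<zero>"
  show "set (take (length us) ks) \<subseteq> {\<zero>}"
  proof (cases "length us \<le> length ks")
   case True
   have "set (take (length us) ks) \<subseteq> F" using ks(1) set_take_subset by fast
   thus ?thesis using True ks(2) by (intro ind) (auto simp: combine_take)
  next
   case False
   have "set (ks @ replicate (length us - length ks) \<zero>) \<subseteq> {\<zero>}"
    using False ks F(2) by (intro ind) (auto simp: combine_append_replicate[OF us])
   thus ?thesis using False by simp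
  qed
 qed
 moreover have "Span F us = V"
  using Span_mem_iff_length_version[OF sf us] spn by blast
 ultimately have "dimension (length us) F V" by (rule dimensionI[OF sf])
 thus ?thesis by (rule dimI[OF sf])
qed

context absval
begin

definition cauchy :: "(nat => complex) => bool" where
 "cauchy s \<longleftrightarrow> range s \<subseteq> K \<and> (\<forall>e>0. \<exists>M. \<forall>m\<ge>M. \<forall>n\<ge>M. v (s m - s n) < e)"

definition null :: "(nat => complex) => bool" where
 "null s \<longleftrightarrow> range s \<subseteq> K \<and> (\<lambda>n. v (s n)) \<longlonglongrightarrow> 0"

abbreviation CS where "CS \<equiv> cauchy_ring K v"

lemma CS_simps [simp]:
 "carrier CS = {s. cauchy s}" "one CS = (\<lambda>n. 1)" "ring.zero CS = (\<lambda>n. 0)"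
 "monoid.mult CS s t = (\<lambda>n. s n * t n)" "ring.add CS s t = (\<lambda>n. s n + t n)"
 by (simp_all add: cauchy_ring_def cauchy_def)

lemma cauchy_in: "cauchy s ==> s n \<in> K" by (auto simp: cauchy_def)
lemma null_in: "null s ==> s n \<in> K" by (auto simp: null_def)

lemma cauchy_const: "c \<in> K ==> cauchy (\<lambda>n. c)" by (auto simp: cauchy_def)

lemma cauchy_add: assumes "cauchy s" "cauchy t" shows "cauchy (\<lambda>n. s n + t n)"
 unfolding cauchy_def
proof (intro conjI allI impI)
 show "range (\<lambda>n. s n + t n) \<subseteq> K" using assms cauchy_in add_in by auto
 fix e :: real assume "e > 0"
 hence "e / 2 > 0" by simp
 then obtain A B where A: "\<And>m n. m \<ge> A ==> n \<ge> A ==> v (s m - s n) < e / 2"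
  and B: "\<And>m n. m \<ge> B ==> n \<ge> B ==> v (t m - t n) < e / 2" using assms unfolding cauchy_def by meson
 have "v (s m + t m - (s n + t n)) < e" if mn: "m \<ge> max A B" "n \<ge> max A B" for m n
 proof -
  have "v ((s m - s n) + (t m - t n)) \<le> v (s m - s n) + v (t m - t n)"
   by (intro v_add diff_in cauchy_in assms)
  moreover have "s m + t m - (s n + t n) = (s m - s n) + (t m - t n)" by simp
  ultimately show ?thesis using A[of m n] B[of m n] mn by (simp only:) linarith
 qed
 thus "\<exists>M. \<forall>m\<ge>M. \<forall>n\<ge>M. v (s m + t m - (s n + t n)) < e" by blast
qed

lemma cauchy_bounded: assumes "cauchy s" shows "\<exists>B>0. \<forall>n. v (s n) \<le> B"
proof -
 have "(1::real) > 0" by simp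
 then obtain A where A: "\<And>m n. m \<ge> A ==> n \<ge> A ==> v (s m - s n) < 1" using assms unfolding cauchy_def by meson
 define B where "B = 1 + v (s A) + (\<Sum>i<A. v (s i))"
 have nn: "0 \<le> v (s i)" for i by (intro v_nonneg cauchy_in assms)
 have "v (s n) \<le> B" for n
 proof (cases "n < A")
  case True
  hence "v (s n) \<le> (\<Sum>i<A. v (s i))" by (intro member_le_sum) (auto simp: nn)
  thus ?thesis unfolding B_def using nn[of A] by linarith
 next
  case False
  have "v (s n) - v (s A) \<le> v (s n - s A)" by (intro v_diff_ge cauchy_in assms)
  moreover have "v (s n - s A) < 1" using False A by simp
  moreover have "0 \<le> (\<Sum>i<A. v (s i))" by (intro sum_nonneg nn)
  ultimately show ?thesis unfolding B_def by linarith
 qed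
 moreover have "B > 0" unfolding B_def using nn by (intro add_pos_nonneg sum_nonneg) (auto intro: add_pos_nonneg)
 ultimately show ?thesis by blast
qed

lemma cauchy_mult: assumes s: "cauchy s" and t: "cauchy t" shows "cauchy (\<lambda>n. s n * t n)"
 unfolding cauchy_def
proof (intro conjI allI impI)
 show "range (\<lambda>n. s n * t n) \<subseteq> K" using assms cauchy_in mult_in by auto
 obtain B1 where B1: "B1 > 0" "\<And>n. v (s n) \<le> B1" using cauchy_bounded[OF s] by blast
 obtain B2 where B2: "B2 > 0" "\<And>n. v (t n) \<le> B2" using cauchy_bounded[OF t] by blast
 fix e :: real assume e: "e > 0"
 have "e / (2 * B2) > 0" "e / (2 * B1) > 0" using e B1 B2 by simp_all
 then obtain A B where A: "\<And>m n. m \<ge> A ==> n \<ge> A ==> v (s m - s n) < e / (2 * B2)"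
  and B: "\<And>m n. m \<ge> B ==> n \<ge> B ==> v (t m - t n) < e / (2 * B1)" using assms unfolding cauchy_def by meson
 have "v (s m * t m - s n * t n) < e" if mn: "m \<ge> max A B" "n \<ge> max A B" for m n
 proof -
  note c = cauchy_in[OF s] cauchy_in[OF t]
  have "v ((s m - s n) * t m + s n * (t m - t n)) \<le> v ((s m - s n) * t m) + v (s n * (t m - t n))"
   by (intro v_add mult_in diff_in c)
  also have "... = v (s m - s n) * v (t m) + v (s n) * v (t m - t n)"
   by (simp add: v_mult diff_in c)
  also have "... \<le> v (s m - s n) * B2 + B1 * v (t m - t n)"
   using B1 B2 by (intro add_mono mult_left_mono mult_right_mono v_nonneg diff_in c)
  also have "... < e / (2 * B2) * B2 + B1 * (e / (2 * B1))"
   using A[of m n] B[of m n] mn B1(1) B2(1) by (intro add_strict_mono mult_strict_left_mono mult_strict_right_mono) auto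
  also have "... = e" using B1(1) B2(1) by simp
  finally show ?thesis by (simp add: algebra_simps)
 qed
 thus "\<exists>M. \<forall>m\<ge>M. \<forall>n\<ge>M. v (s m * t m - s n * t n) < e" by blast
qed

lemma cauchy_minus: assumes "cauchy s" shows "cauchy (\<lambda>n. - s n)"
proof -
 have "cauchy (\<lambda>n. - 1 * s n)" by (intro cauchy_mult cauchy_const minus_in one_in assms)
 thus ?thesis by simp
qed

lemma cring_CS: "cring CS"
proof (rule cringI)
 show "abelian_group CS"
 proof (rule abelian_groupI)
  fix s assume s: "s \<in> carrier CS"
  show "\<exists>t\<in>carrier CS. t \<oplus>\<^bsub>CS\<^esub> s = \<zero>\<^bsub>CS\<^esub>"
   using cauchy_minus[of s] s by (intro bexI[of _ "\<lambda>n. - s n"]) auto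
 qed (auto simp: cauchy_add cauchy_const fun_eq_iff add_ac)
 show "Group.comm_monoid CS"
  by (rule comm_monoidI) (auto simp: cauchy_mult cauchy_const fun_eq_iff mult_ac)
qed (auto simp: fun_eq_iff algebra_simps)

lemma null_add: assumes "null s" "null t" shows "null (\<lambda>n. s n + t n)"
 unfolding null_def
proof (intro conjI)
 show "range (\<lambda>n. s n + t n) \<subseteq> K" using assms null_in add_in by auto
 show "(\<lambda>n. v (s n + t n)) \<longlonglongrightarrow> 0"
 proof (rule tendsto_sandwich[of "\<lambda>_. 0" _ _ "\<lambda>n. v (s n) + v (t n)"])
  have "(\<lambda>n. v (s n) + v (t n)) \<longlonglongrightarrow> 0 + 0" using assms unfolding null_def by (intro tendsto_add) auto
  thus "(\<lambda>n. v (s n) + v (t n)) \<longlonglongrightarrow> 0" by simp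
  show "\<forall>\<^sub>F n in sequentially. 0 \<le> v (s n + t n)" by (intro always_eventually allI v_nonneg add_in null_in assms)
  show "\<forall>\<^sub>F n in sequentially. v (s n + t n) \<le> v (s n) + v (t n)" by (intro always_eventually allI v_add null_in assms)
 qed simp
qed

lemma null_cauchy: assumes "null s" shows "cauchy s"
 unfolding cauchy_def
proof (intro conjI allI impI)
 show "range s \<subseteq> K" using assms by (simp add: null_def)
 fix e :: real assume "e > 0"
 hence "\<forall>\<^sub>F n in sequentially. v (s n) < e / 2" using assms unfolding null_def by (intro order_tendstoD(2)[of _ 0]) auto
 then obtain A where A: "\<And>n. n \<ge> A ==> v (s n) < e / 2" unfolding eventually_sequentially by blast
 have "v (s m - s n) < e" if "m \<ge> A" "n \<ge> A" for m n
  using v_diff[OF null_in[OF assms] null_in[OF assms], of m n] A[OF that(1)] A[OF that(2)] by linarith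
 thus "\<exists>M. \<forall>m\<ge>M. \<forall>n\<ge>M. v (s m - s n) < e" by blast
qed

lemma null_mult: assumes s: "null s" and t: "cauchy t" shows "null (\<lambda>n. t n * s n)"
 unfolding null_def
proof (intro conjI)
 obtain B where B: "B > 0" "\<And>n. v (t n) \<le> B" using cauchy_bounded[OF t] by blast
 show "range (\<lambda>n. t n * s n) \<subseteq> K" using null_in[OF s] cauchy_in[OF t] mult_in by auto
 show "(\<lambda>n. v (t n * s n)) \<longlonglongrightarrow> 0"
 proof (rule tendsto_sandwich[of "\<lambda>_. 0" _ _ "\<lambda>n. B * v (s n)"])
  show "(\<lambda>n. B * v (s n)) \<longlonglongrightarrow> 0" using s unfolding null_def by (intro tendsto_mult_right_zero) auto
  show "\<forall>\<^sub>F n in sequentially. 0 \<le> v (t n * s n)" by (intro always_eventually allI v_nonneg mult_in cauchy_in[OF t] null_in[OF s])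
  show "\<forall>\<^sub>F n in sequentially. v (t n * s n) \<le> B * v (s n)"
  proof (intro always_eventually allI)
   fix n
   have "v (t n) * v (s n) \<le> B * v (s n)" by (intro mult_right_mono B v_nonneg null_in[OF s])
   thus "v (t n * s n) \<le> B * v (s n)" by (simp add: v_mult cauchy_in[OF t] null_in[OF s])
  qed
 qed simp
qed

lemma null_sequences_eq: "null_sequences K v = {s. null s}"
 unfolding null_sequences_def using null_cauchy by (auto simp: null_def cauchy_def)

lemma ideal_null: "ideal (null_sequences K v) CS"
proof -
 interpret CS: cring CS by (rule cring_CS)
 have inv: "inv\<^bsub>add_monoid CS\<^esub> s = (\<lambda>n. - s n)" if "null s" for s
 proof -
  have "\<ominus>\<^bsub>CS\<^esub> s = (\<lambda>n. - s n)"
   by (rule CS.minus_equality) (use null_cauchy[OF that] cauchy_minus in \<open>auto simp: fun_eq_iff\<close>)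
  thus ?thesis by (simp add: a_inv_def)
 qed
 have nneg: "null (\<lambda>n. - s n)" if "null s" for s
 proof -
  have "null (\<lambda>n. - 1 * s n)" by (intro null_mult cauchy_const minus_in one_in that)
  thus ?thesis by simp
 qed
 show ?thesis unfolding null_sequences_eq
 proof (rule idealI)
  show "ring CS" by (rule CS.ring_axioms)
  show "subgroup {s. null s} (add_monoid CS)"
  proof (rule group.subgroupI[OF CS.a_group])
   show "{s. null s} \<subseteq> carrier (add_monoid CS)" using null_cauchy by auto
   have "null (\<lambda>n. 0)" by (auto simp: null_def)
   thus "{s. null s} \<noteq> {}" by blast
   fix a assume a: "a \<in> {s. null s}"
   show "inv\<^bsub>add_monoid CS\<^esub> a \<in> {s. null s}" using inv[of a] nneg[of a] a by (simp only: mem_Collect_eq)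
   fix b assume b: "b \<in> {s. null s}"
   show "a \<otimes>\<^bsub>add_monoid CS\<^esub> b \<in> {s. null s}" using null_add[of a b] a b by simp
  qed
  show "x \<otimes>\<^bsub>CS\<^esub> a \<in> {s. null s}" "a \<otimes>\<^bsub>CS\<^esub> x \<in> {s. null s}" if "a \<in> {s. null s}" "x \<in> carrier CS" for a x
   using null_mult[of a x] that by (auto simp: mult.commute)
 qed
qed

definition cls :: "(nat => complex) => (nat => complex) set" where
 "cls s = null_sequences K v +>\<^bsub>CS\<^esub> s"

abbreviation CK where "CK \<equiv> completion_ring K v"

lemma ring_hom_cls: "ring_hom_ring CS CK cls"
 unfolding completion_ring_def cls_def[abs_def] using ideal.rcos_ring_hom_ring[OF ideal_null] by simp

lemma cring_CK: "cring CK"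
 unfolding completion_ring_def by (rule ideal.quotient_is_cring[OF ideal_null cring_CS])

lemma carrier_CK: "carrier CK = cls ` {s. cauchy s}"
 unfolding completion_ring_def FactRing_def A_RCOSETS_def' cls_def by auto

lemma cls_zero_iff: assumes "cauchy s" shows "cls s = \<zero>\<^bsub>CK\<^esub> \<longleftrightarrow> null s"
proof -
 interpret I: ideal "null_sequences K v" CS by (rule ideal_null)
 have z: "\<zero>\<^bsub>CK\<^esub> = null_sequences K v" by (simp add: completion_ring_def FactRing_def)
 show ?thesis
 proof
  assume "cls s = \<zero>\<^bsub>CK\<^esub>"
  hence "null_sequences K v +>\<^bsub>CS\<^esub> s = null_sequences K v" by (simp add: cls_def z)
  moreover have "s \<in> null_sequences K v +>\<^bsub>CS\<^esub> s" using assms by (intro I.a_rcos_self) simp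
  ultimately show "null s" by (simp add: null_sequences_eq)
 next
  assume "null s"
  hence "s \<in> null_sequences K v" by (simp add: null_sequences_eq)
  hence "null_sequences K v +>\<^bsub>CS\<^esub> s = null_sequences K v" by (rule I.a_rcos_const)
  thus "cls s = \<zero>\<^bsub>CK\<^esub>" by (simp add: cls_def z)
 qed
qed

lemma cls_hom:
 assumes "cauchy s" "cauchy t"
 shows "cls s \<oplus>\<^bsub>CK\<^esub> cls t = cls (\<lambda>n. s n + t n)" "cls s \<otimes>\<^bsub>CK\<^esub> cls t = cls (\<lambda>n. s n * t n)"
  "\<one>\<^bsub>CK\<^esub> = cls (\<lambda>n. 1)" "\<zero>\<^bsub>CK\<^esub> = cls (\<lambda>n. 0)"
proof -
 interpret h: ring_hom_ring CS CK cls by (rule ring_hom_cls)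
 show "cls s \<oplus>\<^bsub>CK\<^esub> cls t = cls (\<lambda>n. s n + t n)" using h.hom_add[of s t] assms by simp
 show "cls s \<otimes>\<^bsub>CK\<^esub> cls t = cls (\<lambda>n. s n * t n)" using h.hom_mult[of s t] assms by simp
 show "\<one>\<^bsub>CK\<^esub> = cls (\<lambda>n. 1)" using h.hom_one by simp
 show "\<zero>\<^bsub>CK\<^esub> = cls (\<lambda>n. 0)" using h.hom_zero by simp
qed

lemma cls_eqI: assumes "cauchy s" "cauchy t" "null (\<lambda>n. s n - t n)" shows "cls s = cls t"
proof -
 interpret CK: cring CK by (rule cring_CK)
 have c: "cauchy (\<lambda>n. s n - t n)" by (rule null_cauchy[OF assms(3)])
 have "cls s = cls (\<lambda>n. (s n - t n) + t n)" by simp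
 also have "... = cls (\<lambda>n. s n - t n) \<oplus>\<^bsub>CK\<^esub> cls t" by (rule cls_hom(1)[OF c assms(2), symmetric])
 also have "cls (\<lambda>n. s n - t n) = \<zero>\<^bsub>CK\<^esub>" using cls_zero_iff[OF c] assms(3) by simp
 also have "\<zero>\<^bsub>CK\<^esub> \<oplus>\<^bsub>CK\<^esub> cls t = cls t" using assms(2) by (intro CK.l_zero) (auto simp: carrier_CK)
 finally show ?thesis .
qed

lemma rat_completion_eq: "rat_completion K v = cls ` {s. cauchy s \<and> range s \<subseteq> \<rat>}"
 unfolding rat_completion_def cls_def by auto

text \<open>A Cauchy sequence that is not null stays away from 0 eventually. Finitely many terms may
  still vanish, and there the product with the inverse is 0 instead of 1, so the inverse is one only
  modulo null sequences.\<close>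

lemma cauchy_inverse:
 assumes s: "cauchy s" and nn: "\<not> null s"
 shows "cauchy (\<lambda>n. inverse (s n))" "null (\<lambda>n. s n * inverse (s n) - 1)"
proof -
 note c = cauchy_in[OF s]
 have "\<not> (\<lambda>n. v (s n)) \<longlonglongrightarrow> 0" using nn s by (auto simp: null_def cauchy_def)
 then obtain d where d: "d > 0" "\<And>N. \<exists>n\<ge>N. \<not> v (s n) < d"
  unfolding LIMSEQ_iff using v_nonneg[OF c] by (auto simp: not_less)
 have "d / 2 > 0" using d by simp
 then obtain A where A: "\<And>m n. m \<ge> A ==> n \<ge> A ==> v (s m - s n) < d / 2" using s unfolding cauchy_def by meson
 obtain N where N: "N \<ge> A" "d \<le> v (s N)" using d(2)[of A] by (auto simp: not_less)
 have low: "d / 2 \<le> v (s n)" if "n \<ge> A" for n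
  using A[of N n] N that v_diff_ge[OF c c, of N n] by linarith
 show "cauchy (\<lambda>n. inverse (s n))" unfolding cauchy_def
 proof (intro conjI allI impI)
  show "range (\<lambda>n. inverse (s n)) \<subseteq> K" using c inverse_in by auto
  fix e :: real assume "e > 0"
  hence "e * (d / 2)\<^sup>2 > 0" using d by simp
  then obtain B where B: "\<And>m n. m \<ge> B ==> n \<ge> B ==> v (s m - s n) < e * (d / 2)\<^sup>2" using s unfolding cauchy_def by meson
  have "v (inverse (s m) - inverse (s n)) < e" if mn: "m \<ge> max A B" "n \<ge> max A B" for m n
  proof -
   have lo: "d / 2 \<le> v (s m)" "d / 2 \<le> v (s n)" using low mn by auto
   hence nz: "s m \<noteq> 0" "s n \<noteq> 0" using d by auto
   have "inverse (s m) - inverse (s n) = (s n - s m) / (s m * s n)" using nz by (simp add: field_simps)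
   hence "v (inverse (s m) - inverse (s n)) = v (s n - s m) / (v (s m) * v (s n))"
    by (simp add: v_divide v_mult diff_in mult_in c)
   also have "... \<le> v (s n - s m) / (d / 2)\<^sup>2"
    using lo d(1) v_nonneg[OF diff_in[OF c c]] unfolding power2_eq_square
    by (intro divide_left_mono mult_mono mult_pos_pos) auto
   also have "... < e" using B[of n m] mn d(1) by (simp add: field_simps)
   finally show ?thesis .
  qed
  thus "\<exists>M. \<forall>m\<ge>M. \<forall>n\<ge>M. v (inverse (s m) - inverse (s n)) < e" by blast
 qed
 have "\<forall>\<^sub>F n in sequentially. v (s n * inverse (s n) - 1) = 0"
  using eventually_ge_at_top[of A]
 proof eventually_elim
  case (elim n)
  hence "s n \<noteq> 0" using low[of n] d(1) by auto
  thus ?case by simp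
 qed
 hence "(\<lambda>n. v (s n * inverse (s n) - 1)) \<longlonglongrightarrow> 0" by (rule tendsto_eventually)
 thus "null (\<lambda>n. s n * inverse (s n) - 1)" using c by (auto simp: null_def intro!: diff_in mult_in inverse_in)
qed

lemma subfield_rat_completion: "subfield (rat_completion K v) CK"
proof -
 interpret CK: cring CK by (rule cring_CK)
 define Q where "Q = {s. cauchy s \<and> range s \<subseteq> \<rat>}"
 have QC: "s \<in> Q ==> cauchy s" for s by (simp add: Q_def)
 have rc: "rat_completion K v = cls ` Q" by (simp add: rat_completion_eq Q_def)
 have sub: "cls ` Q \<subseteq> carrier CK" by (auto simp: carrier_CK Q_def)
 have m1: "- 1 \<in> K" using minus_in[of 1] by simp
 have Qc: "(\<lambda>n. c) \<in> Q" if "c \<in> \<rat>" for c using that Rats_subset by (auto simp: Q_def intro!: cauchy_const)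
 have Qadd: "(\<lambda>n. s n + t n) \<in> Q" and Qmult: "(\<lambda>n. s n * t n) \<in> Q" if "s \<in> Q" "t \<in> Q" for s t
  using that by (auto simp: Q_def cauchy_add cauchy_mult image_subset_iff)
 have Qminus: "(\<lambda>n. - s n) \<in> Q" if "s \<in> Q" for s
  using that by (auto simp: Q_def cauchy_minus image_subset_iff)
 have one_ne: "\<one>\<^bsub>CK\<^esub> \<noteq> \<zero>\<^bsub>CK\<^esub>"
 proof
  assume "\<one>\<^bsub>CK\<^esub> = \<zero>\<^bsub>CK\<^esub>"
  hence "null (\<lambda>n. 1)" using cls_zero_iff[OF cauchy_const[of 1]] cls_hom(3)[OF cauchy_const[of 1] cauchy_const[of 1]] by simp
  thus False unfolding null_def by (simp add: LIMSEQ_const_iff)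
 qed
 have "subring (cls ` Q) CK"
 proof (rule CK.subringI[OF sub])
  show "\<one>\<^bsub>CK\<^esub> \<in> cls ` Q" using cls_hom(3)[OF cauchy_const[of 1] cauchy_const[of 1]] Qc[of 1] by auto
  fix h assume "h \<in> cls ` Q"
  then obtain s where s: "s \<in> Q" "h = cls s" by blast
  have "\<ominus>\<^bsub>CK\<^esub> h = cls (\<lambda>n. - s n)"
  proof (rule CK.minus_equality)
   have "cls (\<lambda>n. - s n) \<oplus>\<^bsub>CK\<^esub> cls s = cls (\<lambda>n. - s n + s n)" by (intro cls_hom(1) cauchy_minus QC s)
   also have "... = \<zero>\<^bsub>CK\<^esub>" using cls_hom(4)[OF QC QC] s by simp
   finally show "cls (\<lambda>n. - s n) \<oplus>\<^bsub>CK\<^esub> h = \<zero>\<^bsub>CK\<^esub>" by (simp add: s(2))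
  qed (use s Qminus sub in auto)
  thus "\<ominus>\<^bsub>CK\<^esub> h \<in> cls ` Q" using Qminus[OF s(1)] by simp
  fix h' assume "h' \<in> cls ` Q"
  then obtain t where t: "t \<in> Q" "h' = cls t" by blast
  show "h \<otimes>\<^bsub>CK\<^esub> h' \<in> cls ` Q" using cls_hom(2)[OF QC QC, OF s(1) t(1)] Qmult[OF s(1) t(1)] s t by auto
  show "h \<oplus>\<^bsub>CK\<^esub> h' \<in> cls ` Q" using cls_hom(1)[OF QC QC, OF s(1) t(1)] Qadd[OF s(1) t(1)] s t by auto
 qed
 hence sc: "subcring (cls ` Q) CK" by (rule CK.subcringI') 
 have "Units (CK\<lparr>carrier := cls ` Q\<rparr>) = cls ` Q - {\<zero>\<^bsub>CK\<^esub>}"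
 proof (intro equalityI subsetI)
  fix h assume h: "h \<in> Units (CK\<lparr>carrier := cls ` Q\<rparr>)"
  then obtain g where g: "h \<in> cls ` Q" "g \<in> cls ` Q" "g \<otimes>\<^bsub>CK\<^esub> h = \<one>\<^bsub>CK\<^esub>" by (auto simp: Units_def)
  have "h \<noteq> \<zero>\<^bsub>CK\<^esub>"
  proof
   assume "h = \<zero>\<^bsub>CK\<^esub>"
   hence "g \<otimes>\<^bsub>CK\<^esub> h = \<zero>\<^bsub>CK\<^esub>" using g(2) sub by auto
   thus False using g(3) one_ne by simp
  qed
  thus "h \<in> cls ` Q - {\<zero>\<^bsub>CK\<^esub>}" using g(1) by simp
 next
  fix h assume h: "h \<in> cls ` Q - {\<zero>\<^bsub>CK\<^esub>}"
  then obtain s where s: "s \<in> Q" "h = cls s" by blast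
  have nn: "\<not> null s" using h s cls_zero_iff[OF QC[OF s(1)]] by simp
  note ci = cauchy_inverse[OF QC[OF s(1)] nn]
  have iQ: "(\<lambda>n. inverse (s n)) \<in> Q" using ci(1) s(1) by (auto simp: Q_def image_subset_iff)
  have "cls s \<otimes>\<^bsub>CK\<^esub> cls (\<lambda>n. inverse (s n)) = cls (\<lambda>n. s n * inverse (s n))" by (rule cls_hom(2)[OF QC[OF s(1)] ci(1)])
  also have "... = cls (\<lambda>n. 1)" by (intro cls_eqI cauchy_mult QC s ci cauchy_const one_in)
  also have "... = \<one>\<^bsub>CK\<^esub>" using cls_hom(3)[OF ci(1) ci(1)] by simp
  finally have 1: "h \<otimes>\<^bsub>CK\<^esub> cls (\<lambda>n. inverse (s n)) = \<one>\<^bsub>CK\<^esub>" by (simp add: s(2))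
  hence "cls (\<lambda>n. inverse (s n)) \<otimes>\<^bsub>CK\<^esub> h = \<one>\<^bsub>CK\<^esub>" using CK.m_comm[of h] sub iQ h by auto
  thus "h \<in> Units (CK\<lparr>carrier := cls ` Q\<rparr>)" using 1 iQ h unfolding Units_def by auto
 qed
 thus ?thesis unfolding rc using CK.subfieldI[OF sc] by simp
qed

lemma combine_cls:
 assumes "length qs = length us" "\<And>q. q \<in> set qs ==> cauchy q" "\<And>u. u \<in> set us ==> u \<in> K"
 shows "ring.combine CK (map cls qs) (map (\<lambda>u. cls (\<lambda>n. u)) us) = cls (\<lambda>n. \<Sum>i<length us. (qs ! i) n * us ! i)
  \<and> cauchy (\<lambda>n. \<Sum>i<length us. (qs ! i) n * us ! i)"
 using assms
proof (induction qs us rule: list_induct2)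
 case Nil
 interpret CK: cring CK by (rule cring_CK)
 show ?case using cls_hom(4)[OF cauchy_const[of 0] cauchy_const[of 0]] by (simp add: cauchy_const)
next
 case (Cons q qs u us)
 interpret CK: cring CK by (rule cring_CK)
 have q: "cauchy q" and u: "cauchy (\<lambda>n. u)" using Cons.prems by (auto intro: cauchy_const)
 define S where "S = (\<lambda>n. \<Sum>i<length us. (qs ! i) n * us ! i)"
 have IH: "CK.combine (map cls qs) (map (\<lambda>u. cls (\<lambda>n. u)) us) = cls S" "cauchy S"
  using Cons unfolding S_def by auto
 have qu: "cauchy (\<lambda>n. q n * u)" by (rule cauchy_mult[OF q u])
 have "CK.combine (map cls (q # qs)) (map (\<lambda>u. cls (\<lambda>n. u)) (u # us)) = cls (\<lambda>n. q n * u + S n)"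
  using cls_hom(2)[OF q u] cls_hom(1)[OF qu IH(2)] IH(1) by simp
 moreover have "(\<lambda>n. \<Sum>i<length (u # us). ((q # qs) ! i) n * (u # us) ! i) = (\<lambda>n. q n * u + S n)"
  unfolding S_def by (simp add: sum.lessThan_Suc_shift del: sum.lessThan_Suc)
 ultimately show ?case using cauchy_add[OF qu IH(2)] by simp
qed

text \<open>Dimension over the completed rationals in terms of sequences: the constants
  \<open>us\<close> must span and be independent with rational Cauchy sequences as coefficients,
  both modulo null sequences.\<close>

lemma local_degreeI:
 assumes us: "set us \<subseteq> K"
  and spn: "\<And>s. cauchy s ==> \<exists>q. (\<forall>i<length us. cauchy (q i) \<and> range (q i) \<subseteq> \<rat>) \<and>
   null (\<lambda>n. s n - (\<Sum>i<length us. q i n * us ! i))"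
  and ind: "\<And>q. (\<forall>i<length us. cauchy (q i) \<and> range (q i) \<subseteq> \<rat>) ==>
   null (\<lambda>n. \<Sum>i<length us. q i n * us ! i) ==> \<forall>i<length us. null (q i)"
 shows "local_degree K v = length us"
proof -
 interpret CK: cring CK by (rule cring_CK)
 define us' where "us' = map (\<lambda>u. cls (\<lambda>n. u)) us"
 have us'c: "set us' \<subseteq> carrier CK" using us by (auto simp: us'_def carrier_CK intro!: cauchy_const)
 have uK: "u \<in> K" if "u \<in> set us" for u using that us by blast
 have lift: "\<exists>qs. ks = map cls qs \<and> (\<forall>q\<in>set qs. cauchy q \<and> range q \<subseteq> \<rat>)"
  if "set ks \<subseteq> rat_completion K v" for ks
 proof (intro exI conjI)
  define g where "g = (\<lambda>k. SOME s. cauchy s \<and> range s \<subseteq> \<rat> \<and> cls s = k)"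
  have g: "cauchy (g k) \<and> range (g k) \<subseteq> \<rat> \<and> cls (g k) = k" if k: "k \<in> rat_completion K v" for k
  proof -
   have "\<exists>s. cauchy s \<and> range s \<subseteq> \<rat> \<and> cls s = k" using k unfolding rat_completion_eq by blast
   thus ?thesis unfolding g_def by (rule someI_ex)
  qed
  show "ks = map cls (map g ks)" using g \<open>set ks \<subseteq> _\<close> by (auto simp: map_idI subset_iff)
  show "\<forall>q\<in>set (map g ks). cauchy q \<and> range q \<subseteq> \<rat>" using g \<open>set ks \<subseteq> _\<close> by auto
 qed
 have "local_degree K v = length us'" unfolding local_degree_def
 proof (rule CK.dimension_eqI[OF subfield_rat_completion us'c])
  fix y
  show "y \<in> carrier CK \<longleftrightarrow> (\<exists>ks. set ks \<subseteq> rat_completion K v \<and> length ks = length us' \<and> y = CK.combine ks us')"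
  proof
   assume "y \<in> carrier CK"
   then obtain s where s: "cauchy s" "y = cls s" unfolding carrier_CK by blast
   from spn[OF s(1)] obtain q where q: "\<forall>i<length us. cauchy (q i) \<and> range (q i) \<subseteq> \<rat>"
    "null (\<lambda>n. s n - (\<Sum>i<length us. q i n * us ! i))" by (elim exE conjE)
   define qs where "qs = map q [0..<length us]"
   have cq: "cauchy a" if "a \<in> set qs" for a using that q(1) by (auto simp: qs_def)
   have cc: "CK.combine (map cls qs) us' = cls (\<lambda>n. \<Sum>i<length us. (qs ! i) n * us ! i)"
    "cauchy (\<lambda>n. \<Sum>i<length us. (qs ! i) n * us ! i)"
    unfolding us'_def using combine_cls[of qs us, OF _ cq uK] by (simp_all add: qs_def)
   have eq: "(\<lambda>n. \<Sum>i<length us. (qs ! i) n * us ! i) = (\<lambda>n. \<Sum>i<length us. q i n * us ! i)"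
    by (simp add: qs_def)
   have "y = CK.combine (map cls qs) us'" unfolding s(2) cc(1)
    by (rule cls_eqI[OF s(1) cc(2)]) (use q(2) in \<open>simp add: eq[unfolded fun_eq_iff]\<close>)
   moreover have "set (map cls qs) \<subseteq> rat_completion K v" using q(1) by (auto simp: qs_def rat_completion_eq)
   ultimately show "\<exists>ks. set ks \<subseteq> rat_completion K v \<and> length ks = length us' \<and> y = CK.combine ks us'"
    by (intro exI[of _ "map cls qs"]) (simp add: qs_def us'_def)
  next
   assume "\<exists>ks. set ks \<subseteq> rat_completion K v \<and> length ks = length us' \<and> y = CK.combine ks us'"
   then obtain ks where ks: "set ks \<subseteq> rat_completion K v" "y = CK.combine ks us'" by blast
   have "set ks \<subseteq> carrier CK" using ks(1) by (auto simp: rat_completion_eq carrier_CK)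
   thus "y \<in> carrier CK" unfolding ks(2) using us'c by (intro CK.combine_in_carrier)
  qed
 next
  fix ks assume ks: "set ks \<subseteq> rat_completion K v" "length ks = length us'" "CK.combine ks us' = \<zero>\<^bsub>CK\<^esub>"
  obtain qs where qs: "ks = map cls qs" "\<forall>q\<in>set qs. cauchy q \<and> range q \<subseteq> \<rat>" using lift[OF ks(1)] by blast
  have len: "length qs = length us" using ks(2) qs(1) by (simp add: us'_def)
  have cq: "cauchy a" if "a \<in> set qs" for a using that qs(2) by auto
  note cc = combine_cls[OF len cq uK]
  have "cls (\<lambda>n. \<Sum>i<length us. (qs ! i) n * us ! i) = \<zero>\<^bsub>CK\<^esub>" using cc ks(3) qs(1) by (simp add: us'_def)
  hence "null (\<lambda>n. \<Sum>i<length us. (qs ! i) n * us ! i)" using cls_zero_iff cc by blast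
  hence "\<forall>i<length us. null (qs ! i)" by (intro ind) (use qs(2) len in auto)
  hence "cls a = \<zero>\<^bsub>CK\<^esub>" if "a \<in> set qs" for a
   using that len cls_zero_iff[OF cq[OF that]] by (auto simp: in_set_conv_nth)
  thus "set ks \<subseteq> {\<zero>\<^bsub>CK\<^esub>}" using qs(1) by auto
 qed
 thus ?thesis by (simp add: us'_def)
qed

end

section \<open>Local degrees as numbers of embeddings\<close>

context galois_subfield
begin

definition local_embs :: "(complex => real) => (complex => real) => (complex => complex) set" where
 "local_embs w v = {e \<in> embs. \<forall>x\<in>K. w (e x) = v x}"

text \<open>The elements of \<open>M\<close> that are limits of rationals for \<open>w\<close>, so
  the intersection of \<open>M\<close> with the completed rationals. It replaces a field of scalars
  that does not lie in the complex numbers.\<close>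

definition rat_closure :: "(complex => real) => complex set" where
 "rat_closure w = {z \<in> M. \<forall>\<epsilon>>0. \<exists>q\<in>\<rat>. w (z - q) < \<epsilon>}"

lemma csubfield_rat_closure:
 assumes "absolute_value_on M w" shows "csubfield (rat_closure w)"
proof -
 interpret w: absval M w by (rule absvalI[OF csubfield_axioms assms])
 have QM: "q \<in> M" if "q \<in> \<rat>" for q using that Rats_subset by blast
 have rat: "q \<in> rat_closure w" if "q \<in> \<rat>" for q
  using that QM unfolding rat_closure_def by (auto intro!: bexI[of _ q])
 show ?thesis
 proof
  show "0 \<in> rat_closure w" "1 \<in> rat_closure w" by (simp_all add: rat)
  fix x assume x: "x \<in> rat_closure w"
  hence xM: "x \<in> M" by (simp add: rat_closure_def)
  have xq: "\<exists>q\<in>\<rat>. w (x - q) < \<epsilon>" if "\<epsilon> > 0" for \<epsilon> using x that by (simp add: rat_closure_def)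
  show "- x \<in> rat_closure w" unfolding rat_closure_def
  proof (intro CollectI conjI allI impI)
   show "- x \<in> M" by (intro minus_in xM)
   fix \<epsilon> :: real assume "\<epsilon> > 0"
   then obtain q where q: "q \<in> \<rat>" "w (x - q) < \<epsilon>" using xq by blast
   have "w (- x - (- q)) < \<epsilon>" using q w.v_minus[OF diff_in[OF xM QM[OF q(1)]]] by simp
   thus "\<exists>q\<in>\<rat>. w (- x - q) < \<epsilon>" using q(1) by (intro bexI[of _ "- q"]) auto
  qed
  show "inverse x \<in> rat_closure w"
  proof (cases "x = 0")
   case False
   have wx: "w x > 0" by (rule w.v_pos[OF xM False])
   show ?thesis unfolding rat_closure_def
   proof (intro CollectI conjI allI impI)
    show "inverse x \<in> M" by (intro inverse_in xM)
    fix \<epsilon> :: real assume \<epsilon>: "\<epsilon> > 0"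
    \<comment> \<open>The first bound keeps q at least half as large as x, the second then controls
      the difference of the inverses.\<close>
    define \<delta> where "\<delta> = min (w x / 2) (\<epsilon> * (w x * (w x / 2)))"
    have "\<delta> > 0" using wx \<epsilon> by (simp add: \<delta>_def)
    then obtain q where q: "q \<in> \<rat>" "w (x - q) < \<delta>" using xq by blast
    note qM = QM[OF q(1)]
    have wq: "w x / 2 \<le> w q" using w.v_diff_ge[OF xM qM] q(2) w.v_add[OF diff_in[OF xM qM] qM] by (simp add: \<delta>_def)
    have q0: "q \<noteq> 0" using wq wx by auto
    have "inverse x - inverse q = (q - x) / (x * q)" using False q0 by (simp add: field_simps)
    hence "w (inverse x - inverse q) = w (x - q) / (w x * w q)"
     by (simp add: w.v_divide w.v_mult w.v_diff_commute[OF xM qM] xM qM diff_in mult_in)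
    also have "... \<le> w (x - q) / (w x * (w x / 2))"
     using wx wq w.v_nonneg[OF diff_in[OF xM qM]] by (intro divide_left_mono mult_left_mono mult_pos_pos) auto
    also have "... < \<epsilon>" using q(2) wx by (simp add: \<delta>_def pos_divide_less_eq)
    finally show "\<exists>q\<in>\<rat>. w (inverse x - q) < \<epsilon>" using q(1) by (intro bexI[of _ "inverse q"]) auto
   qed
  qed (simp add: rat)
  fix y assume y: "y \<in> rat_closure w"
  hence yM: "y \<in> M" by (simp add: rat_closure_def)
  have yq: "\<exists>q\<in>\<rat>. w (y - q) < \<epsilon>" if "\<epsilon> > 0" for \<epsilon> using y that by (simp add: rat_closure_def)
  show "x + y \<in> rat_closure w" unfolding rat_closure_def
  proof (intro CollectI conjI allI impI)
   show "x + y \<in> M" by (intro add_in xM yM)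
   fix \<epsilon> :: real assume "\<epsilon> > 0"
   hence e2: "\<epsilon> / 2 > 0" by simp
   obtain q where q: "q \<in> \<rat>" "w (x - q) < \<epsilon> / 2" using xq[OF e2] by blast
   obtain r where r: "r \<in> \<rat>" "w (y - r) < \<epsilon> / 2" using yq[OF e2] by blast
   have "w ((x - q) + (y - r)) \<le> w (x - q) + w (y - r)" by (intro w.v_add diff_in xM yM QM q r)
   moreover have "x + y - (q + r) = (x - q) + (y - r)" by simp
   ultimately have "w (x + y - (q + r)) \<le> w (x - q) + w (y - r)" by (simp only:)
   hence "w (x + y - (q + r)) < \<epsilon>" using q(2) r(2) by linarith
   thus "\<exists>q\<in>\<rat>. w (x + y - q) < \<epsilon>" using q r by (intro bexI[of _ "q + r"]) auto
  qed
  show "x * y \<in> rat_closure w" unfolding rat_closure_def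
  proof (intro CollectI conjI allI impI)
   show "x * y \<in> M" by (intro mult_in xM yM)
   fix \<epsilon> :: real assume \<epsilon>: "\<epsilon> > 0"
   define \<delta> where "\<delta> = \<epsilon> / (2 * (w y + 1))"
   have wy: "0 \<le> w y" by (rule w.v_nonneg[OF yM])
   have \<delta>: "\<delta> > 0" using \<epsilon> wy by (simp add: \<delta>_def)
   obtain q where q: "q \<in> \<rat>" "w (x - q) < \<delta>" using xq[OF \<delta>] by blast
   note qM = QM[OF q(1)]
   have wq: "0 \<le> w q" by (rule w.v_nonneg[OF qM])
   have \<delta>': "\<epsilon> / (2 * (w q + 1)) > 0" using \<epsilon> wq by simp
   obtain r where r: "r \<in> \<rat>" "w (y - r) < \<epsilon> / (2 * (w q + 1))" using yq[OF \<delta>'] by blast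
   note rM = QM[OF r(1)]
   have "x * y - q * r = (x - q) * y + q * (y - r)" by (simp add: algebra_simps)
   hence "w (x * y - q * r) \<le> w ((x - q) * y) + w (q * (y - r))"
    using w.v_add[of "(x - q) * y" "q * (y - r)"] by (simp add: mult_in diff_in xM yM qM rM)
   also have "... = w (x - q) * w y + w q * w (y - r)" by (simp add: w.v_mult diff_in xM yM qM rM)
   also have "... \<le> w (x - q) * (w y + 1) + (w q + 1) * w (y - r)"
    by (intro add_mono mult_left_mono mult_right_mono w.v_nonneg diff_in xM yM qM rM) auto
   also have "... < \<epsilon> / 2 + \<epsilon> / 2"
    using q(2) r(2) wy wq by (intro add_strict_mono) (simp_all add: \<delta>_def field_simps)
   finally have "w (x * y - q * r) < \<epsilon>" by simp
   thus "\<exists>q\<in>\<rat>. w (x * y - q) < \<epsilon>" using q r by (intro bexI[of _ "q * r"]) auto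
  qed
 qed
qed

text \<open>Take \<open>y\<close> in \<open>K\<close> near 1 at \<open>v\<close> and near 0 at the
  other places above p. The global trace of \<open>x * y\<close> is rational, and at
  \<open>w\<close> the embeddings outside \<open>local_embs w v\<close> contribute almost nothing to
  it.\<close>

lemma local_embs_trace:
 assumes p: "p \<in> place_ids" and w: "w \<in> places_over M p" and v: "v \<in> places_over K p" and x: "x \<in> K"
 shows "(\<Sum>e\<in>local_embs w v. e x) \<in> rat_closure w"
proof -
 interpret v: absval K v by (rule places_overD[OF v K.csubfield_axioms])
 interpret w: absval M w by (rule places_overD[OF w csubfield_axioms])
 note eM = embs_maps
 have sub: "local_embs w v \<subseteq> embs" by (auto simp: local_embs_def)
 have TM: "(\<Sum>e\<in>local_embs w v. e x) \<in> M" using sub by (intro sum_in eM x) auto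
 have "\<exists>q\<in>\<rat>. w ((\<Sum>e\<in>local_embs w v. e x) - q) < \<epsilon>" if \<epsilon>: "\<epsilon> > 0" for \<epsilon>
 proof -
  define B where "B = (\<Sum>e\<in>embs. w (e x)) + 1"
  have Bpos: "0 \<le> (\<Sum>e\<in>embs. w (e x))" by (intro sum_nonneg w.v_nonneg eM x)
  hence B: "B > 0" by (simp add: B_def)
  define \<delta> where "\<delta> = \<epsilon> / B"
  have \<delta>: "\<delta> > 0" using \<epsilon> B by (simp add: \<delta>_def)
  define V where "V = places_over K p - {v}"
  have Vp: "u \<in> places_over K p" "u \<noteq> v" if "u \<in> V" for u using that by (auto simp: V_def)
  obtain q where q: "0 < rat_abs p q" "rat_abs p q < 1" by (rule rat_abs_uniformizer[OF p])
  have vq: "v (of_rat q) = rat_abs p q" by (rule places_overD(2)[OF v K.csubfield_axioms])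
  have "\<exists>y\<in>K. v (y - 1) < \<delta> \<and> (\<forall>u\<in>V. u y < \<delta>)"
  proof (rule weak_approximation[OF K.csubfield_axioms _ v.av])
   show "finite V" using finite_places_over[OF p] by (simp add: V_def)
   show "absolute_value_on K u" if "u \<in> V" for u using Vp[OF that] by (simp add: places_over_def)
   show "of_rat q \<in> K" using K.Rats_subset by auto
   show "0 < v (of_rat q)" "v (of_rat q) < 1" using q vq by simp_all
   show "u (of_rat q) = v (of_rat q)" if "u \<in> V" for u
    using places_overD(2)[OF Vp(1)[OF that] K.csubfield_axioms] vq by simp
   show "\<exists>x\<in>K. v x \<noteq> u x" if u: "u \<in> V" for u
   proof (rule ccontr)
    assume "\<not> ?thesis"
    hence "v = u" using places_overD(3)[OF v K.csubfield_axioms] places_overD(3)[OF Vp(1)[OF u] K.csubfield_axioms]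
     by (intro extensionalityI[of _ K]) auto
    thus False using Vp(2)[OF u] by simp
   qed
  qed fact
  then obtain y where y: "y \<in> K" "v (y - 1) < \<delta>" "\<And>u. u \<in> V ==> u y < \<delta>" by blast
  \<comment> \<open>The error made when the value of \<open>e\<close> at \<open>y\<close> replaces
    the indicator of \<open>local_embs w v\<close>.\<close>
  define c where "c = (\<lambda>e. if e \<in> local_embs w v then 1 - e y else - e y)"
  have cM: "c e \<in> M" if "e \<in> embs" for e using eM[OF that y(1)] by (auto simp: c_def intro: diff_in minus_in)
  have wc: "w (c e) \<le> \<delta>" if e: "e \<in> embs" for e
  proof (cases "e \<in> local_embs w v")
   case True
   interpret e: csubfield_hom K e by (rule embs_hom[OF e])
   have "w (c e) = w (e (1 - y))" using True by (simp add: c_def e.hom_diff y(1) e.hom_one)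
   also have "... = v (1 - y)" using True K.diff_in[of 1 y] y(1) by (simp add: local_embs_def)
   also have "... < \<delta>" using y v.v_diff_commute[of 1 y] by simp
   finally show ?thesis by simp
  next
   case False
   obtain s where s: "s \<in> G" "e = restrict s K" using e unfolding embs_def by blast
   define u where "u = (\<lambda>x\<in>K. w (s x))"
   have ue: "u z = w (e z)" if "z \<in> K" for z using that by (simp add: u_def s(2))
   have "u \<in> places_over K p" unfolding u_def by (rule absval_compose[OF w s(1)])
   moreover have "u \<noteq> v" using False e ue by (auto simp: local_embs_def)
   ultimately have "u y < \<delta>" by (intro y(3)) (simp add: V_def)
   thus ?thesis using False w.v_minus[OF eM[OF e y(1)]] ue[OF y(1)] by (simp add: c_def)
  qed
  define r where "r = (\<Sum>e\<in>embs. e (x * y))"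
  have rQ: "r \<in> \<rat>" unfolding r_def by (intro trace_embs_rat K.mult_in x y(1))
  have exy: "e (x * y) = e x * e y" if "e \<in> embs" for e using csubfield_hom.hom_mult[OF embs_hom[OF that] x y(1)] .
  have "(\<Sum>e\<in>local_embs w v. e x) = (\<Sum>e\<in>embs. if e \<in> local_embs w v then e x else 0)"
   by (rule sum.mono_neutral_cong_left[OF finite_embs sub]) auto
  hence "(\<Sum>e\<in>local_embs w v. e x) - r = (\<Sum>e\<in>embs. e x * c e)"
   unfolding r_def sum_subtractf[symmetric]
   by (simp add: sum_subtractf[symmetric]) (intro sum.cong refl, simp add: c_def exy algebra_simps)
  hence "w ((\<Sum>e\<in>local_embs w v. e x) - r) \<le> (\<Sum>e\<in>embs. w (e x * c e))"
   using w.v_sum[of embs "\<lambda>e. e x * c e"] by (simp add: mult_in eM x cM)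
  also have "... \<le> (\<Sum>e\<in>embs. w (e x) * \<delta>)"
   by (intro sum_mono) (simp add: w.v_mult eM x cM mult_left_mono wc w.v_nonneg)
  also have "... = (B - 1) * \<delta>" by (simp add: B_def sum_distrib_right)
  also have "... < B * \<delta>" using \<delta> by (intro mult_strict_right_mono) auto
  also have "... = \<epsilon>" using B by (simp add: \<delta>_def)
  finally show ?thesis using rQ by blast
 qed
 thus ?thesis using TM by (simp add: rat_closure_def)
qed

text \<open>The dual points for the local embeddings over \<open>rat_closure w\<close> form a basis
  of the completion. Their coefficients lie only in the closure of the rationals, so they are
  approximated by rationals along a Cauchy sequence; the inverse matrix controls the
  coordinates.\<close>

theorem local_degree_eq:
 assumes p: "p \<in> place_ids" and w: "w \<in> places_over M p" and v: "v \<in> places_over K p"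
 shows "local_degree K v = card (local_embs w v)"
proof -
 interpret v: absval K v by (rule places_overD[OF v K.csubfield_axioms])
 interpret w: absval M w by (rule places_overD[OF w csubfield_axioms])
 define E where "E = local_embs w v"
 have sub: "E \<subseteq> embs" by (auto simp: E_def local_embs_def)
 have finE: "finite E" using sub finite_embs finite_subset by blast
 have Ehom: "csubfield_hom K e" if "e \<in> E" for e using embs_hom sub that by blast
 have EM: "e x \<in> M" if "e \<in> E" "x \<in> K" for e x using embs_maps sub that by blast
 have Ew: "w (e x) = v x" if "e \<in> E" "x \<in> K" for e x using that by (simp add: E_def local_embs_def)
 obtain s0 where s0: "s0 \<in> G" "v = (\<lambda>x\<in>K. w (s0 x))" using places_over_transitive[OF p w v] by blast
 have "restrict s0 K \<in> E" unfolding E_def local_embs_def embs_def using s0 by auto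
 hence Ene: "E \<noteq> {}" by blast
 have F: "csubfield (rat_closure w)" by (rule csubfield_rat_closure[OF w.av])
 have "\<exists>x a. (\<forall>t\<in>E. x t \<in> K) \<and> (\<forall>t s. a t s \<in> M) \<and>
  (\<forall>t\<in>E. \<forall>t'\<in>E. (\<Sum>s\<in>E. a t s * s (x t')) = (if t = t' then 1 else 0)) \<and>
  (\<forall>y\<in>K. \<exists>q. (\<forall>t. q t \<in> rat_closure w) \<and> (\<forall>s\<in>E. s y = (\<Sum>t\<in>E. q t * s (x t))))"
 proof (rule character_basis[OF csubfield_axioms K.csubfield_axioms F finE])
  show "csubfield_hom K s" if "s \<in> E" for s by (rule Ehom[OF that])
  show "s x \<in> M" if "s \<in> E" "x \<in> K" for s x by (rule EM[OF that])
  show "\<exists>x\<in>K. s x \<noteq> t x" if "s \<in> E" "t \<in> E" "s \<noteq> t" for s t using embs_dist that sub by blast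
  show "(\<Sum>s\<in>E. s x) \<in> rat_closure w" if "x \<in> K" for x unfolding E_def by (rule local_embs_trace[OF p w v that])
 qed
 then obtain x a where x': "\<forall>t\<in>E. x t \<in> K" and aM': "\<forall>t s. a t s \<in> M"
  and a': "\<forall>t\<in>E. \<forall>t'\<in>E. (\<Sum>s\<in>E. a t s * s (x t')) = (if t = t' then 1 else 0)"
  and rep': "\<forall>y\<in>K. \<exists>q. (\<forall>t. q t \<in> rat_closure w) \<and> (\<forall>s\<in>E. s y = (\<Sum>t\<in>E. q t * s (x t)))"
  by (elim exE conjE)
 note x = x'[rule_format] and aM = aM'[rule_format] and a = a'[rule_format] and rep = rep'[THEN bspec]
 have QM: "c \<in> M" and QK: "c \<in> K" if "c \<in> \<rat>" for c using that Rats_subset K.Rats_subset by blast+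
 have wv: "w c = v c" if cQ: "c \<in> \<rat>" for c
 proof -
  obtain r where "c = of_rat r" using cQ by (auto elim: Rats_cases)
  thus ?thesis using places_overD(2)[OF v K.csubfield_axioms] places_overD(2)[OF w csubfield_axioms] by simp
 qed
 have homsum: "s (\<Sum>t\<in>E. q t * x t) = (\<Sum>t\<in>E. q t * s (x t))"
  if s: "s \<in> E" and q: "\<And>t. t \<in> E ==> q t \<in> \<rat>" for s q
 proof -
  interpret s: csubfield_hom K s by (rule Ehom[OF s])
  have "s (\<Sum>t\<in>E. q t * x t) = (\<Sum>t\<in>E. s (q t * x t))"
   by (rule s.hom_sum) (intro K.mult_in x QK q)
  also have "... = (\<Sum>t\<in>E. q t * s (x t))"
   by (intro sum.cong refl) (simp add: s.hom_mult x QK s.hom_Rats q)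
  finally show ?thesis .
 qed
 define A where "A = (\<lambda>t. \<Sum>s\<in>E. w (a t s))"
 \<comment> \<open>The inverse matrix recovers a coordinate from the conjugates of the element, and
   all local conjugates have its size at \<open>v\<close>. So small elements have small coordinates,
   which yields Cauchy coordinates as well as independence.\<close>
 have coord: "v (q t) \<le> A t * v (\<Sum>t\<in>E. q t * x t)"
  if t: "t \<in> E" and q: "\<And>t. t \<in> E ==> q t \<in> \<rat>" for t q
 proof -
  have zK: "(\<Sum>t\<in>E. q t * x t) \<in> K" by (intro K.sum_in K.mult_in x QK q)
  have "q t = (\<Sum>t'\<in>E. q t' * (if t = t' then 1 else 0))" using sum_mult_delta[OF finE t] by simp
  also have "... = (\<Sum>t'\<in>E. q t' * (\<Sum>s\<in>E. a t s * s (x t')))"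
   by (intro sum.cong refl) (simp add: a t)
  also have "... = (\<Sum>s\<in>E. a t s * (\<Sum>t'\<in>E. q t' * s (x t')))"
   unfolding sum_distrib_left by (subst sum.swap) (simp add: mult_ac)
  also have "... = (\<Sum>s\<in>E. a t s * s (\<Sum>t\<in>E. q t * x t))"
   by (intro sum.cong refl) (simp add: homsum q)
  finally have "w (q t) \<le> (\<Sum>s\<in>E. w (a t s * s (\<Sum>t\<in>E. q t * x t)))"
   using w.v_sum[of E "\<lambda>s. a t s * s (\<Sum>t\<in>E. q t * x t)"] by (simp add: mult_in aM EM zK)
  also have "... = A t * v (\<Sum>t\<in>E. q t * x t)"
   unfolding A_def sum_distrib_right by (intro sum.cong refl) (simp add: w.v_mult aM EM zK Ew)
  finally show ?thesis using wv[OF q[OF t]] by simp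
 qed
 have A0: "0 \<le> A t" for t unfolding A_def by (intro sum_nonneg w.v_nonneg aM)
 obtain es where es: "set es = E" "distinct es" using finite_distinct_list[OF finE] by blast
 have len: "length es = card E" using es distinct_card by fastforce
 define us where "us = map x es"
 have bij: "bij_betw ((!) es) {..<length es} E" using bij_betw_nth[OF es(2), of "{..<length es}" E] es(1) by simp
 have idx: "(\<Sum>i<length us. f (es ! i)) = (\<Sum>t\<in>E. f t)" for f :: "_ => complex"
  using sum.reindex_bij_betw[OF bij, of f] by (simp add: us_def)
 have lus: "length us = length es" by (simp add: us_def)
 have us_nth: "us ! i = x (es ! i)" if "i < length es" for i using that by (simp add: us_def)
 have "local_degree K v = length us"
 proof (rule v.local_degreeI)
  show "set us \<subseteq> K" using x es by (auto simp: us_def)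
 next
  fix s assume s: "v.cauchy s"
  have sK: "s n \<in> K" for n by (rule v.cauchy_in[OF s])
  \<comment> \<open>The n-th term is expanded with rational coefficients that are within 1/(n+1) of
    the exact ones, so the error is a null sequence.\<close>
  have "\<exists>r. (\<forall>t. r t \<in> \<rat>) \<and> v (s n - (\<Sum>t\<in>E. r t * x t)) \<le> (\<Sum>t\<in>E. v (x t)) / real (Suc n)" for n
  proof -
   obtain q where q: "\<forall>t. q t \<in> rat_closure w" "\<forall>e\<in>E. e (s n) = (\<Sum>t\<in>E. q t * e (x t))"
    using rep[OF sK[of n]] by (elim exE conjE)
   have qM: "q t \<in> M" for t using q(1) by (simp add: rat_closure_def)
   have "\<forall>t. \<exists>r. r \<in> \<rat> \<and> w (q t - r) < 1 / real (Suc n)"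
   proof
    fix t
    have "\<forall>\<epsilon>>0. \<exists>r\<in>\<rat>. w (q t - r) < \<epsilon>" using q(1) by (simp add: rat_closure_def)
    moreover have "1 / real (Suc n) > 0" by simp
    ultimately show "\<exists>r. r \<in> \<rat> \<and> w (q t - r) < 1 / real (Suc n)" by blast
   qed
   from choice[OF this] obtain r where r: "\<forall>t. r t \<in> \<rat> \<and> w (q t - r t) < 1 / real (Suc n)" by (elim exE)
   have rM: "r t \<in> M" for t using r QM by blast
   have rQ: "r t \<in> \<rat>" for t using r by blast
   obtain e where e: "e \<in> E" using Ene by blast
   interpret e: csubfield_hom K e by (rule Ehom[OF e])
   have zK: "(\<Sum>t\<in>E. r t * x t) \<in> K" by (intro K.sum_in K.mult_in x QK rQ)
   have "v (s n - (\<Sum>t\<in>E. r t * x t)) = w (e (s n - (\<Sum>t\<in>E. r t * x t)))"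
    using Ew[OF e K.diff_in[OF sK zK]] by simp
   also have "e (s n - (\<Sum>t\<in>E. r t * x t)) = (\<Sum>t\<in>E. q t * e (x t)) - (\<Sum>t\<in>E. r t * e (x t))"
    using e.hom_diff[OF sK zK] q(2) e homsum[OF e, of r] rQ by simp
   also have "... = (\<Sum>t\<in>E. (q t - r t) * e (x t))" by (simp add: sum_subtractf left_diff_distrib)
   also have "w ... \<le> (\<Sum>t\<in>E. w ((q t - r t) * e (x t)))"
    by (rule w.v_sum) (intro mult_in diff_in qM rM EM e x)
   also have "... \<le> (\<Sum>t\<in>E. 1 / real (Suc n) * v (x t))"
   proof (rule sum_mono)
    fix t assume t: "t \<in> E"
    have "w ((q t - r t) * e (x t)) = w (q t - r t) * v (x t)"
     using w.v_mult[OF diff_in[OF qM rM] EM[OF e x[OF t]]] Ew[OF e x[OF t]] by simp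
    also have "... \<le> 1 / real (Suc n) * v (x t)"
     using r by (intro mult_right_mono v.v_nonneg x t) (auto intro: less_imp_le)
    finally show "w ((q t - r t) * e (x t)) \<le> 1 / real (Suc n) * v (x t)" .
   qed
   also have "... = (\<Sum>t\<in>E. v (x t)) / real (Suc n)" by (simp add: sum_divide_distrib)
   finally show ?thesis using rQ by blast
  qed
  hence "\<forall>n. \<exists>r. (\<forall>t. r t \<in> \<rat>) \<and> v (s n - (\<Sum>t\<in>E. r t * x t)) \<le> (\<Sum>t\<in>E. v (x t)) / real (Suc n)" ..
  from choice[OF this] obtain r where r: "\<forall>n. (\<forall>t. r n t \<in> \<rat>) \<and>
    v (s n - (\<Sum>t\<in>E. r n t * x t)) \<le> (\<Sum>t\<in>E. v (x t)) / real (Suc n)" by (elim exE)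
  have rQ: "r n t \<in> \<rat>" for n t using r by blast
  define z where "z = (\<lambda>n. \<Sum>t\<in>E. r n t * x t)"
  have zK: "z n \<in> K" for n unfolding z_def by (intro K.sum_in K.mult_in x QK rQ)
  have nul: "v.null (\<lambda>n. s n - z n)" unfolding v.null_def
  proof (intro conjI)
   show "range (\<lambda>n. s n - z n) \<subseteq> K" using sK zK K.diff_in by auto
   show "(\<lambda>n. v (s n - z n)) \<longlonglongrightarrow> 0"
   proof (rule tendsto_sandwich[of "\<lambda>_. 0" _ _ "\<lambda>n. (\<Sum>t\<in>E. v (x t)) / real (Suc n)"])
    show "(\<lambda>n. (\<Sum>t\<in>E. v (x t)) / real (Suc n)) \<longlonglongrightarrow> 0"
     using tendsto_mult_right_zero[OF LIMSEQ_inverse_real_of_nat, of "\<Sum>t\<in>E. v (x t)"]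
     by (simp add: divide_inverse)
    show "\<forall>\<^sub>F n in sequentially. 0 \<le> v (s n - z n)" by (intro always_eventually allI v.v_nonneg K.diff_in sK zK)
    show "\<forall>\<^sub>F n in sequentially. v (s n - z n) \<le> (\<Sum>t\<in>E. v (x t)) / real (Suc n)"
     using r by (intro always_eventually allI) (simp add: z_def)
   qed simp
  qed
  have cz: "v.cauchy z"
  proof -
   have "v.cauchy (\<lambda>n. s n + - (s n - z n))" by (intro v.cauchy_add v.cauchy_minus s v.null_cauchy nul)
   thus ?thesis by simp
  qed
  have cr: "v.cauchy (\<lambda>n. r n t)" if t: "t \<in> E" for t
   unfolding v.cauchy_def
  proof (intro conjI allI impI)
   show "range (\<lambda>n. r n t) \<subseteq> K" using rQ QK by auto
   fix \<epsilon> :: real assume "\<epsilon> > 0"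
   hence "\<epsilon> / (A t + 1) > 0" using A0[of t] by simp
   hence "\<exists>N. \<forall>m\<ge>N. \<forall>n\<ge>N. v (z m - z n) < \<epsilon> / (A t + 1)"
    using cz unfolding v.cauchy_def by (elim conjE allE impE) assumption+
   then obtain N where N: "\<And>m n. m \<ge> N ==> n \<ge> N ==> v (z m - z n) < \<epsilon> / (A t + 1)" by blast
   have "v (r m t - r n t) < \<epsilon>" if mn: "m \<ge> N" "n \<ge> N" for m n
   proof -
    have "v (r m t - r n t) \<le> A t * v (\<Sum>t\<in>E. (r m t - r n t) * x t)"
     using coord[OF t, of "\<lambda>t. r m t - r n t"] rQ by simp
    also have "(\<Sum>t\<in>E. (r m t - r n t) * x t) = z m - z n" by (simp add: z_def sum_subtractf left_diff_distrib)
    also have "A t * v (z m - z n) \<le> (A t + 1) * v (z m - z n)"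
     by (intro mult_right_mono v.v_nonneg K.diff_in zK) simp
    also have "... < \<epsilon>" using N[OF mn] A0[of t] by (simp add: field_simps)
    finally show ?thesis .
   qed
   thus "\<exists>M. \<forall>m\<ge>M. \<forall>n\<ge>M. v (r m t - r n t) < \<epsilon>" by blast
  qed
  show "\<exists>q. (\<forall>i<length us. v.cauchy (q i) \<and> range (q i) \<subseteq> \<rat>) \<and>
   v.null (\<lambda>n. s n - (\<Sum>i<length us. q i n * us ! i))"
  proof (intro exI[of _ "\<lambda>i n. r n (es ! i)"] conjI allI impI)
   fix i assume "i < length us"
   hence "es ! i \<in> E" using es(1) lus by auto
   thus "v.cauchy (\<lambda>n. r n (es ! i))" by (rule cr)
   show "range (\<lambda>n. r n (es ! i)) \<subseteq> \<rat>" using rQ by auto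
  next
   have "(\<Sum>i<length us. r n (es ! i) * us ! i) = z n" for n
    unfolding z_def idx[symmetric] lus by (intro sum.cong refl) (simp add: us_nth)
   thus "v.null (\<lambda>n. s n - (\<Sum>i<length us. r n (es ! i) * us ! i))" using nul by simp
  qed
 next
  fix q assume q: "\<forall>i<length us. v.cauchy (q i) \<and> range (q i) \<subseteq> \<rat>"
   and nul: "v.null (\<lambda>n. \<Sum>i<length us. q i n * us ! i)"
  define r where "r = (\<lambda>t. q (inv_into {..<length es} ((!) es) t))"
  have r_nth: "r (es ! i) = q i" if "i < length es" for i
   unfolding r_def using that bij by (simp add: bij_betw_def)
  have rQ: "r t n \<in> \<rat>" if te: "t \<in> E" for t n
  proof -
   obtain i where "i < length es" "t = es ! i" using te es(1) in_set_conv_nth[of t es] by auto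
   moreover from this have "range (q i) \<subseteq> \<rat>" using q lus by simp
   ultimately show ?thesis using r_nth[of i] by auto
  qed
  have sum_eq: "(\<Sum>i<length us. q i n * us ! i) = (\<Sum>t\<in>E. r t n * x t)" for n
   unfolding idx[symmetric] lus by (intro sum.cong refl) (simp add: us_nth r_nth)
  show "\<forall>i<length us. v.null (q i)"
  proof (intro allI impI)
   fix i assume i: "i < length us"
   hence ie: "i < length es" by (simp add: lus)
   hence t: "es ! i \<in> E" using es(1) by auto
   show "v.null (q i)" unfolding v.null_def
   proof (intro conjI)
    have "range (q i) \<subseteq> \<rat>" using q i by simp
    thus qK: "range (q i) \<subseteq> K" using K.Rats_subset by (rule order_trans)
    show "(\<lambda>n. v (q i n)) \<longlonglongrightarrow> 0"
    proof (rule tendsto_sandwich[of "\<lambda>_. 0" _ _ "\<lambda>n. A (es ! i) * v (\<Sum>i<length us. q i n * us ! i)"])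
     show "(\<lambda>n. A (es ! i) * v (\<Sum>i<length us. q i n * us ! i)) \<longlonglongrightarrow> 0"
      using nul unfolding v.null_def by (intro tendsto_mult_right_zero) auto
     show "\<forall>\<^sub>F n in sequentially. 0 \<le> v (q i n)"
      by (intro always_eventually allI v.v_nonneg subsetD[OF qK] rangeI)
     show "\<forall>\<^sub>F n in sequentially. v (q i n) \<le> A (es ! i) * v (\<Sum>i<length us. q i n * us ! i)"
     proof (intro always_eventually allI)
      fix n
      have "v (r (es ! i) n) \<le> A (es ! i) * v (\<Sum>t\<in>E. r t n * x t)"
       by (rule coord[OF t]) (rule rQ)
      thus "v (q i n) \<le> A (es ! i) * v (\<Sum>i<length us. q i n * us ! i)"
       unfolding sum_eq r_nth[OF ie] .
     qed
    qed simp
   qed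
  qed
 qed
 thus ?thesis using len by (simp add: us_def E_def)
qed

end

section \<open>The product formula\<close>

lemma multiplicity_int_nat:
 assumes "Factorial_Ring.prime p" "n > 0"
 shows "multiplicity (int p) (int n) = multiplicity p n"
proof -
 have u: "\<not> is_unit p" "\<not> is_unit (int p)" using assms(1) by (auto simp: prime_gt_1_nat)
 have nz: "n \<noteq> 0" "int n \<noteq> 0" using assms(2) by auto
 have "k \<le> multiplicity (int p) (int n) \<longleftrightarrow> k \<le> multiplicity p n" for k
 proof -
  have "k \<le> multiplicity (int p) (int n) \<longleftrightarrow> int p ^ k dvd int n"
   using power_dvd_iff_le_multiplicity[OF nz(2) u(2)] by simp
  also have "... \<longleftrightarrow> p ^ k dvd n" by (metis int_dvd_int_iff of_nat_power)
  also have "... \<longleftrightarrow> k \<le> multiplicity p n" using power_dvd_iff_le_multiplicity[OF nz(1) u(1)] by simp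
  finally show ?thesis .
 qed
 thus ?thesis by (meson le_antisym le_refl)
qed

lemma ln_nat_prime_sum:
 assumes "n > 0" "finite P" "prime_factors n \<subseteq> P" "\<And>p. p \<in> P ==> Factorial_Ring.prime p"
 shows "ln (real n) = (\<Sum>p\<in>P. real (multiplicity (int p) (int n)) * ln (real p))"
proof -
 have "real n = (\<Prod>p\<in>prime_factors n. real p ^ multiplicity p n)"
  using arg_cong[OF prime_factorization_nat[OF assms(1)], of real] by simp
 hence "ln (real n) = ln (\<Prod>p\<in>prime_factors n. real p ^ multiplicity p n)" by (rule arg_cong)
 also have "... = (\<Sum>p\<in>prime_factors n. ln (real p ^ multiplicity p n))"
  by (rule ln_prod) (auto simp: prime_gt_0_nat in_prime_factors_iff)
 also have "... = (\<Sum>p\<in>prime_factors n. real (multiplicity (int p) (int n)) * ln (real p))"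
  by (intro sum.cong refl) (simp add: ln_realpow in_prime_factors_iff prime_gt_0_nat multiplicity_int_nat assms(1))
 also have "... = (\<Sum>p\<in>P. real (multiplicity (int p) (int n)) * ln (real p))"
 proof (rule sum.mono_neutral_left[OF assms(2,3)], rule ballI)
  fix p assume p: "p \<in> P - prime_factors n"
  hence "\<not> p dvd n" using assms(1,4) by (auto simp: in_prime_factors_iff)
  hence "multiplicity p n = 0" by (rule not_dvd_imp_multiplicity_0)
  thus "real (multiplicity (int p) (int n)) * ln (real p) = 0" using p assms(1,4) by (simp add: multiplicity_int_nat)
 qed
 finally show ?thesis .
qed

lemma rat_abs_ln:
 assumes q: "q \<noteq> 0" "quotient_of q = (a, b)" and p: "Factorial_Ring.prime p"
 shows "ln (rat_abs p q) = (real (multiplicity (int p) b) - real (multiplicity (int p) a)) * ln (real p)"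
  "rat_abs p q > 0"
proof -
 have p0: "p \<noteq> 0" "real p > 0" using p prime_gt_0_nat by auto
 have e: "rat_abs p q = real p powi (int (multiplicity (int p) b) - int (multiplicity (int p) a))"
  using q p0 by (simp add: rat_abs_def padic_abs_def)
 show "rat_abs p q > 0" unfolding e using p0 by (simp add: zero_less_power_int)
 show "ln (rat_abs p q) = (real (multiplicity (int p) b) - real (multiplicity (int p) a)) * ln (real p)"
  unfolding e by (subst ln_powi[OF p0(2)]) simp
qed

definition bad_primes :: "rat => nat set" where
 "bad_primes q = (let (a, b) = quotient_of q in prime_factors (nat \<bar>a\<bar>) \<union> prime_factors (nat b))"

lemma finite_bad_primes: "finite (bad_primes q)"
 by (cases "quotient_of q") (simp add: bad_primes_def)

lemma bad_primes_prime: "p \<in> bad_primes q ==> Factorial_Ring.prime p"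
 by (cases "quotient_of q") (auto simp: bad_primes_def in_prime_factors_iff)

lemma multiplicity_int_abs: "multiplicity (int p) a = multiplicity (int p) \<bar>a\<bar>"
 by (cases "a \<ge> 0") (auto simp: abs_if)

text \<open>Unique factorisation of numerator and denominator; \<open>P\<close> may contain further
  primes, which contribute 0.\<close>

lemma product_formula_rat:
 assumes q: "q \<noteq> 0" and P: "finite P" "bad_primes q \<subseteq> P" "\<And>p. p \<in> P ==> Factorial_Ring.prime p"
 shows "ln (rat_abs 0 q) + (\<Sum>p\<in>P. ln (rat_abs p q)) = 0"
proof -
 obtain a b where ab: "quotient_of q = (a, b)" by (cases "quotient_of q")
 have qe: "q = of_int a / of_int b" using quotient_of_div[OF ab] .
 have b: "b > 0" using quotient_of_denom_pos[OF ab] .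
 have a: "a \<noteq> 0" using q qe by auto
 define A B where "A = nat \<bar>a\<bar>" and "B = nat b"
 have AB: "A > 0" "B > 0" "int A = \<bar>a\<bar>" "int B = b" using a b by (auto simp: A_def B_def)
 have sub: "prime_factors A \<subseteq> P" "prime_factors B \<subseteq> P" using P(2) ab by (auto simp: bad_primes_def A_def B_def)
 have "rat_abs 0 q = real A / real B"
 proof -
  have "rat_abs 0 q = \<bar>real_of_int a\<bar> / \<bar>real_of_int b\<bar>"
   by (simp add: rat_abs_def qe abs_divide of_rat_divide of_int_abs[symmetric] del: of_int_abs)
  also have "... = real A / real B" using b by (simp add: A_def B_def)
  finally show ?thesis .
 qed
 hence "ln (rat_abs 0 q) = ln (real A) - ln (real B)" using AB by (simp add: ln_div)
 moreover have "(\<Sum>p\<in>P. ln (rat_abs p q)) = ln (real B) - ln (real A)"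
 proof -
  have "(\<Sum>p\<in>P. ln (rat_abs p q)) = (\<Sum>p\<in>P. real (multiplicity (int p) (int B)) * ln (real p) - real (multiplicity (int p) (int A)) * ln (real p))"
  proof (rule sum.cong[OF refl])
   fix p assume "p \<in> P"
   hence pp: "Factorial_Ring.prime p" by (rule P(3))
   show "ln (rat_abs p q) = real (multiplicity (int p) (int B)) * ln (real p) - real (multiplicity (int p) (int A)) * ln (real p)"
    unfolding rat_abs_ln(1)[OF q ab pp] AB(3,4) multiplicity_int_abs[of p a] by (simp add: algebra_simps)
  qed
  thus ?thesis
   by (simp add: sum_subtractf ln_nat_prime_sum[OF AB(1) P(1) sub(1) P(3)] ln_nat_prime_sum[OF AB(2) P(1) sub(2) P(3)])
 qed
 ultimately show ?thesis by simp
qed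

lemma rat_abs_eq_1: assumes "q \<noteq> 0" "Factorial_Ring.prime p" "p \<notin> bad_primes q" shows "rat_abs p q = 1"
proof -
 obtain a b where ab: "quotient_of q = (a, b)" by (cases "quotient_of q")
 have b: "b > 0" using quotient_of_denom_pos[OF ab] .
 have a: "a \<noteq> 0" using assms(1) quotient_of_div[OF ab] by auto
 have nd: "\<not> p dvd nat \<bar>a\<bar>" "\<not> p dvd nat b" using assms ab a b by (auto simp: bad_primes_def in_prime_factors_iff)
 have pos: "0 < nat \<bar>a\<bar>" "0 < nat b" using a b by auto
 have "multiplicity (int p) (int (nat \<bar>a\<bar>)) = 0" "multiplicity (int p) (int (nat b)) = 0"
  unfolding multiplicity_int_nat[OF assms(2) pos(1)] multiplicity_int_nat[OF assms(2) pos(2)]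
  using nd by (auto intro: not_dvd_imp_multiplicity_0)
 hence "multiplicity (int p) a = 0" "multiplicity (int p) b = 0" using b multiplicity_int_abs[of p a] by auto
 hence "ln (rat_abs p q) = 0" using rat_abs_ln(1)[OF assms(1) ab assms(2)] by simp
 thus ?thesis using rat_abs_ln(2)[OF assms(1) ab assms(2)] by simp
qed

text \<open>The height of a/b in lowest terms is the logarithm of max(|a|, b): the finite places
  contribute ln b because a prime dividing b does not divide a, and the archimedean place then turns
  b into |a| if that is larger.\<close>

lemma rat_num_denom_bound:
 assumes q: "q \<noteq> 0" "quotient_of q = (a, b)"
  and P: "finite P" "bad_primes q \<subseteq> P" "\<And>p. p \<in> P ==> Factorial_Ring.prime p"
  and B: "ln (max 1 (rat_abs 0 q)) + (\<Sum>p\<in>P. ln (max 1 (rat_abs p q))) \<le> B"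
 shows "real_of_int b \<le> exp B" "\<bar>real_of_int a\<bar> \<le> exp B"
proof -
 have qe: "q = of_int a / of_int b" using quotient_of_div[OF q(2)] .
 have b: "b > 0" using quotient_of_denom_pos[OF q(2)] .
 have a: "a \<noteq> 0" using q qe by auto
 have cop: "coprime a b" using quotient_of_coprime[OF q(2)] .
 define B' where "B' = nat b"
 have B': "B' > 0" "int B' = b" using b by (auto simp: B'_def)
 have sub: "prime_factors B' \<subseteq> P" using P(2) q(2) by (auto simp: bad_primes_def B'_def)
 have "ln (real B') = (\<Sum>p\<in>P. real (multiplicity (int p) (int B')) * ln (real p))"
  by (rule ln_nat_prime_sum[OF B'(1) P(1) sub P(3)])
 also have "... \<le> (\<Sum>p\<in>P. ln (max 1 (rat_abs p q)))"
 proof (rule sum_mono)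
  fix p assume "p \<in> P"
  hence pp: "Factorial_Ring.prime p" by (rule P(3))
  show "real (multiplicity (int p) (int B')) * ln (real p) \<le> ln (max 1 (rat_abs p q))"
  proof (cases "multiplicity (int p) b = 0")
   case True
   thus ?thesis by (simp add: B')
  next
   case False
   have pb: "int p dvd b"
   proof (rule ccontr)
    assume "\<not> int p dvd b"
    hence "multiplicity (int p) b = 0" by (rule not_dvd_imp_multiplicity_0)
    with False show False by simp
   qed
   have "\<not> int p dvd a"
   proof
    assume "int p dvd a"
    hence "is_unit (int p)" by (rule coprime_common_divisor[OF cop _ pb])
    thus False using prime_gt_1_nat[OF pp] by simp
   qed
   hence "multiplicity (int p) a = 0" by (rule not_dvd_imp_multiplicity_0)
   hence "real (multiplicity (int p) (int B')) * ln (real p) = ln (rat_abs p q)"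
    using rat_abs_ln(1)[OF q pp] by (simp add: B')
   also have "... \<le> ln (max 1 (rat_abs p q))" using rat_abs_ln(2)[OF q pp] by simp
   finally show ?thesis .
  qed
 qed
 finally have bb: "ln (real B') \<le> (\<Sum>p\<in>P. ln (max 1 (rat_abs p q)))" .
 have b1: "ln (real_of_int b) + ln (max 1 (rat_abs 0 q)) \<le> B" 
 proof -
  have "real B' = real_of_int b" by (simp flip: B'(2))
  from bb[unfolded this] show ?thesis using B by linarith
 qed
 have m1: "ln (max 1 (rat_abs 0 q)) \<ge> 0" by simp
 have bpos: "real_of_int b > 0" using b by simp
 have "ln (real_of_int b) \<le> B" using b1 m1 by linarith
 thus "real_of_int b \<le> exp B" using bpos exp_ln[OF bpos] exp_le_cancel_iff[of "ln (real_of_int b)" B] by simp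
 have r: "rat_abs 0 q = \<bar>real_of_int a\<bar> / real_of_int b"
 proof -
  have "rat_abs 0 q = \<bar>real_of_int a\<bar> / \<bar>real_of_int b\<bar>"
   by (simp add: rat_abs_def qe abs_divide of_rat_divide of_int_abs[symmetric] del: of_int_abs)
  thus ?thesis using b by simp
 qed
 hence rp: "rat_abs 0 q > 0" using a b by simp
 have "\<bar>real_of_int a\<bar> = rat_abs 0 q * real_of_int b" unfolding r using b by simp
 hence "ln \<bar>real_of_int a\<bar> = ln (rat_abs 0 q * real_of_int b)" by (rule arg_cong)
 also have "... = ln (rat_abs 0 q) + ln (real_of_int b)" using rp bpos by (simp add: ln_mult)
 also have "... \<le> ln (max 1 (rat_abs 0 q)) + ln (real_of_int b)" using rp by simp
 also have "... \<le> B" using b1 by simp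
 finally show "\<bar>real_of_int a\<bar> \<le> exp B" 
  using a exp_ln[of "\<bar>real_of_int a\<bar>"] exp_le_cancel_iff[of "ln \<bar>real_of_int a\<bar>" B] by simp
qed

lemma finite_bounded_rats:
 "finite {q. \<bar>real_of_int (fst (quotient_of q))\<bar> \<le> B \<and> real_of_int (snd (quotient_of q)) \<le> B}"
proof -
 define C where "C = \<lceil>B\<rceil>"
 have "{q. \<bar>real_of_int (fst (quotient_of q))\<bar> \<le> B \<and> real_of_int (snd (quotient_of q)) \<le> B}
  \<subseteq> (\<lambda>(a, b). of_int a / of_int b) ` ({-C..C} \<times> {0..C})"
 proof
  fix q assume "q \<in> {q. \<bar>real_of_int (fst (quotient_of q))\<bar> \<le> B \<and> real_of_int (snd (quotient_of q)) \<le> B}"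
  moreover obtain a b where ab: "quotient_of q = (a, b)" by (cases "quotient_of q")
  ultimately have h: "\<bar>real_of_int a\<bar> \<le> B" "real_of_int b \<le> B" by auto
  have "a \<in> {-C..C}" "b \<in> {0..C}" unfolding C_def using h quotient_of_denom_pos[OF ab] by (auto, linarith+)
  thus "q \<in> (\<lambda>(a, b). of_int a / of_int b) ` ({-C..C} \<times> {0..C})"
   using quotient_of_div[OF ab] by (intro image_eqI[of _ _ "(a, b)"]) auto
 qed
 thus ?thesis by (rule finite_subset) simp
qed

section \<open>Weighted sums over places\<close>

definition nweight :: "complex set => (complex => real) => real" where
 "nweight K v = real (local_degree K v) / real (field_degree K)"

text \<open>All sums over places are reduced to this finite form, with \<open>P\<close> containing
  every index at which the summand is not 0; \<open>P\<close> can then be enlarged to serve several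
  sums at once.\<close>

definition psum :: "complex set => nat set => ((complex => real) => real) => real" where
 "psum K P f = (\<Sum>p\<in>P. \<Sum>v\<in>places_over K p. nweight K v * f v)"

definition psupp :: "complex set => complex => nat set" where
 "psupp K x = {p \<in> place_ids. \<exists>v\<in>places_over K p. v x \<noteq> 1}"

context galois_field
begin

text \<open>One fixed place of \<open>M\<close> above each p. By conjugacy all other places of
  \<open>M\<close> and of its subfields are obtained from it through \<open>G\<close>.\<close>

definition wp :: "nat => complex => real" where
 "wp p = (SOME w. w \<in> places_over M p)"

lemma wp: "p \<in> place_ids ==> wp p \<in> places_over M p"
 unfolding wp_def using place_over_exists[of p] by (simp add: some_in_eq)

end

context galois_subfield
begin

text \<open>Each embedding induces a place, and a place is induced by as many embeddings as its
  local degree. The weighted sum is therefore an average over the embeddings, hence over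
  \<open>G\<close>, and no longer depends on the subfield.\<close>

lemma sum_places_over:
 assumes p: "p \<in> place_ids"
 shows "(\<Sum>v\<in>places_over K p. nweight K v * f v) = (\<Sum>s\<in>G. f (\<lambda>x\<in>K. wp p (s x))) / real (card G)"
proof -
 note w = wp[OF p]
 define r where "r = (\<lambda>e::complex => complex. \<lambda>x\<in>K. wp p (e x))"
 have r_in: "r e \<in> places_over K p" if e: "e \<in> embs" for e
 proof -
  obtain s where s: "s \<in> G" "e = restrict s K" using e unfolding embs_def by blast
  have "r e = (\<lambda>x\<in>K. wp p (s x))" by (auto simp: r_def s fun_eq_iff)
  thus ?thesis using absval_compose[OF w s(1)] by simp
 qed
 have fib: "{e \<in> embs. r e = v} = local_embs (wp p) v" if v: "v \<in> places_over K p" for v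
 proof -
  have ev: "v \<in> extensional K" using v by (simp add: places_over_def)
  have "r e = v \<longleftrightarrow> (\<forall>x\<in>K. wp p (e x) = v x)" for e
  proof
   assume "r e = v"
   thus "\<forall>x\<in>K. wp p (e x) = v x" by (auto simp: r_def)
  next
   assume "\<forall>x\<in>K. wp p (e x) = v x"
   thus "r e = v" using ev by (intro extensionalityI[of _ K]) (auto simp: r_def)
  qed
  thus ?thesis by (simp add: local_embs_def)
 qed
 have "(\<Sum>e\<in>embs. f (r e)) = (\<Sum>v\<in>places_over K p. \<Sum>e\<in>{e \<in> embs. r e = v}. f (r e))"
  by (rule sum.group[symmetric]) (use finite_embs finite_places_over[OF p] r_in in auto)
 also have "... = (\<Sum>v\<in>places_over K p. real (local_degree K v) * f v)"
  by (intro sum.cong refl) (simp add: fib local_degree_eq[OF p w] local_embs_def flip: fib, simp add: fib local_embs_def local_degree_eq[OF p w])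
 finally have E: "(\<Sum>e\<in>embs. f (r e)) = (\<Sum>v\<in>places_over K p. real (local_degree K v) * f v)" .
 have "(\<Sum>s\<in>G. f (r (restrict s K))) = real stab_card * (\<Sum>e\<in>embs. f (r e))"
  using sum_G_embs[of "\<lambda>e. f (r e)"] by simp
 moreover have "r (restrict s K) = (\<lambda>x\<in>K. wp p (s x))" for s by (auto simp: r_def fun_eq_iff)
 ultimately have "(\<Sum>s\<in>G. f (\<lambda>x\<in>K. wp p (s x))) / real (card G) = (\<Sum>e\<in>embs. f (r e)) / real (card embs)"
  using stab_card_pos by (simp add: card_G_embs)
 thus ?thesis unfolding E
  by (simp add: nweight_def field_degree_embs(1) sum_divide_distrib)
qed

lemma psum_eq:
 assumes "P \<subseteq> place_ids"
 shows "psum K P f = (\<Sum>p\<in>P. (\<Sum>s\<in>G. f (\<lambda>x\<in>K. wp p (s x)))) / real (card G)"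
 unfolding psum_def sum_divide_distrib using assms by (intro sum.cong refl, subst sum_places_over) (auto simp: sum_divide_distrib)

text \<open>In a monic equation with integral coefficients the leading term of an element larger
  than 1 would dominate all others.\<close>

lemma integral_le_1:
 assumes x: "x \<in> K" and p: "Factorial_Ring.prime p" and v: "v \<in> places_over K p"
  and int: "\<And>i. v (coeff (gpoly x) i) \<le> 1"
 shows "v x \<le> 1"
proof (rule ccontr)
 interpret v: absval K v by (rule places_overD[OF v K.csubfield_axioms])
 assume "\<not> v x \<le> 1"
 hence gt: "1 < v x" by simp
 have xM: "x \<in> M" using x K_le by blast
 define g where "g = card G"
 have g: "g > 0" using card_G_pos by (simp add: g_def)
 have cK: "coeff (gpoly x) i \<in> K" for i using gpoly_over[OF xM] K.Rats_subset unfolding poly_over_def by blast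
 have "0 = (\<Sum>i\<le>g. coeff (gpoly x) i * x ^ i)"
  using gpoly_root[OF xM] gpoly_monic[of x] by (simp add: poly_altdef g_def)
 also have "... = (\<Sum>i<g. coeff (gpoly x) i * x ^ i) + x ^ g"
  using gpoly_monic[of x] by (simp add: g_def flip: lessThan_Suc_atMost)
 finally have "x ^ g = - (\<Sum>i<g. coeff (gpoly x) i * x ^ i)" by (simp add: eq_neg_iff_add_eq_0 add.commute)
 hence "v (x ^ g) = v (- (\<Sum>i<g. coeff (gpoly x) i * x ^ i))" by (rule arg_cong)
 also have "... = v (\<Sum>i<g. coeff (gpoly x) i * x ^ i)"
  by (intro v.v_minus K.sum_in K.mult_in K.power_in cK x)
 also have "... \<le> v x ^ (g - 1)"
 proof (rule v.v_sum_ultrametric)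
  show "v (of_nat n) \<le> 1" for n by (rule place_ultrametric_nat[OF v p])
  show "0 \<le> v x ^ (g - 1)" using gt by simp
  fix i assume i: "i \<in> {..<g}"
  show "coeff (gpoly x) i * x ^ i \<in> K" by (intro K.mult_in K.power_in cK x)
  have "v (coeff (gpoly x) i) * v x ^ i \<le> 1 * v x ^ (g - 1)"
   using i gt by (intro mult_mono int power_increasing v.v_nonneg cK) auto
  thus "v (coeff (gpoly x) i * x ^ i) \<le> v x ^ (g - 1)" by (simp add: v.v_mult v.v_power cK x K.power_in)
 qed
 finally have "v x ^ g \<le> v x ^ (g - 1)" by (simp add: v.v_power x)
 hence "g \<le> g - 1" using gt by (simp add: power_le_imp_le_exp)
 thus False using g by simp
qed

text \<open>Away from the primes in the coefficients of the characteristic polynomials of x and of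
  1/x both are integral, so x has absolute value 1.\<close>

lemma finite_psupp: assumes x: "x \<in> K" "x \<noteq> 0" shows "finite (psupp K x)"
proof -
 have xM: "x \<in> M" "inverse x \<in> M" using x K_le inverse_in by auto
 define Q where "Q = (\<lambda>y. {q. q \<noteq> 0 \<and> (\<exists>i. of_rat q = coeff (gpoly y) i)})"
 have finQ: "finite (Q y)" for y
 proof -
  have "of_rat ` Q y \<subseteq> coeff (gpoly y) ` {..degree (gpoly y)}"
  proof
   fix z :: complex assume "z \<in> of_rat ` Q y"
   then obtain q where q: "z = of_rat q" "q \<in> Q y" by blast
   obtain i where i: "q \<noteq> 0" "of_rat q = coeff (gpoly y) i" using q(2) by (auto simp: Q_def)
   have "coeff (gpoly y) i \<noteq> 0" unfolding i(2)[symmetric] using i(1) by simp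
   hence "i \<le> degree (gpoly y)" by (rule le_degree)
   thus "z \<in> coeff (gpoly y) ` {..degree (gpoly y)}" unfolding q(1) i(2) by blast
  qed
  hence "finite (of_rat ` Q y :: complex set)" by (rule finite_subset) simp
  thus ?thesis by (rule finite_imageD) (auto simp: inj_on_def)
 qed
 \<comment> \<open>The index 0 is included outright, so that all remaining indices are
   primes.\<close>
 define P where "P = insert 0 (\<Union>y\<in>{x, inverse x}. \<Union>q\<in>Q y. bad_primes q)"
 have "finite P" unfolding P_def using finQ finite_bad_primes by simp
 moreover have "psupp K x \<subseteq> P"
 proof
  fix p assume "p \<in> psupp K x"
  then obtain v where v: "p \<in> place_ids" "v \<in> places_over K p" "v x \<noteq> 1" by (auto simp: psupp_def)
  interpret v: absval K v by (rule places_overD[OF v(2) K.csubfield_axioms])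
  show "p \<in> P"
  proof (rule ccontr)
   assume np: "p \<notin> P"
   hence pr: "Factorial_Ring.prime p" using v(1) by (auto simp: P_def place_ids_def)
   have le: "v y \<le> 1" if y: "y \<in> {x, inverse x}" for y
   proof (rule integral_le_1[OF _ pr v(2)])
    show yK: "y \<in> K" using y x K.inverse_in by auto
    have yM: "y \<in> M" using yK K_le by blast
    fix i
    have "coeff (gpoly y) i \<in> \<rat>" using gpoly_over[OF yM] by (simp add: poly_over_def)
    then obtain q where q: "coeff (gpoly y) i = of_rat q" by (auto elim: Rats_cases)
    show "v (coeff (gpoly y) i) \<le> 1"
    proof (cases "q = 0")
     case True
     thus ?thesis by (simp add: q)
    next
     case False
     hence "q \<in> Q y" using q by (auto simp: Q_def intro!: exI[of _ i])
     hence "bad_primes q \<subseteq> (\<Union>q\<in>Q y. bad_primes q)" by blast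
     also have "... \<subseteq> P" unfolding P_def using y by blast
     finally have "bad_primes q \<subseteq> P" .
     hence "p \<notin> bad_primes q" using np by blast
     hence "rat_abs p q = 1" by (rule rat_abs_eq_1[OF False pr])
     thus ?thesis unfolding q using places_overD(2)[OF v(2) K.csubfield_axioms] by simp
    qed
   qed
   have "v x \<le> 1" "inverse (v x) \<le> 1" using le[of x] le[of "inverse x"] x by (simp_all add: v.v_inverse)
   moreover have "0 < v x" by (rule v.v_pos[OF x])
   ultimately have "v x = 1" by (simp add: inverse_le_1_iff)
   thus False using v(3) by simp
  qed
 qed
 ultimately show ?thesis by (rule finite_subset[rotated])
qed

lemma norm_rat: "x \<in> M ==> (\<Prod>s\<in>G. s x) \<in> \<rat>"
proof -
 assume x: "x \<in> M"
 have "coeff (gpoly x) 0 \<in> \<rat>" using gpoly_over[OF x] by (simp add: poly_over_def)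
 also have "coeff (gpoly x) 0 = (\<Prod>s\<in>G. - s x)" by (simp add: gpoly_def coeff_0_prod_list poly_0_coeff_0[symmetric] poly_prod)
 also have "... = (- 1) ^ card G * (\<Prod>s\<in>G. s x)" by (simp add: prod.distrib[symmetric] flip: prod_constant)
 finally show ?thesis by (cases "even (card G)") auto
qed

text \<open>Averaged over \<open>G\<close>, the logarithms above p become that of the p-adic size of
  the norm, and the norm is rational.\<close>

lemma product_formula:
 assumes x: "x \<in> K" "x \<noteq> 0" and P: "finite P" "P \<subseteq> place_ids" "psupp K x \<subseteq> P" "0 \<in> P"
 shows "psum K P (\<lambda>v. ln (v x)) = 0"
proof -
 have xM: "x \<in> M" using x K_le by blast
 obtain q where q: "(\<Prod>s\<in>G. s x) = of_rat q" using norm_rat[OF xM] unfolding Rats_def by blast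
 have sx0: "s x \<noteq> 0" if "s \<in> G" for s using csubfield_hom.hom_eq_0_iff[OF G_hom[OF that] xM] x by simp
 have q0: "q \<noteq> 0"
 proof
  assume "q = 0"
  hence "(\<Prod>s\<in>G. s x) = 0" using q by simp
  thus False using sx0 finite_G by (simp add: prod_zero_iff)
 qed
 \<comment> \<open>The norm may involve other primes than \<open>P\<close>, so \<open>P\<close> is
   enlarged before the rational formula is applied.\<close>
 define P' where "P' = (P - {0}) \<union> bad_primes q"
 have P'fin: "finite P'" using P finite_bad_primes by (simp add: P'_def)
 have P'pr: "Factorial_Ring.prime p" if "p \<in> P'" for p using that P bad_primes_prime by (auto simp: P'_def place_ids_def)
 have P'0: "0 \<notin> P'" using P'pr[of 0] by auto
 have each: "(\<Sum>s\<in>G. ln ((\<lambda>y\<in>K. wp p (s y)) x)) = ln (rat_abs p q)" if p: "p \<in> place_ids" for p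
 proof -
  interpret w: absval M "wp p" by (rule places_overD[OF wp[OF p] csubfield_axioms])
  have pos: "0 < wp p (s x)" if "s \<in> G" for s
   by (rule w.v_pos[OF G_maps[OF that xM] sx0[OF that]])
  have "(\<Sum>s\<in>G. ln ((\<lambda>y\<in>K. wp p (s y)) x)) = (\<Sum>s\<in>G. ln (wp p (s x)))" using x by simp
  also have "... = ln (\<Prod>s\<in>G. wp p (s x))"
   using finite_G pos less_imp_neq[OF pos] by (subst ln_prod) auto
  also have "(\<Prod>s\<in>G. wp p (s x)) = wp p (\<Prod>s\<in>G. s x)" by (rule w.v_prod[symmetric]) (rule G_maps[OF _ xM])
  also have "... = rat_abs p q" unfolding q by (rule places_overD(2)[OF wp[OF p] csubfield_axioms])
  finally show ?thesis .
 qed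
 have sub: "insert 0 P' \<subseteq> place_ids" using P'pr by (auto simp: place_ids_def)
 have "psum K P (\<lambda>v. ln (v x)) = psum K (insert 0 P') (\<lambda>v. ln (v x))"
  unfolding psum_def
 proof (rule sum.mono_neutral_left)
  show "finite (insert 0 P')" using P'fin by simp
  show "P \<subseteq> insert 0 P'" by (auto simp: P'_def)
  show "\<forall>p\<in>insert 0 P' - P. (\<Sum>v\<in>places_over K p. nweight K v * ln (v x)) = 0"
  proof
   fix p assume p: "p \<in> insert 0 P' - P"
   hence "p \<notin> psupp K x" "p \<in> place_ids" using P sub by auto
   hence one: "v x = 1" if "v \<in> places_over K p" for v using that unfolding psupp_def by blast
   show "(\<Sum>v\<in>places_over K p. nweight K v * ln (v x)) = 0"
   proof (intro sum.neutral ballI)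
    fix v assume "v \<in> places_over K p"
    thus "nweight K v * ln (v x) = 0" using one[of v] by simp
   qed
  qed
 qed
 also have "... = (\<Sum>p\<in>insert 0 P'. ln (rat_abs p q)) / real (card G)"
  unfolding psum_eq[OF sub]
  by (intro arg_cong[of _ _ "\<lambda>t. t / real (card G)"] sum.cong refl each) (use sub in blast)
 also have "(\<Sum>p\<in>insert 0 P'. ln (rat_abs p q)) = 0"
  using product_formula_rat[OF q0 P'fin _ P'pr] P'fin P'0 by (simp add: P'_def)
 finally show ?thesis by simp
qed

end

section \<open>Forms as functions\<close>

definition mono_eval :: "('n option \<Rightarrow>\<^sub>0 nat) => complex ^ ('n::finite) option => complex" where
 "mono_eval m x = (\<Prod>i\<in>UNIV. x $ i ^ Poly_Mapping.lookup m i)"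

lemma mono_eval_add: "mono_eval (m + n) x = mono_eval m x * mono_eval n x"
 by (simp add: mono_eval_def lookup_add power_add prod.distrib)

lemma mono_eval_0 [simp]: "mono_eval 0 x = 1" by (simp add: mono_eval_def)

lemma mono_eval_scale: "mono_eval m (c *s x) = c ^ mono_degree m * mono_eval m x"
 by (simp add: mono_eval_def mono_degree_def power_mult_distrib prod.distrib power_sum)

lemma eval_form_superset:
 assumes "finite S" "Poly_Mapping.keys F \<subseteq> S"
 shows "eval_form F x = (\<Sum>m\<in>S. Poly_Mapping.lookup F m * mono_eval m x)"
 unfolding eval_form_def mono_eval_def using assms
 by (intro sum.mono_neutral_left) (auto simp: in_keys_iff)

lemma eval_form_add: "eval_form (F + G) x = eval_form F x + eval_form G x"
proof -
 let ?S = "Poly_Mapping.keys F \<union> Poly_Mapping.keys G"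
 have "eval_form (F + G) x = (\<Sum>m\<in>?S. Poly_Mapping.lookup (F + G) m * mono_eval m x)"
  by (rule eval_form_superset) (use Poly_Mapping.keys_add[of F G] in auto)
 also have "... = (\<Sum>m\<in>?S. Poly_Mapping.lookup F m * mono_eval m x) + (\<Sum>m\<in>?S. Poly_Mapping.lookup G m * mono_eval m x)"
  by (simp add: lookup_add algebra_simps sum.distrib)
 also have "... = eval_form F x + eval_form G x"
  by (subst (1 2) eval_form_superset[of ?S]) auto
 finally show ?thesis .
qed

lemma eval_form_0 [simp]: "eval_form 0 x = 0" by (simp add: eval_form_def)

lemma eval_form_sum: "eval_form (sum F I) x = (\<Sum>i\<in>I. eval_form (F i) x)"
 by (induction I rule: infinite_finite_induct) (simp_all add: eval_form_add)

lemma eval_form_single: "eval_form (Poly_Mapping.single m c) x = c * mono_eval m x"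
 by (subst eval_form_superset[of "{m}"]) (auto simp: lookup_single)

lemma form_sum_single: "F = (\<Sum>m\<in>Poly_Mapping.keys F. Poly_Mapping.single m (Poly_Mapping.lookup F m))"
proof (rule poly_mapping_eqI)
 fix k
 show "Poly_Mapping.lookup F k = Poly_Mapping.lookup (\<Sum>m\<in>Poly_Mapping.keys F. Poly_Mapping.single m (Poly_Mapping.lookup F m)) k"
  by (simp add: lookup_sum lookup_single when_def in_keys_iff)
qed

lemma eval_form_mult: "eval_form (F * G) x = eval_form F x * eval_form G x"
proof -
 have "F * G = (\<Sum>m\<in>Poly_Mapping.keys F. \<Sum>n\<in>Poly_Mapping.keys G.
   Poly_Mapping.single (m + n) (Poly_Mapping.lookup F m * Poly_Mapping.lookup G n))"
  by (subst (1) form_sum_single[of F], subst (1) form_sum_single[of G])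
   (simp only: sum_distrib_left sum_distrib_right mult_single sum.swap[of _ "Poly_Mapping.keys F"])
 hence "eval_form (F * G) x = (\<Sum>m\<in>Poly_Mapping.keys F. \<Sum>n\<in>Poly_Mapping.keys G.
   (Poly_Mapping.lookup F m * mono_eval m x) * (Poly_Mapping.lookup G n * mono_eval n x))"
  by (simp add: eval_form_sum eval_form_single mono_eval_add mult_ac)
 also have "... = eval_form F x * eval_form G x"
  unfolding eval_form_def mono_eval_def[symmetric] by (simp add: sum_product)
 finally show ?thesis .
qed

lemma eval_form_1 [simp]: "eval_form 1 x = 1"
 using eval_form_single[of 0 1 x] by simp

lemma eval_form_power: "eval_form (F ^ k) x = eval_form F x ^ k"
 by (induction k) (simp_all add: eval_form_mult)

lemma eval_form_prod: "eval_form (prod F I) x = (\<Prod>i\<in>I. eval_form (F i) x)"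
 by (induction I rule: infinite_finite_induct) (simp_all add: eval_form_mult)

lemma eval_form_smult: "eval_form (form_smult c F) x = c * eval_form F x"
 by (simp add: form_smult_def eval_form_mult eval_form_single)

definition eval_tuple :: "('n option => ('n::finite) form) => complex ^ 'n option => complex ^ 'n option" where
 "eval_tuple \<Phi> x = (\<chi> i. eval_form (\<Phi> i) x)"

lemma eval_subst_form: "eval_form (subst_form \<Phi> F) x = eval_form F (eval_tuple \<Phi> x)"
 unfolding subst_form_def eval_form_sum eval_form_smult eval_form_prod eval_form_power
 by (simp add: eval_form_def[of F] eval_tuple_def)

lemma eval_tuple_comp: "eval_tuple (comp_morphism \<Phi> \<Psi>) x = eval_tuple \<Phi> (eval_tuple \<Psi> x)"
 by (simp add: eval_tuple_def[of "\<lambda>i. subst_form \<Psi> (\<Phi> i)"] eval_tuple_def[of \<Phi>] comp_morphism_def eval_subst_form)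

lemma eval_tuple_id: "eval_tuple id_morphism x = x"
proof -
 have "mono_eval (Poly_Mapping.single i 1) x = x $ i" for i
 proof -
  have "mono_eval (Poly_Mapping.single i 1) x = (\<Prod>j\<in>UNIV. if j = i then x $ j else 1)"
   unfolding mono_eval_def by (intro prod.cong refl) (auto simp: lookup_single when_def)
  thus ?thesis by simp
 qed
 thus ?thesis by (simp add: eval_tuple_def id_morphism_def eval_form_single vec_eq_iff)
qed

lemma eval_tuple_iter: "eval_tuple (iter_morphism n \<Psi>) x = (eval_tuple \<Psi> ^^ n) x"
 by (induction n) (simp_all add: iter_morphism_def eval_tuple_id eval_tuple_comp)

lemma homogeneous_eval_scale:
 assumes "homogeneous e F" shows "eval_form F (c *s x) = c ^ e * eval_form F x"
 unfolding eval_form_def mono_eval_def[symmetric] sum_distrib_left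
 using assms by (intro sum.cong refl) (auto simp: mono_eval_scale homogeneous_def)

definition mons :: "nat => (('n::finite) option \<Rightarrow>\<^sub>0 nat) set" where
 "mons e = {m. mono_degree m = e}"

lemma mono_degree_add: "mono_degree (m + n) = mono_degree m + mono_degree n"
 by (simp add: mono_degree_def lookup_add sum.distrib)

text \<open>Stars and bars: listing the exponents turns monomials into lists of length N + 1 with
  sum e.\<close>

lemma card_mons: "finite (mons e :: (('n::finite) option \<Rightarrow>\<^sub>0 nat) set)"
 "card (mons e :: (('n::finite) option \<Rightarrow>\<^sub>0 nat) set) = (e + CARD('n)) choose CARD('n)"
proof -
 obtain xs :: "'n option list" where xs: "set xs = UNIV" "distinct xs" using finite_distinct_list[of "UNIV :: 'n option set"] by auto
 have len: "length xs = Suc CARD('n)" using distinct_card[OF xs(2)] xs(1) by simp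
 define L where "L = {l :: nat list. length l = Suc CARD('n) \<and> sum_list l = e}"
 define f where "f = (\<lambda>m :: 'n option \<Rightarrow>\<^sub>0 nat. map (Poly_Mapping.lookup m) xs)"
 have sl: "sum_list (map g xs) = (\<Sum>i\<in>UNIV. g i)" for g :: "'n option => nat"
  using sum_list_distinct_conv_sum_set[OF xs(2), of g] xs(1) by simp
 have bij: "bij_betw f (mons e) L"
 proof (rule bij_betwI')
  fix m n :: "'n option \<Rightarrow>\<^sub>0 nat" assume "m \<in> mons e" "n \<in> mons e"
  show "f m = f n \<longleftrightarrow> m = n"
  proof
   assume "f m = f n"
   hence "\<forall>i\<in>set xs. Poly_Mapping.lookup m i = Poly_Mapping.lookup n i" unfolding f_def by (rule map_eq_conv[THEN iffD1])
   thus "m = n" using xs(1) by (intro poly_mapping_eqI) simp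
  qed simp
 next
  fix m :: "'n option \<Rightarrow>\<^sub>0 nat" assume "m \<in> mons e"
  thus "f m \<in> L" by (simp add: L_def f_def len sl mons_def mono_degree_def)
 next
  fix l assume l: "l \<in> L"
  define g where "g = (\<lambda>i. l ! (THE k. k < length xs \<and> xs ! k = i))"
  have g: "g (xs ! k) = l ! k" if "k < length xs" for k
  proof -
   have "(THE k'. k' < length xs \<and> xs ! k' = xs ! k) = k"
    using that xs(2) by (intro the_equality) (auto simp: nth_eq_iff_index_eq)
   thus ?thesis by (simp add: g_def)
  qed
  have lk: "Poly_Mapping.lookup (Abs_poly_mapping g) = g" by (rule lookup_Abs_poly_mapping) simp
  have mg: "map g xs = l" using l g len by (intro nth_equalityI) (auto simp: L_def)
  have "f (Abs_poly_mapping g) = l" unfolding f_def lk by (rule mg)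
  moreover have "Abs_poly_mapping g \<in> mons e"
   using l sl[of g] unfolding mons_def mono_degree_def lk by (simp add: mg L_def)
  ultimately show "\<exists>m\<in>mons e. l = f m" by blast
 qed
 have "card L = (e + CARD('n)) choose e" unfolding L_def by (subst card_length_sum_list) simp
 also have "... = (e + CARD('n)) choose CARD('n)" using binomial_symmetric[of e "e + CARD('n)"] by simp
 finally have cL: "card L = (e + CARD('n)) choose CARD('n)" .
 hence "finite L" using card_ge_0_finite[of L] by simp
 thus "finite (mons e :: ('n option \<Rightarrow>\<^sub>0 nat) set)" using bij_betw_finite[OF bij] by simp
 show "card (mons e :: ('n option \<Rightarrow>\<^sub>0 nat) set) = (e + CARD('n)) choose CARD('n)"
  using bij_betw_same_card[OF bij] cL by simp
qed

declare card_mons(1) [simp]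

lemma base_expansion_inj:
 fixes a c :: "nat => nat"
 assumes "(\<Sum>i<N. a i * b ^ i) = (\<Sum>i<N. c i * b ^ i)" "\<And>i. i < N ==> a i < b" "\<And>i. i < N ==> c i < b" "i < N"
 shows "a i = c i"
 using assms
proof (induction N arbitrary: a c i)
 case (Suc N)
 have b0: "b > 0" using Suc.prems(2)[of 0] by simp
 have e: "(\<Sum>i<Suc N. f i * b ^ i) = f 0 + b * (\<Sum>i<N. f (Suc i) * b ^ i)" for f :: "nat => nat"
  by (simp add: sum.lessThan_Suc_shift sum_distrib_left mult_ac del: sum.lessThan_Suc)
 have m: "a 0 + b * (\<Sum>i<N. a (Suc i) * b ^ i) = c 0 + b * (\<Sum>i<N. c (Suc i) * b ^ i)"
  using Suc.prems(1) unfolding e .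
 have "a 0 = c 0" using arg_cong[OF m, of "\<lambda>x. x mod b"] Suc.prems(2)[of 0] Suc.prems(3)[of 0] by simp
 hence "(\<Sum>i<N. a (Suc i) * b ^ i) = (\<Sum>i<N. c (Suc i) * b ^ i)" using m b0 by simp
 hence "a (Suc j) = c (Suc j)" if "j < N" for j
  using Suc.IH[of "\<lambda>i. a (Suc i)" "\<lambda>i. c (Suc i)" j] Suc.prems(2,3) that by simp
 thus ?case using \<open>a 0 = c 0\<close> Suc.prems(4) by (cases i) auto
qed simp

text \<open>Kronecker substitution turns distinct monomials into distinct powers of one variable.\<close>

lemma mono_eval_independent:
 fixes c :: "('n::finite option \<Rightarrow>\<^sub>0 nat) => complex"
 assumes S: "finite S" and zero: "\<And>x. (\<Sum>m\<in>S. c m * mono_eval m x) = 0" and m: "m \<in> S"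
 shows "c m = 0"
proof -
 obtain xs :: "'n option list" where xs: "set xs = UNIV" "distinct xs" using finite_distinct_list[of "UNIV :: 'n option set"] by auto
 define b where "b = Suc (Max (insert 0 ((\<lambda>(m, i). Poly_Mapping.lookup m i) ` (S \<times> UNIV))))"
 have b: "Poly_Mapping.lookup m i < b" if "m \<in> S" for m i
  unfolding b_def less_Suc_eq_le using S that by (intro Max_ge) force+
 define N where "N = length xs"
 define E where "E = (\<lambda>m. \<Sum>k<N. Poly_Mapping.lookup m (xs ! k) * b ^ k)"
 have bij: "bij_betw ((!) xs) {..<N} UNIV" using bij_betw_nth[OF xs(2), of "{..<N}" UNIV] xs(1) by (simp add: N_def)
 have Einj: "inj_on E S"
 proof (rule inj_onI)
  fix m n assume mn: "m \<in> S" "n \<in> S" "E m = E n"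
  show "m = n"
  proof (rule poly_mapping_eqI)
   fix i
   obtain k where k: "k < N" "i = xs ! k" using bij_betw_imp_surj_on[OF bij] by (auto simp: set_eq_iff image_iff)
   have "Poly_Mapping.lookup m (xs ! k) = Poly_Mapping.lookup n (xs ! k)"
    using base_expansion_inj[where a = "\<lambda>k. Poly_Mapping.lookup m (xs ! k)" and c = "\<lambda>k. Poly_Mapping.lookup n (xs ! k)"
      and N = N and b = b and i = k] mn b k by (simp add: E_def)
   thus "Poly_Mapping.lookup m i = Poly_Mapping.lookup n i" using k by simp
  qed
 qed
 define pos where "pos = inv_into {..<N} ((!) xs)"
 have mono_t: "mono_eval m (\<chi> i. t ^ (b ^ pos i)) = t ^ E m" for m t
 proof -
  have "mono_eval m (\<chi> i. t ^ (b ^ pos i)) = (\<Prod>i\<in>UNIV. t ^ (b ^ pos i * Poly_Mapping.lookup m i))"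
   by (simp add: mono_eval_def power_mult)
  also have "... = (\<Prod>k<N. t ^ (b ^ pos (xs ! k) * Poly_Mapping.lookup m (xs ! k)))"
   by (rule prod.reindex_bij_betw[OF bij, symmetric])
  also have "... = (\<Prod>k<N. t ^ (Poly_Mapping.lookup m (xs ! k) * b ^ k))"
   using bij by (intro prod.cong refl) (simp add: pos_def bij_betw_def mult.commute)
  finally show ?thesis by (simp add: E_def power_sum)
 qed
 define p where "p = (\<Sum>m\<in>S. monom (c m) (E m))"
 have "poly p t = 0" for t
  using zero[of "\<chi> i. t ^ (b ^ pos i)"] unfolding mono_t by (simp add: p_def poly_sum poly_monom)
 hence "p = 0" using poly_all_0_iff_0[of p] by blast
 hence "coeff p (E m) = 0" by simp
 also have "coeff p (E m) = (\<Sum>n\<in>S. if n = m then c n else 0)"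
  unfolding p_def coeff_sum using m Einj by (intro sum.cong refl) (auto simp: inj_on_def)
 finally show ?thesis using S m by simp
qed

text \<open>Forms are handled as functions, so identities between them can be proved pointwise. The
  zero function belongs to every degree.\<close>

definition hpoly :: "complex set => nat => (complex ^ ('n::finite) option => complex) set" where
 "hpoly F e = {\<lambda>x. \<Sum>m\<in>mons e. c m * mono_eval m x |c. \<forall>m. c m \<in> F}"

lemma hpoly_UNIV: "f \<in> hpoly F e ==> f \<in> hpoly UNIV e" unfolding hpoly_def by blast

lemma hpoly_scale: assumes "f \<in> hpoly F e" shows "f (c *s x) = c ^ e * f x"
proof -
 obtain a where f: "f = (\<lambda>x. \<Sum>m\<in>mons e. a m * mono_eval m x)" using assms unfolding hpoly_def by blast
 show ?thesis unfolding f sum_distrib_left by (intro sum.cong refl) (simp add: mono_eval_scale mons_def)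
qed

context csubfield
begin

lemma hpoly_0: "(\<lambda>x. 0) \<in> hpoly F e"
 unfolding hpoly_def by (intro CollectI exI[of _ "\<lambda>_. 0"]) simp

lemma hpoly_add: assumes "f \<in> hpoly F e" "g \<in> hpoly F e" shows "(\<lambda>x. f x + g x) \<in> hpoly F e"
proof -
 obtain a b where "f = (\<lambda>x. \<Sum>m\<in>mons e. a m * mono_eval m x)" "\<forall>m. a m \<in> F"
  "g = (\<lambda>x. \<Sum>m\<in>mons e. b m * mono_eval m x)" "\<forall>m. b m \<in> F" using assms unfolding hpoly_def by blast
 thus ?thesis unfolding hpoly_def
  by (intro CollectI exI[of _ "\<lambda>m. a m + b m"]) (auto simp: add_in algebra_simps sum.distrib)
qed

lemma hpoly_smult: assumes "f \<in> hpoly F e" "c \<in> F" shows "(\<lambda>x. c * f x) \<in> hpoly F e"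
proof -
 obtain a where "f = (\<lambda>x. \<Sum>m\<in>mons e. a m * mono_eval m x)" "\<forall>m. a m \<in> F" using assms unfolding hpoly_def by blast
 thus ?thesis unfolding hpoly_def using assms(2)
  by (intro CollectI exI[of _ "\<lambda>m. c * a m"]) (auto simp: mult_in sum_distrib_left mult_ac)
qed

lemma hpoly_sum: "(\<And>i. i \<in> I ==> f i \<in> hpoly F e) ==> (\<lambda>x. \<Sum>i\<in>I. f i x) \<in> hpoly F e"
proof (induction I rule: infinite_finite_induct)
 case (insert i I)
 have "(\<lambda>x. f i x + (\<Sum>i\<in>I. f i x)) \<in> hpoly F e" using insert by (intro hpoly_add) auto
 thus ?case using insert.hyps by simp
qed (simp_all add: hpoly_0)

lemma hpoly_mono: assumes "m \<in> mons e" shows "mono_eval m \<in> hpoly F e"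
 unfolding hpoly_def
proof (intro CollectI exI[of _ "\<lambda>n. if n = m then 1 else 0"] conjI)
 show "mono_eval m = (\<lambda>x. \<Sum>n\<in>mons e. (if n = m then 1 else 0) * mono_eval n x)"
  using assms by (simp add: fun_eq_iff if_distrib[of "\<lambda>c. c * _"] cong: if_cong)
qed auto

lemma hpoly_const: "c \<in> F ==> (\<lambda>x. c) \<in> hpoly F 0"
 using hpoly_smult[OF hpoly_mono[of 0 0], of c] by (simp add: mons_def mono_degree_def)

lemma hpoly_var:
 fixes i :: "('n::finite) option"
 shows "(\<lambda>x. x $ i) \<in> hpoly F 1"
proof -
 have A: "mono_eval (Poly_Mapping.single i 1) = (\<lambda>x. x $ i)"
 proof
  fix x :: "complex ^ 'n option"
  have "mono_eval (Poly_Mapping.single i 1) x = (\<Prod>j\<in>UNIV. if j = i then x $ j else 1)"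
   unfolding mono_eval_def by (intro prod.cong refl) (auto simp: lookup_single when_def)
  thus "mono_eval (Poly_Mapping.single i 1) x = x $ i" by simp
 qed
 have B: "Poly_Mapping.single i 1 \<in> mons 1"
 proof -
  have "(\<Sum>j\<in>UNIV. Poly_Mapping.lookup (Poly_Mapping.single i (1::nat)) j) = (\<Sum>j\<in>UNIV. if j = i then 1 else 0)"
   by (intro sum.cong refl) (auto simp: lookup_single when_def)
  thus ?thesis by (simp add: mons_def mono_degree_def)
 qed
 show ?thesis using hpoly_mono[OF B] by (simp only: A)
qed

lemma hpoly_mult: assumes "f \<in> hpoly F e" "g \<in> hpoly F e'" shows "(\<lambda>x. f x * g x) \<in> hpoly F (e + e')"
proof -
 obtain a b where a: "f = (\<lambda>x. \<Sum>m\<in>mons e. a m * mono_eval m x)" "\<forall>m. a m \<in> F"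
  and b: "g = (\<lambda>x. \<Sum>m\<in>mons e'. b m * mono_eval m x)" "\<forall>m. b m \<in> F" using assms unfolding hpoly_def by blast
 have "(\<lambda>x. f x * g x) = (\<lambda>x. \<Sum>m\<in>mons e. \<Sum>n\<in>mons e'. (a m * b n) * mono_eval (m + n) x)"
  unfolding a(1) b(1) by (simp add: fun_eq_iff sum_product mono_eval_add mult_ac)
 also have "... \<in> hpoly F (e + e')"
  using a(2) b(2) by (intro hpoly_sum hpoly_smult hpoly_mono mult_in) (auto simp: mons_def mono_degree_add)
 finally show ?thesis .
qed

lemma hpoly_power: "f \<in> hpoly F e ==> (\<lambda>x. f x ^ k) \<in> hpoly F (k * e)"
proof (induction k)
 case 0
 show ?case using hpoly_const[of 1] by simp
next
 case (Suc k)
 thus ?case using hpoly_mult[of f e "\<lambda>x. f x ^ k" "k * e"] by simp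
qed

lemma hpoly_prod: "finite I ==> (\<And>i. i \<in> I ==> f i \<in> hpoly F (e i)) ==> (\<lambda>x. \<Prod>i\<in>I. f i x) \<in> hpoly F (\<Sum>i\<in>I. e i)"
proof (induction I rule: finite_induct)
 case empty
 show ?case using hpoly_const[of 1] by simp
next
 case (insert i I)
 have "(\<lambda>x. f i x * (\<Prod>i\<in>I. f i x)) \<in> hpoly F (e i + (\<Sum>i\<in>I. e i))" using insert by (intro hpoly_mult) auto
 thus ?case using insert.hyps by simp
qed

lemma hpoly_compose:
 fixes P :: "complex ^ ('m::finite) option => complex ^ ('n::finite) option"
 assumes f: "f \<in> hpoly F e" and P: "\<And>i. (\<lambda>x. P x $ i) \<in> hpoly F d"
 shows "(\<lambda>x. f (P x)) \<in> hpoly F (e * d)"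
proof -
 obtain a where a: "f = (\<lambda>x. \<Sum>m\<in>mons e. a m * mono_eval m x)" "\<forall>m. a m \<in> F" using f unfolding hpoly_def by blast
 have "(\<lambda>x. mono_eval m (P x)) \<in> hpoly F (e * d)" if m: "m \<in> mons e" for m
 proof -
  have "(\<lambda>x. \<Prod>i\<in>UNIV. (P x $ i) ^ Poly_Mapping.lookup m i) \<in> hpoly F (\<Sum>i\<in>UNIV. Poly_Mapping.lookup m i * d)"
   by (intro hpoly_prod hpoly_power P) simp
  thus ?thesis using m by (simp add: mono_eval_def mons_def mono_degree_def sum_distrib_right[symmetric])
 qed
 thus ?thesis unfolding a(1) using a(2) by (intro hpoly_sum hpoly_smult) auto
qed

lemma hpoly_eval_form: assumes "homogeneous e G" "coeffs_in F G" shows "eval_form G \<in> hpoly F e"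
proof -
 have "eval_form G = (\<lambda>x. \<Sum>m\<in>mons e. Poly_Mapping.lookup G m * mono_eval m x)"
  using assms(1) by (intro ext eval_form_superset card_mons(1)) (auto simp: homogeneous_def mons_def)
 thus ?thesis using assms(2) unfolding hpoly_def coeffs_in_def by blast
qed

lemma hpoly_to_form: assumes "f \<in> hpoly F e" obtains G where "homogeneous e G" "coeffs_in F G" "eval_form G = f"
proof -
 obtain a where a: "f = (\<lambda>x. \<Sum>m\<in>mons e. a m * mono_eval m x)" "\<forall>m. a m \<in> F" using assms unfolding hpoly_def by blast
 define G where "G = (\<Sum>m\<in>mons e. Poly_Mapping.single m (a m))"
 have lk: "Poly_Mapping.lookup G k = (if k \<in> mons e then a k else 0)" for k
  by (simp add: G_def lookup_sum lookup_single when_def)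
 have "eval_form G = f" unfolding G_def a(1) by (simp add: fun_eq_iff eval_form_sum eval_form_single)
 moreover have "homogeneous e G" unfolding homogeneous_def by (auto simp: in_keys_iff lk mons_def split: if_splits)
 moreover have "coeffs_in F G" unfolding coeffs_in_def lk using a(2) by simp
 ultimately show thesis using that by blast
qed

text \<open>Elimination uses only field operations on the coefficients, and a complex solution
  \<open>z\<close> certifies that no contradictory equation is left at the end.\<close>

lemma linear_system_descent:
 fixes a :: "'e => 'u => complex"
 assumes "finite E" "finite U" "\<And>e u. e \<in> E ==> u \<in> U ==> a e u \<in> F" "\<And>e. e \<in> E ==> b e \<in> F"
  "\<And>e. e \<in> E ==> (\<Sum>u\<in>U. a e u * z u) = b e"
 shows "\<exists>x. (\<forall>u. x u \<in> F) \<and> (\<forall>e\<in>E. (\<Sum>u\<in>U. a e u * x u) = b e)"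
 using assms
proof (induction E arbitrary: U a b rule: finite_induct)
 case empty
 show ?case by (intro exI[of _ "\<lambda>_. 0"]) simp
next
 case (insert e0 E)
 have aF: "a e u \<in> F" if "e \<in> insert e0 E" "u \<in> U" for e u using insert.prems(2)[OF that] .
 have bF: "b e \<in> F" if "e \<in> insert e0 E" for e using insert.prems(3)[OF that] .
 have sol: "(\<Sum>u\<in>U. a e u * z u) = b e" if "e \<in> insert e0 E" for e using insert.prems(4)[OF that] .
 show ?case
 proof (cases "\<forall>u\<in>U. a e0 u = 0")
  case True
  have "\<exists>x. (\<forall>u. x u \<in> F) \<and> (\<forall>e\<in>E. (\<Sum>u\<in>U. a e u * x u) = b e)"
   by (rule insert.IH[OF insert.prems(1)]) (simp_all add: aF bF sol)
  then obtain x where x: "\<forall>u. x u \<in> F" "\<forall>e\<in>E. (\<Sum>u\<in>U. a e u * x u) = b e" by blast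
  have "b e0 = 0" using sol[of e0] True by simp
  hence "(\<Sum>u\<in>U. a e0 u * x u) = b e0" using True by simp
  with x show ?thesis by blast
 next
  case False
  then obtain u0 where u0: "u0 \<in> U" "a e0 u0 \<noteq> 0" by blast
  define U' where "U' = U - {u0}"
  define r where "r = (\<lambda>e. a e u0 / a e0 u0)"
  define a' where "a' = (\<lambda>e u. a e u - r e * a e0 u)"
  define b' where "b' = (\<lambda>e. b e - r e * b e0)"
  have rF: "r e \<in> F" if "e \<in> E" for e unfolding r_def using that u0 by (intro divide_in aF) auto
  have split: "(\<Sum>u\<in>U. a e u * x u) = a e u0 * x u0 + (\<Sum>u\<in>U'. a e u * x u)" for e x
   using u0 insert.prems(1) by (simp add: U'_def sum.remove[of U u0])
  have elim: "(\<Sum>u\<in>U'. a' e u * x u) = (\<Sum>u\<in>U. a e u * x u) - r e * (\<Sum>u\<in>U. a e0 u * x u)" for e x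
  proof -
   have "(\<Sum>u\<in>U'. a' e u * x u) = (\<Sum>u\<in>U'. a e u * x u) - r e * (\<Sum>u\<in>U'. a e0 u * x u)"
    by (simp add: a'_def algebra_simps sum_distrib_left sum_subtractf)
   thus ?thesis unfolding split using u0 by (simp add: r_def algebra_simps)
  qed
  have "\<exists>x. (\<forall>u. x u \<in> F) \<and> (\<forall>e\<in>E. (\<Sum>u\<in>U'. a' e u * x u) = b' e)"
  proof (rule insert.IH)
   show "finite U'" using insert.prems(1) by (simp add: U'_def)
   show "a' e u \<in> F" if "e \<in> E" "u \<in> U'" for e u
    unfolding a'_def using that by (intro diff_in mult_in rF aF) (auto simp: U'_def)
   show "b' e \<in> F" if "e \<in> E" for e unfolding b'_def using that by (intro diff_in mult_in rF bF) auto
   show "(\<Sum>u\<in>U'. a' e u * z u) = b' e" if "e \<in> E" for e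
    unfolding elim using sol[of e] sol[of e0] that by (simp add: b'_def)
  qed
  then obtain x where x: "\<forall>u. x u \<in> F" "\<forall>e\<in>E. (\<Sum>u\<in>U'. a' e u * x u) = b' e" by blast
  define y where "y = x(u0 := (b e0 - (\<Sum>u\<in>U'. a e0 u * x u)) / a e0 u0)"
  have yU': "(\<Sum>u\<in>U'. c u * y u) = (\<Sum>u\<in>U'. c u * x u)" for c
   by (intro sum.cong refl) (auto simp: y_def U'_def)
  have e0: "(\<Sum>u\<in>U. a e0 u * y u) = b e0" unfolding split yU' using u0 by (simp add: y_def)
  have "(\<Sum>u\<in>U. a e u * y u) = b e" if "e \<in> E" for e
   using elim[of e y] x(2) that unfolding yU' e0 by (simp add: b'_def)
  moreover have "y u \<in> F" for u
   using x(1) u0 unfolding y_def by (auto intro!: divide_in diff_in sum_in mult_in aF bF simp: U'_def)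
  ultimately show ?thesis using e0 by (intro exI[of _ y]) auto
 qed
qed

text \<open>A relation with complex coefficients between forms over \<open>F\<close> can be chosen with coefficients in \<open>F\<close>,
 since comparing coefficients gives a linear system over \<open>F\<close>.\<close>

lemma hpoly_relation_descent:
 fixes P :: "'i => complex ^ ('n::finite) option => complex"
 assumes I: "finite I" and P: "\<And>i. i \<in> I ==> P i \<in> hpoly F d" and L: "L \<in> hpoly F (e + d)"
  and A: "\<And>i. i \<in> I ==> A i \<in> hpoly UNIV e" and rel: "\<And>x. L x = (\<Sum>i\<in>I. A i x * P i x)"
 shows "\<exists>A'. (\<forall>i. A' i \<in> hpoly F e) \<and> (\<forall>x. L x = (\<Sum>i\<in>I. A' i x * P i x))"
proof -
 have "\<forall>i\<in>I. \<exists>c. A i = (\<lambda>x. \<Sum>m\<in>mons e. c m * mono_eval m x)" using A unfolding hpoly_def by blast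
 from bchoice[OF this] obtain c where c0: "\<forall>i\<in>I. A i = (\<lambda>x. \<Sum>m\<in>mons e. c i m * mono_eval m x)" ..
 have c: "A i = (\<lambda>x. \<Sum>m\<in>mons e. c i m * mono_eval m x)" if "i \<in> I" for i using c0[rule_format, OF that] .
 have "\<forall>u\<in>I \<times> mons e. \<exists>b. (\<forall>k. b k \<in> F) \<and>
   (\<lambda>x. mono_eval (snd u) x * P (fst u) x) = (\<lambda>x. \<Sum>k\<in>mons (e + d). b k * mono_eval k x)"
 proof
  fix u :: "'i \<times> ('n option \<Rightarrow>\<^sub>0 nat)" assume "u \<in> I \<times> mons e"
  hence "(\<lambda>x. mono_eval (snd u) x * P (fst u) x) \<in> hpoly F (e + d)" by (intro hpoly_mult hpoly_mono P) auto
  thus "\<exists>b. (\<forall>k. b k \<in> F) \<and>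
   (\<lambda>x. mono_eval (snd u) x * P (fst u) x) = (\<lambda>x. \<Sum>k\<in>mons (e + d). b k * mono_eval k x)"
   unfolding hpoly_def by blast
 qed
 from bchoice[OF this] obtain B where B: "\<forall>u\<in>I \<times> mons e. (\<forall>k. B u k \<in> F) \<and>
   (\<lambda>x. mono_eval (snd u) x * P (fst u) x) = (\<lambda>x. \<Sum>k\<in>mons (e + d). B u k * mono_eval k x)" ..
 define b where "b = (\<lambda>i m. B (i, m))"
 have b: "(\<forall>k. b i m k \<in> F) \<and>
   (\<lambda>x. mono_eval m x * P i x) = (\<lambda>x. \<Sum>k\<in>mons (e + d). b i m k * mono_eval k x)"
  if "i \<in> I" "m \<in> mons e" for i m
  using bspec[OF B, of "(i, m)"] that unfolding b_def by simp
 obtain l where l: "\<forall>k. l k \<in> F" "L = (\<lambda>x. \<Sum>k\<in>mons (e + d). l k * mono_eval k x)" using L unfolding hpoly_def by blast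
 define U where "U = I \<times> (mons e :: ('n option \<Rightarrow>\<^sub>0 nat) set)"
 have finU: "finite U" using I by (simp add: U_def)
 have expand: "(\<Sum>i\<in>I. (\<Sum>m\<in>mons e. y (i, m) * mono_eval m x) * P i x)
   = (\<Sum>k\<in>mons (e + d). (\<Sum>(i, m)\<in>U. b i m k * y (i, m)) * mono_eval k x)" for y :: "'i \<times> ('n option \<Rightarrow>\<^sub>0 nat) => complex" and x
 proof -
  have "(\<Sum>i\<in>I. (\<Sum>m\<in>mons e. y (i, m) * mono_eval m x) * P i x) = (\<Sum>(i, m)\<in>U. y (i, m) * (mono_eval m x * P i x))"
   unfolding U_def by (simp add: sum.cartesian_product[symmetric] sum_distrib_right mult.assoc)
  also have "... = (\<Sum>(i, m)\<in>U. y (i, m) * (\<Sum>k\<in>mons (e + d). b i m k * mono_eval k x))"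
  proof (rule sum.cong[OF refl], clarify)
   fix i m assume "(i, m) \<in> U"
   hence "(\<lambda>x. mono_eval m x * P i x) = (\<lambda>x. \<Sum>k\<in>mons (e + d). b i m k * mono_eval k x)"
    using b by (simp add: U_def)
   from fun_cong[OF this, of x] show "y (i, m) * (mono_eval m x * P i x) = y (i, m) * (\<Sum>k\<in>mons (e + d). b i m k * mono_eval k x)" by simp
  qed
  also have "... = (\<Sum>k\<in>mons (e + d). \<Sum>(i, m)\<in>U. b i m k * y (i, m) * mono_eval k x)"
   unfolding sum_distrib_left case_prod_beta by (subst sum.swap) (simp add: mult_ac)
  finally show ?thesis by (simp add: sum_distrib_right case_prod_beta)
 qed
 have sol: "(\<Sum>(i, m)\<in>U. b i m k * c i m) = l k" if k: "k \<in> mons (e + d)" for k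
 proof -
  have "(\<Sum>k\<in>mons (e + d). ((\<Sum>(i, m)\<in>U. b i m k * c i m) - l k) * mono_eval k x) = 0" for x
  proof -
   have "(\<Sum>i\<in>I. (\<Sum>m\<in>mons e. c i m * mono_eval m x) * P i x) = L x"
    unfolding rel[of x] by (intro sum.cong refl) (simp add: c)
   thus ?thesis using expand[of "\<lambda>(i, m). c i m" x] unfolding l(2) by (simp add: left_diff_distrib sum_subtractf case_prod_beta)
  qed
  from mono_eval_independent[OF card_mons(1) this k] show ?thesis by simp
 qed
 have "\<exists>y. (\<forall>u. y u \<in> F) \<and> (\<forall>k\<in>mons (e + d). (\<Sum>u\<in>U. (\<lambda>(i, m). b i m k) u * y u) = l k)"
 proof (rule linear_system_descent[OF card_mons(1) finU])
  show "(\<lambda>(i, m). b i m k) u \<in> F" if "k \<in> mons (e + d)" "u \<in> U" for k u using that b by (auto simp: U_def)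
  show "l k \<in> F" for k using l by simp
  show "(\<Sum>u\<in>U. (\<lambda>(i, m). b i m k) u * (\<lambda>(i, m). c i m) u) = l k" if "k \<in> mons (e + d)" for k
   using sol[OF that] by (simp add: case_prod_beta)
 qed
 then obtain y where y: "\<forall>u. y u \<in> F" "\<forall>k\<in>mons (e + d). (\<Sum>u\<in>U. (\<lambda>(i, m). b i m k) u * y u) = l k" by blast
 define A' where "A' = (\<lambda>i x. \<Sum>m\<in>mons e. y (i, m) * mono_eval m x)"
 have "A' i \<in> hpoly F e" for i unfolding A'_def hpoly_def using y(1) by (intro CollectI exI[of _ "\<lambda>m. y (i, m)"] conjI) auto
 moreover have "L x = (\<Sum>i\<in>I. A' i x * P i x)" for x
 proof -
  have "(\<Sum>i\<in>I. A' i x * P i x) = (\<Sum>k\<in>mons (e + d). (\<Sum>(i, m)\<in>U. b i m k * y (i, m)) * mono_eval k x)"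
   unfolding A'_def by (rule expand)
  also have "... = (\<Sum>k\<in>mons (e + d). l k * mono_eval k x)"
   using y(2) by (intro sum.cong refl) (simp add: case_prod_beta)
  finally show ?thesis by (simp add: l(2))
 qed
 ultimately show ?thesis by blast
qed

end

lemma hpoly_line:
 assumes "f \<in> hpoly UNIV e" shows "\<exists>p. \<forall>t. poly p t = f (x + t *s y)"
proof -
 obtain a where a: "f = (\<lambda>x. \<Sum>m\<in>mons e. a m * mono_eval m x)" using assms unfolding hpoly_def by blast
 define p where "p = (\<Sum>m\<in>mons e. [:a m:] * (\<Prod>i\<in>UNIV. [:x $ i, y $ i:] ^ Poly_Mapping.lookup m i))"
 have "poly p t = f (x + t *s y)" for t
  unfolding p_def a by (simp add: poly_sum poly_prod poly_power mono_eval_def)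
 thus ?thesis by blast
qed

text \<open>On the line through a point where \<open>f\<close> is nonzero and a point where
  \<open>g\<close> is nonzero, both become nonzero polynomials in one variable with product
  0.\<close>

lemma hpoly_no_zero_divisors:
 assumes f: "f \<in> hpoly UNIV d" and g: "g \<in> hpoly UNIV e" and zero: "\<And>x. f x * g x = 0" and x: "f x \<noteq> 0"
 shows "g y = 0"
proof (rule ccontr)
 assume y: "g y \<noteq> 0"
 obtain p where p: "\<forall>t. poly p t = f (x + t *s (y - x))" using hpoly_line[OF f] by blast
 obtain q where q: "\<forall>t. poly q t = g (x + t *s (y - x))" using hpoly_line[OF g] by blast
 have "poly (p * q) t = 0" for t using zero by (simp add: p q)
 hence "p * q = 0" using poly_all_0_iff_0[of "p * q"] by blast
 hence "p = 0 \<or> q = 0" by simp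
 moreover have "poly p 0 \<noteq> 0" using p[rule_format, of 0] x by simp
 moreover have "poly q 1 \<noteq> 0" using q[rule_format, of 1] y by simp
 ultimately show False by auto
qed

section \<open>A projective Nullstellensatz\<close>

interpretation CC: csubfield UNIV by (rule csubfield_UNIV)

text \<open>A homogeneous ideal, given by its graded pieces. The degree is carried by the index
  alone.\<close>

definition gideal :: "(nat => (complex ^ ('n::finite) option => complex) set) => bool" where
 "gideal J \<longleftrightarrow> (\<forall>m. (\<lambda>x. 0) \<in> J m) \<and> (\<forall>m. \<forall>f\<in>J m. \<forall>g\<in>J m. (\<lambda>x. f x + g x) \<in> J m) \<and>
   (\<forall>m e. \<forall>f\<in>J m. \<forall>g\<in>hpoly UNIV e. (\<lambda>x. g x * f x) \<in> J (e + m))"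

lemma gideal_0: "gideal J ==> (\<lambda>x. 0) \<in> J m"
 unfolding gideal_def by blast

lemma gideal_add: "gideal J ==> f \<in> J m ==> g \<in> J m ==> (\<lambda>x. f x + g x) \<in> J m"
 unfolding gideal_def by blast

lemma gideal_mult:
 assumes "gideal J" "f \<in> J m" "g \<in> hpoly UNIV e" shows "(\<lambda>x. g x * f x) \<in> J (e + m)"
 using assms unfolding gideal_def by blast

lemma gideal_smult:
 assumes "gideal J" "f \<in> J m" shows "(\<lambda>x. c * f x) \<in> J m"
 using gideal_mult[OF assms CC.hpoly_const[of c]] by simp

lemma gideal_sum:
 assumes "gideal J" shows "(\<And>i. i \<in> I ==> f i \<in> J m) ==> (\<lambda>x. \<Sum>i\<in>I. f i x) \<in> J m"
proof (induction I rule: infinite_finite_induct)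
 case (insert i I)
 have "(\<lambda>x. f i x + (\<Sum>i\<in>I. f i x)) \<in> J m" using insert by (intro gideal_add[OF assms]) auto
 thus ?case using insert.hyps by simp
qed (simp_all add: gideal_0[OF assms])

lemma gideal_diff:
 assumes "gideal J" "f \<in> J m" "g \<in> J m" shows "(\<lambda>x. f x - g x) \<in> J m"
 using gideal_add[OF assms(1,2) gideal_smult[OF assms(1,3), of "-1"]] by simp

text \<open>The ideal generated by \<open>J\<close> and a form \<open>l\<close> of degree
  \<open>d\<close>. The cofactor is forced to be 0 below degree \<open>d\<close>, since truncated
  subtraction would otherwise admit constants there.\<close>

definition gideal_insert :: "(complex ^ ('n::finite) option => complex) => nat => (nat => (complex ^ 'n option => complex) set)
  => nat => (complex ^ 'n option => complex) set" where
 "gideal_insert l d J m = {\<lambda>x. a x + g x * l x |a g. a \<in> J m \<and>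
   (if m < d then g = (\<lambda>x. 0) else g \<in> hpoly UNIV (m - d))}"

lemma gideal_insertI:
 assumes "a \<in> J m" "if m < d then g = (\<lambda>x. 0) else g \<in> hpoly UNIV (m - d)" "\<And>x. f x = a x + g x * l x"
 shows "f \<in> gideal_insert l d J m"
proof -
 have "f = (\<lambda>x. a x + g x * l x)" using assms(3) by blast
 thus ?thesis unfolding gideal_insert_def using assms(1,2) by blast
qed

lemma gideal_insertE:
 assumes "f \<in> gideal_insert l d J m"
 shows "\<exists>a g. a \<in> J m \<and> (if m < d then g = (\<lambda>x. 0) else g \<in> hpoly UNIV (m - d)) \<and> f = (\<lambda>x. a x + g x * l x)"
 using assms unfolding gideal_insert_def by blast

lemma gideal_gideal_insert:
 fixes J :: "nat => (complex ^ ('n::finite) option => complex) set"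
 assumes J: "gideal J" shows "gideal (gideal_insert l d J)"
 unfolding gideal_def
proof (intro conjI allI ballI)
 show "(\<lambda>x. 0) \<in> gideal_insert l d J m" for m
  by (rule gideal_insertI[where g = "\<lambda>x. 0", OF gideal_0[OF J]]) (simp_all add: CC.hpoly_0)
 fix m f assume "f \<in> gideal_insert l d J m"
 from gideal_insertE[OF this] obtain a g where f: "a \<in> J m" "if m < d then g = (\<lambda>x. 0) else g \<in> hpoly UNIV (m - d)"
  "f = (\<lambda>x. a x + g x * l x)" by blast
 {
  fix f' assume "f' \<in> gideal_insert l d J m"
  from gideal_insertE[OF this] obtain a' g' where f': "a' \<in> J m" "if m < d then g' = (\<lambda>x. 0) else g' \<in> hpoly UNIV (m - d)"
   "f' = (\<lambda>x. a' x + g' x * l x)" by blast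
  show "(\<lambda>x. f x + f' x) \<in> gideal_insert l d J m"
  proof (rule gideal_insertI)
   show "(\<lambda>x. a x + a' x) \<in> J m" by (rule gideal_add[OF J f(1) f'(1)])
   show "if m < d then (\<lambda>x. g x + g' x) = (\<lambda>x. 0) else (\<lambda>x. g x + g' x) \<in> hpoly UNIV (m - d)"
    using f(2) f'(2) by (auto intro: CC.hpoly_add)
   show "f x + f' x = (a x + a' x) + (g x + g' x) * l x" for x unfolding f(3) f'(3) by (simp add: algebra_simps)
  qed
 }
 fix e and h :: "complex ^ 'n option => complex" assume h: "h \<in> hpoly UNIV e"
 show "(\<lambda>x. h x * f x) \<in> gideal_insert l d J (e + m)"
 proof (rule gideal_insertI)
  show "(\<lambda>x. h x * a x) \<in> J (e + m)" by (rule gideal_mult[OF J f(1) h])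
  show "if e + m < d then (\<lambda>x. h x * g x) = (\<lambda>x. 0) else (\<lambda>x. h x * g x) \<in> hpoly UNIV (e + m - d)"
  proof (cases "m < d")
   case True
   thus ?thesis using f(2) by (simp add: CC.hpoly_0)
  next
   case False
   hence "(\<lambda>x. h x * g x) \<in> hpoly UNIV (e + (m - d))" using f(2) by (intro CC.hpoly_mult[OF h]) simp
   thus ?thesis using False by simp
  qed
  show "h x * f x = h x * a x + h x * g x * l x" for x unfolding f(3) by (simp add: algebra_simps)
 qed
qed

lemma gideal_insert_subset: assumes "f \<in> J m" shows "f \<in> gideal_insert l d J m"
 by (rule gideal_insertI[where a = f and g = "\<lambda>x. 0"]) (simp_all add: CC.hpoly_0 assms)

lemma gideal_insert_self: assumes "gideal J" shows "l \<in> gideal_insert l d J d"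
 by (rule gideal_insertI[OF gideal_0[OF assms], where g = "\<lambda>x. 1"]) (simp_all add: CC.hpoly_const)

text \<open>The homogenisation of \<open>q\<close> to a binary form of degree \<open>n\<close>,
  intended for \<open>n\<close> at least the degree.\<close>

definition homog2 :: "complex poly => nat => complex => complex => complex" where
 "homog2 q n u v = (\<Sum>i\<le>n. coeff q i * u ^ i * v ^ (n - i))"

lemma homog2_linear_mult:
 assumes "degree q \<le> n"
 shows "homog2 ([:-b, 1:] * q) (Suc n) u v = (u - b * v) * homog2 q n u v"
proof -
 have c: "coeff ([:-b, 1:] * q) i = (case i of 0 => 0 | Suc k => coeff q k) - b * coeff q i" for i
  by (simp add: coeff_pCons split: nat.split)
 have z: "coeff q (Suc n) = 0" using assms by (intro coeff_eq_0) simp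
 have "homog2 ([:-b, 1:] * q) (Suc n) u v
   = (\<Sum>i\<le>Suc n. (case i of 0 => 0 | Suc k => coeff q k) * u ^ i * v ^ (Suc n - i)) - b * (\<Sum>i\<le>Suc n. coeff q i * u ^ i * v ^ (Suc n - i))"
  unfolding homog2_def c by (simp add: left_diff_distrib sum_subtractf sum_distrib_left mult.assoc del: sum.atMost_Suc)
 also have "(\<Sum>i\<le>Suc n. (case i of 0 => 0 | Suc k => coeff q k) * u ^ i * v ^ (Suc n - i)) = u * homog2 q n u v"
  unfolding homog2_def by (subst sum.atMost_Suc_shift) (simp add: sum_distrib_left mult_ac)
 also have "(\<Sum>i\<le>Suc n. coeff q i * u ^ i * v ^ (Suc n - i)) = v * homog2 q n u v"
  unfolding homog2_def by (simp add: z sum_distrib_left Suc_diff_le mult_ac)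
 finally show ?thesis by (simp add: algebra_simps)
qed

lemma homog2_prod:
 "finite T ==> homog2 (\<Prod>t\<in>T. [:-t, 1:]) (card T) u v = (\<Prod>t\<in>T. u - t * v) \<and> degree (\<Prod>t\<in>T. [:-t, 1:]) \<le> card T"
proof (induction T rule: finite_induct)
 case empty
 thus ?case by (simp add: homog2_def)
next
 case (insert t T)
 have "degree ([:-t, 1:] * (\<Prod>t\<in>T. [:-t, 1:])) \<le> degree [:-t, 1:] + degree (\<Prod>t\<in>T. [:-t, 1:])" by (rule degree_mult_le)
 also have "... \<le> Suc (card T)" using insert.IH by simp
 finally show ?case using insert homog2_linear_mult[of "\<Prod>t\<in>T. [:-t, 1:]" "card T" t u v] by (simp del: mult_pCons_left)
qed

lemma hpoly_homog2: "(\<lambda>x. homog2 q n (x $ r) (x $ j)) \<in> hpoly UNIV n"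
 unfolding homog2_def
proof (intro CC.hpoly_sum)
 fix i assume "i \<in> {..n}"
 hence e: "0 + i * 1 + (n - i) * 1 = n" by simp
 have "(\<lambda>x. coeff q i * x $ r ^ i * x $ j ^ (n - i)) \<in> hpoly UNIV (0 + i * 1 + (n - i) * 1)"
  by (intro CC.hpoly_mult CC.hpoly_const CC.hpoly_power CC.hpoly_var UNIV_I)
 thus "(\<lambda>x. coeff q i * x $ r ^ i * x $ j ^ (n - i)) \<in> hpoly UNIV n" unfolding e .
qed

lemma hpoly_var_power: "(\<lambda>x. x $ j ^ k) \<in> hpoly UNIV k"
 using CC.hpoly_power[OF CC.hpoly_var, of j k] by simp

lemma hpoly_linear: "(\<lambda>x. x $ r - b * x $ j) \<in> hpoly UNIV 1"
 using CC.hpoly_add[OF CC.hpoly_var[of r] CC.hpoly_smult[OF CC.hpoly_var[of j], of "- b"]] by simp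

text \<open>The binary form splits into linear factors, and each factor can be traded for a power of
  x_j, because modulo \<open>J\<close> such a power is a multiple of the factor. In the end only the
  power is left.\<close>

lemma gideal_cancel_homog2:
 fixes J :: "nat => (complex ^ ('n::finite) option => complex) set"
 assumes J: "gideal J"
  and lin: "\<And>b. \<exists>k h. h \<in> hpoly UNIV k \<and> (\<lambda>x. x $ j ^ Suc k - h x * (x $ r - b * x $ j)) \<in> J (Suc k)"
  and "degree q \<le> n" "q \<noteq> 0" "(\<lambda>x. x $ j ^ N * homog2 q n (x $ r) (x $ j)) \<in> J (N + n)"
 shows "\<exists>M. (\<lambda>x. x $ j ^ M) \<in> J M"
 using assms(3-5)
proof (induction "degree q" arbitrary: q n N)
 case 0
 then obtain c where q: "q = [:c:]" "c \<noteq> 0" using degree_eq_zeroE[of q] by (metis pCons_0_0)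
 have h: "homog2 q n u v = c * v ^ n" for u v
 proof -
  have "homog2 q n u v = (\<Sum>i\<le>n. if i = 0 then c * v ^ n else 0)"
   unfolding homog2_def q(1) by (intro sum.cong refl) (auto simp: coeff_pCons split: nat.splits)
  thus ?thesis by simp
 qed
 have "(\<lambda>x. inverse c * (x $ j ^ N * homog2 q n (x $ r) (x $ j))) \<in> J (N + n)" by (rule gideal_smult[OF J 0(4)])
 moreover have "inverse c * (x $ j ^ N * homog2 q n (x $ r) (x $ j)) = x $ j ^ (N + n)" for x :: "complex ^ 'n option"
  unfolding h using q(2) by (simp add: power_add)
 ultimately show ?case by auto
next
 case (Suc d)
 obtain b where b: "poly q b = 0"
  using fundamental_theorem_of_algebra[of q] Suc(2) by (auto simp: constant_degree)
 then obtain q' where q': "q = [:-b, 1:] * q'" by (auto simp: poly_eq_0_iff_dvd)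
 have q'0: "q' \<noteq> 0" using q' Suc(4) by auto
 have dq: "degree q = Suc (degree q')" unfolding q' using q'0 by (subst degree_mult_eq) auto
 obtain n' where n': "n = Suc n'" using Suc(2,3) by (cases n) auto
 have dq': "degree q' \<le> n'" using dq n' Suc(3) by simp
 obtain k h where h: "h \<in> hpoly UNIV k" "(\<lambda>x. x $ j ^ Suc k - h x * (x $ r - b * x $ j)) \<in> J (Suc k)"
  using lin[of b] by blast
 define w where "w = (\<lambda>x :: complex ^ 'n option. x $ j ^ N * homog2 q' n' (x $ r) (x $ j))"
 have wh: "w \<in> hpoly UNIV (N + n')" unfolding w_def by (intro CC.hpoly_mult hpoly_var_power hpoly_homog2)
 have e: "N + n' + Suc k = k + (N + n)" "k + (N + n) = (N + Suc k) + n'" using n' by simp_all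
 have 1: "(\<lambda>x. h x * (x $ j ^ N * homog2 q n (x $ r) (x $ j))) \<in> J (k + (N + n))" by (rule gideal_mult[OF J Suc(5) h(1)])
 have 2: "(\<lambda>x. w x * (x $ j ^ Suc k - h x * (x $ r - b * x $ j))) \<in> J (N + n' + Suc k)"
  by (rule gideal_mult[OF J h(2) wh])
 \<comment> \<open>The multiple h of the given form contains h times one linear factor; the element
   of \<open>J\<close> replaces that product by a power of x_j.\<close>
 have eq: "w x * (x $ j ^ Suc k - h x * (x $ r - b * x $ j)) + h x * (x $ j ^ N * homog2 q n (x $ r) (x $ j))
   = x $ j ^ (N + Suc k) * homog2 q' n' (x $ r) (x $ j)" for x
  unfolding w_def q' n' homog2_linear_mult[OF dq'] by (simp add: algebra_simps power_add)
 have "(\<lambda>x. x $ j ^ (N + Suc k) * homog2 q' n' (x $ r) (x $ j)) \<in> J ((N + Suc k) + n')"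
  using gideal_add[OF J 2[unfolded e(1)] 1] unfolding eq e(2) .
 from Suc(1)[OF _ dq' q'0 this] show ?case using dq Suc(2) by simp
qed

text \<open>Finite fibres over the natural numbers would make the complex numbers countable.\<close>

lemma infinite_fibre_of_complex:
 fixes k :: "complex => nat" shows "\<exists>m. infinite {b. k b = m}"
proof (rule ccontr)
 assume "\<nexists>m. infinite {b. k b = m}"
 hence "countable (\<Union>m. {b. k b = m})" by (intro countable_UN) (auto intro: countable_finite)
 moreover have "(\<Union>m. {b. k b = m}) = UNIV" by auto
 ultimately show False using uncountable_UNIV_complex by simp
qed

text \<open>If every \<open>b\<close> were bad, uncountably many \<open>b\<close> would share a degree; a linear dependency among the
 corresponding cofactors then yields a nonzero binary form in the ideal.\<close>

lemma gideal_specialise: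
 fixes J :: "nat => (complex ^ ('n::finite) option => complex) set"
 assumes J: "gideal J" and notin: "\<And>M. (\<lambda>x. x $ j ^ M) \<notin> J M"
 shows "\<exists>b. \<forall>M. (\<lambda>x. x $ j ^ M) \<notin> gideal_insert (\<lambda>x. x $ r - b * x $ j) 1 J M"
proof (rule ccontr)
 assume neg: "\<not> ?thesis"
 have lin: "\<exists>k h. h \<in> hpoly UNIV k \<and> (\<lambda>x. x $ j ^ Suc k - h x * (x $ r - b * x $ j)) \<in> J (Suc k)" for b
 proof -
  obtain M where "(\<lambda>x. x $ j ^ M) \<in> gideal_insert (\<lambda>x. x $ r - b * x $ j) 1 J M" using neg by blast
  from gideal_insertE[OF this] obtain a g where ag: "a \<in> J M" "if M < 1 then g = (\<lambda>x. 0) else g \<in> hpoly UNIV (M - 1)"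
   "(\<lambda>x. x $ j ^ M) = (\<lambda>x. a x + g x * (x $ r - b * x $ j))" by blast
  show ?thesis
  proof (cases M)
   case 0
   hence "(\<lambda>x. x $ j ^ M) = a" using ag(2,3) by simp
   thus ?thesis using ag(1) notin[of M] by simp
  next
   case (Suc k)
   have "a = (\<lambda>x. x $ j ^ Suc k - g x * (x $ r - b * x $ j))" using ag(3) Suc by (simp add: fun_eq_iff)
   thus ?thesis using ag(1,2) Suc by (intro exI[of _ k] exI[of _ g]) simp
  qed
 qed
 from choice[OF allI[OF lin]] obtain k where "\<forall>b. \<exists>h. h \<in> hpoly UNIV (k b) \<and> (\<lambda>x. x $ j ^ Suc (k b) - h x * (x $ r - b * x $ j)) \<in> J (Suc (k b))" ..
 from choice[OF this] obtain h where kh: "\<forall>b. h b \<in> hpoly UNIV (k b) \<and> (\<lambda>x. x $ j ^ Suc (k b) - h b x * (x $ r - b * x $ j)) \<in> J (Suc (k b))" ..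
 obtain m where m: "infinite {b. k b = m}" using infinite_fibre_of_complex by blast
 define S where "S = (mons m :: ('n option \<Rightarrow>\<^sub>0 nat) set)"
 have finS: "finite S" by (simp add: S_def)
 obtain B where B: "B \<subseteq> {b. k b = m}" "finite B" "card B = Suc (card S)" using infinite_arbitrarily_large[OF m] by blast
 have hB: "h b \<in> hpoly UNIV m" "(\<lambda>x. x $ j ^ Suc m - h b x * (x $ r - b * x $ j)) \<in> J (Suc m)" if "b \<in> B" for b
  using kh[rule_format, of b] that B(1) by auto
 have "\<forall>b\<in>B. \<exists>c. h b = (\<lambda>x. \<Sum>m\<in>S. c m * mono_eval m x)" using hB(1) unfolding hpoly_def S_def by blast
 from bchoice[OF this] obtain c where c: "\<forall>b\<in>B. h b = (\<lambda>x. \<Sum>m\<in>S. c b m * mono_eval m x)" ..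
 have "\<exists>z. (\<forall>b\<in>B. z b \<in> UNIV) \<and> (\<exists>b\<in>B. z b \<noteq> 0) \<and> (\<forall>m\<in>S. (\<Sum>b\<in>B. c b m * z b) = 0)"
  by (rule underdetermined_system[OF csubfield_UNIV finS B(2)]) (simp_all add: B(3))
 then obtain z where z: "\<exists>b\<in>B. z b \<noteq> 0" "\<forall>m\<in>S. (\<Sum>b\<in>B. c b m * z b) = 0" by blast
 have hz: "(\<Sum>b\<in>B. z b * h b x) = 0" for x
 proof -
  have "(\<Sum>b\<in>B. z b * h b x) = (\<Sum>b\<in>B. \<Sum>m\<in>S. c b m * z b * mono_eval m x)"
   using c by (intro sum.cong refl) (simp add: sum_distrib_left mult_ac)
  also have "... = (\<Sum>m\<in>S. (\<Sum>b\<in>B. c b m * z b) * mono_eval m x)"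
   by (subst sum.swap) (simp add: sum_distrib_right)
  finally show ?thesis using z(2) by simp
 qed
 define s where "s = card S"
 \<comment> \<open>A combination in Lagrange form with the dependency as its weights; its value at a
   point of \<open>B\<close> with nonzero weight is not 0, hence \<open>q\<close> is
   nonzero.\<close>
 define q where "q = (\<Sum>b\<in>B. smult (z b) (\<Prod>t\<in>B - {b}. [:-t, 1:]))"
 have cB: "card (B - {b}) = s" if "b \<in> B" for b using that B by (simp add: s_def)
 have degq: "degree q \<le> s" unfolding q_def
 proof (rule degree_sum_le[OF B(2)])
  fix b assume "b \<in> B"
  hence "degree (\<Prod>t\<in>B - {b}. [:-t, 1:]) \<le> s"
   using homog2_prod[of "B - {b}" 0 0] B(2) cB[of b] by simp
  thus "degree (smult (z b) (\<Prod>t\<in>B - {b}. [:-t, 1:])) \<le> s"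
   by (rule le_trans[OF degree_smult_le])
 qed
 obtain b0 where b0: "b0 \<in> B" "z b0 \<noteq> 0" using z(1) by blast
 have "poly q b0 = (\<Sum>b\<in>B. z b * (\<Prod>t\<in>B - {b}. b0 - t))" by (simp add: q_def poly_sum poly_prod)
 also have "... = (\<Sum>b\<in>B. if b = b0 then z b0 * (\<Prod>t\<in>B - {b0}. b0 - t) else 0)"
  using b0 B(2) by (intro sum.cong refl) auto
 also have "... = z b0 * (\<Prod>t\<in>B - {b0}. b0 - t)" using b0 B(2) by simp
 also have "... \<noteq> 0" using b0 B(2) by (auto simp: prod_zero_iff)
 finally have q0: "q \<noteq> 0" by auto
 have hq: "homog2 q s u v = (\<Sum>b\<in>B. z b * (\<Prod>t\<in>B - {b}. u - t * v))" for u v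
 proof -
  have "homog2 q s u v = (\<Sum>b\<in>B. z b * homog2 (\<Prod>t\<in>B - {b}. [:-t, 1:]) s u v)"
   unfolding homog2_def q_def coeff_sum coeff_smult sum_distrib_right sum_distrib_left
   by (subst sum.swap) (simp add: mult.assoc)
  also have "... = (\<Sum>b\<in>B. z b * (\<Prod>t\<in>B - {b}. u - t * v))"
  proof (intro sum.cong refl)
   fix b assume "b \<in> B"
   thus "z b * homog2 (\<Prod>t\<in>B - {b}. [:-t, 1:]) s u v = z b * (\<Prod>t\<in>B - {b}. u - t * v)"
    using homog2_prod[of "B - {b}" u v] B(2) cB[of b] by simp
  qed
  finally show ?thesis .
 qed
 \<comment> \<open>Summed over \<open>B\<close>, the parts with the cofactors share the product over
   all of \<open>B\<close> and cancel by the dependency; the binary form of \<open>q\<close> times a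
   power of x_j remains.\<close>
 define f where "f = (\<lambda>b x. (z b * (\<Prod>t\<in>B - {b}. x $ r - t * x $ j)) * (x $ j ^ Suc m - h b x * (x $ r - b * x $ j)))"
 have "(\<lambda>x. \<Sum>b\<in>B. f b x) \<in> J (s + Suc m)"
 proof (rule gideal_sum[OF J])
  fix b assume b: "b \<in> B"
  have "(\<lambda>x. \<Prod>t\<in>B - {b}. x $ r - t * x $ j) \<in> hpoly UNIV (\<Sum>t\<in>B - {b}. 1)"
   using B(2) by (intro CC.hpoly_prod hpoly_linear) auto
  hence "(\<lambda>x. z b * (\<Prod>t\<in>B - {b}. x $ r - t * x $ j)) \<in> hpoly UNIV s"
   using cB[OF b] by (intro CC.hpoly_smult) auto
  thus "f b \<in> J (s + Suc m)" unfolding f_def by (intro gideal_mult[OF J hB(2)[OF b]])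
 qed
 moreover have "(\<Sum>b\<in>B. f b x) = x $ j ^ Suc m * homog2 q s (x $ r) (x $ j)" for x
 proof -
  have "f b x = x $ j ^ Suc m * (z b * (\<Prod>t\<in>B - {b}. x $ r - t * x $ j)) - (\<Prod>t\<in>B. x $ r - t * x $ j) * (z b * h b x)"
   if "b \<in> B" for b
  proof -
   have P: "(\<Prod>t\<in>B. x $ r - t * x $ j) = (x $ r - b * x $ j) * (\<Prod>t\<in>B - {b}. x $ r - t * x $ j)"
    by (rule prod.remove[OF B(2) that])
   show ?thesis unfolding f_def P by (simp add: algebra_simps)
  qed
  hence "(\<Sum>b\<in>B. f b x) = (\<Sum>b\<in>B. x $ j ^ Suc m * (z b * (\<Prod>t\<in>B - {b}. x $ r - t * x $ j)) - (\<Prod>t\<in>B. x $ r - t * x $ j) * (z b * h b x))"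
   by (intro sum.cong refl)
  also have "... = x $ j ^ Suc m * homog2 q s (x $ r) (x $ j) - (\<Prod>t\<in>B. x $ r - t * x $ j) * (\<Sum>b\<in>B. z b * h b x)"
   unfolding hq by (simp add: sum_subtractf sum_distrib_left)
  finally show ?thesis by (simp add: hz)
 qed
 ultimately have "(\<lambda>x. x $ j ^ Suc m * homog2 q s (x $ r) (x $ j)) \<in> J (Suc m + s)" by (simp add: add.commute)
 from gideal_cancel_homog2[OF J lin degq q0 this] notin show False by blast
qed

text \<open>The other coordinates are specialised one by one until the enlarged ideal describes a
  single point, still without a power of x_j.\<close>

lemma gideal_specialise_all:
 fixes J :: "nat => (complex ^ ('n::finite) option => complex) set"
 assumes J: "gideal J" and notin: "\<And>M. (\<lambda>x. x $ j ^ M) \<notin> J M" and R: "finite R"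
 shows "\<exists>a J'. gideal J' \<and> (\<forall>m. J m \<subseteq> J' m) \<and> (\<forall>M. (\<lambda>x. x $ j ^ M) \<notin> J' M) \<and>
  (\<forall>r\<in>R. (\<lambda>x. x $ r - a r * x $ j) \<in> J' 1)"
 using R
proof (induction R rule: finite_induct)
 case empty
 show ?case using J notin by (intro exI[of _ "\<lambda>_. 0"] exI[of _ J]) auto
next
 case (insert r R)
 obtain a J' where J': "gideal J'" "\<forall>m. J m \<subseteq> J' m" "\<forall>M. (\<lambda>x. x $ j ^ M) \<notin> J' M"
  "\<forall>r\<in>R. (\<lambda>x. x $ r - a r * x $ j) \<in> J' 1" using insert.IH by (elim exE conjE) (rule that)
 obtain b where b: "\<forall>M. (\<lambda>x. x $ j ^ M) \<notin> gideal_insert (\<lambda>x. x $ r - b * x $ j) 1 J' M"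
  using gideal_specialise[OF J'(1), of j r] J'(3) by blast
 show ?case
 proof (intro exI[of _ "a(r := b)"] exI[of _ "gideal_insert (\<lambda>x. x $ r - b * x $ j) 1 J'"] conjI)
  show "gideal (gideal_insert (\<lambda>x. x $ r - b * x $ j) 1 J')" by (rule gideal_gideal_insert[OF J'(1)])
  show "\<forall>m. J m \<subseteq> gideal_insert (\<lambda>x. x $ r - b * x $ j) 1 J' m"
  proof (intro allI subsetI)
   fix m f assume "f \<in> J m"
   hence "f \<in> J' m" using J'(2)[rule_format, of m] by (rule rev_subsetD)
   thus "f \<in> gideal_insert (\<lambda>x. x $ r - b * x $ j) 1 J' m" by (rule gideal_insert_subset)
  qed
  show "\<forall>M. (\<lambda>x. x $ j ^ M) \<notin> gideal_insert (\<lambda>x. x $ r - b * x $ j) 1 J' M" by (rule b)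
  show "\<forall>ra\<in>insert r R. (\<lambda>x. x $ ra - (a(r := b)) ra * x $ j) \<in> gideal_insert (\<lambda>x. x $ r - b * x $ j) 1 J' 1"
  proof
   fix ra assume "ra \<in> insert r R"
   thus "(\<lambda>x. x $ ra - (a(r := b)) ra * x $ j) \<in> gideal_insert (\<lambda>x. x $ r - b * x $ j) 1 J' 1"
    using gideal_insert_self[OF J'(1), of "\<lambda>x. x $ r - b * x $ j" 1] J'(4) insert.hyps
    by (cases "ra = r") (auto intro: gideal_insert_subset)
  qed
 qed
qed

lemma gideal_cong_mult:
 fixes J :: "nat => (complex ^ ('n::finite) option => complex) set"
 assumes J: "gideal J" and f: "f \<in> hpoly UNIV d" "(\<lambda>x. f x - c * x $ j ^ d) \<in> J d"
  and g: "(\<lambda>x. g x - c' * x $ j ^ e) \<in> J e"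
 shows "(\<lambda>x. f x * g x - (c * c') * x $ j ^ (d + e)) \<in> J (d + e)"
proof -
 have "(\<lambda>x. f x * (g x - c' * x $ j ^ e)) \<in> J (d + e)" by (rule gideal_mult[OF J g f(1)])
 moreover have "(\<lambda>x. (c' * x $ j ^ e) * (f x - c * x $ j ^ d)) \<in> J (e + d)"
  by (intro gideal_mult[OF J f(2)] CC.hpoly_smult hpoly_var_power UNIV_I)
 ultimately have "(\<lambda>x. f x * (g x - c' * x $ j ^ e) + (c' * x $ j ^ e) * (f x - c * x $ j ^ d)) \<in> J (d + e)"
  using gideal_add[OF J] by (simp add: add.commute)
 moreover have "f x * (g x - c' * x $ j ^ e) + (c' * x $ j ^ e) * (f x - c * x $ j ^ d) = f x * g x - (c * c') * x $ j ^ (d + e)" for x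
  by (simp add: algebra_simps power_add)
 ultimately show ?thesis by simp
qed

text \<open>Modulo the linear forms of a point every form is its value there times a power of x_j;
  products of powers are treated first, then sums.\<close>

lemma gideal_cong_hpoly:
 fixes J :: "nat => (complex ^ ('n::finite) option => complex) set"
 assumes J: "gideal J" and lin: "\<And>r. (\<lambda>x. x $ r - a $ r * x $ j) \<in> J 1" and f: "f \<in> hpoly UNIV d"
 shows "(\<lambda>x. f x - f a * x $ j ^ d) \<in> J d"
proof -
 have pw: "(\<lambda>x. x $ r ^ k - a $ r ^ k * x $ j ^ k) \<in> J k" for r k
 proof (induction k)
  case 0
  thus ?case using gideal_0[OF J] by simp
 next
  case (Suc k)
  thus ?case using gideal_cong_mult[OF J CC.hpoly_var[of r], of "a $ r" j "\<lambda>x. x $ r ^ k" "a $ r ^ k" k] lin[of r] by simp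
 qed
 have pr: "(\<lambda>x. (\<Prod>r\<in>R. x $ r ^ k r) - (\<Prod>r\<in>R. a $ r ^ k r) * x $ j ^ (\<Sum>r\<in>R. k r)) \<in> J (\<Sum>r\<in>R. k r)" if "finite R" for R k
  using that
 proof (induction R rule: finite_induct)
  case empty
  thus ?case using gideal_0[OF J] by simp
 next
  case (insert r R)
  thus ?case using gideal_cong_mult[OF J hpoly_var_power pw insert.IH] by simp
 qed
 have mo: "(\<lambda>x. mono_eval m x - mono_eval m a * x $ j ^ d) \<in> J d" if "m \<in> mons d" for m
  using pr[of UNIV "Poly_Mapping.lookup m"] that by (simp add: mono_eval_def mons_def mono_degree_def)
 obtain c where c: "f = (\<lambda>x. \<Sum>m\<in>mons d. c m * mono_eval m x)" using f unfolding hpoly_def by blast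
 have "(\<lambda>x. \<Sum>m\<in>mons d. c m * (mono_eval m x - mono_eval m a * x $ j ^ d)) \<in> J d"
  by (intro gideal_sum[OF J] gideal_smult[OF J] mo)
 thus ?thesis unfolding c by (simp add: algebra_simps sum_subtractf sum_distrib_left sum_distrib_right)
qed

text \<open>If no power of x_j lay in the ideal of the \<Psi> i, specialisation would give a point
  with j-th coordinate 1. Some form is nonzero at it, and modulo the enlarged ideal that form is its
  value times x_j^D; hence x_j^D would lie in the ideal.\<close>

lemma projective_nullstellensatz_complex:
 fixes \<Psi> :: "'n option => complex ^ ('n::finite) option => complex"
 assumes \<Psi>: "\<And>i. \<Psi> i \<in> hpoly UNIV D" and nz: "\<And>x. x \<noteq> 0 ==> \<exists>i. \<Psi> i x \<noteq> 0"
 shows "\<exists>M\<ge>D. \<exists>A. (\<forall>i. A i \<in> hpoly UNIV (M - D)) \<and> (\<forall>x. x $ j ^ M = (\<Sum>i\<in>UNIV. A i x * \<Psi> i x))"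
proof -
 define J where "J = (\<lambda>m. {f. \<exists>A. (\<forall>i. if m < D then A i = (\<lambda>x. 0) else A i \<in> hpoly UNIV (m - D)) \<and>
   f = (\<lambda>x. \<Sum>i\<in>UNIV. A i x * \<Psi> i x)})"
 have JI: "f \<in> J m" if "\<And>i. if m < D then A i = (\<lambda>x. 0) else A i \<in> hpoly UNIV (m - D)" "f = (\<lambda>x. \<Sum>i\<in>UNIV. A i x * \<Psi> i x)" for f m A
  unfolding J_def using that by blast
 have J: "gideal J" unfolding gideal_def
 proof (intro conjI allI ballI)
  show "(\<lambda>x. 0) \<in> J m" for m by (rule JI[of m "\<lambda>i x. 0"]) (simp_all add: CC.hpoly_0)
  fix m f assume "f \<in> J m"
  then obtain A where A: "\<forall>i. if m < D then A i = (\<lambda>x. 0) else A i \<in> hpoly UNIV (m - D)" "f = (\<lambda>x. \<Sum>i\<in>UNIV. A i x * \<Psi> i x)"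
   unfolding J_def by blast
  {
   fix f' assume "f' \<in> J m"
   then obtain A' where A': "\<forall>i. if m < D then A' i = (\<lambda>x. 0) else A' i \<in> hpoly UNIV (m - D)" "f' = (\<lambda>x. \<Sum>i\<in>UNIV. A' i x * \<Psi> i x)"
    unfolding J_def by blast
   show "(\<lambda>x. f x + f' x) \<in> J m"
   proof (rule JI[of m "\<lambda>i x. A i x + A' i x"])
    fix i show "if m < D then (\<lambda>x. A i x + A' i x) = (\<lambda>x. 0) else (\<lambda>x. A i x + A' i x) \<in> hpoly UNIV (m - D)"
     using A(1)[rule_format, of i] A'(1)[rule_format, of i] by (auto intro: CC.hpoly_add)
   qed (simp add: A(2) A'(2) algebra_simps sum.distrib)
  }
  fix e and g :: "complex ^ 'n option => complex" assume g: "g \<in> hpoly UNIV e"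
  show "(\<lambda>x. g x * f x) \<in> J (e + m)"
  proof (rule JI[of "e + m" "\<lambda>i x. g x * A i x"])
   fix i show "if e + m < D then (\<lambda>x. g x * A i x) = (\<lambda>x. 0) else (\<lambda>x. g x * A i x) \<in> hpoly UNIV (e + m - D)"
   proof (cases "m < D")
    case True
    thus ?thesis using A(1)[rule_format, of i] by (simp add: CC.hpoly_0)
   next
    case False
    hence "(\<lambda>x. g x * A i x) \<in> hpoly UNIV (e + (m - D))" using A(1)[rule_format, of i] by (intro CC.hpoly_mult[OF g]) simp
    thus ?thesis using False by simp
   qed
  qed (simp add: A(2) sum_distrib_left mult.assoc)
 qed
 have \<Psi>J: "\<Psi> i \<in> J D" for i
 proof (rule JI[of D "\<lambda>k x. if k = i then 1 else 0"])
  fix k show "if D < D then (\<lambda>x. if k = i then 1 else 0) = (\<lambda>x :: complex ^ 'n option. 0) else (\<lambda>x. if k = i then 1 else 0) \<in> hpoly UNIV (D - D)"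
   by (auto intro: CC.hpoly_const)
  have "(if k = i then 1 else 0) * \<Psi> k x = (if k = i then \<Psi> i x else 0)" for k x by simp
  thus "\<Psi> i = (\<lambda>x. \<Sum>k\<in>UNIV. (if k = i then 1 else 0) * \<Psi> k x)" by (simp add: fun_eq_iff)
 qed
 have "\<exists>M. (\<lambda>x. x $ j ^ M) \<in> J M"
 proof (rule ccontr)
  assume neg: "\<not> ?thesis"
  have "\<exists>a J'. gideal J' \<and> (\<forall>m. J m \<subseteq> J' m) \<and> (\<forall>M. (\<lambda>x. x $ j ^ M) \<notin> J' M) \<and>
    (\<forall>r\<in>UNIV - {j}. (\<lambda>x. x $ r - a r * x $ j) \<in> J' 1)"
   by (rule gideal_specialise_all[OF J]) (use neg in auto)
  then obtain a J' where J': "gideal J'" "\<forall>m. J m \<subseteq> J' m" "\<forall>M. (\<lambda>x. x $ j ^ M) \<notin> J' M"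
   "\<forall>r\<in>UNIV - {j}. (\<lambda>x. x $ r - a r * x $ j) \<in> J' 1" by (elim exE conjE) (rule that)
  define b :: "complex ^ 'n option" where "b = (\<chi> r. if r = j then 1 else a r)"
  have lin: "(\<lambda>x. x $ r - b $ r * x $ j) \<in> J' 1" for r
   using J'(4) gideal_0[OF J'(1)] by (cases "r = j") (auto simp: b_def)
  have "b $ j = 1" by (simp add: b_def)
  hence "b \<noteq> 0" by auto
  then obtain i where i: "\<Psi> i b \<noteq> 0" using nz by blast
  have "\<Psi> i \<in> J' D" using \<Psi>J J'(2) by blast
  hence "(\<lambda>x. \<Psi> i x - (\<Psi> i x - \<Psi> i b * x $ j ^ D)) \<in> J' D"
   by (rule gideal_diff[OF J'(1) _ gideal_cong_hpoly[OF J'(1) lin \<Psi>]])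
  hence "(\<lambda>x. inverse (\<Psi> i b) * (\<Psi> i x - (\<Psi> i x - \<Psi> i b * x $ j ^ D))) \<in> J' D" by (rule gideal_smult[OF J'(1)])
  moreover have "inverse (\<Psi> i b) * (\<Psi> i x - (\<Psi> i x - \<Psi> i b * x $ j ^ D)) = x $ j ^ D" for x using i by simp
  ultimately have "(\<lambda>x. x $ j ^ D) \<in> J' D" by (simp only:)
  thus False using J'(3) by blast
 qed
 then obtain M A where MA: "\<forall>i. if M < D then A i = (\<lambda>x. 0) else A i \<in> hpoly UNIV (M - D)"
  "(\<lambda>x. x $ j ^ M) = (\<lambda>x. \<Sum>i\<in>UNIV. A i x * \<Psi> i x)" unfolding J_def by blast
 have "M \<ge> D"
 proof (rule ccontr)
  assume "\<not> M \<ge> D"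
  hence "A i = (\<lambda>x. 0)" for i using MA(1)[rule_format, of i] by simp
  hence "(1 :: complex ^ 'n option) $ j ^ M = 0" using fun_cong[OF MA(2), of 1] by simp
  thus False by simp
 qed
 thus ?thesis using MA by (intro exI[of _ M] conjI exI[of _ A]) (auto simp: fun_eq_iff)
qed

text \<open>The height estimates need cofactors over the number field; they are obtained from the
  complex ones by descent.\<close>

lemma (in csubfield) projective_nullstellensatz:
 fixes \<Psi> :: "'n option => complex ^ ('n::finite) option => complex"
 assumes \<Psi>: "\<And>i. \<Psi> i \<in> hpoly F D" and nz: "\<And>x. x \<noteq> 0 ==> \<exists>i. \<Psi> i x \<noteq> 0"
 shows "\<exists>M\<ge>D. \<exists>A. (\<forall>i. A i \<in> hpoly F (M - D)) \<and> (\<forall>x. x $ j ^ M = (\<Sum>i\<in>UNIV. A i x * \<Psi> i x))"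
proof -
 have "\<exists>M\<ge>D. \<exists>A. (\<forall>i. A i \<in> hpoly UNIV (M - D)) \<and> (\<forall>x. x $ j ^ M = (\<Sum>i\<in>UNIV. A i x * \<Psi> i x))"
  by (rule projective_nullstellensatz_complex[OF hpoly_UNIV[OF \<Psi>] nz])
 then obtain M A where M: "M \<ge> D" "\<forall>i. A i \<in> hpoly UNIV (M - D)" "\<forall>x. x $ j ^ M = (\<Sum>i\<in>UNIV. A i x * \<Psi> i x)" by blast
 have L: "(\<lambda>x. x $ j ^ M) \<in> hpoly F ((M - D) + D)" using hpoly_power[OF hpoly_var, of j M] M(1) by simp
 have "\<exists>A'. (\<forall>i. A' i \<in> hpoly F (M - D)) \<and> (\<forall>x. x $ j ^ M = (\<Sum>i\<in>UNIV. A' i x * \<Psi> i x))"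
 proof (rule hpoly_relation_descent[where L = "\<lambda>x. x $ j ^ M" and e = "M - D" and d = D and P = \<Psi>])
  show "(\<lambda>x. x $ j ^ M) \<in> hpoly F ((M - D) + D)" by (rule L)
  show "A i \<in> hpoly UNIV (M - D)" for i using M(2) ..
  show "x $ j ^ M = (\<Sum>i\<in>UNIV. A i x * \<Psi> i x)" for x using M(3) ..
 qed (simp_all add: \<Psi>)
 thus ?thesis using M(1) by blast
qed

section \<open>Images of hypersurfaces\<close>

lemma binomial_scale_le: "(t * D + N) choose N \<le> D ^ N * ((t + N) choose N)" if "D \<ge> 1"
proof (induction N)
 case (Suc N)
 have e: "Suc N * ((m + Suc N) choose Suc N) = (m + Suc N) * ((m + N) choose N)" for m
  using Suc_times_binomial[of N "m + N"] by simp
 have "Suc N * ((t * D + Suc N) choose Suc N) = (t * D + Suc N) * ((t * D + N) choose N)" by (rule e)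
 also have "... \<le> (D * (t + Suc N)) * (D ^ N * ((t + N) choose N))"
 proof (rule mult_le_mono[OF _ Suc])
  have "1 * Suc N \<le> D * Suc N" using that by (intro mult_le_mono1)
  thus "t * D + Suc N \<le> D * (t + Suc N)" by (simp add: add_mult_distrib2 mult.commute)
 qed
 also have "... = D ^ Suc N * ((t + Suc N) * ((t + N) choose N))" by (simp only: power_Suc mult_ac)
 also have "... = Suc N * (D ^ Suc N * ((t + Suc N) choose Suc N))" unfolding e[symmetric] by (simp only: mult_ac)
 finally show ?case by (simp only: mult_le_cancel1)
qed simp

lemma binomial_drop_le: "k \<le> m ==> (m + Suc N) choose Suc N \<le> ((m - k + Suc N) choose Suc N) + k * ((m + N) choose N)"
proof (induction k)
 case (Suc k)
 define l where "l = m - Suc k"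
 have l: "m - k = Suc l" using Suc.prems by (simp add: l_def)
 have 1: "(m - k + Suc N) choose Suc N = ((l + Suc N) choose Suc N) + ((Suc l + N) choose N)"
  unfolding l by simp
 have 2: "(Suc l + N) choose N \<le> (m + N) choose N" using l Suc.prems by (intro binomial_right_mono) auto
 have 3: "(m + Suc N) choose Suc N \<le> ((m - k + Suc N) choose Suc N) + k * ((m + N) choose N)"
  using Suc by simp
 have "(m + Suc N) choose Suc N \<le> ((l + Suc N) choose Suc N) + (((m + N) choose N) + k * ((m + N) choose N))"
  using 1 2 3 by linarith
 thus ?case unfolding l_def by (simp only: mult_Suc)
qed simp

text \<open>Lowering the degree t D by k costs at most k b forms, b being the number of forms of
  degree t D in one variable fewer. Since (t D + N) b is at most N D^N times the number of forms of
  degree t, the choice t = k N D^N makes k b smaller than that number.\<close>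

lemma binomial_count:
 assumes "D \<ge> 1" "k \<ge> 1" "N \<ge> 1" defines "t \<equiv> k * N * D ^ N"
 shows "k \<le> t * D" "(t * D + N) choose N < ((t + N) choose N) + ((t * D - k + N) choose N)"
proof -
 have "k * 1 * 1 \<le> k * (N * D ^ N) * D" using assms by (intro mult_le_mono) (auto simp: Suc_le_eq)
 thus kt: "k \<le> t * D" by (simp add: t_def mult.assoc)
 obtain N' where N: "N = Suc N'" using assms(3) by (cases N) auto
 define b where "b = (t * D + N') choose N'"
 have bpos: "b > 0" by (simp add: b_def)
 have tD: "t \<le> t * D" using assms(1) by simp
 have "(t * D + N) * b = N * ((t * D + N) choose N)"
  unfolding b_def N add_Suc_right by (rule Suc_times_binomial[symmetric])
 also have "... \<le> N * (D ^ N * ((t + N) choose N))" by (intro mult_le_mono2 binomial_scale_le assms(1))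
 finally have 0: "(t * D + N) * b \<le> N * (D ^ N * ((t + N) choose N))" .
 have tt: "k * (N * (D ^ N * x)) = t * x" for x by (simp add: t_def mult.assoc)
 have 1: "k * ((t * D + N) * b) \<le> t * ((t + N) choose N)" using mult_le_mono2[OF 0, of k] unfolding tt .
 have tpos: "t > 0" using assms by (simp add: t_def)
 have "t < t * D + N" using tD assms(3) by linarith
 hence "t * (k * b) < (t * D + N) * (k * b)" using bpos assms(2) by (intro mult_strict_right_mono) auto
 also have "... = k * ((t * D + N) * b)" by (rule mult.left_commute)
 also have "... \<le> t * ((t + N) choose N)" by (rule 1)
 finally have "k * b < (t + N) choose N" by (simp only: mult_less_cancel1)
 moreover have "(t * D + N) choose N \<le> ((t * D - k + N) choose N) + k * b"
  using binomial_drop_le[OF kt, of N'] by (simp only: N b_def)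
 ultimately show "(t * D + N) choose N < ((t + N) choose N) + ((t * D - k + N) choose N)" by linarith
qed

text \<open>The linear map taking the pair (B, H) to B composed with \<Psi>, minus f H, has a source
  of larger dimension than its target, so it has a kernel. In a nonzero kernel element B cannot
  vanish, because then f H = 0 and H would vanish too.\<close>

lemma (in csubfield) pushforward_exists:
 fixes \<Psi> :: "complex ^ ('n::finite) option => complex ^ 'n option"
  and f :: "complex ^ 'n option => complex"
 assumes f: "f \<in> hpoly F k" "k \<ge> 1" "f x0 \<noteq> 0" and D: "D \<ge> 1"
  and \<Psi>: "\<And>i. (\<lambda>x. \<Psi> x $ i) \<in> hpoly F D"
 shows "\<exists>t B H. B \<in> hpoly F t \<and> (\<exists>y. B y \<noteq> 0) \<and> (\<forall>x. B (\<Psi> x) = f x * H x)"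
proof -
 define N where "N = CARD('n)"
 have N: "N \<ge> 1" by (simp add: N_def Suc_le_eq)
 define t where "t = k * N * D ^ N"
 have kt: "k \<le> t * D" and cnt: "(t * D + N) choose N < ((t + N) choose N) + ((t * D - k + N) choose N)"
  using binomial_count[OF D f(2) N] by (simp_all add: t_def)
 define T where "T = (mons t :: ('n option \<Rightarrow>\<^sub>0 nat) set)"
 define S where "S = (mons (t * D - k) :: ('n option \<Rightarrow>\<^sub>0 nat) set)"
 define E where "E = (mons (t * D) :: ('n option \<Rightarrow>\<^sub>0 nat) set)"
 have fin: "finite T" "finite S" "finite E" by (simp_all add: T_def S_def E_def)
 have cards: "card T = (t + N) choose N" "card S = (t * D - k + N) choose N" "card E = (t * D + N) choose N"
  by (simp_all only: T_def S_def E_def card_mons(2) N_def)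
 have "\<forall>m\<in>T. \<exists>\<beta>. (\<forall>e. \<beta> e \<in> F) \<and> (\<lambda>x. mono_eval m (\<Psi> x)) = (\<lambda>x. \<Sum>e\<in>E. \<beta> e * mono_eval e x)"
 proof
  fix m assume "m \<in> T"
  hence "(\<lambda>x. mono_eval m (\<Psi> x)) \<in> hpoly F (t * D)"
   by (intro hpoly_compose[OF hpoly_mono \<Psi>]) (simp add: T_def)
  thus "\<exists>\<beta>. (\<forall>e. \<beta> e \<in> F) \<and> (\<lambda>x. mono_eval m (\<Psi> x)) = (\<lambda>x. \<Sum>e\<in>E. \<beta> e * mono_eval e x)"
   unfolding hpoly_def E_def by blast
 qed
 from bchoice[OF this] obtain \<beta> where \<beta>: "\<forall>m\<in>T. (\<forall>e. \<beta> m e \<in> F) \<and> (\<lambda>x. mono_eval m (\<Psi> x)) = (\<lambda>x. \<Sum>e\<in>E. \<beta> m e * mono_eval e x)" ..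
 have "\<forall>m\<in>S. \<exists>\<gamma>. (\<forall>e. \<gamma> e \<in> F) \<and> (\<lambda>x. f x * mono_eval m x) = (\<lambda>x. \<Sum>e\<in>E. \<gamma> e * mono_eval e x)"
 proof
  fix m assume "m \<in> S"
  hence "(\<lambda>x. f x * mono_eval m x) \<in> hpoly F (k + (t * D - k))"
   by (intro hpoly_mult f(1) hpoly_mono) (simp add: S_def)
  thus "\<exists>\<gamma>. (\<forall>e. \<gamma> e \<in> F) \<and> (\<lambda>x. f x * mono_eval m x) = (\<lambda>x. \<Sum>e\<in>E. \<gamma> e * mono_eval e x)"
   unfolding hpoly_def E_def using kt by auto
 qed
 from bchoice[OF this] obtain \<gamma> where \<gamma>: "\<forall>m\<in>S. (\<forall>e. \<gamma> m e \<in> F) \<and> (\<lambda>x. f x * mono_eval m x) = (\<lambda>x. \<Sum>e\<in>E. \<gamma> m e * mono_eval e x)" ..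
 have \<beta>x: "mono_eval m (\<Psi> x) = (\<Sum>e\<in>E. \<beta> m e * mono_eval e x)" if "m \<in> T" for m x
  using fun_cong[OF conjunct2[OF bspec[OF \<beta> that]], of x] .
 have \<gamma>x: "f x * mono_eval m x = (\<Sum>e\<in>E. \<gamma> m e * mono_eval e x)" if "m \<in> S" for m x
  using fun_cong[OF conjunct2[OF bspec[OF \<gamma> that]], of x] .
 define a where "a = (\<lambda>e u. case u of Inl m => \<beta> m e | Inr m => - \<gamma> m e)"
 have "\<exists>z. (\<forall>u\<in>T <+> S. z u \<in> F) \<and> (\<exists>u\<in>T <+> S. z u \<noteq> 0) \<and> (\<forall>e\<in>E. (\<Sum>u\<in>T <+> S. a e u * z u) = 0)"
 proof (rule underdetermined_system[OF csubfield_axioms fin(3)])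
  show "finite (T <+> S)" using fin by simp
  show "card E < card (T <+> S)" using fin cnt by (simp add: cards card_Plus)
  show "a e u \<in> F" if "e \<in> E" "u \<in> T <+> S" for e u
   using that(2)
  proof
   fix m assume "m \<in> T" "u = Inl m"
   thus "a e u \<in> F" using \<beta> by (simp add: a_def)
  next
   fix m assume "m \<in> S" "u = Inr m"
   thus "a e u \<in> F" using \<gamma> minus_in by (simp add: a_def)
  qed
 qed
 then obtain z where z: "\<forall>u\<in>T <+> S. z u \<in> F" "\<exists>u\<in>T <+> S. z u \<noteq> 0" "\<forall>e\<in>E. (\<Sum>u\<in>T <+> S. a e u * z u) = 0" by blast
 define B where "B = (\<lambda>y. \<Sum>m\<in>T. z (Inl m) * mono_eval m y)"
 define H where "H = (\<lambda>x. \<Sum>m\<in>S. z (Inr m) * mono_eval m x)"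
 have zT: "z (Inl m) \<in> F" if "m \<in> T" for m using z(1) that by blast
 have Bh: "B \<in> hpoly F t" unfolding B_def by (intro hpoly_sum hpoly_smult hpoly_mono zT) (simp_all add: T_def)
 have Hh: "H \<in> hpoly UNIV (t * D - k)" unfolding H_def by (intro CC.hpoly_sum CC.hpoly_smult CC.hpoly_mono) (simp_all add: S_def)
 have eq: "B (\<Psi> x) = f x * H x" for x
 proof -
  have z3: "(\<Sum>m\<in>T. \<beta> m e * z (Inl m)) - (\<Sum>m\<in>S. \<gamma> m e * z (Inr m)) = 0" if "e \<in> E" for e
  proof -
   have "(\<Sum>u\<in>T <+> S. a e u * z u) = 0" using z(3) that by blast
   thus ?thesis using fin by (simp add: sum.Plus a_def sum_negf)
  qed
  have "B (\<Psi> x) = (\<Sum>m\<in>T. \<Sum>e\<in>E. \<beta> m e * z (Inl m) * mono_eval e x)"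
   unfolding B_def by (intro sum.cong refl) (simp add: \<beta>x sum_distrib_left mult_ac)
  also have "... = (\<Sum>e\<in>E. (\<Sum>m\<in>T. \<beta> m e * z (Inl m)) * mono_eval e x)"
   by (subst sum.swap) (simp add: sum_distrib_right)
  finally have 1: "B (\<Psi> x) = (\<Sum>e\<in>E. (\<Sum>m\<in>T. \<beta> m e * z (Inl m)) * mono_eval e x)" .
  have "f x * H x = (\<Sum>m\<in>S. z (Inr m) * (f x * mono_eval m x))"
   unfolding H_def by (simp add: sum_distrib_left mult_ac)
  also have "... = (\<Sum>m\<in>S. \<Sum>e\<in>E. \<gamma> m e * z (Inr m) * mono_eval e x)"
   by (intro sum.cong refl) (simp add: \<gamma>x sum_distrib_left mult_ac)
  also have "... = (\<Sum>e\<in>E. (\<Sum>m\<in>S. \<gamma> m e * z (Inr m)) * mono_eval e x)"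
   by (subst sum.swap) (simp add: sum_distrib_right)
  finally have 2: "f x * H x = (\<Sum>e\<in>E. (\<Sum>m\<in>S. \<gamma> m e * z (Inr m)) * mono_eval e x)" .
  have "B (\<Psi> x) - f x * H x = (\<Sum>e\<in>E. ((\<Sum>m\<in>T. \<beta> m e * z (Inl m)) - (\<Sum>m\<in>S. \<gamma> m e * z (Inr m))) * mono_eval e x)"
   unfolding 1 2 by (simp add: left_diff_distrib sum_subtractf)
  also have "... = 0" using z3 by (intro sum.neutral) simp
  finally show ?thesis by simp
 qed
 have "\<exists>y. B y \<noteq> 0"
 proof (rule ccontr)
  assume "\<not> ?thesis"
  hence B0: "B y = 0" for y by blast
  hence "f x * H x = 0" for x using eq[of x] by simp
  hence H0: "H y = 0" for y by (rule hpoly_no_zero_divisors[OF hpoly_UNIV[OF f(1)] Hh _ f(3)])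
  have "z (Inl m) = 0" if "m \<in> T" for m
   using mono_eval_independent[OF fin(1), of "\<lambda>m. z (Inl m)" m] B0 that unfolding B_def by blast
  moreover have "z (Inr m) = 0" if "m \<in> S" for m
   using mono_eval_independent[OF fin(2), of "\<lambda>m. z (Inr m)" m] H0 that unfolding H_def by blast
  ultimately show False using z(2) by blast
 qed
 thus ?thesis using Bh eq by blast
qed

text \<open>Divisibility of forms yields a complex cofactor not known to be homogeneous. Comparing
  powers of s along s x isolates its component of degree l - g, and descent with a one-element index
  type makes its coefficients lie in \<open>F\<close>.\<close>

lemma (in csubfield) homogeneous_cofactor:
 fixes L G :: "complex ^ ('n::finite) option => complex"
 assumes L: "L \<in> hpoly F l" "L x0 \<noteq> 0" and G: "G \<in> hpoly F g" and rel: "\<And>x. L x = G x * eval_form H0 x"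
 shows "g \<le> l \<and> (\<exists>H\<in>hpoly F (l - g). \<forall>x. L x = G x * H x)"
proof -
 define E where "E = mono_degree ` Poly_Mapping.keys H0"
 have finE: "finite E" by (simp add: E_def)
 define h where "h = (\<lambda>e x. \<Sum>m\<in>{m\<in>Poly_Mapping.keys H0. mono_degree m = e}. Poly_Mapping.lookup H0 m * mono_eval m x)"
 have hh: "h e \<in> hpoly UNIV e" for e unfolding h_def
  by (intro CC.hpoly_sum CC.hpoly_smult CC.hpoly_mono) (auto simp: mons_def)
 have H0: "eval_form H0 x = (\<Sum>e\<in>E. h e x)" for x
  unfolding eval_form_def mono_eval_def[symmetric] h_def E_def by (rule sum.image_gen) simp
 have h0: "h e x = 0" if "e \<notin> E" for e x
 proof -
  have "{m\<in>Poly_Mapping.keys H0. mono_degree m = e} = {}" using that by (auto simp: E_def)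
  thus ?thesis unfolding h_def by (simp only: sum.empty)
 qed
 have key: "L x = (if g \<le> l then G x * h (l - g) x else 0)" for x
 proof -
  define p where "p = monom (L x) l - (\<Sum>e\<in>E. monom (G x * h e x) (g + e))"
  have "poly p s = 0" for s
  proof -
   have "s ^ l * L x = s ^ g * G x * (\<Sum>e\<in>E. s ^ e * h e x)"
    using rel[of "s *s x"] unfolding H0 hpoly_scale[OF L(1)] hpoly_scale[OF G] hpoly_scale[OF hh] .
   thus ?thesis by (simp add: p_def poly_monom poly_sum sum_distrib_left power_add mult_ac)
  qed
  hence "p = 0" using poly_all_0_iff_0[of p] by blast
  hence "coeff p l = 0" by simp
  hence "L x = (\<Sum>e\<in>E. if g + e = l then G x * h e x else 0)" by (simp add: p_def coeff_sum)
  also have "... = (\<Sum>e\<in>E. if e = l - g then (if g \<le> l then G x * h (l - g) x else 0) else 0)"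
   by (intro sum.cong refl) auto
  also have "... = (if g \<le> l then G x * h (l - g) x else 0)" using finE h0[of "l - g" x] by auto
  finally show ?thesis .
 qed
 have gl: "g \<le> l" using key[of x0] L(2) by (auto split: if_splits)
 have "\<exists>A'. (\<forall>i::unit. A' i \<in> hpoly F (l - g)) \<and> (\<forall>x. L x = (\<Sum>i\<in>UNIV. A' i x * G x))"
 proof (rule hpoly_relation_descent)
  show "L \<in> hpoly F (l - g + g)" using L(1) gl by simp
  show "L x = (\<Sum>i\<in>(UNIV :: unit set). h (l - g) x * G x)" for x using key[of x] gl by (simp add: mult.commute)
 qed (simp_all add: G hh)
 then obtain A' where "\<forall>i::unit. A' i \<in> hpoly F (l - g)" "\<forall>x. L x = (\<Sum>i\<in>(UNIV::unit set). A' i x * G x)" by blast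
 thus ?thesis using gl by (auto intro!: bexI[of _ "A' ()"] simp: UNIV_unit mult.commute)
qed

section \<open>Heights as finite sums\<close>

lemma abs_proj_eq_iff:
 fixes x y :: "complex ^ ('n::finite) option"
 assumes "x \<noteq> 0" "y \<noteq> 0" shows "abs_proj x = abs_proj y \<longleftrightarrow> (\<exists>c. c \<noteq> 0 \<and> y = c *s x)"
proof -
 have "proj_rel z z" if "z \<noteq> 0" for z :: "complex ^ 'n option"
  using that by (auto simp: proj_rel_def intro!: exI[of _ 1])
 thus ?thesis using Quotient_rel[OF Quotient_proj, of x y] assms by (auto simp: proj_rel_def)
qed

lemma abs_proj_scale:
 fixes x :: "complex ^ ('n::finite) option"
 assumes x: "x \<noteq> 0" and c: "c \<noteq> 0" shows "abs_proj (c *s x) = abs_proj x"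
proof -
 have "c *s x \<noteq> 0" using assms by simp
 hence "abs_proj x = abs_proj (c *s x)" using abs_proj_eq_iff[OF x, of "c *s x"] c by blast
 thus ?thesis by simp
qed

lemma rep_proj_props:
 fixes p :: "('n::finite) proj"
 shows "rep_proj p \<noteq> 0" "abs_proj (rep_proj p) = p"
 using Quotient_rep_reflp[OF Quotient_proj, of p] Quotient_abs_rep[OF Quotient_proj, of p]
 by (auto simp: proj_rel_def)

lemma rep_abs_proj:
 fixes x :: "complex ^ ('n::finite) option"
 assumes "x \<noteq> 0" shows "\<exists>c. c \<noteq> 0 \<and> rep_proj (abs_proj x) = c *s x"
 using abs_proj_eq_iff[OF assms rep_proj_props(1), of "abs_proj x"] rep_proj_props(2)[of "abs_proj x"] by simp

lemma zero_locus_iff: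
 assumes "homogeneous e F" "x \<noteq> 0" shows "abs_proj x \<in> zero_locus F \<longleftrightarrow> eval_form F x = 0"
proof -
 obtain c where "c \<noteq> 0" "rep_proj (abs_proj x) = c *s x" using rep_abs_proj[OF assms(2)] by blast
 thus ?thesis by (simp add: zero_locus_def homogeneous_eval_scale[OF assms(1)])
qed

lemma coords_props:
 assumes "p \<in> rational_points K"
 shows "coords K p \<noteq> 0" "\<And>i. coords K p $ i \<in> K" "abs_proj (coords K p) = p"
proof -
 obtain x where "x \<noteq> 0 \<and> (\<forall>i. x $ i \<in> K) \<and> abs_proj x = p" using assms unfolding rational_points_def by blast
 from someI[of "\<lambda>x. x \<noteq> 0 \<and> (\<forall>i. x $ i \<in> K) \<and> abs_proj x = p", OF this]
 show "coords K p \<noteq> 0" "\<And>i. coords K p $ i \<in> K" "abs_proj (coords K p) = p"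
  unfolding coords_def by blast+
qed

definition vnorm :: "(complex => real) => complex ^ ('n::finite) option => real" where
 "vnorm v x = Max (range (\<lambda>i. v (x $ i)))"

lemma vnorm_ge: "v (x $ i) \<le> vnorm v x" unfolding vnorm_def by (intro Max_ge) auto

lemma vnorm_attained: "\<exists>i. vnorm v x = v (x $ i)"
proof -
 have "vnorm v x \<in> range (\<lambda>i. v (x $ i))" unfolding vnorm_def by (intro Max_in) auto
 thus ?thesis by blast
qed

lemma vnorm_eqI: "(\<And>i. v (x $ i) \<le> B) ==> v (x $ j) = B ==> vnorm v x = B"
 using vnorm_attained[of v x] vnorm_ge[of v x j] by (metis antisym)

lemma vnorm_cong: "(\<And>i. v (x $ i) = w (y $ i)) ==> vnorm v x = vnorm w y" by (simp add: vnorm_def)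

context absval
begin

lemma vnorm_pos:
 fixes x :: "complex ^ ('n::finite) option"
 assumes "x \<noteq> 0" "\<And>i. x $ i \<in> K" shows "0 < vnorm v x"
proof -
 obtain i where "x $ i \<noteq> 0" using assms(1) by (auto simp: vec_eq_iff)
 thus ?thesis using v_pos[OF assms(2)] vnorm_ge[of v x i] by (metis less_le_trans)
qed

lemma vnorm_scale:
 fixes x :: "complex ^ ('n::finite) option"
 assumes c: "c \<in> K" and x: "\<And>i. x $ i \<in> K" shows "vnorm v (c *s x) = v c * vnorm v x"
proof -
 obtain j where j: "vnorm v x = v (x $ j)" using vnorm_attained by blast
 show ?thesis
 proof (rule vnorm_eqI)
  show "v ((c *s x) $ i) \<le> v c * vnorm v x" for i
   using vnorm_ge[of v x i] v_nonneg[OF c] by (simp add: v_mult c x mult_left_mono)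
  show "v ((c *s x) $ j) = v c * vnorm v x" by (simp add: v_mult c x j)
 qed
qed

end

definition vsupp :: "complex set => complex ^ ('n::finite) option => nat set" where
 "vsupp K x = (\<Union>i\<in>{i. x $ i \<noteq> 0}. psupp K (x $ i))"

lemma psuppD: "p \<in> place_ids ==> p \<notin> psupp K x ==> v \<in> places_over K p ==> v x = 1"
 unfolding psupp_def by blast

lemma psum_add: "psum K P (\<lambda>v. f v + g v) = psum K P f + psum K P g"
 by (simp add: psum_def sum.distrib distrib_left)

lemma psum_diff: "psum K P (\<lambda>v. f v - g v) = psum K P f - psum K P g"
 by (simp add: psum_def sum_subtractf right_diff_distrib)

lemma psum_cmult: "psum K P (\<lambda>v. c * f v) = c * psum K P f"
 by (simp add: psum_def sum_distrib_left mult_ac)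

lemma psum_cong:
 assumes "\<And>p v. p \<in> P ==> v \<in> places_over K p ==> f v = g v" shows "psum K P f = psum K P g"
 unfolding psum_def using assms by (intro sum.cong refl) simp

lemma psum_mono:
 assumes "\<And>p v. p \<in> P ==> v \<in> places_over K p ==> f v \<le> g v" shows "psum K P f \<le> psum K P g"
 unfolding psum_def using assms by (intro sum_mono mult_left_mono) (simp_all add: nweight_def)

lemma psum_mono_neutral:
 assumes "finite Q" "P \<subseteq> Q" "\<And>p v. p \<in> Q - P ==> v \<in> places_over K p ==> f v = 0"
 shows "psum K P f = psum K Q f"
 unfolding psum_def using assms by (intro sum.mono_neutral_left) auto

lemma psum_mono2:
 assumes "finite Q" "P \<subseteq> Q" "\<And>p v. p \<in> Q ==> v \<in> places_over K p ==> 0 \<le> f v"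
 shows "psum K P f \<le> psum K Q f"
 unfolding psum_def using assms by (intro sum_mono2 sum_nonneg mult_nonneg_nonneg) (auto simp: nweight_def)

lemma normalized_abs_ln:
 assumes "v y > 0" shows "ln (normalized_abs K v y) = nweight K v * ln (v y)" "normalized_abs K v y > 0"
 using assms by (simp_all add: normalized_abs_def nweight_def ln_powr)

lemma normalized_abs_mono: "0 \<le> v y ==> v y \<le> v z ==> normalized_abs K v y \<le> normalized_abs K v z"
 unfolding normalized_abs_def by (intro powr_mono2) auto

text \<open>The local height before multiplication by the normalising weight of the place.\<close>

definition lam :: "nat => (complex ^ ('n::finite) option => complex) => (complex => real) => complex ^ 'n option => real" where
 "lam e f v x = real e * ln (vnorm v x) - ln (v (f x))"

context galois_subfield
begin

lemma finite_vsupp: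
 fixes x :: "complex ^ ('n::finite) option"
 shows "(\<And>i. x $ i \<in> K) ==> finite (vsupp K x)"
 unfolding vsupp_def by (intro finite_UN_I finite_psupp) auto

lemma vnorm_eq_1:
 fixes x :: "complex ^ ('n::finite) option"
 assumes "x \<noteq> 0" "\<And>i. x $ i \<in> K" "p \<in> place_ids" "p \<notin> vsupp K x" "v \<in> places_over K p"
 shows "vnorm v x = 1"
proof -
 interpret v: absval K v by (rule places_overD[OF assms(5) K.csubfield_axioms])
 have one: "v (x $ i) = 1" if "x $ i \<noteq> 0" for i
  using that assms(4) by (intro psuppD[OF assms(3) _ assms(5)]) (auto simp: vsupp_def)
 obtain j where j: "x $ j \<noteq> 0" using assms(1) by (auto simp: vec_eq_iff)
 show ?thesis
 proof (rule vnorm_eqI)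
  show "v (x $ i) \<le> 1" for i using one[of i] by (cases "x $ i = 0") auto
  show "v (x $ j) = 1" by (rule one[OF j])
 qed
qed

lemma psum_const: assumes "P \<subseteq> place_ids" shows "psum K P (\<lambda>_. c) = c * real (card P)"
 unfolding psum_eq[OF assms] using card_G_pos by simp

lemma nweight_sum: assumes "p \<in> place_ids" shows "(\<Sum>v\<in>places_over K p. nweight K v) = 1"
 using psum_const[of "{p}" 1] assms by (simp add: psum_def)

lemma psum_le:
 assumes "P \<subseteq> place_ids" "\<And>p v. p \<in> P ==> v \<in> places_over K p ==> f v \<le> b p"
 shows "psum K P f \<le> (\<Sum>p\<in>P. b p)"
 unfolding psum_def
proof (rule sum_mono)
 fix p assume p: "p \<in> P"
 have "(\<Sum>v\<in>places_over K p. nweight K v * f v) \<le> (\<Sum>v\<in>places_over K p. nweight K v * b p)"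
  using assms(2)[OF p] by (intro sum_mono mult_left_mono) (simp_all add: nweight_def)
 also have "... = b p" using nweight_sum[of p] assms(1) p by (simp add: sum_distrib_right[symmetric] subset_iff)
 finally show "(\<Sum>v\<in>places_over K p. nweight K v * f v) \<le> b p" .
qed

text \<open>Only finitely many places lie above each p, so a summand that vanishes outside
  \<open>P\<close> leaves a finite sum.\<close>

lemma infsum_places:
 fixes f :: "(complex => real) => 'a::{comm_monoid_add, t2_space}"
 assumes P: "finite P" "P \<subseteq> place_ids" and A: "A \<subseteq> places K"
  and f: "\<And>p v. p \<in> place_ids - P ==> v \<in> places_over K p ==> f v = 0"
 shows "infsum f A = (\<Sum>p\<in>P. \<Sum>v\<in>places_over K p. if v \<in> A then f v else 0)"
proof -
 define V where "V = (\<Union>p\<in>P. places_over K p)"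
 have fin: "finite (places_over K p)" if "p \<in> P" for p using finite_places_over that P by blast
 have finV: "finite V" unfolding V_def using P(1) fin by blast
 have "infsum f A = infsum f (A \<inter> V)"
  by (rule infsum_cong_neutral) (use A f in \<open>auto simp: places_eq V_def\<close>)
 also have "... = sum f (A \<inter> V)" using finV by (intro infsum_finite) simp
 also have "... = (\<Sum>v\<in>V. if v \<in> A then f v else 0)" unfolding Int_commute[of A] by (rule sum.inter_restrict[OF finV])
 also have "... = (\<Sum>p\<in>P. \<Sum>v\<in>places_over K p. if v \<in> A then f v else 0)"
  unfolding V_def
 proof (rule sum.UNION_disjoint[OF P(1)])
  show "\<forall>p\<in>P. finite (places_over K p)" using fin by blast
  show "\<forall>p\<in>P. \<forall>p'\<in>P. p \<noteq> p' \<longrightarrow> places_over K p \<inter> places_over K p' = {}"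
   using places_over_disjoint P(2) by (simp add: subset_iff)
 qed
 finally show ?thesis .
qed

lemma ln_Max_normalized:
 fixes x :: "complex ^ ('n::finite) option"
 assumes x: "x \<noteq> 0" "\<And>i. x $ i \<in> K" and v: "v \<in> places_over K p" and that: "vnorm v x = v (x $ j)"
 shows "Max (range (\<lambda>i. normalized_abs K v (x $ i))) = normalized_abs K v (x $ j)"
proof (rule antisym)
 interpret v: absval K v by (rule places_overD[OF v K.csubfield_axioms])
 show "Max (range (\<lambda>i. normalized_abs K v (x $ i))) \<le> normalized_abs K v (x $ j)"
  using vnorm_ge[of v x] v.v_nonneg[OF x(2)] that by (auto intro!: normalized_abs_mono)
qed (intro Max_ge; auto)

lemma height_coords:
 assumes p: "p \<in> rational_points K" and P: "finite P" "P \<subseteq> place_ids" "vsupp K (coords K p) \<subseteq> P"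
 shows "height K p = psum K P (\<lambda>v. ln (vnorm v (coords K p)))"
proof -
 define x where "x = coords K p"
 have x: "x \<noteq> 0" "\<And>i. x $ i \<in> K" using coords_props[OF p] by (simp_all add: x_def)
 have loc: "ln (Max (range (\<lambda>i. normalized_abs K v (x $ i)))) = nweight K v * ln (vnorm v x)"
  if v: "v \<in> places_over K q" for v q
 proof -
  interpret v: absval K v by (rule places_overD[OF v K.csubfield_axioms])
  obtain j where j: "vnorm v x = v (x $ j)" using vnorm_attained by blast
  have "0 < v (x $ j)" using v.vnorm_pos[OF x] j by simp
  thus ?thesis unfolding ln_Max_normalized[OF x v j] unfolding j by (rule normalized_abs_ln)
 qed
 have "height K p = (\<Sum>q\<in>P. \<Sum>v\<in>places_over K q. if v \<in> places K then ln (Max (range (\<lambda>i. normalized_abs K v (x $ i)))) else 0)"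
  unfolding height_def x_def[symmetric]
 proof (rule infsum_places[OF P(1,2) order.refl])
  fix q v assume q: "q \<in> place_ids - P" "v \<in> places_over K q"
  have "vnorm v x = 1" using q P(3) by (intro vnorm_eq_1[OF x, of q]) (auto simp: x_def)
  thus "ln (Max (range (\<lambda>i. normalized_abs K v (x $ i)))) = 0" using loc[OF q(2)] by simp
 qed
 also have "... = psum K P (\<lambda>v. ln (vnorm v x))" unfolding psum_def
 proof (intro sum.cong refl)
  fix q v assume "q \<in> P" "v \<in> places_over K q"
  moreover from this have "v \<in> places K" using P(2) unfolding places_eq by blast
  ultimately show "(if v \<in> places K then ln (Max (range (\<lambda>i. normalized_abs K v (x $ i)))) else 0) = nweight K v * ln (vnorm v x)"
   using loc by simp
 qed
 finally show ?thesis by (simp add: x_def)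
qed

lemma proportional_in:
 fixes x y :: "complex ^ ('n::finite) option"
 assumes "x \<noteq> 0" "\<And>i. x $ i \<in> K" "\<And>i. y $ i \<in> K" "y = c *s x" shows "c \<in> K"
proof -
 obtain i where i: "x $ i \<noteq> 0" using assms(1) by (auto simp: vec_eq_iff)
 have "y $ i / x $ i \<in> K" using assms(2,3) by (intro K.divide_in)
 thus ?thesis using i assms(4) by simp
qed

text \<open>\<open>coords\<close> is an arbitrary choice of coordinates; the factor to any other
  choice disappears by the product formula, after \<open>P\<close> has been enlarged by the places
  where that factor or the chosen coordinates are not units.\<close>

lemma height_eq:
 fixes y :: "complex ^ ('n::finite) option"
 assumes y: "y \<noteq> 0" "\<And>i. y $ i \<in> K" and P: "finite P" "P \<subseteq> place_ids" "vsupp K y \<subseteq> P" "0 \<in> P"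
 shows "height K (abs_proj y) = psum K P (\<lambda>v. ln (vnorm v y))"
proof -
 define p where "p = abs_proj y"
 have p: "p \<in> rational_points K" unfolding p_def rational_points_def using y by blast
 define x where "x = coords K p"
 have x: "x \<noteq> 0" "\<And>i. x $ i \<in> K" "abs_proj x = p" using coords_props[OF p] by (simp_all add: x_def)
 obtain c where c: "c \<noteq> 0" "x = c *s y" using abs_proj_eq_iff[OF y(1) x(1)] x(3) by (auto simp: p_def)
 have cK: "c \<in> K" by (rule proportional_in[OF y x(2) c(2)])
 define Q where "Q = P \<union> vsupp K x \<union> psupp K c"
 have Q: "finite Q" "Q \<subseteq> place_ids" "P \<subseteq> Q" "vsupp K x \<subseteq> Q" "psupp K c \<subseteq> Q" "0 \<in> Q"
  using P finite_vsupp[OF x(2)] finite_psupp[OF cK c(1)] by (auto simp: Q_def vsupp_def psupp_def)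
 have "height K p = psum K Q (\<lambda>v. ln (vnorm v x))" using height_coords[OF p Q(1,2)] Q(4) by (simp add: x_def)
 also have "... = psum K Q (\<lambda>v. ln (v c) + ln (vnorm v y))"
 proof (rule psum_cong)
  fix q v assume v: "v \<in> places_over K q"
  interpret v: absval K v by (rule places_overD[OF v K.csubfield_axioms])
  show "ln (vnorm v x) = ln (v c) + ln (vnorm v y)"
   unfolding c(2) v.vnorm_scale[OF cK y(2)] using v.v_pos[OF cK c(1)] v.vnorm_pos[OF y] by (simp add: ln_mult)
 qed
 also have "... = psum K Q (\<lambda>v. ln (vnorm v y))"
  unfolding psum_add using product_formula[OF cK c(1) Q(1,2,5,6)] by simp
 also have "... = psum K P (\<lambda>v. ln (vnorm v y))"
 proof (rule psum_mono_neutral[OF Q(1,3), symmetric])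
  fix q v assume "q \<in> Q - P" "v \<in> places_over K q"
  hence "vnorm v y = 1" using Q P by (intro vnorm_eq_1[OF y, of q]) auto
  thus "ln (vnorm v y) = 0" by simp
 qed
 finally show ?thesis by (simp add: p_def)
qed

lemma lam_scale:
 fixes y :: "complex ^ ('n::finite) option"
 assumes f: "f \<in> hpoly K e" and y: "y \<noteq> 0" "\<And>i. y $ i \<in> K" "f y \<in> K" "f y \<noteq> 0" and c: "c \<in> K" "c \<noteq> 0" and v: "v \<in> places_over K p"
 shows "lam e f v (c *s y) = lam e f v y"
proof -
 interpret v: absval K v by (rule places_overD[OF v K.csubfield_axioms])
 show ?thesis
  using v.v_pos[OF c] v.vnorm_pos[OF y(1,2)] v.v_pos[OF y(3,4)]
  by (simp add: lam_def v.vnorm_scale[OF c(1) y(2)] hpoly_scale[OF f] v.v_mult v.v_power K.power_in c y ln_mult ln_realpow algebra_simps)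
qed

lemma hpoly_in:
 fixes y :: "complex ^ ('n::finite) option"
 assumes "f \<in> hpoly K e" "\<And>i. y $ i \<in> K" shows "f y \<in> K"
proof -
 obtain a where "f = (\<lambda>x. \<Sum>m\<in>mons e. a m * mono_eval m x)" "\<forall>m. a m \<in> K" using assms(1) unfolding hpoly_def by blast
 thus ?thesis using assms(2) by (auto simp: mono_eval_def intro!: K.sum_in K.mult_in K.prod_in K.power_in)
qed

lemma local_height_eq:
 fixes y :: "complex ^ ('n::finite) option"
 assumes F: "homogeneous e F" "coeffs_in K F" "form_degree F = e"
  and y: "y \<noteq> 0" "\<And>i. y $ i \<in> K" "eval_form F y \<noteq> 0" and v: "v \<in> places_over K p"
 shows "local_height K v F (abs_proj y) = ereal (nweight K v * lam e (eval_form F) v y)"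
proof -
 interpret v: absval K v by (rule places_overD[OF v K.csubfield_axioms])
 define q where "q = abs_proj y"
 have q: "q \<in> rational_points K" unfolding q_def rational_points_def using y by blast
 define x where "x = coords K q"
 have x: "x \<noteq> 0" "\<And>i. x $ i \<in> K" "abs_proj x = q" using coords_props[OF q] by (simp_all add: x_def)
 obtain c where c: "c \<noteq> 0" "x = c *s y" using abs_proj_eq_iff[OF y(1) x(1)] x(3) by (auto simp: q_def)
 have cK: "c \<in> K" by (rule proportional_in[OF y(1,2) x(2) c(2)])
 have hF: "eval_form F \<in> hpoly K e" by (rule K.hpoly_eval_form[OF F(1,2)])
 have Fx: "eval_form F x \<noteq> 0" unfolding c(2) using homogeneous_eval_scale[OF F(1)] c(1) y(3) by simp
 have FxK: "eval_form F x \<in> K" by (rule hpoly_in[OF hF x(2)])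
 have FyK: "eval_form F y \<in> K" by (rule hpoly_in[OF hF y(2)])
 obtain j where j: "vnorm v x = v (x $ j)" using vnorm_attained by blast
 have xj: "0 < v (x $ j)" using v.vnorm_pos[OF x(1,2)] j by simp
 hence xj0: "x $ j \<noteq> 0" by auto
 have "Min (range (\<lambda>i. valuation K v (x $ i))) = valuation K v (x $ j)"
 proof (rule antisym)
  have "valuation K v (x $ j) \<le> valuation K v (x $ i)" for i
  proof (cases "x $ i = 0")
   case False
   have le: "v (x $ i) \<le> v (x $ j)" using vnorm_ge[of v x i] j by simp
   have "ln (normalized_abs K v (x $ i)) \<le> ln (normalized_abs K v (x $ j))"
    using v.v_pos[OF x(2) False] normalized_abs_ln(2)[of v "x $ i" K] normalized_abs_mono[OF _ le, of K]
    by (intro ln_mono) auto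
   thus ?thesis using False xj0 by (simp add: valuation_def)
  qed (simp add: valuation_def)
  thus "valuation K v (x $ j) \<le> Min (range (\<lambda>i. valuation K v (x $ i)))" by (intro Min.boundedI) auto
 qed (intro Min_le; auto)
 also have "... = ereal (- nweight K v * ln (vnorm v x))"
  using xj0 normalized_abs_ln(1)[of v "x $ j" K, OF xj] j by (simp add: valuation_def)
 finally have mn: "Min (range (\<lambda>i. valuation K v (x $ i))) = ereal (- nweight K v * ln (vnorm v x))" .
 have vF: "valuation K v (eval_form F x) = ereal (- nweight K v * ln (v (eval_form F x)))"
  using Fx normalized_abs_ln(1)[of v "eval_form F x" K, OF v.v_pos[OF FxK Fx]] by (simp add: valuation_def)
 have "local_height K v F q = ereal (nweight K v * lam e (eval_form F) v x)"
  unfolding local_height_def x_def[symmetric] mn vF F(3) lam_def by (simp add: algebra_simps)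
 also have "lam e (eval_form F) v x = lam e (eval_form F) v y"
  unfolding c(2) by (rule lam_scale[OF hF y(1,2) FyK y(3) cK c(1) v])
 finally show ?thesis by (simp add: q_def)
qed

lemma lam_eq_0:
 fixes y :: "complex ^ ('n::finite) option"
 assumes y: "y \<noteq> 0" "\<And>i. y $ i \<in> K" and p: "p \<in> place_ids" "p \<notin> vsupp K y" "p \<notin> psupp K (f y)" and v: "v \<in> places_over K p"
 shows "lam e f v y = 0"
 using vnorm_eq_1[OF y p(1,2) v] psuppD[OF p(1,3) v] by (simp add: lam_def)

lemma sum_local_heights:
 fixes y :: "complex ^ ('n::finite) option"
 assumes F: "homogeneous e F" "coeffs_in K F" "form_degree F = e"
  and y: "y \<noteq> 0" "\<And>i. y $ i \<in> K" "eval_form F y \<noteq> 0"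
  and P: "finite P" "P \<subseteq> place_ids" "vsupp K y \<subseteq> P" "psupp K (eval_form F y) \<subseteq> P" and A: "A \<subseteq> places K"
 shows "(\<Sum>\<^sub>\<infinity>v\<in>A. local_height K v F (abs_proj y)) = ereal (psum K P (\<lambda>v. if v \<in> A then lam e (eval_form F) v y else 0))"
proof -
 have "(\<Sum>\<^sub>\<infinity>v\<in>A. local_height K v F (abs_proj y))
   = (\<Sum>p\<in>P. \<Sum>v\<in>places_over K p. if v \<in> A then local_height K v F (abs_proj y) else 0)"
 proof (rule infsum_places[OF P(1,2) A])
  fix p v assume p: "p \<in> place_ids - P" "v \<in> places_over K p"
  have "lam e (eval_form F) v y = 0" by (rule lam_eq_0[OF y(1,2) _ _ _ p(2)]) (use p P in auto)
  thus "local_height K v F (abs_proj y) = 0" using local_height_eq[OF F y p(2)] by simp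
 qed
 also have "... = (\<Sum>p\<in>P. \<Sum>v\<in>places_over K p. ereal (nweight K v * (if v \<in> A then lam e (eval_form F) v y else 0)))"
 proof (intro sum.cong refl)
  fix p v assume "v \<in> places_over K p"
  from local_height_eq[OF F y this] show "(if v \<in> A then local_height K v F (abs_proj y) else 0) =
    ereal (nweight K v * (if v \<in> A then lam e (eval_form F) v y else 0))" by simp
 qed
 finally show ?thesis by (simp add: psum_def)
qed

text \<open>Bounds at the places of the rationals, to be used in the form \<open>exp (b p)\<close>.\<close>

definition adelic_bound :: "(nat => real) => bool" where
 "adelic_bound b \<longleftrightarrow> (\<forall>p. 0 \<le> b p) \<and> finite {p. b p \<noteq> 0}"

lemma adelic_bound_add: "adelic_bound b ==> adelic_bound c ==> adelic_bound (\<lambda>p. b p + c p)"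
 unfolding adelic_bound_def by (auto intro: finite_subset[of _ "{p. b p \<noteq> 0} \<union> {p. c p \<noteq> 0}"])

lemma adelic_bound_sum: "finite I ==> (\<And>i. i \<in> I ==> adelic_bound (b i)) ==> adelic_bound (\<lambda>p. \<Sum>i\<in>I. b i p)"
 by (induction I rule: finite_induct) (simp_all add: adelic_bound_add, simp add: adelic_bound_def)

lemma adelic_bound_total:
 assumes "adelic_bound b" "finite P" shows "(\<Sum>p\<in>P. b p) \<le> (\<Sum>p\<in>{p. b p \<noteq> 0}. b p)"
proof -
 have "(\<Sum>p\<in>P. b p) = (\<Sum>p\<in>P \<inter> {p. b p \<noteq> 0}. b p)" using assms(2) by (intro sum.mono_neutral_right) auto
 also have "... \<le> (\<Sum>p\<in>{p. b p \<noteq> 0}. b p)" using assms(1) unfolding adelic_bound_def by (intro sum_mono2) auto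
 finally show ?thesis .
qed

lemma hpoly_adelic_bound:
 fixes f :: "complex ^ ('n::finite) option => complex"
 assumes f: "f \<in> hpoly K e"
 shows "\<exists>b. adelic_bound b \<and> (\<forall>p\<in>place_ids. \<forall>v\<in>places_over K p. \<forall>x. (\<forall>i. x $ i \<in> K) \<longrightarrow> v (f x) \<le> exp (b p) * vnorm v x ^ e)"
proof -
 obtain a where a: "f = (\<lambda>x. \<Sum>m\<in>mons e. a m * mono_eval m x)" "\<forall>m. a m \<in> K" using f unfolding hpoly_def by blast
 define S where "S = (mons e :: ('n option \<Rightarrow>\<^sub>0 nat) set)"
 have finS: "finite S" by (simp add: S_def)
 define T where "T = insert 0 (\<Union>m\<in>{m\<in>S. a m \<noteq> 0}. psupp K (a m))"
 have T: "finite T" "T \<subseteq> place_ids" "0 \<in> T" using finS finite_psupp a(2) by (auto simp: T_def psupp_def place_ids_def)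
 define V where "V = (\<Union>p\<in>T. places_over K p)"
 have finV: "finite V" unfolding V_def using T finite_places_over by blast
 have nn: "0 \<le> v (a m)" if "v \<in> places_over K p" for v p m
  using absval.v_nonneg[OF places_overD(1)[OF that K.csubfield_axioms]] a(2) by blast
 \<comment> \<open>A single constant for all exceptional places; the summand 1 keeps its logarithm
   nonnegative.\<close>
 define C where "C = 1 + (\<Sum>v\<in>V. \<Sum>m\<in>S. v (a m))"
 have VS: "0 \<le> (\<Sum>m\<in>S. v (a m))" if "v \<in> V" for v using that nn unfolding V_def by (blast intro: sum_nonneg)
 have C: "1 \<le> C" unfolding C_def using sum_nonneg[of V "\<lambda>v. \<Sum>m\<in>S. v (a m)"] VS by simp
 have CV: "(\<Sum>m\<in>S. v (a m)) \<le> C" if "v \<in> V" for v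
  unfolding C_def by (rule order.trans[OF member_le_sum[of v V "\<lambda>v. \<Sum>m\<in>S. v (a m)"]]) (use that VS finV in auto)
 define b where "b = (\<lambda>p. if p \<in> T then ln C else 0)"
 have "adelic_bound b" unfolding adelic_bound_def b_def using C T(1) by (auto intro: finite_subset[of _ T])
 moreover have "v (f x) \<le> exp (b p) * vnorm v x ^ e"
  if p: "p \<in> place_ids" and v: "v \<in> places_over K p" and x: "\<forall>i. x $ i \<in> K" for p v and x :: "complex ^ 'n option"
 proof -
  interpret v: absval K v by (rule places_overD[OF v K.csubfield_axioms])
  have xK: "x $ i \<in> K" for i using x by blast
  have moK: "mono_eval m x \<in> K" for m unfolding mono_eval_def using x by (intro K.prod_in K.power_in) blast
  have vn0: "0 \<le> vnorm v x" using vnorm_ge[of v x None] v.v_nonneg[OF xK[of None]] by linarith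
  have mo: "v (mono_eval m x) \<le> vnorm v x ^ e" if "m \<in> S" for m
  proof -
   have "v (mono_eval m x) = (\<Prod>i\<in>UNIV. v (x $ i) ^ Poly_Mapping.lookup m i)"
    unfolding mono_eval_def by (simp add: v.v_prod v.v_power K.power_in xK)
   also have "... \<le> (\<Prod>i\<in>UNIV. vnorm v x ^ Poly_Mapping.lookup m i)"
    by (intro prod_mono conjI power_mono vnorm_ge zero_le_power v.v_nonneg xK)
   also have "... = vnorm v x ^ e" using that by (simp add: power_sum[symmetric] S_def mons_def mono_degree_def)
   finally show ?thesis .
  qed
  show ?thesis
  proof (cases "p \<in> T")
   case True
   hence vV: "v \<in> V" using v by (auto simp: V_def)
   have "v (f x) \<le> (\<Sum>m\<in>S. v (a m * mono_eval m x))"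
    unfolding a(1) S_def using a(2) by (intro v.v_sum K.mult_in moK) blast
   also have "... \<le> (\<Sum>m\<in>S. v (a m) * vnorm v x ^ e)"
    using a(2) mo nn[OF v] by (intro sum_mono) (simp add: v.v_mult moK mult_left_mono)
   also have "... \<le> C * vnorm v x ^ e"
    unfolding sum_distrib_right[symmetric] using CV[OF vV] vn0 by (intro mult_right_mono) auto
   finally show ?thesis using True C by (simp add: b_def)
  next
   case False
   hence pr: "Factorial_Ring.prime p" using p T(3) by (auto simp: place_ids_def)
   have va: "v (a m) \<le> 1" if "m \<in> S" for m
   proof (cases "a m = 0")
    case False
    hence "p \<notin> psupp K (a m)" using \<open>p \<notin> T\<close> that by (auto simp: T_def)
    thus ?thesis using psuppD[OF p _ v] by simp
   qed simp
   have "v (f x) \<le> vnorm v x ^ e" unfolding a(1) S_def[symmetric]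
   proof (rule v.v_sum_ultrametric)
    show "v (of_nat n) \<le> 1" for n by (rule place_ultrametric_nat[OF v pr])
    show "a m * mono_eval m x \<in> K" if "m \<in> S" for m using a(2) moK by (intro K.mult_in) blast+
    show "v (a m * mono_eval m x) \<le> vnorm v x ^ e" if "m \<in> S" for m
    proof -
     have "v (a m) * v (mono_eval m x) \<le> 1 * vnorm v x ^ e"
      using va[OF that] mo[OF that] v.v_nonneg[OF moK] by (intro mult_mono) auto
     thus ?thesis using a(2) by (simp add: v.v_mult moK)
    qed
   qed (use vn0 in simp)
   thus ?thesis using False by (simp add: b_def)
  qed
 qed
 ultimately show ?thesis by blast
qed

lemma sum_adelic_bound:
 assumes p: "p \<in> place_ids" and v: "v \<in> places_over K p" and I: "finite I" "I \<noteq> {}"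
  and u: "\<And>i. i \<in> I ==> u i \<in> K" "\<And>i. i \<in> I ==> v (u i) \<le> B" and B: "0 \<le> B"
 shows "v (\<Sum>i\<in>I. u i) \<le> exp (if p = 0 then ln (real (card I)) else 0) * B"
proof -
 interpret v: absval K v by (rule places_overD[OF v K.csubfield_axioms])
 show ?thesis
 proof (cases "p = 0")
  case True
  have "v (\<Sum>i\<in>I. u i) \<le> (\<Sum>i\<in>I. v (u i))" by (rule v.v_sum[OF u(1)])
  also have "... \<le> real (card I) * B" using sum_bounded_above[of I "\<lambda>i. v (u i)" B] u(2) by simp
  finally show ?thesis using True I by (simp add: card_gt_0_iff)
 next
  case False
  hence pr: "Factorial_Ring.prime p" using p by (auto simp: place_ids_def)
  have "v (\<Sum>i\<in>I. u i) \<le> B"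
   by (rule v.v_sum_ultrametric[OF place_ultrametric_nat[OF v pr] B u])
  thus ?thesis using False by simp
 qed
qed

lemma morphism_upper_bound:
 fixes \<Psi> :: "complex ^ ('n::finite) option => complex ^ 'n option"
 assumes \<Psi>: "\<And>i. (\<lambda>x. \<Psi> x $ i) \<in> hpoly K D"
 shows "\<exists>b. adelic_bound b \<and> (\<forall>p\<in>place_ids. \<forall>v\<in>places_over K p. \<forall>x. (\<forall>i. x $ i \<in> K) \<longrightarrow>
  vnorm v (\<Psi> x) \<le> exp (b p) * vnorm v x ^ D)"
proof -
 have "\<forall>i. \<exists>b. adelic_bound b \<and> (\<forall>p\<in>place_ids. \<forall>v\<in>places_over K p. \<forall>x. (\<forall>i. x $ i \<in> K) \<longrightarrow>
  v (\<Psi> x $ i) \<le> exp (b p) * vnorm v x ^ D)" using hpoly_adelic_bound[OF \<Psi>] by blast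
 from choice[OF this] obtain b where b: "\<forall>i. adelic_bound (b i) \<and> (\<forall>p\<in>place_ids. \<forall>v\<in>places_over K p. \<forall>x. (\<forall>i. x $ i \<in> K) \<longrightarrow>
  v (\<Psi> x $ i) \<le> exp (b i p) * vnorm v x ^ D)" ..
 have ad: "adelic_bound (\<lambda>p. \<Sum>i\<in>UNIV. b i p)" by (rule adelic_bound_sum) (use b in auto)
 moreover have "vnorm v (\<Psi> x) \<le> exp (\<Sum>i\<in>UNIV. b i p) * vnorm v x ^ D"
  if p: "p \<in> place_ids" and v: "v \<in> places_over K p" and x: "\<forall>i. x $ i \<in> K" for p v and x :: "complex ^ 'n option"
 proof -
  interpret v: absval K v by (rule places_overD[OF v K.csubfield_axioms])
  have xN: "x $ None \<in> K" using x by blast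
  have vn0: "0 \<le> vnorm v x" using vnorm_ge[of v x None] v.v_nonneg[OF xN] by linarith
  obtain j where j: "vnorm v (\<Psi> x) = v (\<Psi> x $ j)" using vnorm_attained by blast
  have "vnorm v (\<Psi> x) \<le> exp (b j p) * vnorm v x ^ D" unfolding j using b p v x by blast
  also have "b j p \<le> (\<Sum>i\<in>UNIV. b i p)" using b unfolding adelic_bound_def by (intro member_le_sum) auto
  finally show ?thesis using vn0 by (simp add: mult_right_mono)
 qed
 ultimately show ?thesis by blast
qed

text \<open>At the coordinate x_j of largest size the Nullstellensatz writes a power of x_j through
  the components of \<Psi>; the surplus power of the norm cancels against the cofactors.\<close>

lemma morphism_lower_bound:
 fixes \<Psi> :: "complex ^ ('n::finite) option => complex ^ 'n option"
 assumes \<Psi>: "\<And>i. (\<lambda>x. \<Psi> x $ i) \<in> hpoly K D" and nz: "\<And>x. x \<noteq> 0 ==> \<Psi> x \<noteq> 0"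
 shows "\<exists>b. adelic_bound b \<and> (\<forall>p\<in>place_ids. \<forall>v\<in>places_over K p. \<forall>x. x \<noteq> 0 \<longrightarrow> (\<forall>i. x $ i \<in> K) \<longrightarrow>
  vnorm v x ^ D \<le> exp (b p) * vnorm v (\<Psi> x))"
proof -
 have nz': "\<exists>i. \<Psi> x $ i \<noteq> 0" if "x \<noteq> 0" for x using nz[OF that] by (auto simp: vec_eq_iff)
 have "\<forall>j. \<exists>M A. D \<le> M \<and> (\<forall>i. A i \<in> hpoly K (M - D)) \<and> (\<forall>x. x $ j ^ M = (\<Sum>i\<in>UNIV. A i x * \<Psi> x $ i))"
  using K.projective_nullstellensatz[of "\<lambda>i x. \<Psi> x $ i", OF \<Psi> nz'] by blast
 from choice[OF this] obtain M where "\<forall>j. \<exists>A. D \<le> M j \<and> (\<forall>i. A i \<in> hpoly K (M j - D)) \<and> (\<forall>x. x $ j ^ M j = (\<Sum>i\<in>UNIV. A i x * \<Psi> x $ i))" ..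
 from choice[OF this] obtain A where A: "\<forall>j. D \<le> M j \<and> (\<forall>i. A j i \<in> hpoly K (M j - D)) \<and> (\<forall>x. x $ j ^ M j = (\<Sum>i\<in>UNIV. A j i x * \<Psi> x $ i))" ..
 have A1: "D \<le> M j" and A2: "A j i \<in> hpoly K (M j - D)" and A3: "x $ j ^ M j = (\<Sum>i\<in>UNIV. A j i x * \<Psi> x $ i)" for i j x
  using A by blast+
 have "\<forall>u. \<exists>b. adelic_bound b \<and> (\<forall>p\<in>place_ids. \<forall>v\<in>places_over K p. \<forall>x. (\<forall>i. x $ i \<in> K) \<longrightarrow>
  v (A (fst u) (snd u) x) \<le> exp (b p) * vnorm v x ^ (M (fst u) - D))"
  by (intro allI hpoly_adelic_bound A2)
 from choice[OF this] obtain b where b: "\<forall>u. adelic_bound (b u) \<and> (\<forall>p\<in>place_ids. \<forall>v\<in>places_over K p. \<forall>x. (\<forall>i. x $ i \<in> K) \<longrightarrow>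
  v (A (fst u) (snd u) x) \<le> exp (b u p) * vnorm v x ^ (M (fst u) - D))" ..
 \<comment> \<open>The number of summands matters at the archimedean places only. \<open>B\<close>
   adds up the bounds of all cofactors, since the coordinate of largest size varies with the place
   and the point.\<close>
 define b0 where "b0 = (\<lambda>p::nat. if p = 0 then ln (real CARD('n option)) else 0)"
 define B where "B = (\<lambda>p. b0 p + (\<Sum>u\<in>UNIV. b u p))"
 have ad: "adelic_bound B" unfolding B_def
 proof (intro adelic_bound_add adelic_bound_sum)
  show "adelic_bound b0" by (auto simp: adelic_bound_def b0_def)
  show "adelic_bound (b u)" for u using b by blast
 qed simp
 moreover have "vnorm v x ^ D \<le> exp (B p) * vnorm v (\<Psi> x)"
  if p: "p \<in> place_ids" and v: "v \<in> places_over K p" and x: "x \<noteq> 0" "\<forall>i. x $ i \<in> K" for p v and x :: "complex ^ 'n option"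
 proof -
  interpret v: absval K v by (rule places_overD[OF v K.csubfield_axioms])
  have xK: "x $ i \<in> K" for i using x by blast
  have \<Psi>K: "\<Psi> x $ i \<in> K" for i by (rule hpoly_in[OF \<Psi> xK])
  have vn: "0 < vnorm v x" by (rule v.vnorm_pos[OF x(1) xK])
  have vn\<Psi>: "0 < vnorm v (\<Psi> x)" by (rule v.vnorm_pos[OF nz[OF x(1)] \<Psi>K])
  obtain j where j: "vnorm v x = v (x $ j)" using vnorm_attained by blast
  define R where "R = exp (\<Sum>u\<in>UNIV. b u p) * vnorm v x ^ (M j - D) * vnorm v (\<Psi> x)"
  have R0: "0 \<le> R" using vn vn\<Psi> by (simp add: R_def)
  have AK: "A j i x \<in> K" for i by (rule hpoly_in[OF A2 xK])
  have each: "v (A j i x * \<Psi> x $ i) \<le> R" for i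
  proof -
   have "v (A j i x) \<le> exp (b (j, i) p) * vnorm v x ^ (M j - D)"
    using b[THEN spec[of _ "(j, i)"]] p v x(2) by (simp add: Ball_def)
   also have "... \<le> exp (\<Sum>u\<in>UNIV. b u p) * vnorm v x ^ (M j - D)"
   proof -
    have "b (j, i) p \<le> (\<Sum>u\<in>UNIV. b u p)" using b unfolding adelic_bound_def by (intro member_le_sum) auto
    thus ?thesis using vn by (simp add: mult_right_mono)
   qed
   finally have "v (A j i x) * v (\<Psi> x $ i) \<le> R"
    unfolding R_def using vn vnorm_ge[of v "\<Psi> x" i] v.v_nonneg[OF \<Psi>K] by (intro mult_mono) auto
   thus ?thesis by (simp add: v.v_mult AK \<Psi>K)
  qed
  have "vnorm v x ^ M j = v (\<Sum>i\<in>UNIV. A j i x * \<Psi> x $ i)" unfolding j A3[symmetric] by (simp add: v.v_power xK)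
  also have "... \<le> exp (b0 p) * R" unfolding b0_def
   by (rule sum_adelic_bound[OF p v finite UNIV_not_empty _ each R0]) (intro K.mult_in AK \<Psi>K)
  also have "... = vnorm v x ^ (M j - D) * (exp (B p) * vnorm v (\<Psi> x))" by (simp add: R_def B_def exp_add)
  finally have "vnorm v x ^ (M j - D) * vnorm v x ^ D \<le> vnorm v x ^ (M j - D) * (exp (B p) * vnorm v (\<Psi> x))"
   using A1[of j] by (simp add: power_add[symmetric])
  thus ?thesis using vn by simp
 qed
 ultimately show ?thesis by blast
qed

end

section \<open>Finiteness of points of bounded height\<close>

lemma (in absval) coeff_prod_ultrametric:
 assumes nat: "\<And>n::nat. v (of_nat n) \<le> 1" and f: "\<And>s. s \<in> H ==> f s \<in> K" and H: "finite H"
 shows "coeff (\<Prod>s\<in>H. [:- f s, 1:]) i \<in> K \<and> v (coeff (\<Prod>s\<in>H. [:- f s, 1:]) i) \<le> (\<Prod>s\<in>H. max 1 (v (f s)))"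
 using H f
proof (induction H arbitrary: i rule: finite_induct)
 case empty
 thus ?case by (simp add: coeff_pCons split: nat.split)
next
 case (insert t H)
 define q where "q = (\<Prod>s\<in>H. [:- f s, 1:])"
 define B where "B = (\<Prod>s\<in>H. max 1 (v (f s)))"
 have IH: "coeff q i \<in> K \<and> v (coeff q i) \<le> B" for i unfolding q_def B_def using insert by blast
 have B0: "0 \<le> B" unfolding B_def by (intro prod_nonneg) auto
 have tK: "f t \<in> K" using insert.prems by simp
 define a where "a = (case i of 0 => 0 | Suc k => coeff q k)"
 have a: "a \<in> K" "v a \<le> B" unfolding a_def using IH B0 by (auto split: nat.split)
 have c: "coeff ([:- f t, 1:] * q) i = a + (- (f t * coeff q i))"
  by (simp add: coeff_pCons a_def split: nat.split)
 have tq: "f t * coeff q i \<in> K" using tK IH by (intro mult_in) auto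
 have B1: "B \<le> max 1 (v (f t)) * B" using mult_right_mono[of 1 "max 1 (v (f t))" B] B0 by simp
 have B2: "v (f t) * v (coeff q i) \<le> max 1 (v (f t)) * B"
  using IH[of i] v_nonneg[OF tK] v_nonneg[of "coeff q i"] by (intro mult_mono) auto
 have "v (a + (- (f t * coeff q i))) \<le> max (v a) (v (- (f t * coeff q i)))"
  by (rule v_of_nat_ultrametric[OF nat a(1) minus_in[OF tq]])
 also have "... \<le> max 1 (v (f t)) * B"
  using a(2) B1 B2 IH[of i] by (simp add: v_minus[OF tq] v_mult tK)
 finally have "v (coeff ([:- f t, 1:] * q) i) \<le> max 1 (v (f t)) * B" unfolding c .
 moreover have "coeff ([:- f t, 1:] * q) i \<in> K" unfolding c by (rule add_in[OF a(1) minus_in[OF tq]])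
 ultimately show ?case using insert.hyps by (simp add: q_def B_def del: mult_pCons_left)
qed

context galois_field
begin

text \<open>The coefficients of the characteristic polynomial are rationals of bounded height, so
  there are finitely many such polynomials and finitely many roots.\<close>

lemma finite_bounded_elements:
 "finite {\<alpha>\<in>M. \<forall>P. finite P \<and> P \<subseteq> place_ids \<longrightarrow> (\<Sum>p\<in>P. \<Sum>s\<in>G. ln (max 1 (wp p (s \<alpha>)))) \<le> B}" (is "finite ?A")
proof -
 define g where "g = card G"
 \<comment> \<open>The factor 2^g stems from the archimedean estimate 1 + t \<le> 2 max(1, t) for
   each of the g conjugates.\<close>
 define E where "E = exp (real g * ln 2 + B)"
 define R :: "complex set" where
  "R = insert 0 (of_rat ` {q. \<bar>real_of_int (fst (quotient_of q))\<bar> \<le> E \<and> real_of_int (snd (quotient_of q)) \<le> E})"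
 have finR: "finite R" unfolding R_def using finite_bounded_rats by simp
 have coeff_R: "coeff (gpoly \<alpha>) i \<in> R" if \<alpha>: "\<alpha> \<in> ?A" for \<alpha> i
 proof -
  have \<alpha>M: "\<alpha> \<in> M" and bd: "\<And>P. finite P ==> P \<subseteq> place_ids ==> (\<Sum>p\<in>P. \<Sum>s\<in>G. ln (max 1 (wp p (s \<alpha>)))) \<le> B"
   using \<alpha> by blast+
  have sM: "s \<alpha> \<in> M" if "s \<in> G" for s by (rule G_maps[OF that \<alpha>M])
  have "coeff (gpoly \<alpha>) i \<in> \<rat>" using gpoly_over[OF \<alpha>M] by (simp add: poly_over_def)
  then obtain q where q: "coeff (gpoly \<alpha>) i = of_rat q" unfolding Rats_def by blast
  show ?thesis
  proof (cases "q = 0")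
   case True
   thus ?thesis by (simp add: q R_def)
  next
   case False
   hence "i \<le> g" using le_degree[of "gpoly \<alpha>" i] q gpoly_monic(2) by (simp add: g_def)
   have est: "ln (max 1 (rat_abs p q)) \<le> (if p = 0 then real g * ln 2 else 0) + (\<Sum>s\<in>G. ln (max 1 (wp p (s \<alpha>))))"
    if p: "p \<in> place_ids" for p
   proof -
    interpret w: absval M "wp p" by (rule places_overD[OF wp[OF p] csubfield_axioms])
    have wq: "rat_abs p q = wp p (coeff (gpoly \<alpha>) i)" unfolding q by (rule places_overD(2)[OF wp[OF p] csubfield_axioms, symmetric])
    define W where "W = (\<Prod>s\<in>G. max 1 (wp p (s \<alpha>)))"
    have W1: "1 \<le> W" unfolding W_def by (intro prod_ge_1) auto
    have lnW: "ln W = (\<Sum>s\<in>G. ln (max 1 (wp p (s \<alpha>))))" unfolding W_def using finite_G by (intro ln_prod) auto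
    show ?thesis
    proof (cases "p = 0")
     case True
     have "wp p (coeff (gpoly \<alpha>) i) \<le> coeff_norm (wp p) g (gpoly \<alpha>)"
      unfolding coeff_norm_def using \<open>i \<le> g\<close> gpoly_over[OF \<alpha>M] Rats_subset
      by (intro member_le_sum w.v_nonneg) (auto simp: poly_over_def)
     also have "... \<le> coeff_norm (wp p) g (\<Prod>s\<in>G. [:- s \<alpha>, 1:])" by (simp add: gpoly_def)
     also have "... \<le> (\<Prod>s\<in>G. 1 + wp p (s \<alpha>))" by (rule w.coeff_norm_prod(2)[OF finite_G sM])
     also have "... \<le> (\<Prod>s\<in>G. 2 * max 1 (wp p (s \<alpha>)))"
      using w.v_nonneg[OF sM] by (intro prod_mono) auto
     also have "... = 2 ^ g * W" by (simp add: W_def g_def prod.distrib)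
     finally have "max 1 (rat_abs p q) \<le> 2 ^ g * W"
      using W1 mult_mono[of 1 "2 ^ g" 1 W] unfolding wq by simp
     hence "ln (max 1 (rat_abs p q)) \<le> ln (2 ^ g * W)" by (intro ln_mono) auto
     also have "... = real g * ln 2 + ln W" using W1 by (simp add: ln_mult ln_realpow)
     finally show ?thesis using True lnW by simp
    next
     case False
     hence pr: "Factorial_Ring.prime p" using p by (auto simp: place_ids_def)
     have "wp p (coeff (gpoly \<alpha>) i) \<le> W"
      unfolding W_def gpoly_def
      using w.coeff_prod_ultrametric[OF place_ultrametric_nat[OF wp[OF p] pr], of G "\<lambda>s. s \<alpha>" i] sM finite_G by blast
     hence "ln (max 1 (rat_abs p q)) \<le> ln W" using W1 unfolding wq by (intro ln_mono) auto
     thus ?thesis using False lnW by simp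
    qed
   qed
   define P where "P = bad_primes q"
   have P: "finite P" "\<And>p. p \<in> P ==> Factorial_Ring.prime p" "0 \<notin> P"
    using finite_bad_primes bad_primes_prime[of _ q] by (auto simp: P_def dest: bad_primes_prime)
   have Pp: "insert 0 P \<subseteq> place_ids" using P(2) by (auto simp: place_ids_def)
   have "(\<Sum>p\<in>insert 0 P. ln (max 1 (rat_abs p q))) \<le> (\<Sum>p\<in>insert 0 P. (if p = 0 then real g * ln 2 else 0) + (\<Sum>s\<in>G. ln (max 1 (wp p (s \<alpha>)))))"
    using est Pp by (intro sum_mono) blast
   also have "... = real g * ln 2 + (\<Sum>p\<in>insert 0 P. \<Sum>s\<in>G. ln (max 1 (wp p (s \<alpha>))))"
    using P(1) by (simp add: sum.distrib sum.delta del: sum.insert)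
   also have "... \<le> real g * ln 2 + B" using bd[of "insert 0 P"] P(1) Pp by simp
   finally have le: "ln (max 1 (rat_abs 0 q)) + (\<Sum>p\<in>P. ln (max 1 (rat_abs p q))) \<le> real g * ln 2 + B"
    using P by simp
   obtain a b where ab: "quotient_of q = (a, b)" by (cases "quotient_of q")
   have "real_of_int b \<le> E" "\<bar>real_of_int a\<bar> \<le> E"
    using rat_num_denom_bound[OF False ab P(1) _ P(2) le] by (simp_all add: E_def P_def)
   thus ?thesis unfolding q R_def using ab by auto
  qed
 qed
 define pl where "pl = (\<lambda>\<phi>. \<Sum>i\<le>g. monom (\<phi> i) i :: complex poly)"
 have "?A \<subseteq> (\<Union>\<phi>\<in>{\<phi>\<in>PiE {..g} (\<lambda>_. R). pl \<phi> \<noteq> 0}. {z. poly (pl \<phi>) z = 0})"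
 proof
  fix \<alpha> assume \<alpha>: "\<alpha> \<in> ?A"
  define \<phi> where "\<phi> = (\<lambda>i\<in>{..g}. coeff (gpoly \<alpha>) i)"
  have "pl \<phi> = (\<Sum>i\<le>g. monom (coeff (gpoly \<alpha>) i) i)" unfolding pl_def \<phi>_def by (intro sum.cong) auto
  also have "... = gpoly \<alpha>" using poly_as_sum_of_monoms[of "gpoly \<alpha>"] gpoly_monic(2)[of \<alpha>] by (simp add: g_def)
  finally have e: "pl \<phi> = gpoly \<alpha>" .
  have "\<phi> \<in> PiE {..g} (\<lambda>_. R)" unfolding \<phi>_def using coeff_R[OF \<alpha>] by auto
  moreover have "poly (pl \<phi>) \<alpha> = 0" "pl \<phi> \<noteq> 0" unfolding e using gpoly_root[of \<alpha>] gpoly_monic(3)[of \<alpha>] \<alpha> by auto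
  ultimately show "\<alpha> \<in> (\<Union>\<phi>\<in>{\<phi>\<in>PiE {..g} (\<lambda>_. R). pl \<phi> \<noteq> 0}. {z. poly (pl \<phi>) z = 0})" by blast
 qed
 moreover have "finite (\<Union>\<phi>\<in>{\<phi>\<in>PiE {..g} (\<lambda>_. R). pl \<phi> \<noteq> 0}. {z. poly (pl \<phi>) z = 0})"
 proof (rule finite_UN_I)
  have "finite (PiE {..g} (\<lambda>_. R))" using finR by (intro finite_PiE) auto
  thus "finite {\<phi>\<in>PiE {..g} (\<lambda>_. R). pl \<phi> \<noteq> 0}" by simp
  fix \<phi> assume "\<phi> \<in> {\<phi>\<in>PiE {..g} (\<lambda>_. R). pl \<phi> \<noteq> 0}"
  hence "pl \<phi> \<noteq> 0" by simp
  thus "finite {z. poly (pl \<phi>) z = 0}" by (rule poly_roots_finite)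
 qed
 ultimately show ?thesis by (rule finite_subset)
qed

lemma galois_subfield_self: "galois_subfield M G M"
 by (intro galois_subfield.intro galois_subfield_axioms.intro galois_field_axioms csubfield_axioms order.refl)

text \<open>With one coordinate equal to 1, every other coordinate has height at most that of the
  point. The factor \<open>card G\<close> occurs because \<open>psum\<close> is an average over
  \<open>G\<close>.\<close>

lemma northcott: "finite {p \<in> rational_points M :: ('n::finite) proj set. height M p \<le> B}"
proof -
 interpret MM: galois_subfield M G M by (rule galois_subfield_self)
 define A where "A = {\<alpha>\<in>M. \<forall>P. finite P \<and> P \<subseteq> place_ids \<longrightarrow> (\<Sum>p\<in>P. \<Sum>s\<in>G. ln (max 1 (wp p (s \<alpha>)))) \<le> B * real (card G)}"
 have "finite A" unfolding A_def by (rule finite_bounded_elements)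
 have "{p \<in> rational_points M :: 'n proj set. height M p \<le> B} \<subseteq> (\<lambda>\<phi>. abs_proj (\<chi> i. \<phi> i)) ` PiE (UNIV :: 'n option set) (\<lambda>_. A)"
 proof
  fix p :: "'n proj" assume "p \<in> {p \<in> rational_points M. height M p \<le> B}"
  hence p: "p \<in> rational_points M" "height M p \<le> B" by auto
  then obtain x :: "complex ^ 'n option" where x: "x \<noteq> 0" "\<forall>i. x $ i \<in> M" "p = abs_proj x" unfolding rational_points_def by blast
  obtain j where j: "x $ j \<noteq> 0" using x(1) by (auto simp: vec_eq_iff)
  define z where "z = inverse (x $ j) *s x"
  have zM: "z $ i \<in> M" for i using x(2) inverse_in mult_in by (simp add: z_def)
  have zj: "z $ j = 1" using j by (simp add: z_def)
  hence z0: "z \<noteq> 0" by auto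
  have pz: "abs_proj z = p" unfolding x(3) z_def using j by (intro abs_proj_scale x(1)) simp
  have "z $ i \<in> A" for i unfolding A_def
  proof (intro CollectI conjI allI impI zM)
   fix P :: "nat set" assume P: "finite P \<and> P \<subseteq> place_ids"
   define Q where "Q = insert 0 (P \<union> vsupp M z)"
   have Q: "finite Q" "Q \<subseteq> place_ids" "vsupp M z \<subseteq> Q" "0 \<in> Q" "P \<subseteq> Q"
    using P MM.finite_vsupp[OF zM] by (auto simp: Q_def vsupp_def psupp_def place_ids_def)
   have one: "1 \<le> v 1" if "v \<in> places_over M q" for v q
    using absval.v_1[OF places_overD(1)[OF that csubfield_axioms]] by simp
   have vn1: "1 \<le> vnorm v z" if "v \<in> places_over M q" for v q
    using vnorm_ge[of v z j] one[OF that] zj by simp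
   have "psum M P (\<lambda>v. ln (max 1 (v (z $ i)))) \<le> psum M P (\<lambda>v. ln (vnorm v z))"
   proof (rule psum_mono)
    fix q v assume "v \<in> places_over M q"
    thus "ln (max 1 (v (z $ i))) \<le> ln (vnorm v z)" using vn1[of v q] vnorm_ge[of v z i] by (intro ln_mono) auto
   qed
   also have "... \<le> psum M Q (\<lambda>v. ln (vnorm v z))"
    by (rule psum_mono2[OF Q(1,5)]) (use vn1 in auto)
   also have "... = height M p" using MM.height_eq[OF z0 zM Q(1,2,3,4)] pz by simp
   finally have "psum M P (\<lambda>v. ln (max 1 (v (z $ i)))) \<le> B" using p(2) by simp
   hence "(\<Sum>q\<in>P. \<Sum>s\<in>G. ln (max 1 ((\<lambda>x\<in>M. wp q (s x)) (z $ i)))) / real (card G) \<le> B"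
    using MM.psum_eq[of P] P by simp
   thus "(\<Sum>q\<in>P. \<Sum>s\<in>G. ln (max 1 (wp q (s (z $ i))))) \<le> B * real (card G)"
    using card_G_pos zM by (simp add: divide_le_eq)
  qed
  hence zA: "(\<lambda>i. z $ i) \<in> PiE UNIV (\<lambda>_. A)" by auto
  show "p \<in> (\<lambda>\<phi>. abs_proj (\<chi> i. \<phi> i)) ` PiE (UNIV :: 'n option set) (\<lambda>_. A)"
  proof (rule image_eqI[OF _ zA])
   show "p = abs_proj (\<chi> i. z $ i)" using pz by simp
  qed
 qed
 moreover have "finite ((\<lambda>\<phi>. abs_proj (\<chi> i. \<phi> i)) ` PiE (UNIV :: 'n option set) (\<lambda>_. A))"
  using \<open>finite A\<close> by (intro finite_imageI finite_PiE) auto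
 ultimately show ?thesis by (rule finite_subset)
qed

end

section \<open>Comparison of local heights\<close>

context galois_subfield
begin

lemma restrict_place:
 assumes "w \<in> places_over M p" shows "restrict w K \<in> places_over K p"
proof -
 have "(\<lambda>x\<in>K. w ((\<lambda>x\<in>M. x) x)) = restrict w K"
  by (rule ext) (use K_le in \<open>auto simp: restrict_def\<close>)
 thus ?thesis using absval_compose[OF assms G_id] by simp
qed

text \<open>Both sides are averages over the same group \<open>G\<close>; this lets heights over
  \<open>K\<close> be computed over \<open>M\<close>.\<close>

lemma psum_restrict:
 assumes "P \<subseteq> place_ids" shows "psum K P f = psum M P (\<lambda>w. f (restrict w K))"
proof -
 interpret MM: galois_subfield M G M by (rule galois_subfield_self)
 have "(\<lambda>x\<in>K. wp p (s x)) = restrict (\<lambda>x\<in>M. wp p (s x)) K" for p s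
  by (rule ext) (use K_le in \<open>auto simp: restrict_def\<close>)
 thus ?thesis unfolding psum_eq[OF assms] MM.psum_eq[OF assms] by simp
qed

lemma finite_restrict_places:
 assumes S: "finite S" "S \<subseteq> places K" shows "finite {w \<in> places M. restrict w K \<in> S}"
proof -
 interpret MM: galois_subfield M G M by (rule galois_subfield_self)
 have "finite {w \<in> places M. restrict w K = v}" if "v \<in> S" for v
 proof -
  obtain p where p: "p \<in> place_ids" "v \<in> places_over K p" using \<open>v \<in> S\<close> S(2) unfolding places_eq by blast
  have "{w \<in> places M. restrict w K = v} \<subseteq> places_over M p"
  proof
   fix w assume w: "w \<in> {w \<in> places M. restrict w K = v}"
   then obtain q where q: "q \<in> place_ids" "w \<in> places_over M q" unfolding places_eq by blast
   have vq: "v \<in> places_over K q" using restrict_place[OF q(2)] w by simp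
   have "q = p"
   proof (rule ccontr)
    assume "q \<noteq> p"
    from places_over_disjoint[OF q(1) p(1) this, of K] show False using p(2) vq by blast
   qed
   thus "w \<in> places_over M p" using q by simp
  qed
  thus ?thesis using MM.finite_places_over[OF p(1)] by (rule finite_subset)
 qed
 hence "finite (\<Union>v\<in>S. {w \<in> places M. restrict w K = v})" using S(1) by blast
 thus ?thesis by (rule rev_finite_subset) blast
qed

text \<open>Here \<open>x\<close> represents the point over \<open>K\<close> and \<open>y\<close> a
  preimage over \<open>M\<close>. At each place the local height of \<open>F\<close> at \<Psi> y is
  that of \<open>E\<close> at \<open>y\<close> plus that of the cofactor \<open>H\<close>, the
  latter bounded below up to the errors. Over all places the local heights of \<open>E\<close> sum
  to g times the height of \<open>y\<close>; subtracting the part on \<open>S'\<close>, for which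
  \<open>B\<close> is an upper bound, bounds the part outside \<open>S\<close> from below.\<close>

lemma local_height_comparison:
 fixes \<Psi> :: "complex ^ ('n::finite) option => complex ^ 'n option" and F E :: "'n form"
 assumes \<Psi>: "\<And>i. (\<lambda>x. \<Psi> x $ i) \<in> hpoly M D" and nz: "\<And>x. x \<noteq> 0 ==> \<Psi> x \<noteq> 0"
  and F: "homogeneous f F" "coeffs_in K F" "form_degree F = f"
  and E: "homogeneous g E" "coeffs_in M E" "form_degree E = g"
  and H: "H \<in> hpoly M (f * D - g)" "g \<le> f * D" and rel: "\<And>y. eval_form F (\<Psi> y) = eval_form E y * H y"
  and S: "finite S" "S \<subseteq> places K"
 defines "S' \<equiv> {w \<in> places M. restrict w K \<in> S}"
 shows "\<exists>C. \<forall>x y. x \<noteq> 0 \<longrightarrow> (\<forall>i. x $ i \<in> K) \<longrightarrow> y \<noteq> 0 \<longrightarrow> (\<forall>i. y $ i \<in> M) \<longrightarrow> abs_proj x = abs_proj (\<Psi> y) \<longrightarrow>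
   eval_form F x \<noteq> 0 \<longrightarrow>
   (\<exists>r. (\<Sum>\<^sub>\<infinity>v\<in>places K - S. local_height K v F (abs_proj x)) = ereal r \<and>
    (\<forall>B. (\<Sum>w\<in>S'. local_height M w E (abs_proj y)) \<le> ereal B \<longrightarrow> real g * height M (abs_proj y) - B - C \<le> r)) \<and>
   height K (abs_proj x) \<le> real D * height M (abs_proj y) + C \<and> height K (abs_proj x) = height M (abs_proj x)"
proof -
 interpret MM: galois_subfield M G M by (rule galois_subfield_self)
 obtain b1 where b1: "adelic_bound b1" "\<forall>p\<in>place_ids. \<forall>w\<in>places_over M p. \<forall>x. x \<noteq> 0 \<longrightarrow> (\<forall>i. x $ i \<in> M) \<longrightarrow>
   vnorm w x ^ D \<le> exp (b1 p) * vnorm w (\<Psi> x)"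
  using MM.morphism_lower_bound[of \<Psi> D, OF \<Psi> nz] by blast
 obtain b2 where b2: "adelic_bound b2" "\<forall>p\<in>place_ids. \<forall>w\<in>places_over M p. \<forall>x. (\<forall>i. x $ i \<in> M) \<longrightarrow>
   vnorm w (\<Psi> x) \<le> exp (b2 p) * vnorm w x ^ D"
  using MM.morphism_upper_bound[of \<Psi> D, OF \<Psi>] by blast
 obtain b3 where b3: "adelic_bound b3" "\<forall>p\<in>place_ids. \<forall>w\<in>places_over M p. \<forall>x. (\<forall>i. x $ i \<in> M) \<longrightarrow>
   w (H x) \<le> exp (b3 p) * vnorm w x ^ (f * D - g)"
  using MM.hpoly_adelic_bound[OF H(1)] by blast
 define b where "b = (\<lambda>p. b1 p + b2 p + b3 p)"
 have ab: "adelic_bound b" unfolding b_def by (intro adelic_bound_add b1 b2 b3)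
 have bnn: "0 \<le> b1 p" "0 \<le> b2 p" "0 \<le> b3 p" for p using b1(1) b2(1) b3(1) by (simp_all add: adelic_bound_def)
 define tot where "tot = (\<Sum>p\<in>{p. b p \<noteq> 0}. b p)"
 have tot: "(\<Sum>p\<in>P. b p) \<le> tot" if "finite P" for P unfolding tot_def by (rule adelic_bound_total[OF ab that])
 have tot0: "0 \<le> tot" using tot[of "{}"] by simp
 \<comment> \<open>The lower bound for \<Psi> enters f times and the bound for \<open>H\<close>
   once. The comparison of heights costs only one copy of the total.\<close>
 define C where "C = (real f + 1) * tot"
 have totC: "tot \<le> C" using tot0 by (simp add: C_def algebra_simps)
 have hF: "eval_form F \<in> hpoly M f"
  by (rule hpoly_eval_form[OF F(1)]) (use F(2) K_le in \<open>auto simp: coeffs_in_def\<close>)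
 have hFK: "eval_form F \<in> hpoly K f" by (rule K.hpoly_eval_form[OF F(1,2)])
 have hE: "eval_form E \<in> hpoly M g" by (rule hpoly_eval_form[OF E(1,2)])
 show ?thesis
 proof (intro exI[of _ C] allI impI)
  fix x y :: "complex ^ 'n option"
  assume x: "x \<noteq> 0" "\<forall>i. x $ i \<in> K" and y: "y \<noteq> 0" "\<forall>i. y $ i \<in> M" and pe: "abs_proj x = abs_proj (\<Psi> y)"
   and Fx: "eval_form F x \<noteq> 0"
  have xK: "x $ i \<in> K" and xM: "x $ i \<in> M" and yM: "y $ i \<in> M" for i using x(2) y(2) K_le by blast+
  have z0: "\<Psi> y \<noteq> 0" by (rule nz[OF y(1)])
  have zM: "\<Psi> y $ i \<in> M" for i by (rule MM.hpoly_in[OF \<Psi> yM])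
  obtain c where c: "c \<noteq> 0" "\<Psi> y = c *s x" using abs_proj_eq_iff[OF x(1) z0] pe by blast
  have cM: "c \<in> M" by (rule MM.proportional_in[OF x(1) xM zM c(2)])
  have Fz: "eval_form F (\<Psi> y) \<noteq> 0" unfolding c(2) homogeneous_eval_scale[OF F(1)] using c(1) Fx by simp
  have Ey: "eval_form E y \<noteq> 0" and Hy: "H y \<noteq> 0" using Fz unfolding rel by auto
  have FxK: "eval_form F x \<in> K" by (rule hpoly_in[OF hFK xK])
  have FxM: "eval_form F x \<in> M" using FxK K_le by blast
  have FzM: "eval_form F (\<Psi> y) \<in> M" by (rule MM.hpoly_in[OF hF zM])
  have EyM: "eval_form E y \<in> M" by (rule MM.hpoly_in[OF hE yM])
  have HyM: "H y \<in> M" by (rule MM.hpoly_in[OF H(1) yM])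
  \<comment> \<open>One common index set for all sums below, so that they can be subtracted
    termwise.\<close>
  define P where "P = insert 0 (vsupp K x \<union> psupp K (eval_form F x) \<union> vsupp M x \<union> vsupp M y \<union> vsupp M (\<Psi> y) \<union> psupp M (eval_form E y))"
  have P: "finite P" "P \<subseteq> place_ids" "0 \<in> P"
   using finite_vsupp[OF xK] finite_psupp[OF FxK Fx] MM.finite_vsupp[OF xM] MM.finite_vsupp[OF yM]
    MM.finite_vsupp[OF zM] MM.finite_psupp[OF EyM Ey]
   by (auto simp: P_def vsupp_def psupp_def place_ids_def)
  have sub: "vsupp K x \<subseteq> P" "psupp K (eval_form F x) \<subseteq> P" "vsupp M x \<subseteq> P" "vsupp M y \<subseteq> P" "vsupp M (\<Psi> y) \<subseteq> P"
   "psupp M (eval_form E y) \<subseteq> P" by (auto simp: P_def)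
  have hy: "height M (abs_proj y) = psum M P (\<lambda>w. ln (vnorm w y))" by (rule MM.height_eq[OF y(1) yM P(1,2) sub(4) P(3)])
  have hz: "height M (abs_proj x) = psum M P (\<lambda>w. ln (vnorm w (\<Psi> y)))"
   unfolding pe by (rule MM.height_eq[OF z0 zM P(1,2) sub(5) P(3)])
  have hx: "height M (abs_proj x) = psum M P (\<lambda>w. ln (vnorm w x))" by (rule MM.height_eq[OF x(1) xM P(1,2) sub(3) P(3)])
  have vr: "vnorm (restrict w K) x = vnorm w x" for w by (rule vnorm_cong) (simp add: xK)
  have hK: "height K (abs_proj x) = height M (abs_proj x)"
   unfolding hx height_eq[OF x(1) xK P(1,2) sub(1) P(3)] psum_restrict[OF P(2)] vr ..
  have place: "w \<in> places M" if "p \<in> P" "w \<in> places_over M p" for p w using that P(2) unfolding places_eq by blast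
  have placeK: "restrict w K \<in> places K" if "p \<in> P" "w \<in> places_over M p" for p w
   using restrict_place[OF that(2)] that(1) P(2) unfolding places_eq by blast
  have upper: "ln (vnorm w (\<Psi> y)) \<le> real D * ln (vnorm w y) + b2 p"
   and lower: "real D * ln (vnorm w y) - b1 p \<le> ln (vnorm w (\<Psi> y))"
   and Hb: "ln (w (H y)) \<le> real (f * D - g) * ln (vnorm w y) + b3 p"
   if p: "p \<in> P" "w \<in> places_over M p" for p w
  proof -
   interpret w: absval M w by (rule places_overD[OF p(2) csubfield_axioms])
   have pp: "p \<in> place_ids" using p(1) P(2) by blast
   have vy: "0 < vnorm w y" by (rule w.vnorm_pos[OF y(1) yM])
   have vz: "0 < vnorm w (\<Psi> y)" by (rule w.vnorm_pos[OF z0 zM])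
   have vH: "0 < w (H y)" by (rule w.v_pos[OF HyM Hy])
   have "vnorm w (\<Psi> y) \<le> exp (b2 p) * vnorm w y ^ D" using b2(2)[rule_format, OF pp p(2), of y] yM by blast
   hence "ln (vnorm w (\<Psi> y)) \<le> ln (exp (b2 p) * vnorm w y ^ D)" using vz by (intro ln_mono) auto
   thus "ln (vnorm w (\<Psi> y)) \<le> real D * ln (vnorm w y) + b2 p" using vy by (simp add: ln_mult ln_realpow)
   have "vnorm w y ^ D \<le> exp (b1 p) * vnorm w (\<Psi> y)" using b1(2)[rule_format, OF pp p(2) y(1)] yM by blast
   hence "ln (vnorm w y ^ D) \<le> ln (exp (b1 p) * vnorm w (\<Psi> y))" using vy by (intro ln_mono) auto
   thus "real D * ln (vnorm w y) - b1 p \<le> ln (vnorm w (\<Psi> y))" using vy vz by (simp add: ln_mult ln_realpow)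
   have "w (H y) \<le> exp (b3 p) * vnorm w y ^ (f * D - g)" using b3(2)[rule_format, OF pp p(2), of y] yM by blast
   hence "ln (w (H y)) \<le> ln (exp (b3 p) * vnorm w y ^ (f * D - g))" using vH by (intro ln_mono) auto
   thus "ln (w (H y)) \<le> real (f * D - g) * ln (vnorm w y) + b3 p" using vy by (simp add: ln_mult ln_realpow)
  qed
  define r where "r = psum K P (\<lambda>v. if v \<in> places K - S then lam f (eval_form F) v x else 0)"
  have rsum: "(\<Sum>\<^sub>\<infinity>v\<in>places K - S. local_height K v F (abs_proj x)) = ereal r"
   unfolding r_def by (rule sum_local_heights[OF F x(1) xK Fx P(1,2) sub(1,2)]) blast
  \<comment> \<open>From here everything is a sum over places of \<open>M\<close> at \<Psi> y: being
    above \<open>S\<close> is membership in \<open>S'\<close>, and the factor between \<Psi> y and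
    \<open>x\<close> does not change local heights.\<close>
  have r2: "r = psum M P (\<lambda>w. if w \<in> S' then 0 else lam f (eval_form F) w (\<Psi> y))"
   unfolding r_def psum_restrict[OF P(2)]
  proof (rule psum_cong)
   fix p w assume p: "p \<in> P" "w \<in> places_over M p"
   have "lam f (eval_form F) (restrict w K) x = lam f (eval_form F) w x"
    by (simp add: lam_def vr FxK)
   also have "... = lam f (eval_form F) w (\<Psi> y)"
    unfolding c(2) by (rule MM.lam_scale[OF hF x(1) xM FxM Fx cM c(1) p(2), symmetric])
   finally show "(if restrict w K \<in> places K - S then lam f (eval_form F) (restrict w K) x else 0)
     = (if w \<in> S' then 0 else lam f (eval_form F) w (\<Psi> y))"
    using placeK[OF p] place[OF p] by (simp add: S'_def)
  qed
  have main: "psum M P (\<lambda>w. (if w \<in> S' then 0 else lam g (eval_form E) w y) - (if w \<in> S' then 0 else lam f (eval_form F) w (\<Psi> y))) \<le> C"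
  proof -
   have "psum M P (\<lambda>w. (if w \<in> S' then 0 else lam g (eval_form E) w y) - (if w \<in> S' then 0 else lam f (eval_form F) w (\<Psi> y)))
     \<le> (\<Sum>p\<in>P. (real f + 1) * b p)"
   proof (rule MM.psum_le[OF P(2)])
    fix p w assume p: "p \<in> P" "w \<in> places_over M p"
    interpret w: absval M w by (rule places_overD[OF p(2) csubfield_axioms])
    have l: "ln (w (eval_form F (\<Psi> y))) = ln (w (eval_form E y)) + ln (w (H y))"
     unfolding rel using w.v_pos[OF EyM Ey] w.v_pos[OF HyM Hy] by (simp add: w.v_mult EyM HyM ln_mult)
    have fl: "real f * (real D * ln (vnorm w y) - b1 p) \<le> real f * ln (vnorm w (\<Psi> y))"
     using lower[OF p] by (intro mult_left_mono) auto
    have fdg: "real (f * D - g) = real f * real D - real g" using H(2) by (simp add: of_nat_diff)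
    have "lam g (eval_form E) w y - lam f (eval_form F) w (\<Psi> y) \<le> real f * b1 p + b3 p"
     unfolding lam_def l using fl Hb[OF p] unfolding fdg by (simp add: algebra_simps)
    also have "... \<le> real f * b p + b p" using bnn[of p] by (intro add_mono mult_left_mono) (auto simp: b_def)
    finally have 1: "lam g (eval_form E) w y - lam f (eval_form F) w (\<Psi> y) \<le> (real f + 1) * b p" by (simp add: algebra_simps)
    have "0 \<le> (real f + 1) * b p" using bnn[of p] by (simp add: b_def)
    thus "(if w \<in> S' then 0 else lam g (eval_form E) w y) - (if w \<in> S' then 0 else lam f (eval_form F) w (\<Psi> y)) \<le> (real f + 1) * b p"
     using 1 by simp
   qed
   also have "... = (real f + 1) * (\<Sum>p\<in>P. b p)" by (rule sum_distrib_left[symmetric])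
   also have "... \<le> C" unfolding C_def using tot[OF P(1)] by (intro mult_left_mono) auto
   finally show ?thesis .
  qed
  have S'fin: "finite S'" unfolding S'_def by (rule finite_restrict_places[OF S])
  have S'sum: "(\<Sum>w\<in>S'. local_height M w E (abs_proj y)) = ereal (psum M P (\<lambda>w. if w \<in> S' then lam g (eval_form E) w y else 0))"
   using MM.sum_local_heights[OF E y(1) yM Ey P(1,2) sub(4,6), of S'] S'fin by (simp add: S'_def)
  have all: "psum M P (\<lambda>w. lam g (eval_form E) w y) = real g * height M (abs_proj y)"
   unfolding lam_def psum_diff psum_cmult hy[symmetric]
   using MM.product_formula[OF EyM Ey P(1,2) sub(6) P(3)] by simp
  have split: "psum M P (\<lambda>w. if w \<in> S' then 0 else lam g (eval_form E) w y)
    = real g * height M (abs_proj y) - psum M P (\<lambda>w. if w \<in> S' then lam g (eval_form E) w y else 0)"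
   unfolding all[symmetric] psum_diff[symmetric] by (rule psum_cong) simp
  have "real g * height M (abs_proj y) - B - C \<le> r" if B: "(\<Sum>w\<in>S'. local_height M w E (abs_proj y)) \<le> ereal B" for B
  proof -
   have "psum M P (\<lambda>w. if w \<in> S' then lam g (eval_form E) w y else 0) \<le> B" using B unfolding S'sum by simp
   thus ?thesis using main unfolding psum_diff split r2[symmetric] by linarith
  qed
  moreover have "height K (abs_proj x) \<le> real D * height M (abs_proj y) + C"
  proof -
   have "psum M P (\<lambda>w. ln (vnorm w (\<Psi> y)) - real D * ln (vnorm w y)) \<le> (\<Sum>p\<in>P. b p)"
   proof (rule MM.psum_le[OF P(2)])
    fix p w assume "p \<in> P" "w \<in> places_over M p"
    from upper[OF this] show "ln (vnorm w (\<Psi> y)) - real D * ln (vnorm w y) \<le> b p" using bnn[of p] by (simp add: b_def)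
   qed
   also have "... \<le> C" using tot[OF P(1)] totC by linarith
   finally show ?thesis unfolding hK hz hy psum_diff psum_cmult by linarith
  qed
  ultimately show "(\<exists>r. (\<Sum>\<^sub>\<infinity>v\<in>places K - S. local_height K v F (abs_proj x)) = ereal r \<and>
    (\<forall>B. (\<Sum>w\<in>S'. local_height M w E (abs_proj y)) \<le> ereal B \<longrightarrow> real g * height M (abs_proj y) - B - C \<le> r)) \<and>
   height K (abs_proj x) \<le> real D * height M (abs_proj y) + C \<and> height K (abs_proj x) = height M (abs_proj x)"
   using rsum hK by blast
 qed
qed

end

section \<open>Sets contained in a hypersurface\<close>

interpretation QB: csubfield Qbar by (rule csubfield_Qbar)

text \<open>Degree 0 is allowed; the form is then a nonzero constant and the set is empty.\<close>

definition in_hypersurface :: "('n::finite) proj set => bool" where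
 "in_hypersurface U \<longleftrightarrow> (\<exists>t. \<exists>B\<in>hpoly Qbar t. (\<exists>y. B y \<noteq> 0) \<and> (\<forall>x. x \<noteq> 0 \<longrightarrow> abs_proj x \<in> U \<longrightarrow> B x = 0))"

lemma in_hypersurface_subset: "in_hypersurface V ==> U \<subseteq> V ==> in_hypersurface U"
 unfolding in_hypersurface_def by blast

lemma in_hypersurface_empty: "in_hypersurface ({} :: ('n::finite) proj set)"
 unfolding in_hypersurface_def
 by (rule exI[of _ 0], rule bexI[of _ "\<lambda>x. 1"]) (auto intro: QB.hpoly_const)

lemma in_hypersurface_Un:
 fixes U V :: "('n::finite) proj set"
 assumes "in_hypersurface U" "in_hypersurface V" shows "in_hypersurface (U \<union> V)"
proof -
 obtain t B where B: "B \<in> hpoly Qbar t" "\<exists>y. B y \<noteq> 0" "\<forall>x. x \<noteq> 0 \<longrightarrow> abs_proj x \<in> U \<longrightarrow> B x = 0"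
  using assms(1) unfolding in_hypersurface_def by blast
 obtain t' B' where B': "B' \<in> hpoly Qbar t'" "\<exists>y. B' y \<noteq> 0" "\<forall>x. x \<noteq> 0 \<longrightarrow> abs_proj x \<in> V \<longrightarrow> B' x = 0"
  using assms(2) unfolding in_hypersurface_def by blast
 have "\<exists>y. B y * B' y \<noteq> 0"
 proof (rule ccontr)
  assume "\<not> ?thesis"
  hence zero: "\<And>x. B x * B' x = 0" by blast
  obtain x where x: "B x \<noteq> 0" using B(2) by blast
  have "B' y = 0" for y by (rule hpoly_no_zero_divisors[OF hpoly_UNIV[OF B(1)] hpoly_UNIV[OF B'(1)] zero x])
  thus False using B'(2) by blast
 qed
 moreover have "(\<lambda>x. B x * B' x) \<in> hpoly Qbar (t + t')" by (rule QB.hpoly_mult[OF B(1) B'(1)])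
 moreover have "B x * B' x = 0" if "x \<noteq> 0" "abs_proj x \<in> U \<union> V" for x using B(3) B'(3) that by auto
 ultimately show ?thesis unfolding in_hypersurface_def
  by (intro exI[of _ "t + t'"] bexI[of _ "\<lambda>x. B x * B' x"] conjI allI impI) auto
qed

lemma in_hypersurface_UN:
 fixes U :: "'i => ('n::finite) proj set"
 shows "finite I ==> (\<And>i. i \<in> I ==> in_hypersurface (U i)) ==> in_hypersurface (\<Union>i\<in>I. U i)"
 by (induction I rule: finite_induct) (simp_all add: in_hypersurface_empty in_hypersurface_Un)

lemma in_hypersurface_point:
 fixes p :: "('n::finite) proj"
 assumes "p \<in> rational_points Qbar" shows "in_hypersurface {p}"
proof -
 obtain z :: "complex ^ 'n option" where z: "z \<noteq> 0" "\<forall>i. z $ i \<in> Qbar" "p = abs_proj z"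
  using assms unfolding rational_points_def by blast
 obtain j where j: "z $ j \<noteq> 0" using z(1) by (auto simp: vec_eq_iff)
 \<comment> \<open>A second coordinate exists because N is at least 1; the 2 by 2 minor of two
   coordinates vanishes at the point.\<close>
 obtain r :: "'n option" where r: "r \<noteq> j" by (cases j) (metis option.distinct(1))+
 define B where "B = (\<lambda>x :: complex ^ 'n option. z $ j * x $ r + (- z $ r) * x $ j)"
 have "B \<in> hpoly Qbar 1" unfolding B_def using z(2)
  by (intro QB.hpoly_add QB.hpoly_smult QB.hpoly_var QB.minus_in) blast+
 moreover have "B (axis r 1) \<noteq> 0" using j r by (simp add: B_def axis_def)
 moreover have "B x = 0" if nz: "x \<noteq> 0" "abs_proj x \<in> {p}" for x
 proof -
  have "abs_proj z = abs_proj x" using nz(2) z(3) by simp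
  then obtain c where "x = c *s z" using abs_proj_eq_iff[OF z(1) nz(1)] by blast
  thus ?thesis by (simp add: B_def)
 qed
 ultimately show ?thesis unfolding in_hypersurface_def by blast
qed

lemma eval_form_nonzero: assumes "F \<noteq> 0" shows "\<exists>x. eval_form F x \<noteq> 0"
proof (rule ccontr)
 assume "\<not> ?thesis"
 hence "eval_form F x = 0" for x by blast
 hence z: "(\<Sum>m\<in>Poly_Mapping.keys F. Poly_Mapping.lookup F m * mono_eval m x) = 0" for x
  unfolding eval_form_def mono_eval_def[symmetric] .
 have "Poly_Mapping.keys F \<noteq> {}" using assms by simp
 then obtain m where m: "m \<in> Poly_Mapping.keys F" by blast
 have "Poly_Mapping.lookup F m = 0" by (rule mono_eval_independent[OF finite_keys z m])
 thus False using m by (simp add: in_keys_iff)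
qed

lemma homogeneous_form_degree: assumes "homogeneous e F" "F \<noteq> 0" shows "form_degree F = e"
proof -
 have "Poly_Mapping.keys F \<noteq> {}" using assms(2) by simp
 then obtain m where m: "m \<in> Poly_Mapping.keys F" by blast
 have "mono_degree ` Poly_Mapping.keys F = (\<lambda>_. e) ` Poly_Mapping.keys F"
  using assms(1) by (intro image_cong) (simp_all add: homogeneous_def)
 also have "... = {e}" by (rule image_constant[OF m])
 finally have "mono_degree ` Poly_Mapping.keys F = {e}" .
 thus ?thesis by (simp add: form_degree_def)
qed

text \<open>The pushed-forward form pulls back to a multiple of the given equation, so it vanishes
  on the images of its zeros.\<close>

lemma in_hypersurface_image:
 fixes \<Psi> :: "complex ^ ('n::finite) option => complex ^ 'n option"
 assumes \<Psi>: "\<And>i. (\<lambda>x. \<Psi> x $ i) \<in> hpoly Qbar D" and D: "D \<ge> 1" and nz: "\<And>x. x \<noteq> 0 ==> \<Psi> x \<noteq> 0"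
  and H: "hypersurface H"
 shows "in_hypersurface {abs_proj (\<Psi> y) |y. y \<noteq> 0 \<and> abs_proj y \<in> H}"
proof -
 obtain F where F: "effective_divisor F" "form_degree F > 0" "H = zero_locus F" using H unfolding hypersurface_def by blast
 obtain k where k: "F \<noteq> 0" "homogeneous k F" "coeffs_in Qbar F" using F(1) unfolding effective_divisor_def by blast
 have k1: "k \<ge> 1" using F(2) homogeneous_form_degree[OF k(2,1)] by simp
 obtain x0 where x0: "eval_form F x0 \<noteq> 0" using eval_form_nonzero[OF k(1)] by blast
 obtain t B h where B: "B \<in> hpoly Qbar t" "\<exists>y. B y \<noteq> 0" "\<forall>x. B (\<Psi> x) = eval_form F x * h x"
  using QB.pushforward_exists[OF QB.hpoly_eval_form[OF k(2,3)] k1 x0 D \<Psi>] by blast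
 have "B x = 0" if x: "x \<noteq> 0" "abs_proj x \<in> {abs_proj (\<Psi> y) |y. y \<noteq> 0 \<and> abs_proj y \<in> H}" for x
 proof -
  obtain y where y: "abs_proj x = abs_proj (\<Psi> y)" "y \<noteq> 0" "abs_proj y \<in> H"
   using x(2) by (elim CollectE exE conjE) (rule that)
  have "abs_proj (\<Psi> y) = abs_proj x" using y(1) by simp
  then obtain c where "x = c *s \<Psi> y" using abs_proj_eq_iff[OF nz[OF y(2)] x(1)] by blast
  moreover have "eval_form F y = 0" using y zero_locus_iff[OF k(2) y(2)] F(3) by simp
  ultimately show ?thesis using B(3) hpoly_scale[OF B(1)] by simp
 qed
 thus ?thesis unfolding in_hypersurface_def using B(1,2) by blast
qed

lemma in_hypersurface_not_dense:
 fixes U :: "('n::finite) proj set"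
 assumes "in_hypersurface U" shows "\<not> zariski_dense U"
proof
 assume dense: "zariski_dense U"
 obtain t B where B: "B \<in> hpoly Qbar t" "\<exists>y. B y \<noteq> 0" "\<forall>x. x \<noteq> 0 \<longrightarrow> abs_proj x \<in> U \<longrightarrow> B x = 0"
  using assms unfolding in_hypersurface_def by blast
 obtain F where F: "homogeneous t F" "coeffs_in Qbar F" "eval_form F = B" by (rule QB.hpoly_to_form[OF B(1)])
 have cl: "zariski_closed (zero_locus F)"
  unfolding zariski_closed_def using F(1,2) by (intro exI[of _ "{F}"]) auto
 have sub: "U \<subseteq> zero_locus F"
 proof
  fix p assume "p \<in> U"
  hence "B (rep_proj p) = 0" using B(3) rep_proj_props[of p] by simp
  thus "p \<in> zero_locus F" by (simp add: zero_locus_def F(3))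
 qed
 have UN: "zero_locus F = UNIV" using dense cl sub unfolding zariski_dense_def by blast
 have z: "B x = 0" if "x \<noteq> 0" for x using zero_locus_iff[OF F(1) that] UN by (simp add: F(3))
 obtain y where y: "B y \<noteq> 0" using B(2) by blast
 have y0: "y = 0" using z[of y] y by blast
 \<comment> \<open>The form vanishes at all nonzero vectors; along a line through the origin it is a
   polynomial with infinitely many roots, so it vanishes at the origin as well.\<close>
 obtain p where p: "\<forall>s. poly p s = B (y + s *s 1)" using hpoly_line[OF hpoly_UNIV[OF B(1)], of y 1] by blast
 have "poly p s = 0" if "s \<noteq> 0" for s using p z[of "y + s *s 1"] that by (simp add: y0 vec_eq_iff)
 hence "UNIV - {0} \<subseteq> {s. poly p s = 0}" by auto
 moreover have "infinite (UNIV - {0} :: complex set)" using infinite_UNIV_char_0 by simp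
 ultimately have "infinite {s. poly p s = 0}" using finite_subset by blast
 hence "p = 0" using poly_roots_finite by blast
 thus False using p[rule_format, of 0] y by simp
qed

section \<open>Points with a small prime-to-\<open>S\<close> part\<close>

lemma lookup_form_smult: "Poly_Mapping.lookup (form_smult c F) m = c * Poly_Mapping.lookup F m"
 by (simp add: form_smult_def mult_map_scale_conv_mult[symmetric] Poly_Mapping.map.rep_eq when_def)

lemma form_smult_props:
 assumes "c \<noteq> 0" "homogeneous e F"
 shows "homogeneous e (form_smult c F)" "F \<noteq> 0 ==> form_smult c F \<noteq> 0"
proof -
 have k: "Poly_Mapping.keys (form_smult c F) = Poly_Mapping.keys F"
  using assms(1) by (simp add: Set.set_eq_iff in_keys_iff lookup_form_smult)
 show "homogeneous e (form_smult c F)" using assms(2) unfolding homogeneous_def k .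
 show "form_smult c F \<noteq> 0" if "F \<noteq> 0"
 proof
  assume "form_smult c F = 0"
  hence "Poly_Mapping.keys F = {}" using k by simp
  thus False using that by simp
 qed
qed

lemma eval_tuple_nonzero: "proj_morphism d \<psi> ==> x \<noteq> 0 ==> eval_tuple \<psi> x \<noteq> 0"
 unfolding proj_morphism_def by (auto simp: eval_tuple_def vec_eq_iff)

lemma eval_tuple_funpow_nonzero:
 assumes "proj_morphism d \<psi>" "x \<noteq> 0" shows "(eval_tuple \<psi> ^^ n) x \<noteq> 0"
 by (induction n) (simp_all add: assms eval_tuple_nonzero[OF assms(1)])

lemma proj_map_abs:
 assumes \<psi>: "proj_morphism d \<psi>" and x: "x \<noteq> 0" shows "proj_map \<psi> (abs_proj x) = abs_proj (eval_tuple \<psi> x)"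
proof -
 obtain c where c: "c \<noteq> 0" "rep_proj (abs_proj x) = c *s x" using rep_abs_proj[OF x] by blast
 have hom: "homogeneous d (\<psi> i)" for i using \<psi> by (simp add: proj_morphism_def)
 have "eval_tuple \<psi> (c *s x) = c ^ d *s eval_tuple \<psi> x"
  by (simp add: eval_tuple_def vec_eq_iff homogeneous_eval_scale[OF hom])
 moreover have "proj_map \<psi> (abs_proj x) = abs_proj (eval_tuple \<psi> (c *s x))"
  by (simp add: proj_map_def eval_tuple_def c(2))
 moreover have "abs_proj (eval_tuple \<psi> x) = abs_proj (c ^ d *s eval_tuple \<psi> x)"
  using abs_proj_scale[OF eval_tuple_nonzero[OF \<psi> x], of "c ^ d"] c(1) by simp
 ultimately show ?thesis by simp
qed

lemma proj_map_funpow_abs: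
 assumes \<psi>: "proj_morphism d \<psi>" and x: "x \<noteq> 0"
 shows "(proj_map \<psi> ^^ n) (abs_proj x) = abs_proj ((eval_tuple \<psi> ^^ n) x)"
 by (induction n) (simp_all add: proj_map_abs[OF \<psi> eval_tuple_funpow_nonzero[OF \<psi> x]])

lemma (in csubfield) hpoly_funpow:
 fixes \<psi> :: "'n option => ('n::finite) form"
 assumes \<psi>: "\<And>i. homogeneous d (\<psi> i)" "\<And>i. coeffs_in F (\<psi> i)"
 shows "(\<lambda>x. (eval_tuple \<psi> ^^ n) x $ i) \<in> hpoly F (d ^ n)"
proof (induction n arbitrary: i)
 case 0
 show ?case using hpoly_var[of i] by simp
next
 case (Suc n)
 have "(\<lambda>x. eval_form (\<psi> i) ((eval_tuple \<psi> ^^ n) x)) \<in> hpoly F (d * d ^ n)"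
  by (rule hpoly_compose[OF hpoly_eval_form[OF \<psi>] Suc])
 moreover have "eval_tuple \<psi> z $ i = eval_form (\<psi> i) z" for z by (simp add: eval_tuple_def)
 ultimately show ?case by simp
qed

lemma (in csubfield) proj_map_rational_points:
 fixes \<psi> :: "'n option => ('n::finite) form"
 assumes \<psi>: "proj_morphism d \<psi>" and def: "morphism_defined_over F \<psi>" and q: "q \<in> rational_points F"
 shows "proj_map \<psi> q \<in> rational_points F"
proof -
 obtain x :: "complex ^ 'n option" where x: "x \<noteq> 0" "\<forall>i. x $ i \<in> F" "q = abs_proj x" using q unfolding rational_points_def by blast
 obtain c where c: "c \<noteq> 0" "\<forall>i. coeffs_in F (form_smult c (\<psi> i))" using def unfolding morphism_defined_over_def by blast
 have in_F: "eval_form (form_smult c (\<psi> i)) x \<in> F" for i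
  unfolding eval_form_def using c(2) x(2)
  by (intro sum_in mult_in prod_in power_in) (auto simp: coeffs_in_def)
 have nz: "eval_tuple \<psi> x \<noteq> 0" by (rule eval_tuple_nonzero[OF \<psi> x(1)])
 define z where "z = c *s eval_tuple \<psi> x"
 have "z $ i \<in> F" for i using in_F[of i] by (simp add: z_def eval_tuple_def eval_form_smult)
 moreover have "z \<noteq> 0" using nz c(1) by (simp add: z_def)
 moreover have "proj_map \<psi> q = abs_proj z"
  unfolding x(3) proj_map_abs[OF \<psi> x(1)] unfolding z_def by (rule abs_proj_scale[OF nz c(1), symmetric])
 ultimately show ?thesis unfolding rational_points_def by blast
qed

lemma (in csubfield) proj_map_funpow_rational_points:
 assumes \<psi>: "proj_morphism d \<psi>" and def: "morphism_defined_over F \<psi>" and q: "q \<in> rational_points F"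
 shows "(proj_map \<psi> ^^ n) q \<in> rational_points F"
 by (induction n) (simp_all add: q proj_map_rational_points[OF \<psi> def])

lemma rational_points_mono: "A \<subseteq> B ==> rational_points A \<subseteq> rational_points B"
 unfolding rational_points_def by blast

text \<open>Here h is the height of the image point and hy that of its preimage. Both bounds for r
  have the main term (g - N1) h / Dn; they differ by \<epsilon> f h, of which e' absorbs at most
  half, and the other half is bounded by constants.\<close>

lemma small_height_bound:
 fixes h hy r :: real
 assumes "h \<le> Dn * hy + C" "g * hy - ((N1 + e') * hy + C2) - C \<le> r" "r \<le> ((g - N1) / (Dn * f) - \<epsilon>) * (f * h)"
  and "Dn > 0" "f > 0" "\<epsilon> > 0" "h > 0" "e' \<le> 1" "e' \<le> \<epsilon> * f * Dn / 2" "g - N1 \<ge> 1"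
 shows "h \<le> 2 * ((g - N1 - e') * C / Dn + C2 + C) / (\<epsilon> * f)"
proof -
 define \<delta> where "\<delta> = g - N1 - e'"
 have \<delta>: "\<delta> \<ge> 0" using assms by (simp add: \<delta>_def)
 have "(h - C) / Dn \<le> hy" using assms(1,4) by (simp add: divide_le_eq algebra_simps)
 hence "\<delta> * ((h - C) / Dn) \<le> \<delta> * hy" using \<delta> by (rule mult_left_mono)
 hence 1: "\<delta> * h / Dn - \<delta> * C / Dn - C2 - C \<le> r" using assms(2) by (simp add: \<delta>_def algebra_simps diff_divide_distrib)
 have "((g - N1) / (Dn * f) - \<epsilon>) * (f * h) = (g - N1) * h / Dn - \<epsilon> * f * h"
  using assms(4,5) by (simp add: field_simps)
 hence 2: "r \<le> (g - N1) * h / Dn - \<epsilon> * f * h" using assms(3) by simp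
 have 3: "(g - N1) * h / Dn = \<delta> * h / Dn + e' * h / Dn" by (simp add: \<delta>_def add_divide_distrib[symmetric] algebra_simps)
 have "e' * h \<le> (\<epsilon> * f * Dn / 2) * h" using assms(7,9) by (intro mult_right_mono) auto
 hence 4: "e' * h / Dn \<le> \<epsilon> * f * h / 2" using assms(4) by (simp add: field_simps)
 have "\<epsilon> * f * h / 2 \<le> \<delta> * C / Dn + C2 + C" using 1 2 3 4 by linarith
 thus ?thesis using assms(5,6) by (simp add: \<delta>_def field_simps)
qed

theorem theorem6:
  fixes \<phi> \<psi> :: "'n option \<Rightarrow> ('n::finite) form"
    and P :: "'n proj"
    and D Dnc :: "'n form"
    and K :: "complex set"
    and d e n :: nat
    and c :: real
    and eqn :: "complex set \<Rightarrow> 'n form \<Rightarrow> 'n form"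
  assumes "proj_morphism e \<phi>" and "e \<ge> 2"
    and "P \<in> rational_points Qbar"
    and "proj_morphism d \<psi>" and "d \<ge> 2"
    and "effective_divisor D"
    and "nc_part (pullback (iter_morphism n \<psi>) D) Dnc"
    and "form_degree Dnc > CARD('n) + 1"
    and "number_field K"
    and "morphism_defined_over K \<phi>" and "morphism_defined_over K \<psi>"
    and "divisor_defined_over K D"
    and "\<forall>m. \<exists>Q \<in> rational_points K. (proj_map \<phi> ^^ m) P = (proj_map \<psi> ^^ n) Q"
    and "c = (real (form_degree Dnc) - (real CARD('n) + 1)) / (real d ^ n * real (form_degree D))"
    and "integral_equations eqn"
    and "vojta_conjecture eqn Dnc"
  shows "\<forall>S \<epsilon>. finite S \<and> S \<subseteq> places K \<and> \<epsilon> > 0 \<longrightarrow>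
    \<not> zariski_dense
        {p. \<exists>m. p = (proj_map \<phi> ^^ m) P \<and> p \<notin> zero_locus D \<and> height K p > 0 \<and>
            (\<Sum>\<^sub>\<infinity>v\<in>places K - S. local_height K v (eqn K D) p)
                / ereal (real (form_degree D) * height K p) \<le> ereal (c - \<epsilon>)}"
proof (intro allI impI)
 fix S and \<epsilon> :: real
 assume S\<epsilon>: "finite S \<and> S \<subseteq> places K \<and> \<epsilon> > 0"
 define T where "T = {p. \<exists>m. p = (proj_map \<phi> ^^ m) P \<and> p \<notin> zero_locus D \<and> height K p > 0 \<and>
      (\<Sum>\<^sub>\<infinity>v\<in>places K - S. local_height K v (eqn K D) p)
        / ereal (real (form_degree D) * height K p) \<le> ereal (c - \<epsilon>)}"
 define f where "f = form_degree D"
 define g where "g = form_degree Dnc"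
 have D: "D \<noteq> 0" "homogeneous f D" "coeffs_in Qbar D"
  using assms(6) homogeneous_form_degree unfolding effective_divisor_def f_def by blast+
 have nc: "effective_divisor Dnc" "Dnc dvd pullback (iter_morphism n \<psi>) D"
  using assms(7) unfolding nc_part_def nc_subdivisor_def by blast+
 have Dnc: "Dnc \<noteq> 0" "homogeneous g Dnc" "coeffs_in Qbar Dnc"
  using nc(1) homogeneous_form_degree unfolding effective_divisor_def g_def by blast+
 have \<psi>hom: "homogeneous d (\<psi> i)" and \<psi>Q: "coeffs_in Qbar (\<psi> i)" for i using assms(4) by (simp_all add: proj_morphism_def)
 obtain B0 where B0': "finite B0 \<and> B0 \<subseteq> K \<and> (\<forall>F. csubfield F \<and> B0 \<subseteq> F \<longrightarrow> K \<subseteq> F)"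
  using number_fieldD(2)[OF assms(9)] ..
 have B0: "finite B0" "B0 \<subseteq> K" "\<And>F. csubfield F ==> B0 \<subseteq> F ==> K \<subseteq> F" using B0' by simp_all
 note Kf = number_fieldD(1,3)[OF assms(9)]
 interpret K: csubfield K by (rule Kf(1))
 define cf where "cf = (\<lambda>F :: 'n form. Poly_Mapping.lookup F ` Poly_Mapping.keys F)"
 have cf: "coeffs_in A F" if "csubfield A" "cf F \<subseteq> A" for A F
 proof -
  interpret A: csubfield A by fact
  show ?thesis unfolding coeffs_in_def
  proof
   fix m show "Poly_Mapping.lookup F m \<in> A"
    using that(2) by (cases "m \<in> Poly_Mapping.keys F") (auto simp: cf_def in_keys_iff)
  qed
 qed
 \<comment> \<open>The normal-crossings part need not be defined over \<open>K\<close>. Its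
   coefficients are adjoined, and Vojta's conjecture is applied over the larger field
   \<open>M\<close>.\<close>
 define BB where "BB = B0 \<union> cf Dnc \<union> (\<Union>i\<in>UNIV. cf (\<psi> i))"
 have BB: "finite BB" "BB \<subseteq> Qbar"
  using B0(1,2) Kf(2) Dnc(3) \<psi>Q by (auto simp: BB_def cf_def coeffs_in_def)
 obtain M G where MG: "galois_field M G" "BB \<subseteq> M" by (rule galois_field_exists[OF BB])
 interpret galois_field M G by (rule MG(1))
 have KM: "K \<subseteq> M" using B0(3)[OF csubfield_axioms] MG(2) by (auto simp: BB_def)
 interpret galois_subfield M G K
  by (intro galois_subfield.intro galois_subfield_axioms.intro galois_field_axioms K.csubfield_axioms KM)
 interpret MM: galois_subfield M G M by (rule galois_subfield_self)
 have Mnf: "number_field M" by (rule MM.field_degree_embs(2))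
 have MQ: "M \<subseteq> Qbar" by (rule number_fieldD(3)[OF Mnf])
 have DncM: "coeffs_in M Dnc" by (rule cf[OF csubfield_axioms]) (use MG(2) in \<open>auto simp: BB_def\<close>)
 have \<psi>M: "coeffs_in M (\<psi> i)" for i
 proof (rule cf[OF csubfield_axioms])
  show "cf (\<psi> i) \<subseteq> M" using MG(2) unfolding BB_def by blast
 qed
 have defM: "divisor_defined_over M Dnc" unfolding divisor_defined_over_def
  using DncM by (intro exI[of _ 1]) (simp add: coeffs_in_def lookup_form_smult)
 define F where "F = eqn K D"
 define E where "E = eqn M Dnc"
 obtain c1 where c1: "c1 \<noteq> 0" "F = form_smult c1 D" and FK: "coeffs_in K F"
  using assms(15)[unfolded integral_equations_def, rule_format, of K D] assms(6,9,12)
  unfolding F_def coeffs_in_def ring_of_integers_def by blast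
 obtain c2 where c2: "c2 \<noteq> 0" "E = form_smult c2 Dnc" and EM: "coeffs_in M E"
  using assms(15)[unfolded integral_equations_def, rule_format, of M Dnc] Mnf nc(1) defM
  unfolding E_def coeffs_in_def ring_of_integers_def by blast
 have Fp: "homogeneous f F" "form_degree F = f"
  using form_smult_props[OF c1(1) D(2)] D(1) homogeneous_form_degree[of f F] unfolding c1(2) by auto
 have Ep: "homogeneous g E" "form_degree E = g"
  using form_smult_props[OF c2(1) Dnc(2)] Dnc(1) homogeneous_form_degree[of g E] unfolding c2(2) by auto
 define \<Psi> where "\<Psi> = eval_tuple \<psi> ^^ n"
 define Dn where "Dn = d ^ n"
 have Dn: "Dn \<ge> 1" using assms(5) by (simp add: Dn_def)
 have \<Psi>M: "(\<lambda>x. \<Psi> x $ i) \<in> hpoly M Dn" for i unfolding \<Psi>_def Dn_def by (rule hpoly_funpow[OF \<psi>hom \<psi>M])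
 have \<Psi>Q: "(\<lambda>x. \<Psi> x $ i) \<in> hpoly Qbar Dn" for i unfolding \<Psi>_def Dn_def by (rule QB.hpoly_funpow[OF \<psi>hom \<psi>Q])
 have nz: "\<Psi> x \<noteq> 0" if "x \<noteq> 0" for x unfolding \<Psi>_def by (rule eval_tuple_funpow_nonzero[OF assms(4) that])
 have FM: "coeffs_in M F" using FK KM by (auto simp: coeffs_in_def)
 \<comment> \<open>A point of \<open>T\<close> has coordinates over \<open>K\<close>, and so has its
   preimage under the n-th iterate; lying outside the divisor makes the equation nonzero at both
   vectors.\<close>
 have point: "\<exists>x y. x \<noteq> 0 \<and> (\<forall>i. x $ i \<in> K) \<and> y \<noteq> 0 \<and> (\<forall>i. y $ i \<in> K) \<and> p = abs_proj x \<and> p = abs_proj (\<Psi> y) \<and> eval_form F x \<noteq> 0 \<and> eval_form F (\<Psi> y) \<noteq> 0"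
  if p: "p \<in> T" for p
 proof -
  obtain m where m: "p = (proj_map \<phi> ^^ m) P" "p \<notin> zero_locus D" using p unfolding T_def by blast
  obtain Q where Q: "Q \<in> rational_points K" "p = (proj_map \<psi> ^^ n) Q" using assms(13) m(1) by metis
  obtain y :: "complex ^ 'n option" where y: "y \<noteq> 0" "\<forall>i. y $ i \<in> K" "Q = abs_proj y" using Q(1) unfolding rational_points_def by blast
  have "p \<in> rational_points K" unfolding Q(2) by (rule K.proj_map_funpow_rational_points[OF assms(4,11) Q(1)])
  then obtain x :: "complex ^ 'n option" where x: "x \<noteq> 0" "\<forall>i. x $ i \<in> K" "p = abs_proj x" unfolding rational_points_def by blast
  have py: "p = abs_proj (\<Psi> y)" unfolding Q(2) y(3) \<Psi>_def by (rule proj_map_funpow_abs[OF assms(4) y(1)])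
  have "eval_form D x \<noteq> 0" using m(2) zero_locus_iff[OF D(2) x(1)] x(3) by simp
  moreover have "eval_form D (\<Psi> y) \<noteq> 0" using m(2) zero_locus_iff[OF D(2) nz[OF y(1)]] py by simp
  ultimately show ?thesis using x y py c1 by (intro exI[of _ x] exI[of _ y]) (simp add: eval_form_smult)
 qed
 have "in_hypersurface T"
 \<comment> \<open>A point of \<open>T\<close> is needed to know that the pulled-back equation is
   not identically zero, without which the degrees could not be compared.\<close>
 proof (cases "T = {}")
  case True
  thus ?thesis by (simp add: in_hypersurface_empty)
 next
  case False
  then obtain p0 where "p0 \<in> T" by blast
  from point[OF this] obtain y0 where y0: "eval_form F (\<Psi> y0) \<noteq> 0" by blast
  obtain k where k: "pullback (iter_morphism n \<psi>) D = Dnc * k" using nc(2) by (auto simp: dvd_def)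
  have LM: "(\<lambda>x. eval_form F (\<Psi> x)) \<in> hpoly M (f * Dn)" by (rule hpoly_compose[OF hpoly_eval_form[OF Fp(1) FM] \<Psi>M])
  have rel0: "eval_form F (\<Psi> x) = eval_form E x * eval_form (form_smult (c1 / c2) k) x" for x
  proof -
   have "eval_form F (\<Psi> x) = c1 * eval_form (pullback (iter_morphism n \<psi>) D) x"
    by (simp add: c1(2) eval_form_smult pullback_def eval_subst_form eval_tuple_iter \<Psi>_def)
   thus ?thesis using c2(1) by (simp add: k c2(2) eval_form_mult eval_form_smult)
  qed
  from homogeneous_cofactor[OF LM y0 hpoly_eval_form[OF Ep(1) EM] rel0]
  obtain H where H: "g \<le> f * Dn" "H \<in> hpoly M (f * Dn - g)" "\<forall>x. eval_form F (\<Psi> x) = eval_form E x * H x" by blast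
  define S' where "S' = {w \<in> places M. restrict w K \<in> S}"
  have S': "finite S'" "S' \<subseteq> places M" using finite_restrict_places S\<epsilon> by (auto simp: S'_def)
  have Hrel: "eval_form F (\<Psi> y) = eval_form E y * H y" for y using H(3) ..
  have "\<exists>C. \<forall>x y. x \<noteq> 0 \<longrightarrow> (\<forall>i. x $ i \<in> K) \<longrightarrow> y \<noteq> 0 \<longrightarrow> (\<forall>i. y $ i \<in> M) \<longrightarrow> abs_proj x = abs_proj (\<Psi> y) \<longrightarrow>
   eval_form F x \<noteq> 0 \<longrightarrow>
   (\<exists>r. (\<Sum>\<^sub>\<infinity>v\<in>places K - S. local_height K v F (abs_proj x)) = ereal r \<and>
    (\<forall>B. (\<Sum>w\<in>S'. local_height M w E (abs_proj y)) \<le> ereal B \<longrightarrow> real g * height M (abs_proj y) - B - C \<le> r)) \<and>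
   height K (abs_proj x) \<le> real Dn * height M (abs_proj y) + C \<and> height K (abs_proj x) = height M (abs_proj x)"
   unfolding S'_def
  proof (rule local_height_comparison[where \<Psi> = \<Psi> and D = Dn and f = f and F = F and g = g and E = E and H = H])
   show "\<And>i. (\<lambda>x. \<Psi> x $ i) \<in> hpoly M Dn" by (rule \<Psi>M)
   show "\<And>x. x \<noteq> 0 ==> \<Psi> x \<noteq> 0" by (rule nz)
   show "\<And>y. eval_form F (\<Psi> y) = eval_form E y * H y" by (rule Hrel)
  qed (use Fp FK Ep EM H(1,2) S\<epsilon> in blast)+
  then obtain C where C: "\<forall>x y. x \<noteq> 0 \<longrightarrow> (\<forall>i. x $ i \<in> K) \<longrightarrow> y \<noteq> 0 \<longrightarrow> (\<forall>i. y $ i \<in> M) \<longrightarrow> abs_proj x = abs_proj (\<Psi> y) \<longrightarrow>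
   eval_form F x \<noteq> 0 \<longrightarrow>
   (\<exists>r. (\<Sum>\<^sub>\<infinity>v\<in>places K - S. local_height K v F (abs_proj x)) = ereal r \<and>
    (\<forall>B. (\<Sum>w\<in>S'. local_height M w E (abs_proj y)) \<le> ereal B \<longrightarrow> real g * height M (abs_proj y) - B - C \<le> r)) \<and>
   height K (abs_proj x) \<le> real Dn * height M (abs_proj y) + C \<and> height K (abs_proj x) = height M (abs_proj x)" ..
  have g: "real g - (real CARD('n) + 1) \<ge> 1" using assms(8) by (simp add: g_def)
  \<comment> \<open>A divisor of degree 0 has a pullback of degree 0, too small to contain one of
    degree above N + 1.\<close>
  have f0: "f > 0"
  proof (rule ccontr)
   assume "\<not> f > 0"
   thus False using H(1) g by simp
  qed
  \<comment> \<open>Measured at the image point, \<epsilon>' costs at most half of \<epsilon>; being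
    at most 1, it keeps g - (N + 1) - \<epsilon>' nonnegative.\<close>
  define \<epsilon>' where "\<epsilon>' = min 1 (\<epsilon> * real f * real Dn / 2)"
  have \<epsilon>': "\<epsilon>' > 0" "\<epsilon>' \<le> 1" "\<epsilon>' \<le> \<epsilon> * real f * real Dn / 2" using S\<epsilon> f0 Dn by (simp_all add: \<epsilon>'_def)
  obtain \<H> C2 where V: "finite \<H>" "\<forall>H\<in>\<H>. hypersurface H"
   "\<forall>p \<in> rational_points M - \<Union>\<H>. (\<Sum>v\<in>S'. local_height M v E p) < ereal ((real CARD('n) + 1 + \<epsilon>') * height M p + C2)"
   using assms(16)[unfolded vojta_conjecture_def, rule_format, of M S' \<epsilon>'] Mnf defM S' \<epsilon>'(1) unfolding E_def by blast
  define R where "R = 2 * ((real g - (real CARD('n) + 1) - \<epsilon>') * C / real Dn + C2 + C) / (\<epsilon> * real f)"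
  \<comment> \<open>A preimage in an exceptional hypersurface puts the point into the image of that
    hypersurface; for any other preimage the two bounds for the part outside \<open>S\<close> limit
    the height of the point to \<open>R\<close>.\<close>
  have sub: "T \<subseteq> (\<Union>H\<in>\<H>. {abs_proj (\<Psi> y) |y. y \<noteq> 0 \<and> abs_proj y \<in> H}) \<union> (\<Union>p\<in>{p \<in> rational_points M. height M p \<le> R}. {p})"
  proof
   fix p assume p: "p \<in> T"
   from point[OF p] obtain x y :: "complex ^ 'n option" where x: "x \<noteq> 0" "\<forall>i. x $ i \<in> K" "p = abs_proj x" and y: "y \<noteq> 0" "\<forall>i. y $ i \<in> K" "p = abs_proj (\<Psi> y)"
    and Fx: "eval_form F x \<noteq> 0" by blast
   have yM: "\<forall>i. y $ i \<in> M" and xM: "\<forall>i. x $ i \<in> M" using x(2) y(2) KM by blast+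
   show "p \<in> (\<Union>H\<in>\<H>. {abs_proj (\<Psi> y) |y. y \<noteq> 0 \<and> abs_proj y \<in> H}) \<union> (\<Union>p\<in>{p \<in> rational_points M. height M p \<le> R}. {p})"
   proof (cases "abs_proj y \<in> \<Union>\<H>")
    case True
    then obtain H where HH: "H \<in> \<H>" "abs_proj y \<in> H" by blast
    have "p \<in> {abs_proj (\<Psi> y) |y. y \<noteq> 0 \<and> abs_proj y \<in> H}"
     by (intro CollectI exI[of _ y] conjI) (fact y HH(2))+
    thus ?thesis using HH(1) by (intro UnI1 UN_I)
   next
    case False
    have "abs_proj y \<in> rational_points M" using y(1) yM unfolding rational_points_def by blast
    hence vj: "(\<Sum>v\<in>S'. local_height M v E (abs_proj y)) \<le> ereal ((real CARD('n) + 1 + \<epsilon>') * height M (abs_proj y) + C2)"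
     using V(3) False by (simp add: less_imp_le)
    have comp: "(\<exists>r. (\<Sum>\<^sub>\<infinity>v\<in>places K - S. local_height K v F (abs_proj x)) = ereal r \<and>
      (\<forall>B. (\<Sum>w\<in>S'. local_height M w E (abs_proj y)) \<le> ereal B \<longrightarrow> real g * height M (abs_proj y) - B - C \<le> r)) \<and>
     height K (abs_proj x) \<le> real Dn * height M (abs_proj y) + C \<and> height K (abs_proj x) = height M (abs_proj x)"
     by (rule C[THEN spec, THEN spec, THEN mp, THEN mp, THEN mp, THEN mp, THEN mp, THEN mp,
       OF x(1,2) y(1) yM trans[OF x(3)[symmetric] y(3)] Fx])
    from conjunct1[OF comp] obtain r where r0: "(\<Sum>\<^sub>\<infinity>v\<in>places K - S. local_height K v F (abs_proj x)) = ereal r \<and>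
      (\<forall>B. (\<Sum>w\<in>S'. local_height M w E (abs_proj y)) \<le> ereal B \<longrightarrow> real g * height M (abs_proj y) - B - C \<le> r)" ..
    have r: "(\<Sum>\<^sub>\<infinity>v\<in>places K - S. local_height K v F p) = ereal r"
     "real g * height M (abs_proj y) - ((real CARD('n) + 1 + \<epsilon>') * height M (abs_proj y) + C2) - C \<le> r"
     using conjunct1[OF r0] conjunct2[OF r0, THEN spec, THEN mp, OF vj] x(3) by simp_all
    have h: "height K p \<le> real Dn * height M (abs_proj y) + C" "height K p = height M p" using comp x(3) by auto
    have hp: "height K p > 0" and q: "(\<Sum>\<^sub>\<infinity>v\<in>places K - S. local_height K v F p) / ereal (real f * height K p) \<le> ereal (c - \<epsilon>)"
     using p unfolding T_def F_def f_def by auto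
    have fh: "real f * height K p > 0" using hp f0 by simp
    have "r / (real f * height K p) \<le> c - \<epsilon>" using q f0 hp unfolding r(1) by simp
    hence "r \<le> (c - \<epsilon>) * (real f * height K p)" using fh by (simp add: pos_divide_le_eq)
    moreover have "c = (real g - (real CARD('n) + 1)) / (real Dn * real f)" by (simp add: assms(14) g_def f_def Dn_def)
    ultimately have r3: "r \<le> ((real g - (real CARD('n) + 1)) / (real Dn * real f) - \<epsilon>) * (real f * height K p)" by simp
    have "height K p \<le> R" unfolding R_def
     by (rule small_height_bound[OF h(1) r(2) r3]) (use Dn f0 S\<epsilon> hp \<epsilon>' g in auto)
    moreover have "p \<in> rational_points M" unfolding x(3) rational_points_def using x(1) xM by blast
    ultimately show ?thesis using h(2) by simp
   qed
  qed
  have "in_hypersurface ((\<Union>H\<in>\<H>. {abs_proj (\<Psi> y) |y. y \<noteq> 0 \<and> abs_proj y \<in> H}) \<union> (\<Union>p\<in>{p \<in> rational_points M. height M p \<le> R}. {p}))"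
  proof (intro in_hypersurface_Un in_hypersurface_UN V(1) northcott)
   show "in_hypersurface {abs_proj (\<Psi> y) |y. y \<noteq> 0 \<and> abs_proj y \<in> H}" if "H \<in> \<H>" for H
   proof (rule in_hypersurface_image[where \<Psi> = \<Psi> and D = Dn])
    show "\<And>i. (\<lambda>x. \<Psi> x $ i) \<in> hpoly Qbar Dn" by (rule \<Psi>Q)
    show "\<And>x. x \<noteq> 0 ==> \<Psi> x \<noteq> 0" by (rule nz)
    show "hypersurface H" using V(2) that ..
   qed (rule Dn)
   fix p :: "'n proj" assume "p \<in> {p \<in> rational_points M. height M p \<le> R}"
   hence "p \<in> rational_points Qbar" using rational_points_mono[OF MQ] by blast
   thus "in_hypersurface {p}" by (rule in_hypersurface_point)
  qed
  thus ?thesis using sub by (rule in_hypersurface_subset)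
 qed
 thus "\<not> zariski_dense {p. \<exists>m. p = (proj_map \<phi> ^^ m) P \<and> p \<notin> zero_locus D \<and> height K p > 0 \<and>
      (\<Sum>\<^sub>\<infinity>v\<in>places K - S. local_height K v (eqn K D) p)
        / ereal (real (form_degree D) * height K p) \<le> ereal (c - \<epsilon>)}"
  unfolding T_def by (rule in_hypersurface_not_dense)
qed

end
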